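(* Let $m$ be odd and $\ell\ge 3$. As $m\to\infty$, \begin{align*} \rho(K_m\,\square\,C_\ell)&=\frac{m+2}{2}\log 2-\frac{m-1}{2m}\log m-\frac{\log\pi}{2}-\frac{3}{2m}+O\Bigl(\frac{1}{m^2}+\frac{\log m}{m\ell}\Bigr)\\ &=\widehat\rho(K_m\,\square\,C_\ell)+\frac{\log m}{2m}-\frac{3}{4m}+O\Bigl(\frac{1}{m^2}+\frac{\log m}{m\ell}\Bigr)\\ &=\rho_\tau(K_m\,\square\,C_\ell)+O\Bigl(\frac{1}{m^2}+\frac{\log m}{m\ell}\Bigr). \end{align*}
   Context: $K_m\,\square\,C_\ell$ is the Cartesian product of the complete graph $K_m$ and the cycle $C_\ell$ (vertex set $V(K_m)\times V(C_\ell)$, $(u,v)\sim(u',v')$ iff $u=u'$ and $vv'\in E(C_\ell)$, or $v=v'$ and $u\ne u'$); it is $(m+1)$-regular with $n=m\ell$ vertices. For a graph $G$ on $n$ vertices with even degrees $d_1,\ldots,d_n$: $\operatorname{EO}(G)$ is the number of orientations of the edges such that every vertex has in-degree equal to out-degree; $\rho(G)=\frac1n\log\operatorname{EO}(G)$; $\widehat\rho(G)=\frac1n\sum_{i=1}^n\bigl(\log\binom{d_i}{d_i/2}-\frac{d_i}{2}\log2\bigr)$; $\tau(G)=\frac1n\log t(G)$ with $t(G)$ the number of spanning trees. For $d$-regular $G$, $\tau_d:=\log\frac{(d-1)^{d-1}}{(d^2-2d)^{d/2-1}}$ and $\rho_\tau(G):=\widehat\rho(G)+\frac12\tau_d-\frac12\tau(G)$.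 *)

theory Defs
  imports Complex_Main "HOL-Library.Landau_Symbols"
begin

text \<open>
  Simple undirected graphs, given by a vertex set and a set of edges, each edge being the
  two-element set of its endpoints. Finiteness and well-formedness are not part of the type;
  the notions below are meant for finite graphs whose edges are two-element sets of vertices.
\<close>

record 'a ugraph =
  verts :: "'a set"
  edges :: "'a set set"

definition degree :: "'a ugraph \<Rightarrow> 'a \<Rightarrow> nat" where
  "degree G v = card {e \<in> edges G. v \<in> e}"

definition complete_graph :: "nat \<Rightarrow> nat ugraph" where
  "complete_graph m = \<lparr> verts = {..<m}, edges = {{u, v} | u v. u < m \<and> v < m \<and> u \<noteq> v} \<rparr>"

text \<open>The cycle of length \<open>l\<close>; this is a simple graph only for \<open>l \<ge> 3\<close>.\<close>

definition cycle_graph :: "nat \<Rightarrow> nat ugraph" where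
  "cycle_graph l = \<lparr> verts = {..<l}, edges = {{i, (i + 1) mod l} | i. i < l} \<rparr>"

definition cartesian_product :: "'a ugraph \<Rightarrow> 'b ugraph \<Rightarrow> ('a \<times> 'b) ugraph" (infixl \<open>\<box>\<close> 70) where
  "G \<box> H = \<lparr> verts = verts G \<times> verts H,
     edges = {{(u, v), (u, v')} | u v v'. u \<in> verts G \<and> {v, v'} \<in> edges H}
           \<union> {{(u, v), (u', v)} | u u' v. {u, u'} \<in> edges G \<and> v \<in> verts H} \<rparr>"


text \<open>An orientation is given by its set of arcs, which contains exactly one arc for every edge.\<close>

definition orientation :: "'a ugraph \<Rightarrow> ('a \<times> 'a) set \<Rightarrow> bool" where
  "orientation G D \<longleftrightarrow>
     (\<forall>(u, v)\<in>D. {u, v} \<in> edges G) \<and> (\<forall>e\<in>edges G. \<exists>!a. a \<in> D \<and> {fst a, snd a} = e)"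

definition eulerian_orientation :: "'a ugraph \<Rightarrow> ('a \<times> 'a) set \<Rightarrow> bool" where
  "eulerian_orientation G D \<longleftrightarrow>
     orientation G D \<and> (\<forall>v\<in>verts G. card {u. (u, v) \<in> D} = card {u. (v, u) \<in> D})"

definition EO :: "'a ugraph \<Rightarrow> nat" where
  "EO G = card {D. eulerian_orientation G D}"

definition connected_graph :: "'a ugraph \<Rightarrow> bool" where
  "connected_graph G \<longleftrightarrow>
     verts G \<noteq> {} \<and> (\<forall>u\<in>verts G. \<forall>v\<in>verts G. (u, v) \<in> {(x, y). {x, y} \<in> edges G}\<^sup>*)"

definition is_cycle :: "'a ugraph \<Rightarrow> 'a list \<Rightarrow> bool" where
  "is_cycle G c \<longleftrightarrow> length c \<ge> 3 \<and> distinct c \<and>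
     (\<forall>i<length c. {c ! i, c ! ((i + 1) mod length c)} \<in> edges G)"

definition tree :: "'a ugraph \<Rightarrow> bool" where
  "tree G \<longleftrightarrow> connected_graph G \<and> \<not> (\<exists>c. is_cycle G c)"

text \<open>A spanning tree is identified with its edge set.\<close>

definition num_spanning_trees :: "'a ugraph \<Rightarrow> nat" where
  "num_spanning_trees G = card {T. T \<subseteq> edges G \<and> tree \<lparr> verts = verts G, edges = T \<rparr>}"


definition rho :: "'a ugraph \<Rightarrow> real" where
  "rho G = ln (real (EO G)) / real (card (verts G))"

definition rho_hat :: "'a ugraph \<Rightarrow> real" where
  "rho_hat G = (\<Sum>v\<in>verts G. ln (real (degree G v choose (degree G v div 2)))
                              - real (degree G v) / 2 * ln 2) / real (card (verts G))"

definition tau :: "'a ugraph \<Rightarrow> real" where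
  "tau G = ln (real (num_spanning_trees G)) / real (card (verts G))"

text \<open>
  Intended for \<open>d \<ge> 2\<close>. The base of the power in the denominator vanishes for \<open>d = 2\<close>;
  the value is then \<open>0\<close>, as it is under the convention that zero to the power zero is \<open>1\<close>.
\<close>

definition tau_reg :: "nat \<Rightarrow> real" where
  "tau_reg d = ln ((real d - 1) ^ (d - 1) / ((real d)\<^sup>2 - 2 * real d) powr (real d / 2 - 1))"

text \<open>The common degree of the vertices of a (nonempty) regular graph.\<close>

definition regular_degree :: "'a ugraph \<Rightarrow> nat" where
  "regular_degree G = (THE d. \<forall>v\<in>verts G. degree G v = d)"

definition rho_tau :: "'a ugraph \<Rightarrow> real" where
  "rho_tau G = rho_hat G + tau_reg (regular_degree G) / 2 - tau G / 2"


text \<open>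
  The limit \<open>m \<rightarrow> \<infinity>\<close> over odd \<open>m\<close>, uniformly in \<open>l \<ge> 3\<close>: bounds that hold eventually
  along this filter hold for all odd \<open>m\<close> from some point on and all \<open>l \<ge> 3\<close> at once.
\<close>

definition odd_uniform :: "(nat \<times> nat) filter" where
  "odd_uniform = inf sequentially (principal {m. odd m}) \<times>\<^sub>F principal {3..}"

lemma eventually_odd_uniform:
  "eventually P odd_uniform \<longleftrightarrow> (\<exists>M. \<forall>m\<ge>M. \<forall>l\<ge>3. odd m \<longrightarrow> P (m, l))"
proof
  assume "eventually P odd_uniform"
  then obtain Q R where Q: "eventually Q (inf sequentially (principal {m. odd m}))"
    and R: "eventually R (principal {3..})" and QR: "\<And>m l. Q m \<Longrightarrow> R l \<Longrightarrow> P (m, l)"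
    unfolding odd_uniform_def eventually_prod_filter by blast
  from Q obtain M where "\<And>m. m \<ge> M \<Longrightarrow> odd m \<Longrightarrow> Q m"
    by (auto simp: eventually_inf_principal eventually_sequentially)
  then show "\<exists>M. \<forall>m\<ge>M. \<forall>l\<ge>3. odd m \<longrightarrow> P (m, l)"
    using R QR unfolding eventually_principal by (metis atLeast_iff)
next
  assume "\<exists>M. \<forall>m\<ge>M. \<forall>l\<ge>3. odd m \<longrightarrow> P (m, l)"
  then obtain M where M: "\<And>m l. m \<ge> M \<Longrightarrow> l \<ge> 3 \<Longrightarrow> odd m \<Longrightarrow> P (m, l)" by blast
  have "eventually (\<lambda>m. m \<ge> M \<and> odd m) (inf sequentially (principal {m. odd m}))"
    by (auto simp: eventually_inf_principal eventually_sequentially)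
  moreover have "eventually (\<lambda>l. l \<ge> 3) (principal {3::nat..})"
    by (simp add: eventually_principal)
  ultimately show "eventually P odd_uniform"
    unfolding odd_uniform_def eventually_prod_filter using M by blast
qed

lemma degree_complete_box_cycle:
  assumes "u < m" "v < l" "l \<ge> 3"
  shows "degree (complete_graph m \<box> cycle_graph l) (u, v) = m + 1"
proof -
  let ?p = "if v = 0 then l - 1 else v - 1"
  let ?s = "(v + 1) mod l"
  let ?N = "({..<m} - {u}) \<times> {v} \<union> {u} \<times> {?s, ?p}"
  have s: "?s = (if v = l - 1 then 0 else v + 1)"
    using assms by (auto simp: mod_less)
  have pred: "i = ?p" if "(i + 1) mod l = v" "i < l" for i
    using that by (cases "i + 1 = l") auto
  have pl: "?p < l" and ps: "(?p + 1) mod l = v" using assms by auto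
  have "{e \<in> edges (complete_graph m \<box> cycle_graph l). (u, v) \<in> e} = (\<lambda>y. {(u, v), y}) ` ?N"
    (is "?L = ?R")
  proof
    show "?L \<subseteq> ?R"
    proof
      fix e assume e: "e \<in> ?L"
      consider (cyc) a b b' i where "e = {(a, b), (a, b')}" "{b, b'} = {i, (i + 1) mod l}" "i < l"
        | (com) a a' b w z where "e = {(a, b), (a', b)}" "{a, a'} = {w, z}" "w < m" "z < m" "w \<noteq> z"
        using e by (auto simp: cartesian_product_def complete_graph_def cycle_graph_def)
      then show "e \<in> ?R"
      proof cases
        case cyc
        then have "e = {(a, i), (a, (i + 1) mod l)}" by (auto simp: doubleton_eq_iff)
        moreover from this e have "a = u" "v = i \<or> v = (i + 1) mod l" by auto
        ultimately have "e = {(u, v), (u, ?s)} \<or> e = {(u, v), (u, ?p)}"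
          using pred[of i] \<open>i < l\<close> by (auto simp: insert_commute)
        then show ?thesis by blast
      next
        case com
        then have "e = {(w, b), (z, b)}" by (auto simp: doubleton_eq_iff)
        moreover from this e have "b = v" "u = w \<or> u = z" by auto
        ultimately show ?thesis using com(3-5) by (auto simp: insert_commute)
      qed
    qed
    show "?R \<subseteq> ?L"
    proof
      fix e assume "e \<in> ?R"
      then consider (com) z where "z < m" "z \<noteq> u" "e = {(u, v), (z, v)}"
        | (suc) "e = {(u, v), (u, ?s)}" | (pre) "e = {(u, v), (u, ?p)}" by auto
      then show "e \<in> ?L"
      proof cases
        case com
        have "{u, z} \<in> edges (complete_graph m)" "v \<in> verts (cycle_graph l)"
          using com assms by (auto simp: complete_graph_def cycle_graph_def)
        then show ?thesis unfolding cartesian_product_def using com(3) by auto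
      next
        case suc
        have "{v, ?s} \<in> edges (cycle_graph l)" "u \<in> verts (complete_graph m)"
          using assms by (auto simp: complete_graph_def cycle_graph_def)
        then show ?thesis unfolding cartesian_product_def using suc by auto
      next
        case pre
        have "{?p, (?p + 1) mod l} \<in> edges (cycle_graph l)"
          unfolding cycle_graph_def using pl by auto
        then have "{v, ?p} \<in> edges (cycle_graph l)" unfolding ps by (simp add: insert_commute)
        moreover have "u \<in> verts (complete_graph m)"
          using assms by (auto simp: complete_graph_def)
        ultimately show ?thesis unfolding cartesian_product_def using pre by auto
      qed
    qed
  qed
  then have "degree (complete_graph m \<box> cycle_graph l) (u, v) = card ((\<lambda>y. {(u, v), y}) ` ?N)"
    by (simp only: degree_def)
  also have "\<dots> = card ?N"
    by (rule card_image) (auto simp: inj_on_def doubleton_eq_iff)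
  also have "\<dots> = card (({..<m} - {u}) \<times> {v}) + card ({u} \<times> {?s, ?p})"
    by (rule card_Un_disjoint) auto
  also have "\<dots> = (m - 1) + 2"
  proof -
    have "?s \<noteq> ?p" unfolding s using assms by auto
    then have "card {?s, ?p} = 2" by (simp only: card_2_iff) blast
    then show ?thesis using assms by (simp only: card_cartesian_product) simp
  qed
  also have "\<dots> = m + 1" using assms by simp
  finally show ?thesis .
qed

lemma regular_degree_complete_box_cycle:
  assumes "m \<ge> 1" "l \<ge> 3"
  shows "regular_degree (complete_graph m \<box> cycle_graph l) = m + 1"
  unfolding regular_degree_def
proof (rule the_equality)
  have V: "verts (complete_graph m \<box> cycle_graph l) = {..<m} \<times> {..<l}"
    by (simp add: cartesian_product_def complete_graph_def cycle_graph_def)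
  show "\<forall>x\<in>verts (complete_graph m \<box> cycle_graph l).
          degree (complete_graph m \<box> cycle_graph l) x = m + 1"
    unfolding V using degree_complete_box_cycle assms(2) by auto
  have "(0, 0) \<in> verts (complete_graph m \<box> cycle_graph l)" unfolding V using assms by auto
  then show "d = m + 1" if "\<forall>x\<in>verts (complete_graph m \<box> cycle_graph l).
          degree (complete_graph m \<box> cycle_graph l) x = d" for d
    using that degree_complete_box_cycle[of 0 m 0 l] assms by force
qed

end

theory Submission
  imports "HOL-Probability.Probability" "HOL-Real_Asymp.Real_Asymp" "Jordan_Normal_Form.Determinant" Defs
begin

text \<open>An Eulerian orientation of the product is determined by the sets \<open>S v\<close> of edges of the layer
  between two copies of the complete graph that point forwards, together with an orientation of each copy
  whose imbalances make up for them.  Hence the number of Eulerian orientations is the trace of the \<open>l\<close>-th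
  power of a nonnegative symmetric matrix indexed by subsets of \<open>{..<m}\<close>, whose entries count tournaments
  with prescribed scores.  A reflection argument shows that the diagonal entries of the powers dominate
  their rows, so up to a factor \<open>exp (O(ln m))\<close> the trace is the \<open>l\<close>-th power of the largest row sum,
  which belongs to the subsets of size \<open>m div 2\<close>.  Deleting two vertices from a tournament on \<open>m + 2\<close>
  vertices identifies that row sum as the number of regular tournaments on \<open>m + 2\<close> vertices divided by a
  central binomial coefficient.

  Regular tournaments are counted by integrating a product of cosines of differences of angles over a torus.
  Near the diagonal the integrand is compared with a Gaussian, the quartic Taylor term of \<open>ln cos\<close>
  contributing its mean; far from it, removing the two angles that are far apart gains an exponentially
  small factor.  Spanning trees are counted by the matrix-tree theorem, the Laplacian
  being diagonalised by the characters of a product of two cyclic groups.\<close>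

section \<open>Orientations with prescribed imbalances\<close>

text \<open>The error budget shapes the proof. The logarithm is divided by the \<open>m * l\<close>
  vertices, so the largest row sum is wanted up to a factor \<open>1 + O(1/m)\<close>, whereas
  passing from the trace to the \<open>l\<close>-th power may cost one factor polynomial in
  \<open>m\<close>; that factor is the source of \<open>ln m / (m * l)\<close>. The lower bound
  costs nothing. The upper bound pays \<open>2 ^ m * rtour m / rowsum m (m div 2)\<close>, and it
  takes the tournament asymptotics to show that this is polynomial. For tournaments, relative error
  \<open>O(1/n)\<close> requires the mean of the quartic sum, with its variance entering as an error
  only. The far region is delicate because the leading value decays like
  \<open>n ^ (- n / 2)\<close> up to exponential factors, so an exponentially small absolute bound
  is useless: the gain has to be measured against the same integral with two angles fewer, which
  calls for an a priori bound by induction. The comparison quantities are explicit, but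
  \<open>rho_hat\<close> requires the central binomial coefficient with relative error
  \<open>O(1/m^2)\<close>, and the spanning trees require a logarithm of a product in which the
  first-order terms cancel.\<close>

definition imb :: "('a \<times> 'a) set \<Rightarrow> 'a \<Rightarrow> int" where
  "imb D v = int (card {u. (v, u) \<in> D}) - int (card {u. (u, v) \<in> D})"

definition ori :: "'a set set \<Rightarrow> ('a \<times> 'a) set set" where
  "ori E = {D. (\<forall>(u, v)\<in>D. {u, v} \<in> E) \<and> (\<forall>e\<in>E. \<exists>!a. a \<in> D \<and> {fst a, snd a} = e)}"

text \<open>Arbitrary imbalances are prescribed, not just zero, because removing an edge shifts the
  prescription at its two ends; only the general count satisfies a recursion.\<close>

definition orn :: "'a set set \<Rightarrow> ('a \<Rightarrow> int) \<Rightarrow> nat" where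
  "orn E d = card {D \<in> ori E. imb D = d}"

definition wf_edges :: "'a set set \<Rightarrow> bool" where
  "wf_edges E \<longleftrightarrow> finite E \<and> (\<forall>e\<in>E. card e = 2)"

lemma wf_edgesD: "wf_edges E \<Longrightarrow> finite E" "wf_edges E \<Longrightarrow> e \<in> E \<Longrightarrow> finite e"
  unfolding wf_edges_def by (auto intro: card_ge_0_finite)

lemma wf_edges_insert: "wf_edges (insert {u, v} E) \<longleftrightarrow> u \<noteq> v \<and> wf_edges E"
  unfolding wf_edges_def by (auto simp: card_insert_if)

lemma ori_subset:
  assumes "D \<in> ori E" shows "D \<subseteq> \<Union>E \<times> \<Union>E"
proof
  fix a assume "a \<in> D"
  then have "{fst a, snd a} \<in> E" using assms by (cases a) (auto simp: ori_def)
  then show "a \<in> \<Union>E \<times> \<Union>E" by (cases a) auto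
qed

lemma finite_ori:
  assumes "wf_edges E" shows "finite (ori E)" "D \<in> ori E \<Longrightarrow> finite D"
proof -
  have "finite (\<Union>E \<times> \<Union>E)" using wf_edgesD[OF assms] by auto
  then show "finite (ori E)" "D \<in> ori E \<Longrightarrow> finite D"
    using ori_subset[of _ E] by (auto intro: finite_subset[of _ "Pow (\<Union>E \<times> \<Union>E)"] finite_subset)
qed

lemma ori_arc: "D \<in> ori E \<Longrightarrow> b \<in> D \<Longrightarrow> {fst b, snd b} \<in> E"
  by (cases b) (auto simp: ori_def)

lemma ori_ex1:
  assumes "D \<in> ori E" "e \<in> E"
  obtains b where "b \<in> D" "{fst b, snd b} = e" "\<And>c. c \<in> D \<Longrightarrow> {fst c, snd c} = e \<Longrightarrow> c = b"
proof -
  have "\<exists>!a. a \<in> D \<and> {fst a, snd a} = e" using assms by (simp add: ori_def)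
  then show ?thesis using that by (elim ex1E) blast
qed

lemma ori_empty: "ori {} = {{}}"
  unfolding ori_def by auto

lemma ori_insert:
  assumes "u \<noteq> v" "{u, v} \<notin> E"
  shows "ori (insert {u, v} E) = insert (u, v) ` ori E \<union> insert (v, u) ` ori E"
proof
  show "ori (insert {u, v} E) \<subseteq> insert (u, v) ` ori E \<union> insert (v, u) ` ori E"
  proof
    fix D assume D: "D \<in> ori (insert {u, v} E)"
    obtain a where a: "a \<in> D" "{fst a, snd a} = {u, v}"
      and a': "\<And>b. b \<in> D \<Longrightarrow> {fst b, snd b} = {u, v} \<Longrightarrow> b = a"
      by (rule ori_ex1[OF D insertI1]) (rule that)
    have aa: "a = (u, v) \<or> a = (v, u)" using a(2) by (auto simp: doubleton_eq_iff prod_eq_iff)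
    have "D - {a} \<in> ori E" unfolding ori_def
    proof (intro CollectI conjI ballI)
      fix b assume b: "b \<in> D - {a}"
      then have "{fst b, snd b} \<in> insert {u, v} E" using ori_arc[OF D] by blast
      moreover have "{fst b, snd b} \<noteq> {u, v}" using a' b by blast
      ultimately show "case b of (x, y) \<Rightarrow> {x, y} \<in> E" by (cases b) auto
    next
      fix e assume e: "e \<in> E"
      obtain b where b: "b \<in> D" "{fst b, snd b} = e"
        and b': "\<And>c. c \<in> D \<Longrightarrow> {fst c, snd c} = e \<Longrightarrow> c = b" by (rule ori_ex1[OF D insertI2[OF e]]) (rule that)
      have "b \<noteq> a" using a(2) b(2) e assms(2) by metis
      with b have "b \<in> D - {a} \<and> {fst b, snd b} = e" by simp
      then show "\<exists>!b. b \<in> D - {a} \<and> {fst b, snd b} = e" by (rule ex1I) (use b' in blast)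
    qed
    moreover have "D = insert a (D - {a})" using a by auto
    ultimately show "D \<in> insert (u, v) ` ori E \<union> insert (v, u) ` ori E" using aa by blast
  qed
next
  have *: "insert (x, y) D \<in> ori (insert {u, v} E)" if D: "D \<in> ori E" and xy: "{x, y} = {u, v}" for x y D
  proof -
    have 1: "{fst b, snd b} \<in> E" if "b \<in> D" for b using D that unfolding ori_def by (cases b) auto
    show ?thesis unfolding ori_def
    proof (intro CollectI conjI ballI)
      fix b assume "b \<in> insert (x, y) D"
      then show "case b of (p, q) \<Rightarrow> {p, q} \<in> insert {u, v} E" using 1[of b] xy by (cases b) auto
    next
      fix e assume "e \<in> insert {u, v} E"
      then consider "e = {u, v}" | "e \<in> E" "e \<noteq> {u, v}" using assms by auto
      then show "\<exists>!a. a \<in> insert (x, y) D \<and> {fst a, snd a} = e"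
      proof cases
        case 1
        then have "(x, y) \<in> insert (x, y) D \<and> {fst (x, y), snd (x, y)} = e" using xy by simp
        then show ?thesis
        proof (rule ex1I)
          fix b assume "b \<in> insert (x, y) D \<and> {fst b, snd b} = e"
          then show "b = (x, y)" using ori_arc[OF D, of b] assms(2) 1 by (metis insertE)
        qed
      next
        case 2
        obtain b where b: "b \<in> D" "{fst b, snd b} = e" and b': "\<And>c. c \<in> D \<Longrightarrow> {fst c, snd c} = e \<Longrightarrow> c = b"
          by (rule ori_ex1[OF D 2(1)]) (rule that)
        from b have "b \<in> insert (x, y) D \<and> {fst b, snd b} = e" by simp
        then show ?thesis
        proof (rule ex1I)
          fix c assume "c \<in> insert (x, y) D \<and> {fst c, snd c} = e"
          then show "c = b" using b' 2(2) xy by (metis fst_conv insertE snd_conv)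
        qed
      qed
    qed
  qed
  show "insert (u, v) ` ori E \<union> insert (v, u) ` ori E \<subseteq> ori (insert {u, v} E)"
    using * by (auto simp: insert_commute)
qed

lemma sum_ori_insert:
  assumes "u \<noteq> v" "{u, v} \<notin> E" "wf_edges E"
  shows "(\<Sum>D\<in>ori (insert {u, v} E). g D) =
    (\<Sum>D\<in>ori E. g (insert (u, v) D) + (g (insert (v, u) D) :: 'b :: comm_monoid_add))"
proof -
  have n: "(u, v) \<notin> D" "(v, u) \<notin> D" if "D \<in> ori E" for D
    using that assms(2) unfolding ori_def by (auto simp: insert_commute)
  have i: "inj_on (insert (u, v)) (ori E)" "inj_on (insert (v, u)) (ori E)"
    by (rule inj_onI; use n insert_ident in metis)+
  have d: "insert (u, v) ` ori E \<inter> insert (v, u) ` ori E = {}"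
    using n assms(1) by (auto simp: set_eq_iff) metis
  show ?thesis unfolding ori_insert[OF assms(1,2)]
    using finite_ori(1)[OF assms(3)] d
    by (subst sum.union_disjoint) (auto simp: sum.reindex[OF i(1)] sum.reindex[OF i(2)] sum.distrib)
qed

lemma imb_insert:
  assumes "finite D" "(u, v) \<notin> D" "u \<noteq> v"
  shows "imb (insert (u, v) D) = (imb D)(u := imb D u + 1, v := imb D v - 1)"
proof
  fix w
  have fin: "finite {x. (w, x) \<in> D}" "finite {x. (x, w) \<in> D}"
    using assms(1) finite_subset[of "{x. (w, x) \<in> D}" "snd ` D"] finite_subset[of "{x. (x, w) \<in> D}" "fst ` D"]
    by force+
  have o: "{x. (w, x) \<in> insert (u, v) D} = (if w = u then insert v {x. (w, x) \<in> D} else {x. (w, x) \<in> D})"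
    and i: "{x. (x, w) \<in> insert (u, v) D} = (if w = v then insert u {x. (x, w) \<in> D} else {x. (x, w) \<in> D})"
    by auto
  show "imb (insert (u, v) D) w = ((imb D)(u := imb D u + 1, v := imb D v - 1)) w"
    unfolding imb_def o i using assms fin by auto
qed

lemma fun_upd_shift_iff:
  fixes f d :: "'a \<Rightarrow> int"
  assumes "u \<noteq> v"
  shows "f(u := f u + p, v := f v + q) = d \<longleftrightarrow> f = d(u := d u - p, v := d v - q)"
proof
  assume "f(u := f u + p, v := f v + q) = d"
  then have d: "d = f(u := f u + p, v := f v + q)" by simp
  show "f = d(u := d u - p, v := d v - q)" unfolding d using assms by (auto simp: fun_eq_iff)
next
  assume f: "f = d(u := d u - p, v := d v - q)"
  show "f(u := f u + p, v := f v + q) = d" unfolding f using assms by (auto simp: fun_eq_iff)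
qed

text \<open>The recursion behind most of the counting below: the new edge points one of two ways,
  and either way uses up one unit of the prescription at one end and adds one at the other.\<close>

lemma orn_insert:
  assumes "u \<noteq> v" "{u, v} \<notin> E" "wf_edges E"
  shows "orn (insert {u, v} E) d =
    orn E (d(u := d u - 1, v := d v + 1)) + orn E (d(u := d u + 1, v := d v - 1))"
proof -
  have orn: "orn F d = (\<Sum>D\<in>ori F. of_bool (imb D = d))" if "wf_edges F" for F :: "'a set set" and d
    unfolding orn_def using finite_ori(1)[OF that] by (simp add: sum.If_cases of_bool_def Int_def)
  have n: "(u, v) \<notin> D" "(v, u) \<notin> D" "finite D" if "D \<in> ori E" for D
    using that assms(2) finite_ori(2)[OF assms(3)] unfolding ori_def by (auto simp: insert_commute)
  have 1: "imb (insert (u, v) D) = d \<longleftrightarrow> imb D = d(u := d u - 1, v := d v + 1)"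
    and 2: "imb (insert (v, u) D) = d \<longleftrightarrow> imb D = d(u := d u + 1, v := d v - 1)" if "D \<in> ori E" for D
    using n[OF that] assms(1) fun_upd_shift_iff[of u v "imb D" 1 "-1" d] fun_upd_shift_iff[of v u "imb D" 1 "-1" d]
    by (simp_all add: imb_insert fun_upd_twist[of v u])
  show ?thesis using assms
    by (simp add: orn wf_edges_insert sum_ori_insert 1 2 sum.distrib)
qed

lemma orn_empty: "orn {} d = of_bool (d = (\<lambda>_. 0))"
proof -
  have "imb {} = (\<lambda>_. 0)" by (auto simp: imb_def)
  then have "{D \<in> ori {}. imb D = d} = (if d = (\<lambda>_. 0) then {{}} else {})" by (auto simp: ori_empty)
  then show ?thesis by (simp add: orn_def)
qed

lemma wf_edges_induct [consumes 1, case_names empty insert]: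
  assumes "wf_edges E" "P {}"
    and "\<And>u v E. u \<noteq> v \<Longrightarrow> {u, v} \<notin> E \<Longrightarrow> wf_edges E \<Longrightarrow> P E \<Longrightarrow> P (insert {u, v} E)"
  shows "P E"
proof -
  have "finite E" "\<forall>e\<in>E. card e = 2" using assms(1) by (auto simp: wf_edges_def)
  then show ?thesis
  proof (induction E)
    case (insert e E)
    then obtain u v where "e = {u, v}" "u \<noteq> v" by (auto simp: card_2_iff)
    then show ?case using insert assms(3)[of u v E] by (auto simp: wf_edges_def)
  qed (use assms in auto)
qed

lemma imb_outside:
  assumes "D \<in> ori E" "v \<notin> \<Union>E" shows "imb D v = 0"
proof -
  have "{u. (v, u) \<in> D} = {}" "{u. (u, v) \<in> D} = {}" using assms ori_subset by blast+
  then show ?thesis by (simp add: imb_def)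
qed

lemma orn_outside: "v \<notin> \<Union>E \<Longrightarrow> d v \<noteq> 0 \<Longrightarrow> orn E d = 0"
proof -
  assume "v \<notin> \<Union>E" "d v \<noteq> 0"
  then have "{D \<in> ori E. imb D = d} = {}" using imb_outside[of _ E v] by auto
  then show "orn E d = 0" by (simp only: orn_def) simp
qed

text \<open>Every arc contributes \<open>1\<close> at its tail and \<open>-1\<close> at its head, so
  the imbalances always sum to zero.\<close>

lemma orn_sum_nonzero:
  assumes "wf_edges E" "\<Union>E \<subseteq> V" "finite V" "sum d V \<noteq> 0"
  shows "orn E d = 0"
  using assms
proof (induction E arbitrary: d rule: wf_edges_induct)
  case empty
  then show ?case by (auto simp: orn_empty)
next
  case (insert u v E)
  then have V: "u \<in> V" "v \<in> V" by auto
  have s: "sum (d(u := x, v := y)) V = sum d V + (x - d u) + (y - d v)" for x y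
  proof -
    have "sum (d(u := x, v := y)) V = x + (y + sum d (V - {u} - {v}))"
      using V insert by (subst sum.remove[of _ u], simp, simp, subst sum.remove[of _ v]) (auto intro!: sum.cong)
    moreover have "sum d V = d u + (d v + sum d (V - {u} - {v}))"
      using V insert by (subst sum.remove[of _ u], simp, simp, subst sum.remove[of _ v]) auto
    ultimately show ?thesis by simp
  qed
  have "sum (d(u := d u - 1, v := d v + 1)) V \<noteq> 0" "sum (d(u := d u + 1, v := d v - 1)) V \<noteq> 0"
    using insert.prems(3) unfolding s by simp_all
  then show ?case using insert by (simp add: orn_insert)
qed

text \<open>Balance is required on \<open>verts G\<close> only, while \<open>orn\<close> compares
  imbalances on the whole type; since edges stay inside \<open>verts G\<close>, the imbalance
  outside is zero anyway.\<close>

lemma EO_eq_orn: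
  assumes "\<Union>(edges G) \<subseteq> verts G"
  shows "EO G = orn (edges G) (\<lambda>_. 0)"
proof -
  have "eulerian_orientation G D \<longleftrightarrow> D \<in> ori (edges G) \<and> imb D = (\<lambda>_. 0)" for D
  proof -
    have "orientation G D \<longleftrightarrow> D \<in> ori (edges G)" by (auto simp: orientation_def ori_def)
    moreover have "(\<forall>v\<in>verts G. card {u. (u, v) \<in> D} = card {u. (v, u) \<in> D}) \<longleftrightarrow> imb D = (\<lambda>_. 0)"
      if "D \<in> ori (edges G)"
    proof -
      have "imb D v = 0 \<longleftrightarrow> card {u. (u, v) \<in> D} = card {u. (v, u) \<in> D}" for v
        by (auto simp: imb_def)
      moreover have "imb D v = 0" if "v \<notin> verts G" for v
        using imb_outside[OF \<open>D \<in> ori (edges G)\<close>] that assms by blast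
      ultimately show ?thesis by (auto simp: fun_eq_iff)
    qed
    ultimately show ?thesis by (auto simp: eulerian_orientation_def)
  qed
  then show ?thesis by (simp add: EO_def orn_def)
qed

text \<open>\<open>S\<close> collects the indices whose edge runs from \<open>x i\<close> to
  \<open>y i\<close>. Fixing the orientation of the whole family at once leaves \<open>E\<close>
  with the prescription that makes up for it.\<close>

lemma orn_family:
  fixes x y :: "'i \<Rightarrow> 'a"
  assumes "finite X" "wf_edges E" "\<And>i. i \<in> X \<Longrightarrow> x i \<noteq> y i" "\<And>i. i \<in> X \<Longrightarrow> {x i, y i} \<notin> E"
    "inj_on (\<lambda>i. {x i, y i}) X"
  shows "orn (E \<union> (\<lambda>i. {x i, y i}) ` X) d =
    (\<Sum>S\<in>Pow X. orn E (\<lambda>w. d w - (\<Sum>i\<in>X. (if i \<in> S then 1 else -1) * (of_bool (w = x i) - of_bool (w = y i)))))"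
  using assms
proof (induction arbitrary: d)
  case empty
  then show ?case by simp
next
  case (insert j X)
  let ?c = "\<lambda>S X w. \<Sum>i\<in>X. (if i \<in> S then 1 else -1) * (of_bool (w = x i) - of_bool (w = y i) :: int)"
  have wf: "wf_edges (E \<union> (\<lambda>i. {x i, y i}) ` X)"
    using insert.prems insert.hyps by (auto simp: wf_edges_def card_insert_if)
  have ni: "{x j, y j} \<notin> E \<union> (\<lambda>i. {x i, y i}) ` X"
    using insert.prems(3)[of j] insert.prems(4) insert.hyps(2) by (auto simp: inj_on_def)
  have IH: "orn (E \<union> (\<lambda>i. {x i, y i}) ` X) d = (\<Sum>S\<in>Pow X. orn E (\<lambda>w. d w - ?c S X w))" for d
    using insert by auto
  have S1: "?c (insert j S) (insert j X) w = (of_bool (w = x j) - of_bool (w = y j)) + ?c S X w"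
    if "S \<in> Pow X" for S w
  proof -
    have "?c (insert j S) X w = ?c S X w" using insert.hyps by (intro sum.cong) auto
    then show ?thesis using insert.hyps by simp
  qed
  have S2: "?c S (insert j X) w = - (of_bool (w = x j) - of_bool (w = y j)) + ?c S X w"
    if "S \<in> Pow X" for S w
    using insert.hyps that by auto
  have inj: "inj_on (insert j) (Pow X)" using insert.hyps by (auto simp: inj_on_def)
  have dis: "Pow X \<inter> insert j ` Pow X = {}" using insert.hyps by auto
  have "(\<Sum>S\<in>Pow (insert j X). orn E (\<lambda>w. d w - ?c S (insert j X) w))
    = (\<Sum>S\<in>Pow X. orn E (\<lambda>w. d w - ?c S (insert j X) w)) + (\<Sum>S\<in>Pow X. orn E (\<lambda>w. d w - ?c (insert j S) (insert j X) w))"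
    unfolding Pow_insert using insert.hyps dis
    by (subst sum.union_disjoint) (auto simp: sum.reindex[OF inj])
  also have "\<dots> = (\<Sum>S\<in>Pow X. orn E (\<lambda>w. (d(x j := d (x j) + 1, y j := d (y j) - 1)) w - ?c S X w))
     + (\<Sum>S\<in>Pow X. orn E (\<lambda>w. (d(x j := d (x j) - 1, y j := d (y j) + 1)) w - ?c S X w))"
    using insert.prems(2)[of j]
    by (intro arg_cong2[of _ _ _ _ "(+)"] sum.cong refl arg_cong[of _ _ "orn E"] ext)
       (simp_all only: S1 S2, auto)
  also have "\<dots> = orn (insert {x j, y j} (E \<union> (\<lambda>i. {x i, y i}) ` X)) d"
    unfolding orn_insert[OF insert.prems(2)[OF insertI1] ni wf] IH by (rule add.commute)
  finally show ?case by simp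
qed

text \<open>Both factors live on the same vertex type, so the prescription is split by overwriting
  it with zero off the relevant side. An edgeless side counts as one if its prescription vanishes
  and as zero otherwise.\<close>

lemma orn_disjoint:
  assumes "wf_edges E2" "wf_edges E1" "\<Union>E2 \<subseteq> V2" "\<Union>E1 \<inter> V2 = {}"
  shows "orn (E1 \<union> E2) d = orn E1 (\<lambda>w. if w \<in> V2 then 0 else d w) * orn E2 (\<lambda>w. if w \<in> V2 then d w else 0)"
  using assms
proof (induction E2 arbitrary: d rule: wf_edges_induct)
  case empty
  show ?case
  proof (cases "\<exists>w\<in>V2. d w \<noteq> 0")
    case True
    then obtain w where w: "w \<in> V2" "d w \<noteq> 0" by blast
    then have "orn E1 d = 0" using empty orn_outside[of w E1 d] by blast
    moreover have "orn {} (\<lambda>w. if w \<in> V2 then d w else 0) = 0"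
      using w by (auto simp: orn_empty fun_eq_iff)
    ultimately show ?thesis by simp
  next
    case False
    then have "(\<lambda>w. if w \<in> V2 then 0 else d w) = d" "(\<lambda>w. if w \<in> V2 then d w else 0) = (\<lambda>_. 0)"
      by (auto simp: fun_eq_iff)
    then show ?thesis by (simp add: orn_empty)
  qed
next
  case (insert u v E)
  have uv: "u \<in> V2" "v \<in> V2" using insert.prems by auto
  have ni: "{u, v} \<notin> E1 \<union> E" using insert uv by auto
  have wf: "wf_edges (E1 \<union> E)" using insert by (auto simp: wf_edges_def)
  have e1: "(\<lambda>w. if w \<in> V2 then 0 else (d(u := p, v := q)) w) = (\<lambda>w. if w \<in> V2 then 0 else d w)" for p q
    using uv by (auto simp: fun_eq_iff)
  have e2: "(\<lambda>w. if w \<in> V2 then (d(u := p, v := q)) w else 0) = (\<lambda>w. if w \<in> V2 then d w else 0)(u := p, v := q)" for p q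
    using uv by (auto simp: fun_eq_iff)
  have IH: "orn (E1 \<union> E) d = orn E1 (\<lambda>w. if w \<in> V2 then 0 else d w) * orn E (\<lambda>w. if w \<in> V2 then d w else 0)" for d
    using insert by auto
  show ?case using insert.hyps uv
    by (simp add: orn_insert[OF _ ni wf] orn_insert IH e1 e2 algebra_simps del: fun_upd_apply)
qed

lemma orn_image:
  assumes "wf_edges E" "inj f"
  shows "orn ((`) f ` E) (\<lambda>w. if w \<in> range f then d (inv_into UNIV f w) else 0) = orn E d"
  using assms
proof (induction E arbitrary: d rule: wf_edges_induct)
  case empty
  have "(\<lambda>w. if w \<in> range f then d (inv_into UNIV f w) else 0) = (\<lambda>_. 0) \<longleftrightarrow> d = (\<lambda>_. 0)"
    using empty by (auto simp: fun_eq_iff) (metis inv_f_f rangeI)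
  then show ?case by (simp add: orn_empty)
next
  case (insert u v E)
  have fuv: "f u \<noteq> f v" using insert by (auto dest: injD)
  have ni: "{f u, f v} \<notin> (`) f ` E"
  proof
    assume "{f u, f v} \<in> (`) f ` E"
    then obtain x where "x \<in> E" "f ` {u, v} = f ` x" by auto
    then show False using insert.hyps(2) inj_image_eq_iff[OF insert.prems] by metis
  qed
  have wf: "wf_edges ((`) f ` E)"
    using insert.hyps(3) insert.prems by (auto simp: wf_edges_def card_image inj_on_def)
  have e: "(\<lambda>w. if w \<in> range f then d (inv_into UNIV f w) else 0)(f u := p, f v := q) =
     (\<lambda>w. if w \<in> range f then (d(u := p, v := q)) (inv_into UNIV f w) else 0)" for p q
    using insert.prems by (auto simp: fun_eq_iff)
  have fe: "(`) f ` insert {u, v} E = insert {f u, f v} ((`) f ` E)" by simp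
  show ?case unfolding fe
    using insert.hyps insert.IH insert.prems
    by (simp add: orn_insert[OF fuv ni wf] orn_insert e inv_f_f del: fun_upd_apply)
qed

text \<open>Grouping the edges at a third vertex w by whether \<open>u\<close> and \<open>v\<close> are treated alike shows that
  the count is a positive combination of binomial coefficients in \<open>s\<close>, hence unimodal.\<close>

lemma orn_unimodal:
  assumes "finite W" "u \<noteq> v" "u \<notin> W" "v \<notin> W" "wf_edges E0" "u \<notin> \<Union>E0" "v \<notin> \<Union>E0"
    and "\<bar>s\<bar> \<le> \<bar>s'\<bar>" "even (s - s')"
  shows "orn (insert {u, v} (E0 \<union> (\<lambda>w. {u, w}) ` W \<union> (\<lambda>w. {v, w}) ` W)) (d(u := c + s', v := c - s'))
    \<le> orn (insert {u, v} (E0 \<union> (\<lambda>w. {u, w}) ` W \<union> (\<lambda>w. {v, w}) ` W)) (d(u := c + s, v := c - s))"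
  using assms
proof (induction arbitrary: d c s s')
  case empty
  have ni: "{u, v} \<notin> E0" using empty by auto
  let ?K = "orn E0 (d(u := 0, v := 0))"
  have 0: "orn E0 (d(u := p, v := q)) = (if p = 0 \<and> q = 0 then ?K else 0)" for p q
  proof (cases "p = 0 \<and> q = 0")
    case False
    then have "(d(u := p, v := q)) u \<noteq> 0 \<or> (d(u := p, v := q)) v \<noteq> 0" using \<open>u \<noteq> v\<close> by auto
    then have "orn E0 (d(u := p, v := q)) = 0"
      using orn_outside[OF \<open>u \<notin> \<Union>E0\<close>] orn_outside[OF \<open>v \<notin> \<Union>E0\<close>] by metis
    then show ?thesis unfolding if_not_P[OF False] .
  qed simp
  \<comment> \<open>Once \<open>u\<close> and \<open>v\<close> meet no edge except
    \<open>{u, v}\<close>, that edge alone must produce the prescription, which is \<open>1\<close>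
    at one end and \<open>-1\<close> at the other.\<close>
  have 1: "orn (insert {u, v} E0) (d(u := c + s, v := c - s)) = (if c = 0 \<and> \<bar>s\<bar> = 1 then ?K else 0)" for s
  proof -
    have a: "(d(u := c + s, v := c - s))(u := (d(u := c + s, v := c - s)) u - 1, v := (d(u := c + s, v := c - s)) v + 1)
        = d(u := c + s - 1, v := c - s + 1)"
      "(d(u := c + s, v := c - s))(u := (d(u := c + s, v := c - s)) u + 1, v := (d(u := c + s, v := c - s)) v - 1)
        = d(u := c + s + 1, v := c - s - 1)" using \<open>u \<noteq> v\<close> by (auto simp: fun_eq_iff)
    show ?thesis unfolding orn_insert[OF \<open>u \<noteq> v\<close> ni \<open>wf_edges E0\<close>] a 0[of "c + s - 1"] 0[of "c + s + 1"] by auto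
  qed
  have "\<bar>s\<bar> = 1" if "\<bar>s'\<bar> = 1" using that empty by presburger
  then show ?case by (simp add: 1 del: fun_upd_apply)
next
  case (insert w W)
  define E where "E = insert {u, v} (E0 \<union> (\<lambda>w. {u, w}) ` W \<union> (\<lambda>w. {v, w}) ` W)"
  have wne: "w \<noteq> u" "w \<noteq> v" using insert by auto
  have IH: "orn E (d(u := c + s', v := c - s')) \<le> orn E (d(u := c + s, v := c - s))"
    if "\<bar>s\<bar> \<le> \<bar>s'\<bar>" "even (s - s')" for d c s s'
    unfolding E_def
    by (rule insert.IH[OF insert.prems(1) _ _ insert.prems(4,5,6) that]) (use insert.prems(2,3) in auto)
  have wfE: "wf_edges E" using insert by (auto simp: E_def wf_edges_def card_insert_if)
  show ?case
  proof (cases "w \<in> \<Union>E0 \<and> False")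
    case False
    have n1: "{u, w} \<notin> E" using insert wne by (auto simp: E_def doubleton_eq_iff)
    have n2: "{v, w} \<notin> insert {u, w} E" using insert wne by (auto simp: E_def doubleton_eq_iff)
    have wf2: "wf_edges (insert {u, w} E)" using wfE wne by (simp add: wf_edges_insert)
    \<comment> \<open>Of the four orientations of \<open>{u, w}\<close> and \<open>{v, w}\<close>,
      the two that treat \<open>u\<close> and \<open>v\<close> alike shift \<open>c\<close> by one,
      and the two that treat them oppositely shift \<open>s\<close> by one.\<close>
    have rec: "orn (insert {v, w} (insert {u, w} E)) (d(u := c + s, v := c - s)) =
      orn E ((d(w := d w + 2))(u := (c - 1) + s, v := (c - 1) - s))
      + orn E ((d(w := d w - 2))(u := (c + 1) + s, v := (c + 1) - s))
      + (orn E (d(u := c + (s - 1), v := c - (s - 1))) + orn E (d(u := c + (s + 1), v := c - (s + 1))))" for s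
    proof -
      have a: "(d(u := c + s, v := c - s))(v := (d(u := c + s, v := c - s)) v - 1, w := (d(u := c + s, v := c - s)) w + 1)
         = d(u := c + s, v := c - s - 1, w := d w + 1)"
        "(d(u := c + s, v := c - s))(v := (d(u := c + s, v := c - s)) v + 1, w := (d(u := c + s, v := c - s)) w - 1)
         = d(u := c + s, v := c - s + 1, w := d w - 1)" using wne by auto
      have b: "(d(u := c + s, v := c - s - 1, w := d w + 1))(u := (d(u := c + s, v := c - s - 1, w := d w + 1)) u - 1, w := (d(u := c + s, v := c - s - 1, w := d w + 1)) w + 1)
          = (d(w := d w + 2))(u := (c - 1) + s, v := (c - 1) - s)"
        "(d(u := c + s, v := c - s - 1, w := d w + 1))(u := (d(u := c + s, v := c - s - 1, w := d w + 1)) u + 1, w := (d(u := c + s, v := c - s - 1, w := d w + 1)) w - 1)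
          = d(u := c + (s + 1), v := c - (s + 1))"
        "(d(u := c + s, v := c - s + 1, w := d w - 1))(u := (d(u := c + s, v := c - s + 1, w := d w - 1)) u - 1, w := (d(u := c + s, v := c - s + 1, w := d w - 1)) w + 1)
          = d(u := c + (s - 1), v := c - (s - 1))"
        "(d(u := c + s, v := c - s + 1, w := d w - 1))(u := (d(u := c + s, v := c - s + 1, w := d w - 1)) u + 1, w := (d(u := c + s, v := c - s + 1, w := d w - 1)) w - 1)
          = (d(w := d w - 2))(u := (c + 1) + s, v := (c + 1) - s)"
        using wne insert.prems(1) by (auto simp: fun_eq_iff)
      show ?thesis
        unfolding orn_insert[OF not_sym[OF wne(2)] n2 wf2] a orn_insert[OF not_sym[OF wne(1)] n1 wfE] b by simp
    qed
    let ?G = "\<lambda>x. orn E (d(u := c + x, v := c - x))"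
    \<comment> \<open>If the absolute values agree, both sides are equal because \<open>?G\<close>
      is even. Otherwise parity gives a gap of at least \<open>2\<close>, and then the neighbours of
      \<open>s'\<close> are no closer to \<open>0\<close> than the corresponding neighbours of
      \<open>s\<close>.\<close>
    have "?G (s' - 1) + ?G (s' + 1) \<le> ?G (s - 1) + ?G (s + 1)"
    proof (cases "\<bar>s\<bar> = \<bar>s'\<bar>")
      case True
      have sym: "?G (- x) = ?G x" for x
        using IH[of x "-x" d c] IH[of "-x" x d c] by simp
      from True consider "s' = s" | "s' = - s" by linarith
      then show ?thesis
      proof cases
        case 2
        have "?G (s' - 1) = ?G (s + 1)" "?G (s' + 1) = ?G (s - 1)"
          using sym[of "s + 1"] sym[of "s - 1"] 2 by (simp_all add: algebra_simps)
        then show ?thesis by simp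
      qed simp
    next
      case False
      then have "\<bar>s\<bar> + 2 \<le> \<bar>s'\<bar>" using insert.prems by presburger
      then have "?G (s' - 1) \<le> ?G (s - 1)" "?G (s' + 1) \<le> ?G (s + 1)"
        using insert.prems by (intro IH; simp)+
      then show ?thesis by simp
    qed
    moreover have "insert {u, v} (E0 \<union> (\<lambda>w. {u, w}) ` insert w W \<union> (\<lambda>w. {v, w}) ` insert w W)
      = insert {v, w} (insert {u, w} E)" by (auto simp: E_def)
    ultimately show ?thesis
      using IH[OF insert.prems(7,8), of "d(w := d w + 2)" "c - 1"] IH[OF insert.prems(7,8), of "d(w := d w - 2)" "c + 1"]
      by (simp only: rec)
  qed simp
qed

text \<open>Vertex \<open>i\<close> of a layer receives an edge from the layer before iff \<open>i \<in> S\<close> and sends one to the next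
  layer iff \<open>i \<in> S'\<close>; hence the imbalance inside the layer.\<close>

definition nbal :: "nat \<Rightarrow> nat set \<Rightarrow> nat set \<Rightarrow> nat" where
  "nbal m S S' = orn (edges (complete_graph m)) (\<lambda>i. 2 * (of_bool (i \<in> S) - of_bool (i \<in> S')))"

definition rtour :: "nat \<Rightarrow> nat" where
  "rtour m = orn (edges (complete_graph m)) (\<lambda>_. 0)"

lemma edges_complete_graph: "edges (complete_graph m) = {{u, v} | u v. u < m \<and> v < m \<and> u \<noteq> v}"
  by (simp add: complete_graph_def)

lemma wf_edges_complete: "wf_edges (edges (complete_graph m))"
proof -
  have "edges (complete_graph m) \<subseteq> Pow {..<m}" by (auto simp: edges_complete_graph)
  then show ?thesis
    unfolding wf_edges_def by (auto simp: edges_complete_graph card_insert_if intro: finite_subset)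
qed

lemma Union_complete: "\<Union>(edges (complete_graph m)) \<subseteq> {..<m}"
  by (auto simp: edges_complete_graph)

lemma nbal_same: "nbal m S S = rtour m"
  by (simp add: nbal_def rtour_def)

lemma nbal_card:
  assumes "S \<subseteq> {..<m}" "S' \<subseteq> {..<m}" "card S \<noteq> card S'" shows "nbal m S S' = 0"
proof -
  have c: "(\<Sum>i<m. of_bool (i \<in> A)) = int (card A)" if "A \<subseteq> {..<m}" for A
    using that by (simp add: of_bool_def sum.If_cases Int_absorb1)
  have "(\<Sum>i<m. 2 * (of_bool (i \<in> S) - of_bool (i \<in> S'))) = 2 * (int (card S) - int (card S'))"
    unfolding sum_distrib_left[symmetric] sum_subtractf c[OF assms(1)] c[OF assms(2)] ..
  then show ?thesis unfolding nbal_def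
    using assms by (intro orn_sum_nonzero[OF wf_edges_complete Union_complete]) auto
qed

lemma orn_complete_permute:
  assumes "p permutes {..<m}"
  shows "orn (edges (complete_graph m)) (\<lambda>i. d (inv_into UNIV p i)) = orn (edges (complete_graph m)) d"
proof -
  have inj: "inj p" and ran: "range p = UNIV"
    using permutes_bij[OF assms] by (auto simp: bij_def)
  have lt: "p u < m \<longleftrightarrow> u < m" for u using permutes_in_image[OF assms, of u] by simp
  have "(`) p ` edges (complete_graph m) = edges (complete_graph m)"
  proof (intro equalityI subsetI)
    fix e assume "e \<in> (`) p ` edges (complete_graph m)"
    then obtain u v where "e = {p u, p v}" "u < m" "v < m" "u \<noteq> v" by (auto simp: edges_complete_graph)
    then show "e \<in> edges (complete_graph m)" using lt inj by (auto simp: edges_complete_graph dest: injD)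
  next
    fix e assume "e \<in> edges (complete_graph m)"
    then obtain u v where e: "e = {u, v}" "u < m" "v < m" "u \<noteq> v" by (auto simp: edges_complete_graph)
    obtain u' v' where p: "u = p u'" "v = p v'" using ran by (metis surjD)
    then have "{u', v'} \<in> edges (complete_graph m)" using e lt by (auto simp: edges_complete_graph)
    moreover have "e = p ` {u', v'}" using e p by simp
    ultimately show "e \<in> (`) p ` edges (complete_graph m)" by blast
  qed
  then show ?thesis using orn_image[OF wf_edges_complete[of m] inj, of d] ran by simp
qed

lemma nbal_permute:
  assumes "p permutes {..<m}"
  shows "nbal m (p ` S) (p ` S') = nbal m S S'"
proof -
  have "i \<in> p ` A \<longleftrightarrow> inv_into UNIV p i \<in> A" for i A
    using permutes_inverses[OF assms] permutes_inj[OF assms] by (metis image_iff inv_f_f)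
  then show ?thesis unfolding nbal_def
    using orn_complete_permute[OF assms, of "\<lambda>i. 2 * (of_bool (i \<in> S) - of_bool (i \<in> S'))"] by simp
qed

text \<open>Isolates the edges at two chosen vertices, in the shape to which
  \<open>orn_unimodal\<close> applies.\<close>

lemma edges_complete_split:
  assumes "u < m" "v < m" "u \<noteq> v"
  shows "edges (complete_graph m) = insert {u, v}
    ({e \<in> edges (complete_graph m). u \<notin> e \<and> v \<notin> e} \<union> (\<lambda>w. {u, w}) ` ({..<m} - {u, v}) \<union> (\<lambda>w. {v, w}) ` ({..<m} - {u, v}))"
  (is "?L = ?R")
proof
  show "?L \<subseteq> ?R"
  proof
    fix e assume e: "e \<in> ?L"
    then obtain a b where ab: "e = {a, b}" "a < m" "b < m" "a \<noteq> b" by (auto simp: edges_complete_graph)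
    show "e \<in> ?R"
    proof (cases "u \<in> e \<or> v \<in> e")
      case True
      then consider "e = {u, v}" | w where "w < m" "w \<notin> {u, v}" "e = {u, w} \<or> e = {v, w}"
        using ab by (auto simp: insert_commute)
      then show ?thesis by cases auto
    qed (use e in auto)
  qed
  show "?R \<subseteq> ?L" using assms by (auto simp: edges_complete_graph)
qed

text \<open>Exchanging \<open>u\<close> for \<open>v\<close> in \<open>S\<close> changes the
  prescription at these two vertices from \<open>0, 0\<close> to \<open>2, -2\<close>, so this is
  unimodality at \<open>c = 0\<close> for \<open>s = 0\<close> and \<open>s' = 2\<close>.\<close>

lemma nbal_swap_le:
  assumes "u < m" "v < m" "u \<in> R" "v \<notin> R" "u \<in> S" "v \<notin> S"
  shows "nbal m R (insert v (S - {u})) \<le> nbal m R S"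
proof -
  let ?d = "\<lambda>i. 2 * (of_bool (i \<in> R) - of_bool (i \<in> S)) :: int"
  have uv: "u \<noteq> v" using assms by auto
  have 1: "?d(u := 0 + 0, v := 0 - 0) = ?d" using assms by (auto simp: fun_eq_iff)
  have 2: "?d(u := 0 + 2, v := 0 - 2) = (\<lambda>i. 2 * (of_bool (i \<in> R) - of_bool (i \<in> insert v (S - {u}))))"
    using assms uv by (auto simp: fun_eq_iff)
  have wf: "wf_edges {e \<in> edges (complete_graph m). u \<notin> e \<and> v \<notin> e}"
    using wf_edges_complete[of m] by (auto simp: wf_edges_def)
  show ?thesis unfolding nbal_def
    using orn_unimodal[OF _ uv _ _ wf, of "{..<m} - {u, v}" 0 2 ?d 0,
        unfolded 1 2 edges_complete_split[OF assms(1,2) uv, symmetric]] by auto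
qed

text \<open>Entries of the powers of the transfer matrix \<open>nbal m\<close>, starting from the
  identity matrix.\<close>

fun walks :: "nat \<Rightarrow> nat \<Rightarrow> nat set \<Rightarrow> nat set \<Rightarrow> nat" where
  "walks m 0 A B = of_bool (A = B)"
| "walks m (Suc r) A B = (\<Sum>C\<in>Pow {..<m}. walks m r A C * nbal m C B)"

lemma transpose_image_swap:
  assumes "u \<in> S" "v \<notin> S" shows "Transposition.transpose u v ` S = insert v (S - {u})"
  using assms by (auto simp: Transposition.transpose_def image_iff split: if_splits)

text \<open>Reflection principle: pairing each intermediate set with its image under the swap of \<open>u\<close> and
  \<open>v\<close>, the difference of the two sides is a walk count with nonnegative weights.\<close>

lemma walks_swap_le:
  assumes "u < m" "v < m" "u \<in> A" "v \<notin> A" "u \<in> B" "v \<notin> B"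
  shows "walks m r A (Transposition.transpose u v ` B) \<le> walks m r A B"
  using assms(5,6)
proof (induction r arbitrary: B)
  case 0
  have "Transposition.transpose u v ` B \<noteq> A" using assms 0 by (auto simp: transpose_image_swap)
  then show ?case by auto
next
  case (Suc r)
  let ?t = "Transposition.transpose u v"
  have t: "?t permutes {..<m}" using assms by (simp add: permutes_swap_id)
  have tt: "?t ` (?t ` C) = C" for C by (simp add: image_image)
  \<comment> \<open>The swap exchanges \<open>?P\<close> with \<open>?Q\<close> and fixes every
    member of \<open>?N\<close>, so the sum over intermediate sets becomes a sum over pairs from
    \<open>?P\<close> plus a part on which both sides agree.\<close>
  let ?P = "{C \<in> Pow {..<m}. u \<in> C \<and> v \<notin> C}"
  let ?Q = "{C \<in> Pow {..<m}. u \<notin> C \<and> v \<in> C}"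
  let ?N = "{C \<in> Pow {..<m}. u \<in> C \<longleftrightarrow> v \<in> C}"
  have split: "(\<Sum>C\<in>Pow {..<m}. f C) = (\<Sum>C\<in>?P. f C + f (?t ` C)) + sum f ?N" for f :: "nat set \<Rightarrow> nat"
  proof -
    have "Pow {..<m} = (?P \<union> ?Q) \<union> ?N" by auto
    then have "sum f (Pow {..<m}) = sum f ?P + sum f ?Q + sum f ?N"
    proof -
      assume e: "Pow {..<m} = (?P \<union> ?Q) \<union> ?N"
      have "sum f ((?P \<union> ?Q) \<union> ?N) = sum f (?P \<union> ?Q) + sum f ?N" by (rule sum.union_disjoint) auto
      moreover have "sum f (?P \<union> ?Q) = sum f ?P + sum f ?Q" by (rule sum.union_disjoint) auto
      ultimately show ?thesis using arg_cong[OF e, of "sum f"] by simp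
    qed
    moreover have "sum f ?Q = (\<Sum>C\<in>?P. f (?t ` C))"
    proof (rule sum.reindex_bij_witness[of _ "(`) ?t" "(`) ?t"])
      fix C assume "C \<in> ?Q"
      then show "?t ` C \<in> ?P" using assms t
        by (auto simp: Transposition.transpose_def image_iff split: if_splits)
    next
      fix C assume "C \<in> ?P"
      then show "?t ` C \<in> ?Q" using assms t
        by (auto simp: Transposition.transpose_def image_iff split: if_splits)
    qed (auto simp: tt)
    ultimately show ?thesis by (simp add: sum.distrib)
  qed
  have N: "nbal m C (?t ` B) = nbal m C B" if "C \<in> ?N" for C
  proof -
    have "?t ` C = C" using that by (auto simp: Transposition.transpose_def image_iff split: if_splits)
    then show ?thesis using nbal_permute[OF t, of C B] by simp
  qed
  \<comment> \<open>Rearrangement inequality: with \<open>a' \<le> a\<close> for the walk counts and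
    \<open>b' \<le> b\<close> for the matrix entries, \<open>a b' + a' b \<le> a b + a' b'\<close>.
    The first comparison is the induction hypothesis, the second is
    \<open>nbal_swap_le\<close>.\<close>
  have P: "walks m r A C * nbal m C (?t ` B) + walks m r A (?t ` C) * nbal m (?t ` C) (?t ` B)
     \<le> walks m r A C * nbal m C B + walks m r A (?t ` C) * nbal m (?t ` C) B" if "C \<in> ?P" for C
  proof -
    have 1: "nbal m (?t ` C) (?t ` B) = nbal m C B" by (rule nbal_permute[OF t])
    have 2: "nbal m (?t ` C) B = nbal m C (?t ` B)" using nbal_permute[OF t, of C "?t ` B"] by (simp add: tt)
    have 3: "nbal m C (?t ` B) \<le> nbal m C B"
      using nbal_swap_le[OF assms(1,2), of C B] that Suc.prems by (simp add: transpose_image_swap)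
    have 4: "walks m r A (?t ` C) \<le> walks m r A C" using Suc.IH that by simp
    obtain x y where "nbal m C B = nbal m C (?t ` B) + x" "walks m r A C = walks m r A (?t ` C) + y"
      using 3 4 by (auto simp: le_iff_add)
    then show ?thesis unfolding 1 2 by (simp add: algebra_simps)
  qed
  show ?case unfolding walks.simps split
    by (intro add_mono sum_mono P) (auto simp: N)
qed

text \<open>As long as \<open>B\<close> differs from \<open>A\<close>, swapping an element of
  \<open>B - A\<close> for one of \<open>A - B\<close> brings \<open>B\<close> closer to
  \<open>A\<close> and, by reflection, does not decrease the number of walks.\<close>

lemma walks_le_diag:
  assumes "A \<subseteq> {..<m}" "B \<subseteq> {..<m}" "card A = card B"
  shows "walks m r A B \<le> walks m r A A"
  using assms
proof (induction "card (A - B)" arbitrary: B rule: less_induct)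
  case less
  have fin: "finite A" "finite B" using less.prems finite_subset by blast+
  show ?case
  proof (cases "A = B")
    case False
    have "\<not> A \<subseteq> B" "\<not> B \<subseteq> A" using False less.prems fin card_subset_eq by metis+
    then obtain u v where uv: "u \<in> A" "u \<notin> B" "v \<in> B" "v \<notin> A" by blast
    let ?B = "Transposition.transpose u v ` B"
    have B: "?B = insert u (B - {v})"
      using transpose_image_swap[OF uv(3,2)] by (simp add: transpose_commute)
    have B': "Transposition.transpose u v ` ?B = B" by (simp add: image_image)
    have sub: "?B \<subseteq> {..<m}" using uv less.prems unfolding B by auto
    have "inj (Transposition.transpose u v)" by (metis injI transpose_involutory)
    then have "card ?B = card A" using less.prems(3) by (metis card_image inj_on_subset subset_UNIV)
    moreover have "card (A - ?B) < card (A - B)" using uv fin unfolding B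
      by (intro psubset_card_mono) auto
    ultimately have "walks m r A ?B \<le> walks m r A A" using less sub by simp
    moreover have "walks m r A (Transposition.transpose u v ` ?B) \<le> walks m r A ?B"
      using uv less.prems unfolding B by (intro walks_swap_le) auto
    ultimately show ?thesis unfolding B' by simp
  qed simp
qed

text \<open>The case of walks of length one: all diagonal entries of the transfer matrix equal
  \<open>rtour m\<close>.\<close>

lemma nbal_le_rtour:
  assumes "A \<subseteq> {..<m}" "B \<subseteq> {..<m}" shows "nbal m A B \<le> rtour m"
proof (cases "card A = card B")
  case True
  have w: "walks m (Suc 0) A C = nbal m A C" for C
  proof -
    have "(\<Sum>D\<in>Pow {..<m}. of_bool (A = D) * nbal m D C) = (\<Sum>D\<in>{A}. of_bool (A = D) * nbal m D C)"
      using assms by (intro sum.mono_neutral_right) auto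
    then show ?thesis by simp
  qed
  show ?thesis using walks_le_diag[OF assms True, of "Suc 0"] unfolding w nbal_same .
qed (use nbal_card[OF assms] in simp)

lemma permutes_map_disjoint_sets:
  assumes "finite V" "A \<subseteq> V" "B \<subseteq> V" "A' \<subseteq> V" "B' \<subseteq> V" "A \<inter> B = {}" "A' \<inter> B' = {}"
    "card A = card A'" "card B = card B'"
  obtains p where "p permutes V" "p ` A = A'" "p ` B = B'"
proof -
  have fin: "finite A" "finite A'" "finite B" "finite B'" using assms by (auto intro: finite_subset)
  have "card (V - (A \<union> B)) = card (V - (A' \<union> B'))"
    using assms fin by (simp add: card_Diff_subset card_Un_disjoint)
  then obtain f g h where f: "bij_betw f A A'" and g: "bij_betw g B B'"
    and h: "bij_betw h (V - (A \<union> B)) (V - (A' \<union> B'))"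
    using assms fin by (metis finite_Diff finite_same_card_bij)
  define p where "p x = (if x \<in> A then f x else if x \<in> B then g x else if x \<in> V then h x else x)" for x
  have pA: "bij_betw p A A'" by (rule bij_betw_cong[THEN iffD1, OF _ f]) (simp add: p_def)
  have pB: "bij_betw p B B'"
    by (rule bij_betw_cong[THEN iffD1, OF _ g]) (use assms(6) in \<open>auto simp: p_def\<close>)
  have pC: "bij_betw p (V - (A \<union> B)) (V - (A' \<union> B'))"
    by (rule bij_betw_cong[THEN iffD1, OF _ h]) (simp add: p_def)
  have "bij_betw p ((A \<union> B) \<union> (V - (A \<union> B))) ((A' \<union> B') \<union> (V - (A' \<union> B')))"
    using assms by (intro bij_betw_combine pA pB pC) auto
  moreover have "(A \<union> B) \<union> (V - (A \<union> B)) = V" "(A' \<union> B') \<union> (V - (A' \<union> B')) = V" using assms by auto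
  ultimately have "bij_betw p V V" by simp
  then have "p permutes V" using assms by (intro bij_imp_permutes) (auto simp: p_def)
  then show ?thesis using that pA pB by (simp add: bij_betw_imp_surj_on)
qed

section \<open>Row sums of the transfer matrix\<close>

text \<open>By symmetry under permutations an entry depends only on the common size \<open>k\<close>
  of the two differences, and a standard pair of disjoint sets represents it. In
  \<open>rowsum\<close> the binomial factors vanish unless \<open>2 * k \<le> m\<close>, where both
  intervals lie inside \<open>{..<m}\<close>.\<close>

definition ntour :: "nat \<Rightarrow> nat \<Rightarrow> nat" where
  "ntour m k = nbal m {..<k} {k..<2 * k}"

lemma nbal_eq_ntour:
  assumes "A \<subseteq> {..<m}" "B \<subseteq> {..<m}" "A \<inter> B = {}" "card A = card B"
  shows "nbal m A B = ntour m (card A)"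
proof -
  have fin: "finite A" "finite B" using assms finite_subset by blast+
  have "card (A \<union> B) \<le> card {..<m}" using assms by (intro card_mono) auto
  then have le: "2 * card A \<le> m" using assms fin by (simp add: card_Un_disjoint)
  obtain p where "p permutes {..<m}" "p ` A = {..<card A}" "p ` B = {card A..<2 * card A}"
    by (rule permutes_map_disjoint_sets[of "{..<m}" A B "{..<card A}" "{card A..<2 * card A}"])
       (use assms le in auto)
  then show ?thesis unfolding ntour_def using nbal_permute by metis
qed

lemma sum_Pow_card:
  fixes g :: "nat \<Rightarrow> nat"
  assumes "finite S"
  shows "(\<Sum>X\<in>Pow S. g (card X)) = (\<Sum>k\<le>card S. (card S choose k) * g k)"
proof -
  have "(\<Sum>k\<in>{..card S}. \<Sum>X\<in>{X\<in>Pow S. card X = k}. g (card X)) = (\<Sum>X\<in>Pow S. g (card X))"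
    using assms by (intro sum.group) (auto intro: card_mono)
  moreover have "(\<Sum>X\<in>{X\<in>Pow S. card X = k}. g (card X)) = (card S choose k) * g k" for k
    using n_subsets[OF assms, of k] by simp
  ultimately show ?thesis by (simp only:)
qed

text \<open>The index \<open>k\<close> is the size of \<open>S - B\<close> and of \<open>B - S\<close> when the row \<open>S\<close> has size \<open>p\<close>.\<close>

definition rowsum :: "nat \<Rightarrow> nat \<Rightarrow> nat" where
  "rowsum m p = (\<Sum>k\<le>m. (p choose k) * ((m - p) choose k) * ntour m k)"

lemma sum_nbal:
  assumes S: "S \<subseteq> {..<m}"
  shows "(\<Sum>B\<in>Pow {..<m}. nbal m S B) = rowsum m (card S)"
proof -
  let ?C = "{..<m} - S"
  have fin: "finite S" using assms finite_subset by blast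
  \<comment> \<open>An entry depends on \<open>S\<close> and \<open>B\<close> only through
    \<open>S - B\<close> and \<open>B - S\<close>, which may be chosen independently inside
    \<open>S\<close> and its complement.\<close>
  have "(\<Sum>B\<in>Pow {..<m}. nbal m S B) = (\<Sum>(X, Y)\<in>Pow S \<times> Pow ?C. nbal m X Y)"
  proof (rule sum.reindex_bij_witness[of _ "\<lambda>(X, Y). (S - X) \<union> Y" "\<lambda>B. (S - B, B - S)"])
    fix B assume "B \<in> Pow {..<m}"
    have "(\<lambda>i. 2 * (of_bool (i \<in> S) - of_bool (i \<in> B)) :: int) = (\<lambda>i. 2 * (of_bool (i \<in> S - B) - of_bool (i \<in> B - S)))"
      by auto
    then show "(case (S - B, B - S) of (X, Y) \<Rightarrow> nbal m X Y) = nbal m S B" by (simp add: nbal_def)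
  qed (use S in auto)
  also have "\<dots> = (\<Sum>X\<in>Pow S. \<Sum>Y\<in>Pow ?C. nbal m X Y)" by (rule sum.cartesian_product[symmetric])
  also have "\<dots> = (\<Sum>X\<in>Pow S. (card ?C choose card X) * ntour m (card X))"
  proof (rule sum.cong[OF refl])
    fix X assume X: "X \<in> Pow S"
    have "(\<Sum>Y\<in>Pow ?C. nbal m X Y) = (\<Sum>Y\<in>{Y. Y \<subseteq> ?C \<and> card Y = card X}. nbal m X Y)"
    proof (intro sum.mono_neutral_right ballI)
      fix Y assume "Y \<in> Pow ?C - {Y. Y \<subseteq> ?C \<and> card Y = card X}"
      then show "nbal m X Y = 0" using X S by (intro nbal_card) auto
    qed auto
    also have "\<dots> = (\<Sum>Y\<in>{Y. Y \<subseteq> ?C \<and> card Y = card X}. ntour m (card X))"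
      using X S by (intro sum.cong refl nbal_eq_ntour) auto
    also have "\<dots> = (card ?C choose card X) * ntour m (card X)" by (simp add: n_subsets)
    finally show "(\<Sum>Y\<in>Pow ?C. nbal m X Y) = (card ?C choose card X) * ntour m (card X)" .
  qed
  also have "\<dots> = (\<Sum>k\<le>card S. (card S choose k) * ((card ?C choose k) * ntour m k))"
    by (rule sum_Pow_card[OF fin])
  also have "\<dots> = (\<Sum>k\<le>m. (card S choose k) * ((card ?C choose k) * ntour m k))"
    using card_mono[OF _ S] by (intro sum.mono_neutral_left) auto
  finally show ?thesis using S fin by (simp add: rowsum_def card_Diff_subset mult.assoc)
qed

text \<open>By Pascal's rule, with \<open>k = Suc j\<close>, the claim reduces to comparing the
  ratios of consecutive binomials, \<open>(n - j) / (j + 1)\<close> for \<open>n = a\<close> and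
  \<open>n = q\<close>, and these grow with \<open>n\<close>.\<close>

lemma binomial_prod_le:
  assumes "a < q"
  shows "(a choose k) * (Suc q choose k) \<le> (Suc a choose k) * (q choose k)"
proof (cases k)
  case (Suc j)
  have step: "Suc j * (n choose Suc j) = (n - j) * (n choose j)" for n
    by (metis Suc_times_binomial_eq binomial_absorb_comp binomial_absorption mult.commute)
  have "Suc j * ((a choose Suc j) * (q choose j)) = ((a choose j) * (q choose j)) * (a - j)"
    using step[of a] by (simp only: mult.assoc[symmetric]) (simp add: ac_simps)
  also have "\<dots> \<le> ((a choose j) * (q choose j)) * (q - j)" using assms by (intro mult_left_mono) auto
  also have "\<dots> = Suc j * ((a choose j) * (q choose Suc j))"
  proof -
    have "(a choose j) * ((q - j) * (q choose j)) = (a choose j) * (Suc j * (q choose Suc j))"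
      by (simp only: step[of q])
    then show ?thesis by (simp only: ac_simps)
  qed
  finally have "(a choose Suc j) * (q choose j) \<le> (a choose j) * (q choose Suc j)"
    by (simp only: mult_le_cancel1)
  then show ?thesis unfolding Suc by (simp add: algebra_simps)
qed simp

text \<open>Moving \<open>p\<close> one step towards the middle increases every coefficient in the
  sum over \<open>k\<close>, while \<open>p\<close> and \<open>m - p\<close> give the same row
  sum.\<close>

lemma rowsum_le:
  assumes "p \<le> m" shows "rowsum m p \<le> rowsum m (m div 2)"
proof -
  have step: "rowsum m a \<le> rowsum m (Suc a)" if "Suc a \<le> m div 2" for a
    unfolding rowsum_def
  proof (intro sum_mono mult_right_mono)
    fix k
    have "a < m - Suc a" "m - a = Suc (m - Suc a)" using that by auto
    then show "(a choose k) * ((m - a) choose k) \<le> (Suc a choose k) * ((m - Suc a) choose k)"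
      using binomial_prod_le[of a "m - Suc a" k] by simp
  qed simp
  have half: "rowsum m p \<le> rowsum m (m div 2)" if "p \<le> m div 2" for p
    using that
  proof (induction rule: inc_induct)
    case (step n)
    then show ?case using \<open>\<And>a. Suc a \<le> m div 2 \<Longrightarrow> rowsum m a \<le> rowsum m (Suc a)\<close>[of n] by simp
  qed simp
  have "rowsum m p = rowsum m (m - p)" using assms by (simp add: rowsum_def mult.commute)
  then show ?thesis using half[of p] half[of "m - p"] by (cases "p \<le> m div 2") auto
qed

lemma sum_sign:
  assumes "S \<subseteq> {..<m}"
  shows "(\<Sum>i<m. if i \<in> S then 1 else -1 :: int) = 2 * int (card S) - int m"
proof -
  have "(if i \<in> S then 1 else -1 :: int) = 2 * of_bool (i \<in> S) - 1" for i by simp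
  then have "(\<Sum>i<m. if i \<in> S then 1 else -1 :: int) = (\<Sum>i<m. 2 * of_bool (i \<in> S) - 1)" by simp
  also have "\<dots> = 2 * (\<Sum>i<m. of_bool (i \<in> S)) - int m" by (simp add: sum_subtractf sum_distrib_left)
  also have "(\<Sum>i<m. of_bool (i \<in> S)) = int (card S)"
    using assms by (simp add: of_bool_def sum.If_cases Int_absorb1)
  finally show ?thesis .
qed

text \<open>\<open>S\<close> and \<open>S'\<close> hold the out-neighbours of the two extra
  vertices. The balance at \<open>m\<close> fixes the size of \<open>S\<close>; what remains on
  \<open>{..<m}\<close> is the prescription of \<open>nbal m S\<close> against the complement of
  \<open>S'\<close>, so summing over \<open>S'\<close> produces a full row of the transfer
  matrix.\<close>

lemma orn_two_stars:
  assumes "d = (\<lambda>_. 0)(m := e, Suc m := - e)"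
  shows "orn ((edges (complete_graph m) \<union> (\<lambda>i. {m, i}) ` {..<m}) \<union> (\<lambda>i. {Suc m, i}) ` {..<m}) d
    = (\<Sum>S\<in>{S \<in> Pow {..<m}. 2 * int (card S) = int m + e}. rowsum m (card S))"
proof -
  let ?K = "edges (complete_graph m)"
  let ?c = "\<lambda>S x w. \<Sum>i<m. (if i \<in> S then 1 else -1) * (of_bool (w = x) - of_bool (w = i)) :: int"
  have wf: "wf_edges ?K" "wf_edges (?K \<union> (\<lambda>i. {m, i}) ` {..<m})"
    using wf_edges_complete[of m] by (auto simp: wf_edges_def card_insert_if)
  have c: "?c S x w = (if w = x then 2 * int (card S) - int m else if w < m then (if w \<in> S then -1 else 1) else 0)"
    if "S \<subseteq> {..<m}" "x \<ge> m" for S x w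
  proof (cases "w = x")
    case True
    then have "?c S x w = (\<Sum>i<m. if i \<in> S then 1 else -1)" using that by (intro sum.cong) auto
    then show ?thesis using True sum_sign[OF that(1)] by simp
  next
    case False
    then have "?c S x w = (\<Sum>i<m. if i = w then (if w \<in> S then -1 else 1) else 0)" by (intro sum.cong) auto
    then show ?thesis using False by (simp add: sum.delta)
  qed
  have "orn ((?K \<union> (\<lambda>i. {m, i}) ` {..<m}) \<union> (\<lambda>i. {Suc m, i}) ` {..<m}) d
    = (\<Sum>S'\<in>Pow {..<m}. orn (?K \<union> (\<lambda>i. {m, i}) ` {..<m}) (\<lambda>w. d w - ?c S' (Suc m) w))"
    by (rule orn_family[OF _ wf(2)]) (auto simp: edges_complete_graph inj_on_def doubleton_eq_iff)
  also have "\<dots> = (\<Sum>S'\<in>Pow {..<m}. \<Sum>S\<in>Pow {..<m}. orn ?K (\<lambda>w. (d w - ?c S' (Suc m) w) - ?c S m w))"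
    by (intro sum.cong refl orn_family[OF _ wf(1)]) (auto simp: edges_complete_graph inj_on_def doubleton_eq_iff)
  also have "\<dots> = (\<Sum>S'\<in>Pow {..<m}. \<Sum>S\<in>Pow {..<m}. if 2 * int (card S) = int m + e then nbal m S ({..<m} - S') else 0)"
  proof (intro sum.cong refl)
    fix S' S assume "S' \<in> Pow {..<m}" "S \<in> Pow {..<m}"
    then have S': "S' \<subseteq> {..<m}" and S: "S \<subseteq> {..<m}" by auto
    let ?f = "\<lambda>w. (d w - ?c S' (Suc m) w) - ?c S m w"
    have f: "?f w = (if w = m then e + int m - 2 * int (card S) else if w = Suc m then - e + int m - 2 * int (card S')
        else if w < m then (if w \<in> S then 1 else -1) + (if w \<in> S' then 1 else -1) else 0)" for w
      using S S' unfolding assms by (simp add: c)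
    show "orn ?K ?f = (if 2 * int (card S) = int m + e then nbal m S ({..<m} - S') else 0)"
    proof (cases "2 * int (card S) = int m + e")
      case False
      have "m \<notin> \<Union>?K" using Union_complete[of m] by auto
      moreover have "?f m \<noteq> 0" using False by (subst f) simp
      ultimately have "orn ?K ?f = 0" by (rule orn_outside)
      then show ?thesis using False by (simp only: if_False)
    next
      case True
      have card: "card ({..<m} - S') = m - card S'" "card S' \<le> m"
        using S' card_mono[OF _ S'] by (auto simp: card_Diff_subset finite_subset)
      show ?thesis
      proof (cases "card ({..<m} - S') = card S")
        \<comment> \<open>Here the condition at \<open>Suc m\<close> fails. The matching entry of
          the transfer matrix is also zero, so the condition need not appear in the sum and whole
          rows may be summed.\<close>
        case False
        have "Suc m \<notin> \<Union>?K" using Union_complete[of m] by auto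
        moreover have "?f (Suc m) \<noteq> 0" using False True card by (subst f) simp
        ultimately have "orn ?K ?f = 0" by (rule orn_outside)
        moreover have "nbal m S ({..<m} - S') = 0" using False S by (intro nbal_card) auto
        ultimately show ?thesis by (simp only: if_cancel)
      next
        case c: True
        have "?f = (\<lambda>i. 2 * (of_bool (i \<in> S) - of_bool (i \<in> {..<m} - S')))"
          unfolding f using S S' True c card by (auto simp: fun_eq_iff)
        then show ?thesis using True by (simp only: nbal_def simp_thms if_True)
      qed
    qed
  qed
  also have "\<dots> = (\<Sum>C\<in>Pow {..<m}. \<Sum>S\<in>Pow {..<m}. if 2 * int (card S) = int m + e then nbal m S C else 0)"
    by (rule sum.reindex_bij_witness[of _ "\<lambda>C. {..<m} - C" "\<lambda>C. {..<m} - C"]) (auto simp: double_diff)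
  also have "\<dots> = (\<Sum>S\<in>Pow {..<m}. \<Sum>C\<in>Pow {..<m}. if 2 * int (card S) = int m + e then nbal m S C else 0)"
    by (rule sum.swap)
  also have "\<dots> = (\<Sum>S\<in>Pow {..<m}. if 2 * int (card S) = int m + e then rowsum m (card S) else 0)"
    by (intro sum.cong refl) (auto simp: sum_nbal)
  also have "\<dots> = (\<Sum>S\<in>{S \<in> Pow {..<m}. 2 * int (card S) = int m + e}. rowsum m (card S))"
    by (rule sum.inter_filter[symmetric]) simp
  finally show ?thesis .
qed

text \<open>Deleting two vertices from a regular tournament leaves a pair of neighbouring layers.\<close>

lemma rtour_add2:
  assumes "odd m"
  shows "rtour (m + 2) = 2 * (m choose (m div 2)) * rowsum m (m div 2)"
proof -
  let ?K = "edges (complete_graph m)"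
  let ?E = "(?K \<union> (\<lambda>i. {m, i}) ` {..<m}) \<union> (\<lambda>i. {Suc m, i}) ` {..<m}"
  have E: "edges (complete_graph (m + 2)) = insert {m, Suc m} ?E"
  proof
    show "edges (complete_graph (m + 2)) \<subseteq> insert {m, Suc m} ?E"
    proof
      fix e assume "e \<in> edges (complete_graph (m + 2))"
      then obtain u v where uv: "e = {u, v}" "u < m + 2" "v < m + 2" "u \<noteq> v" by (auto simp: edges_complete_graph)
      have "u < m \<or> u = m \<or> u = Suc m" "v < m \<or> v = m \<or> v = Suc m" using uv by auto
      then show "e \<in> insert {m, Suc m} ?E" using uv
        by (elim disjE) (auto simp: edges_complete_graph insert_commute)
    qed
    show "insert {m, Suc m} ?E \<subseteq> edges (complete_graph (m + 2))"
      by (auto simp: edges_complete_graph) force+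
  qed
  have wf: "wf_edges ?E" using wf_edges_complete[of m] by (auto simp: wf_edges_def card_insert_if)
  have ni: "{m, Suc m} \<notin> ?E" by (auto simp: edges_complete_graph doubleton_eq_iff)
  obtain h where h: "m = 2 * h + 1" using assms by (elim oddE)
  \<comment> \<open>The edge \<open>{m, Suc m}\<close> takes up one unit, so the out-neighbourhood
    of \<open>m\<close> has size \<open>h\<close> or \<open>Suc h\<close>; the reflection of
    \<open>{..<m}\<close> sizes about \<open>m / 2\<close> makes the two cases equal.\<close>
  have half: "(\<Sum>S\<in>{S \<in> Pow {..<m}. 2 * int (card S) = int m + e}. rowsum m (card S)) = (m choose h) * rowsum m h"
    if "e = 1 \<or> e = -1" for e
  proof -
    define k where "k = (if e = 1 then Suc h else h)"
    have "{S \<in> Pow {..<m}. 2 * int (card S) = int m + e} = {S. S \<subseteq> {..<m} \<and> card S = k}"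
      using that h by (auto simp: k_def)
    then have "(\<Sum>S\<in>{S \<in> Pow {..<m}. 2 * int (card S) = int m + e}. rowsum m (card S)) = (m choose k) * rowsum m k"
      using n_subsets[of "{..<m}" k] by simp
    moreover have "m choose Suc h = m choose h" using binomial_symmetric[of h m] h by simp
    moreover have "rowsum m (Suc h) = rowsum m h" using h by (simp add: rowsum_def mult.commute)
    ultimately show ?thesis by (simp add: k_def)
  qed
  have "rtour (m + 2) = orn ?E ((\<lambda>_. 0)(m := -1, Suc m := 1)) + orn ?E ((\<lambda>_. 0)(m := 1, Suc m := -1))"
    unfolding rtour_def E using orn_insert[OF _ ni wf, of "\<lambda>_. 0"] by simp
  also have "\<dots> = 2 * ((m choose h) * rowsum m h)"
    using orn_two_stars[of _ m "-1", OF refl] orn_two_stars[of _ m 1, OF refl] half[of 1] half[of "-1"] by simp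
  finally show ?thesis using h by simp
qed

section \<open>The transfer matrix of the product graph\<close>

definition layer :: "nat \<Rightarrow> nat \<Rightarrow> (nat \<times> nat) set set" where
  "layer m v = (`) (\<lambda>u. (u, v)) ` edges (complete_graph m)"

lemma Union_layer: "\<Union>(layer m v) \<subseteq> {..<m} \<times> {v}"
  by (auto simp: layer_def edges_complete_graph)

lemma wf_edges_layer: "wf_edges (layer m v)"
  using wf_edges_complete[of m] by (auto simp: layer_def wf_edges_def card_image inj_on_def)

lemma orn_layers:
  assumes "\<And>u v. v \<ge> l \<Longrightarrow> d (u, v) = 0"
  shows "orn (\<Union>v<l. layer m v) d = (\<Prod>v<l. orn (edges (complete_graph m)) (\<lambda>u. d (u, v)))"
  using assms
proof (induction l arbitrary: d)
  case 0
  then have "d = (\<lambda>_. 0)" by (auto simp: fun_eq_iff)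
  then show ?case by (simp add: orn_empty)
next
  case (Suc l)
  let ?V = "UNIV \<times> {l} :: (nat \<times> nat) set"
  have wf: "wf_edges (\<Union>v<l. layer m v)" using wf_edges_layer by (auto simp: wf_edges_def)
  have "\<Union>(\<Union>v<l. layer m v) \<inter> ?V = {}" using Union_layer by fastforce
  moreover have "\<Union>(layer m l) \<subseteq> ?V" using Union_layer by fastforce
  ultimately have "orn ((\<Union>v<l. layer m v) \<union> layer m l) d =
    orn (\<Union>v<l. layer m v) (\<lambda>w. if w \<in> ?V then 0 else d w) * orn (layer m l) (\<lambda>w. if w \<in> ?V then d w else 0)"
    by (intro orn_disjoint wf wf_edges_layer)
  also have "orn (\<Union>v<l. layer m v) (\<lambda>w. if w \<in> ?V then 0 else d w) = (\<Prod>v<l. orn (edges (complete_graph m)) (\<lambda>u. d (u, v)))"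
    using Suc.prems by (subst Suc.IH) (auto intro!: prod.cong)
  also have "orn (layer m l) (\<lambda>w. if w \<in> ?V then d w else 0) = orn (edges (complete_graph m)) (\<lambda>u. d (u, l))"
  proof -
    have inj: "inj (\<lambda>u::nat. (u, l))" by (auto simp: inj_on_def)
    have "(\<lambda>w. if w \<in> ?V then d w else 0) =
      (\<lambda>w. if w \<in> range (\<lambda>u. (u, l)) then d (inv_into UNIV (\<lambda>u. (u, l)) w, l) else 0)"
      using inv_f_f[OF inj] by (auto simp: fun_eq_iff)
    then show ?thesis unfolding layer_def
      using orn_image[OF wf_edges_complete[of m] inj, of "\<lambda>u. d (u, l)"] by simp
  qed
  finally show ?case by (simp add: lessThan_Suc Un_commute mult.commute)
qed

text \<open>The edges along the cycle are indexed by the endpoint they leave in cyclic order, the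
  form in which \<open>orn_family\<close> removes them.\<close>

lemma edges_box:
  "edges (complete_graph m \<box> cycle_graph l) =
    (\<Union>v<l. layer m v) \<union> (\<lambda>i. {i, (fst i, (snd i + 1) mod l)}) ` ({..<m} \<times> {..<l})" (is "?L = ?R")
proof
  show "?L \<subseteq> ?R"
  proof
    fix e assume "e \<in> ?L"
    then consider (cyc) a b b' i where "a < m" "e = {(a, b), (a, b')}" "{b, b'} = {i, (i + 1) mod l}" "i < l"
      | (com) a a' b w z where "b < l" "e = {(a, b), (a', b)}" "{a, a'} = {w, z}" "w < m" "z < m" "w \<noteq> z"
      by (auto simp: cartesian_product_def complete_graph_def cycle_graph_def)
    then show "e \<in> ?R"
    proof cases
      case cyc
      then have "e = {(a, i), (a, (i + 1) mod l)}" by (auto simp: doubleton_eq_iff)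
      then show ?thesis using cyc by (intro UnI2 image_eqI[of _ _ "(a, i)"]) auto
    next
      case com
      then have "e = (\<lambda>u. (u, b)) ` {w, z}" by (auto simp: doubleton_eq_iff)
      moreover have "{w, z} \<in> edges (complete_graph m)" using com by (auto simp: edges_complete_graph)
      ultimately have "e \<in> layer m b" unfolding layer_def by (rule image_eqI)
      then show ?thesis using com by auto
    qed
  qed
  show "?R \<subseteq> ?L"
  proof
    fix e assume "e \<in> ?R"
    then consider u v where "u < m" "v < l" "e = {(u, v), (u, (v + 1) mod l)}"
      | v w where "v < l" "w \<in> edges (complete_graph m)" "e = (\<lambda>u. (u, v)) ` w"
      by (auto simp: layer_def)
    then show "e \<in> ?L"
    proof cases
      case 1
      then have "{v, (v + 1) mod l} \<in> edges (cycle_graph l)" "u \<in> verts (complete_graph m)"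
        by (auto simp: cycle_graph_def complete_graph_def)
      then show ?thesis unfolding cartesian_product_def using 1 by auto
    next
      case 2
      then obtain a b where "w = {a, b}" by (auto simp: edges_complete_graph)
      then have "e = {(a, v), (b, v)}" "{a, b} \<in> edges (complete_graph m)" "v \<in> verts (cycle_graph l)"
        using 2 by (auto simp: cycle_graph_def)
      then show ?thesis unfolding cartesian_product_def by auto
    qed
  qed
qed

lemma verts_box: "verts (complete_graph m \<box> cycle_graph l) = {..<m} \<times> {..<l}"
  by (simp add: cartesian_product_def complete_graph_def cycle_graph_def)

lemma Union_edges_box:
  "\<Union>(edges (complete_graph m \<box> cycle_graph l)) \<subseteq> verts (complete_graph m \<box> cycle_graph l)"
proof -
  have "\<Union>(layer m v) \<subseteq> {..<m} \<times> {..<l}" if "v < l" for v using Union_layer[of m v] that by auto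
  then show ?thesis unfolding edges_box verts_box by auto
qed

text \<open>For \<open>l = 2\<close> the edges leaving the two vertices would coincide, so
  \<open>l \<ge> 3\<close> is essential here.\<close>

lemma cycle_shift_inj:
  fixes l :: nat
  assumes "l \<ge> 3" "v < l" "w < l" "{v, (v + 1) mod l} = {w, (w + 1) mod l}" shows "v = w"
proof (rule ccontr)
  assume "v \<noteq> w"
  then have "v = (w + 1) mod l" "w = (v + 1) mod l" using assms(4) by (auto simp: doubleton_eq_iff)
  then show False using assms by (auto simp: mod_if split: if_splits)
qed

text \<open>\<open>S\<close> holds the cycle edges pointing forwards. Once they are fixed the layers
  are independent, and each sees only the slice of \<open>S\<close> entering it and the slice
  leaving it.\<close>

lemma EO_box_families:
  assumes "l \<ge> 3"
  shows "EO (complete_graph m \<box> cycle_graph l) = (\<Sum>S\<in>Pow ({..<m} \<times> {..<l}).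
    \<Prod>v<l. nbal m {u. (u, if v = 0 then l - 1 else v - 1) \<in> S} {u. (u, v) \<in> S})"
proof -
  let ?X = "{..<m} \<times> {..<l}"
  let ?L = "\<Union>v<l. layer m v"
  let ?y = "\<lambda>i. (fst i, (snd i + 1) mod l) :: nat \<times> nat"
  let ?p = "\<lambda>v. if v = 0 then l - 1 else v - 1"
  let ?s = "\<lambda>S i. if i \<in> S then 1 else -1 :: int"
  have wf: "wf_edges ?L" using wf_edges_layer by (auto simp: wf_edges_def)
  have y: "i \<noteq> ?y i" if "i \<in> ?X" for i
    using assms that by (cases i) (auto simp: mod_if)
  have ni: "{i, ?y i} \<notin> ?L" if "i \<in> ?X" for i
  proof
    assume "{i, ?y i} \<in> ?L"
    then obtain v where v: "{i, ?y i} \<in> layer m v" by blast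
    have "i \<in> \<Union>(layer m v)" "?y i \<in> \<Union>(layer m v)" by (rule UnionI[OF v], simp)+
    then have "snd i = v" "snd (?y i) = v" using Union_layer[of m v] by (cases i; auto)+
    then show False using y[OF that] by (cases i) auto
  qed
  have inj: "inj_on (\<lambda>i. {i, ?y i}) ?X"
  proof (rule inj_onI)
    fix i j assume ij: "i \<in> ?X" "j \<in> ?X" "{i, ?y i} = {j, ?y j}"
    then have "fst ` {i, ?y i} = fst ` {j, ?y j}" "snd ` {i, ?y i} = snd ` {j, ?y j}" by simp_all
    then have "fst i = fst j" "{snd i, (snd i + 1) mod l} = {snd j, (snd j + 1) mod l}" by simp_all
    then show "i = j" using ij cycle_shift_inj[OF assms, of "snd i" "snd j"] by (auto simp: prod_eq_iff)
  qed
  let ?c = "\<lambda>S w. \<Sum>i\<in>?X. ?s S i * (of_bool (w = i) - of_bool (w = ?y i))"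
  have "EO (complete_graph m \<box> cycle_graph l) = orn (?L \<union> (\<lambda>i. {i, ?y i}) ` ?X) (\<lambda>_. 0)"
    unfolding EO_eq_orn[OF Union_edges_box] edges_box by simp
  also have "\<dots> = (\<Sum>S\<in>Pow ?X. orn ?L (\<lambda>w. 0 - ?c S w))"
    by (rule orn_family[OF _ wf y ni inj]) auto
  also have "\<dots> = (\<Sum>S\<in>Pow ?X. \<Prod>v<l. nbal m {u. (u, ?p v) \<in> S} {u. (u, v) \<in> S})"
  proof (intro sum.cong refl)
    fix S assume S: "S \<in> Pow ?X"
    have c: "?c S (u, v) = (if u < m \<and> v < l then ?s S (u, v) - ?s S (u, ?p v) else 0)" for u v
    proof -
      have "?c S (u, v) = (\<Sum>i\<in>?X. if i = (u, v) then ?s S i else 0) - (\<Sum>i\<in>?X. if ?y i = (u, v) then ?s S i else 0)"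
        unfolding sum_subtractf[symmetric] by (intro sum.cong) auto
      also have "(\<Sum>i\<in>?X. if i = (u, v) then ?s S i else 0) = (if u < m \<and> v < l then ?s S (u, v) else 0)"
        by (subst sum.delta) auto
      also have "(\<Sum>i\<in>?X. if ?y i = (u, v) then ?s S i else 0) = (if u < m \<and> v < l then ?s S (u, ?p v) else 0)"
      proof (cases "u < m \<and> v < l")
        case True
        have iff: "?y i = (u, v) \<longleftrightarrow> i = (u, ?p v)" if "i \<in> ?X" for i
        proof
          assume "?y i = (u, v)"
          then show "i = (u, ?p v)" using that True by (cases i) (auto simp: mod_if split: if_splits)
        next
          assume "i = (u, ?p v)"
          then show "?y i = (u, v)" using that True by auto
        qed
        have "(\<Sum>i\<in>?X. if ?y i = (u, v) then ?s S i else 0) = (\<Sum>i\<in>?X. if i = (u, ?p v) then ?s S i else 0)"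
          by (intro sum.cong refl) (simp only: iff)
        then show ?thesis using True by (subst (asm) sum.delta) auto
      next
        case False
        then have "?y i \<noteq> (u, v)" if "i \<in> ?X" for i using that by (cases i) auto
        then have "(\<Sum>i\<in>?X. if ?y i = (u, v) then ?s S i else 0) = (\<Sum>i\<in>?X. 0)"
          by (intro sum.cong refl) (simp only: if_False)
        then show ?thesis using False by simp
      qed
      finally show ?thesis by auto
    qed
    have "orn ?L (\<lambda>w. 0 - ?c S w) = (\<Prod>v<l. orn (edges (complete_graph m)) (\<lambda>u. 0 - ?c S (u, v)))"
    proof (rule orn_layers)
      fix u v assume "l \<le> v"
      then show "0 - ?c S (u, v) = 0" unfolding c by simp
    qed
    also have "\<dots> = (\<Prod>v<l. nbal m {u. (u, ?p v) \<in> S} {u. (u, v) \<in> S})"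
    proof (intro prod.cong refl)
      fix v assume "v \<in> {..<l}"
      then have "(\<lambda>u. 0 - ?c S (u, v)) = (\<lambda>i. 2 * (of_bool (i \<in> {u. (u, ?p v) \<in> S}) - of_bool (i \<in> {u. (u, v) \<in> S})))"
        using S unfolding c by (auto simp: fun_eq_iff)
      then show "orn (edges (complete_graph m)) (\<lambda>u. 0 - ?c S (u, v)) = nbal m {u. (u, ?p v) \<in> S} {u. (u, v) \<in> S}"
        by (simp only: nbal_def)
    qed
    finally show "orn ?L (\<lambda>w. 0 - ?c S w) = (\<Prod>v<l. nbal m {u. (u, ?p v) \<in> S} {u. (u, v) \<in> S})" .
  qed
  finally show ?thesis .
qed

lemma sum_PiE_insert:
  assumes "i \<notin> I"
  shows "(\<Sum>f\<in>insert i I \<rightarrow>\<^sub>E K. h f) = (\<Sum>f\<in>I \<rightarrow>\<^sub>E K. \<Sum>y\<in>K. h (f(i := y)))"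
proof -
  have "(\<Sum>f\<in>insert i I \<rightarrow>\<^sub>E K. h f) = (\<Sum>(f, y)\<in>(I \<rightarrow>\<^sub>E K) \<times> K. h (f(i := y)))"
    using assms
    by (intro sum.reindex_bij_witness[of _ "\<lambda>(f, y). f(i := y)" "\<lambda>f. (f(i := undefined), f i)"])
       (auto simp: PiE_iff extensional_def fun_eq_iff)
  then show ?thesis by (simp add: sum.cartesian_product)
qed

text \<open>The kernel \<open>g\<close> on the two endpoints is left arbitrary so that the induction
  can absorb the last step of the path into it.\<close>

lemma sum_paths:
  "(\<Sum>f\<in>{..<Suc r} \<rightarrow>\<^sub>E Pow {..<m}. g (f 0) (f r) * (\<Prod>v<r. nbal m (f v) (f (Suc v))))
    = (\<Sum>A\<in>Pow {..<m}. \<Sum>B\<in>Pow {..<m}. g A B * walks m r A B)"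
proof (induction r arbitrary: g)
  case 0
  have "{..<Suc 0} = insert (0::nat) {}" by auto
  then have "(\<Sum>f\<in>{..<Suc 0} \<rightarrow>\<^sub>E Pow {..<m}. g (f 0) (f 0)) = (\<Sum>A\<in>Pow {..<m}. g A A)"
    by (simp only:) (subst sum_PiE_insert; simp)
  moreover have "(\<Sum>B\<in>Pow {..<m}. g A B * of_bool (A = B)) = g A A" if "A \<in> Pow {..<m}" for A
  proof -
    have "(\<Sum>B\<in>Pow {..<m}. g A B * of_bool (A = B)) = (\<Sum>B\<in>{A}. g A B * of_bool (A = B))"
      using that by (intro sum.mono_neutral_right) auto
    then show ?thesis by simp
  qed
  ultimately show ?case by simp
next
  case (Suc r)
  have ins: "{..<Suc (Suc r)} = insert (Suc r) {..<Suc r}" by auto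
  have "(\<Sum>f\<in>{..<Suc (Suc r)} \<rightarrow>\<^sub>E Pow {..<m}. g (f 0) (f (Suc r)) * (\<Prod>v<Suc r. nbal m (f v) (f (Suc v))))
    = (\<Sum>f\<in>{..<Suc r} \<rightarrow>\<^sub>E Pow {..<m}. \<Sum>y\<in>Pow {..<m}.
        g (f 0) y * ((\<Prod>v<r. nbal m (f v) (f (Suc v))) * nbal m (f r) y))"
    unfolding ins by (subst sum_PiE_insert) (auto intro!: sum.cong arg_cong2[of _ _ _ _ "(*)"] prod.cong)
  also have "\<dots> = (\<Sum>f\<in>{..<Suc r} \<rightarrow>\<^sub>E Pow {..<m}. (\<Sum>y\<in>Pow {..<m}. g (f 0) y * nbal m (f r) y)
      * (\<Prod>v<r. nbal m (f v) (f (Suc v))))"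
    by (intro sum.cong refl, subst sum_distrib_right) (intro sum.cong refl, simp only: ac_simps)
  also have "\<dots> = (\<Sum>A\<in>Pow {..<m}. \<Sum>B\<in>Pow {..<m}. (\<Sum>y\<in>Pow {..<m}. g A y * nbal m B y) * walks m r A B)"
    by (rule Suc.IH)
  also have "\<dots> = (\<Sum>A\<in>Pow {..<m}. \<Sum>y\<in>Pow {..<m}. g A y * walks m (Suc r) A y)"
  proof (rule sum.cong[OF refl])
    fix A
    have "(\<Sum>B\<in>Pow {..<m}. (\<Sum>y\<in>Pow {..<m}. g A y * nbal m B y) * walks m r A B) =
      (\<Sum>B\<in>Pow {..<m}. \<Sum>y\<in>Pow {..<m}. g A y * (walks m r A B * nbal m B y))"
      by (intro sum.cong refl, subst sum_distrib_right) (intro sum.cong refl, simp only: ac_simps)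
    also have "\<dots> = (\<Sum>y\<in>Pow {..<m}. \<Sum>B\<in>Pow {..<m}. g A y * (walks m r A B * nbal m B y))"
      by (rule sum.swap)
    finally show "(\<Sum>B\<in>Pow {..<m}. (\<Sum>y\<in>Pow {..<m}. g A y * nbal m B y) * walks m r A B)
      = (\<Sum>y\<in>Pow {..<m}. g A y * walks m (Suc r) A y)" by (simp add: sum_distrib_left)
  qed
  finally show ?case .
qed

text \<open>The slices of \<open>S\<close> form a closed walk of length \<open>l\<close>; with
  \<open>g\<close> chosen as the closing step from the last slice to the first,
  \<open>sum_paths\<close> gives the trace.\<close>

lemma EO_box_walks:
  assumes "l \<ge> 3"
  shows "EO (complete_graph m \<box> cycle_graph l) = (\<Sum>A\<in>Pow {..<m}. walks m l A A)"
proof -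
  obtain r where r: "l = Suc r" using assms by (cases l) auto
  let ?p = "\<lambda>v. if v = 0 then l - 1 else v - 1"
  have "EO (complete_graph m \<box> cycle_graph l) =
    (\<Sum>f\<in>{..<Suc r} \<rightarrow>\<^sub>E Pow {..<m}. \<Prod>v<l. nbal m (f (?p v)) (f v))"
    unfolding EO_box_families[OF assms]
  proof (rule sum.reindex_bij_witness[of _ "\<lambda>f. {(u, v). v < l \<and> u \<in> f v}" "\<lambda>S. \<lambda>v\<in>{..<Suc r}. {u. (u, v) \<in> S}"])
    fix S assume "S \<in> Pow ({..<m} \<times> {..<l})"
    then show "(\<Prod>v<l. nbal m ((\<lambda>v\<in>{..<Suc r}. {u. (u, v) \<in> S}) (?p v)) ((\<lambda>v\<in>{..<Suc r}. {u. (u, v) \<in> S}) v))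
      = (\<Prod>v<l. nbal m {u. (u, ?p v) \<in> S} {u. (u, v) \<in> S})"
      using r by (intro prod.cong refl) auto
  qed (use r in \<open>auto simp: PiE_iff extensional_def fun_eq_iff\<close>)
  also have "\<dots> = (\<Sum>f\<in>{..<Suc r} \<rightarrow>\<^sub>E Pow {..<m}. nbal m (f r) (f 0) * (\<Prod>v<r. nbal m (f v) (f (Suc v))))"
    unfolding r by (subst prod.lessThan_Suc_shift) simp
  also have "\<dots> = (\<Sum>A\<in>Pow {..<m}. \<Sum>B\<in>Pow {..<m}. nbal m B A * walks m r A B)"
    by (rule sum_paths[of "\<lambda>A B. nbal m B A"])
  finally show ?thesis unfolding r by (simp add: mult.commute)
qed

lemma walks_card:
  assumes "A \<subseteq> {..<m}" "B \<subseteq> {..<m}" "card A \<noteq> card B" shows "walks m r A B = 0"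
  using assms(2,3)
proof (induction r arbitrary: B)
  case (Suc r)
  have "walks m r A C * nbal m C B = 0" if "C \<in> Pow {..<m}" for C
    using Suc that nbal_card[of C m B] by (cases "card A = card C") auto
  then show ?case by simp
qed auto

text \<open>Walks never change the size of the set, and on sets of one size all row sums agree; a
  matrix with constant row sums has powers with constant row sums.\<close>

lemma sum_walks:
  assumes "A \<subseteq> {..<m}"
  shows "(\<Sum>B\<in>Pow {..<m}. walks m r A B) = rowsum m (card A) ^ r"
proof (induction r)
  case 0
  have "(\<Sum>B\<in>Pow {..<m}. of_bool (A = B)) = (\<Sum>B\<in>{A}. of_bool (A = B) :: nat)"
    using assms by (intro sum.mono_neutral_right) auto
  then show ?case by simp
next
  case (Suc r)
  have "(\<Sum>B\<in>Pow {..<m}. walks m (Suc r) A B) = (\<Sum>C\<in>Pow {..<m}. \<Sum>B\<in>Pow {..<m}. walks m r A C * nbal m C B)"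
    by (simp, rule sum.swap)
  also have "\<dots> = (\<Sum>C\<in>Pow {..<m}. walks m r A C * rowsum m (card A))"
  proof (intro sum.cong refl)
    fix C assume "C \<in> Pow {..<m}"
    then show "(\<Sum>B\<in>Pow {..<m}. walks m r A C * nbal m C B) = walks m r A C * rowsum m (card A)"
      using walks_card[OF assms, of C r] sum_nbal[of C m]
      by (cases "card A = card C") (auto simp: sum_distrib_left[symmetric])
  qed
  finally show ?case using Suc by (simp add: sum_distrib_right[symmetric])
qed

text \<open>The row sum of the \<open>l\<close>-th power at a set of middle size is spread over
  \<open>card ?H\<close> entries, none above the diagonal one. There are equally many diagonal
  entries in this block, so the factor \<open>card ?H\<close> cancels and nothing is lost.\<close>

lemma EO_box_lower:
  assumes "l \<ge> 3"
  shows "rowsum m (m div 2) ^ l \<le> EO (complete_graph m \<box> cycle_graph l)"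
proof -
  define h where "h = m div 2"
  let ?H = "{A. A \<subseteq> {..<m} \<and> card A = h}"
  have fin: "finite ?H" by simp
  have "{..<h} \<in> ?H" by (auto simp: h_def)
  then have pos: "card ?H > 0" using fin by (simp only: card_gt_0_iff) blast
  have 1: "rowsum m h ^ l \<le> card ?H * walks m l A A" if "A \<in> ?H" for A
  proof -
    have "rowsum m h ^ l = (\<Sum>B\<in>Pow {..<m}. walks m l A B)" using that sum_walks[of A m l] by auto
    also have "\<dots> = (\<Sum>B\<in>?H. walks m l A B)"
    proof (intro sum.mono_neutral_right ballI)
      fix B assume "B \<in> Pow {..<m} - ?H"
      then show "walks m l A B = 0" using that by (intro walks_card) auto
    qed auto
    also have "\<dots> \<le> (\<Sum>B\<in>?H. walks m l A A)"
      using that by (intro sum_mono walks_le_diag) auto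
    finally show ?thesis by simp
  qed
  have "card ?H * rowsum m h ^ l \<le> (\<Sum>A\<in>?H. card ?H * walks m l A A)"
    using sum_mono[of ?H "\<lambda>_. rowsum m h ^ l" "\<lambda>A. card ?H * walks m l A A"] 1 by simp
  also have "\<dots> = card ?H * (\<Sum>A\<in>?H. walks m l A A)" by (simp add: sum_distrib_left)
  finally have "rowsum m h ^ l \<le> (\<Sum>A\<in>?H. walks m l A A)" using pos by simp
  also have "\<dots> \<le> (\<Sum>A\<in>Pow {..<m}. walks m l A A)" by (intro sum_mono2) auto
  finally show ?thesis by (simp add: EO_box_walks[OF assms] h_def)
qed

text \<open>The closing step of each closed walk is bounded by \<open>rtour m\<close>, and
  \<open>2 ^ m\<close> diagonal entries are summed. This is the only lossy estimate;
  \<open>ln_rowsum_asymp\<close> shows that the loss is polynomial in \<open>m\<close>.\<close>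

lemma EO_box_upper:
  assumes "l \<ge> 3"
  shows "EO (complete_graph m \<box> cycle_graph l) \<le> 2 ^ m * rtour m * rowsum m (m div 2) ^ (l - 1)"
proof -
  obtain r where r: "l = Suc r" using assms by (cases l) auto
  have "walks m l A A \<le> rtour m * rowsum m (m div 2) ^ r" if A: "A \<in> Pow {..<m}" for A
  proof -
    have "walks m l A A \<le> (\<Sum>C\<in>Pow {..<m}. walks m r A C * rtour m)"
      unfolding r walks.simps using A by (intro sum_mono mult_left_mono nbal_le_rtour) auto
    also have "\<dots> = rowsum m (card A) ^ r * rtour m"
      using A by (simp add: sum_distrib_right[symmetric] sum_walks)
    also have "\<dots> \<le> rowsum m (m div 2) ^ r * rtour m"
      using A by (intro mult_right_mono power_mono rowsum_le) (auto dest: card_mono[rotated])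
    finally show ?thesis by (simp add: mult.commute)
  qed
  then have "(\<Sum>A\<in>Pow {..<m}. walks m l A A) \<le> (\<Sum>A\<in>Pow {..<m}. rtour m * rowsum m (m div 2) ^ r)"
    by (rule sum_mono)
  then show ?thesis unfolding EO_box_walks[OF assms] unfolding r
    by (simp add: card_Pow mult.assoc del: walks.simps)
qed

section \<open>Gaussian bounds for products of cosines\<close>

lemma DERIV_tan_sq: "cos x \<noteq> 0 \<Longrightarrow> (tan has_real_derivative 1 + (tan x)\<^sup>2) (at x)" for x :: real
  using DERIV_tan[of x] tan_sec[of x] by (simp add: power_inverse)

lemma cos_pos_half: "0 \<le> x \<Longrightarrow> x < pi / 2 \<Longrightarrow> cos x > 0"
  by (intro cos_gt_zero_pi) (auto simp: less_le_trans[OF _ pi_ge_zero])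

text \<open>The bounds on \<open>tan\<close> are bootstrapped: each one, inserted into the
  derivative \<open>1 + (tan x)\<^sup>2\<close> and integrated, yields the next, and one further
  integration turns them into bounds on \<open>ln (cos x)\<close>.\<close>

lemma tan_ge_self:
  assumes "0 \<le> x" "x < pi / 2" shows "x \<le> tan x"
proof -
  have "tan 0 - 0 \<le> tan x - x"
  proof (rule DERIV_nonneg_imp_nondecreasing[OF assms(1), of "\<lambda>y. tan y - y"])
    fix y assume "0 \<le> y" "y \<le> x"
    then have "cos y \<noteq> 0" using cos_pos_half[of y] assms by auto
    then show "\<exists>z. ((\<lambda>y. tan y - y) has_real_derivative z) (at y) \<and> 0 \<le> z"
      by (intro exI[of _ "(1 + (tan y)\<^sup>2) - 1"] conjI DERIV_diff DERIV_tan_sq DERIV_ident) auto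
  qed
  then show ?thesis by simp
qed

lemma tan_ge_cubic:
  assumes "0 \<le> x" "x < pi / 2" shows "x + x ^ 3 / 3 \<le> tan x"
proof -
  have "tan 0 - (0 + 0 ^ 3 / 3) \<le> tan x - (x + x ^ 3 / 3)"
  proof (rule DERIV_nonneg_imp_nondecreasing[OF assms(1), of "\<lambda>y. tan y - (y + y ^ 3 / 3)"])
    fix y assume y: "0 \<le> y" "y \<le> x"
    then have c: "cos y \<noteq> 0" using cos_pos_half[of y] assms by auto
    have "y \<le> tan y" using y assms by (intro tan_ge_self) auto
    then have "y\<^sup>2 \<le> (tan y)\<^sup>2" using y by (intro power_mono) auto
    moreover have "((\<lambda>y. tan y - (y + y ^ 3 / 3)) has_real_derivative (1 + (tan y)\<^sup>2) - (1 + y\<^sup>2)) (at y)"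
      by (rule DERIV_diff[OF DERIV_tan_sq[OF c]]) (auto intro!: derivative_eq_intros simp: power2_eq_square)
    ultimately show "\<exists>z. ((\<lambda>y. tan y - (y + y ^ 3 / 3)) has_real_derivative z) (at y) \<and> 0 \<le> z"
      by (intro exI[of _ "(1 + (tan y)\<^sup>2) - (1 + y\<^sup>2)"]) auto
  qed
  then show ?thesis by simp
qed

lemma pi_quarter_bounds: "pi / 4 < (1 :: real)" "pi / 4 < pi / 2" "pi / 4 \<le> pi / 3"
  using pi_less_4 pi_gt_zero by simp_all

text \<open>Starts the chain of upper bounds. The restriction to \<open>pi / 4\<close> keeps the
  cosine above \<open>1 / 2\<close>.\<close>

lemma tan_le_double:
  assumes "0 \<le> x" "x \<le> pi / 4" shows "tan x \<le> 2 * x"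
proof -
  have "cos (pi / 3) \<le> cos x" using assms pi_quarter_bounds by (intro cos_monotone_0_pi_le) auto
  then have c: "1 / 2 \<le> cos x" by (simp add: cos_60)
  have "sin x \<le> x * (2 * cos x)"
    using sin_x_le_x[OF assms(1)] mult_left_mono[of 1 "2 * cos x" x] c assms by simp
  then show ?thesis using c by (simp add: tan_def divide_le_eq mult_ac)
qed

lemma tan_le_cubic:
  assumes "0 \<le> x" "x \<le> pi / 4" shows "tan x \<le> x + 4 / 3 * x ^ 3"
proof -
  have "(0 + 4 / 3 * 0 ^ 3) - tan 0 \<le> (x + 4 / 3 * x ^ 3) - tan x"
  proof (rule DERIV_nonneg_imp_nondecreasing[OF assms(1), of "\<lambda>y. (y + 4 / 3 * y ^ 3) - tan y"])
    fix y assume y: "0 \<le> y" "y \<le> x"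
    then have y': "y < pi / 2" "y \<le> pi / 4" using assms pi_quarter_bounds by linarith+
    then have c: "cos y \<noteq> 0" using y cos_pos_half[of y] by auto
    have "0 \<le> tan y" using tan_ge_self[of y] y y' by auto
    then have "(tan y)\<^sup>2 \<le> (2 * y)\<^sup>2" using y y' by (intro power_mono tan_le_double) auto
    moreover have "((\<lambda>y. (y + 4 / 3 * y ^ 3) - tan y) has_real_derivative (1 + 4 * y\<^sup>2) - (1 + (tan y)\<^sup>2)) (at y)"
      by (rule DERIV_diff[OF _ DERIV_tan_sq[OF c]]) (auto intro!: derivative_eq_intros simp: power2_eq_square)
    ultimately show "\<exists>z. ((\<lambda>y. (y + 4 / 3 * y ^ 3) - tan y) has_real_derivative z) (at y) \<and> 0 \<le> z"
      by (intro exI[of _ "(1 + 4 * y\<^sup>2) - (1 + (tan y)\<^sup>2)"]) (auto simp: power_mult_distrib)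
  qed
  then show ?thesis by simp
qed

lemma tan_le_quintic:
  assumes "0 \<le> x" "x \<le> pi / 4" shows "tan x \<le> x + x ^ 3 / 3 + x ^ 5"
proof -
  have "(0 + 0 ^ 3 / 3 + 0 ^ 5) - tan 0 \<le> (x + x ^ 3 / 3 + x ^ 5) - tan x"
  proof (rule DERIV_nonneg_imp_nondecreasing[OF assms(1), of "\<lambda>y. (y + y ^ 3 / 3 + y ^ 5) - tan y"])
    fix y assume y: "0 \<le> y" "y \<le> x"
    then have y': "y < pi / 2" "y \<le> pi / 4" "y \<le> 1" using assms pi_quarter_bounds by linarith+
    then have c: "cos y \<noteq> 0" using y cos_pos_half[of y] by auto
    have "0 \<le> tan y" using tan_ge_self[of y] y y' by auto
    then have "(tan y)\<^sup>2 \<le> (y + 4 / 3 * y ^ 3)\<^sup>2" using y y' by (intro power_mono tan_le_cubic) auto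
    also have "\<dots> = y\<^sup>2 + 8 / 3 * y ^ 4 + 16 / 9 * y ^ 4 * y\<^sup>2"
      by (simp add: power2_eq_square algebra_simps eval_nat_numeral)
    also have "\<dots> \<le> y\<^sup>2 + 8 / 3 * y ^ 4 + 16 / 9 * y ^ 4 * 1"
      using y y' by (intro add_left_mono mult_left_mono) (auto simp: power_le_one)
    \<comment> \<open>\<open>8 / 3 + 16 / 9\<close> is below \<open>5\<close>, and
      \<open>5 * y ^ 4\<close> is the derivative of the quintic error term.\<close>
    also have "\<dots> \<le> y\<^sup>2 + 5 * y ^ 4" by simp
    finally have "(tan y)\<^sup>2 \<le> y\<^sup>2 + 5 * y ^ 4" .
    moreover have "((\<lambda>y. (y + y ^ 3 / 3 + y ^ 5) - tan y) has_real_derivative (1 + y\<^sup>2 + 5 * y ^ 4) - (1 + (tan y)\<^sup>2)) (at y)"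
      by (rule DERIV_diff[OF _ DERIV_tan_sq[OF c]]) (auto intro!: derivative_eq_intros simp: power2_eq_square)
    ultimately show "\<exists>z. ((\<lambda>y. (y + y ^ 3 / 3 + y ^ 5) - tan y) has_real_derivative z) (at y) \<and> 0 \<le> z"
      by (intro exI[of _ "(1 + y\<^sup>2 + 5 * y ^ 4) - (1 + (tan y)\<^sup>2)"]) auto
  qed
  then show ?thesis by simp
qed

lemma DERIV_ln_cos: "cos x > 0 \<Longrightarrow> ((\<lambda>x. ln (cos x)) has_real_derivative - tan x) (at x)" for x :: real
  by (auto intro!: derivative_eq_intros simp: tan_def)

text \<open>Integrates \<open>tan_ge_cubic\<close>, since \<open>- tan\<close> is the derivative of
  \<open>ln (cos x)\<close>; the quartic coefficient \<open>1 / 12\<close> is the exact Taylor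
  coefficient, as the mean of this term survives in the final constant.\<close>

lemma cos_le_exp:
  assumes "\<bar>x\<bar> < pi / 2" shows "cos x \<le> exp (- (x\<^sup>2 / 2 + x ^ 4 / 12))"
proof -
  have *: "cos x \<le> exp (- (x\<^sup>2 / 2 + x ^ 4 / 12))" if "0 \<le> x" "x < pi / 2" for x
  proof -
    have "- (0\<^sup>2 / 2 + 0 ^ 4 / 12) - ln (cos 0) \<le> - (x\<^sup>2 / 2 + x ^ 4 / 12) - ln (cos x)"
    proof (rule DERIV_nonneg_imp_nondecreasing[OF that(1), of "\<lambda>y. - (y\<^sup>2 / 2 + y ^ 4 / 12) - ln (cos y)"])
      fix y assume y: "0 \<le> y" "y \<le> x"
      then have c: "cos y > 0" using that by (intro cos_pos_half) auto
      have "((\<lambda>y. - (y\<^sup>2 / 2 + y ^ 4 / 12) - ln (cos y)) has_real_derivative - (y + y ^ 3 / 3) - (- tan y)) (at y)"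
        by (rule DERIV_diff[OF _ DERIV_ln_cos[OF c]]) (auto intro!: derivative_eq_intros)
      then show "\<exists>z. ((\<lambda>y. - (y\<^sup>2 / 2 + y ^ 4 / 12) - ln (cos y)) has_real_derivative z) (at y) \<and> 0 \<le> z"
        using tan_ge_cubic[of y] y that by (intro exI[of _ "- (y + y ^ 3 / 3) - (- tan y)"]) auto
    qed
    then have "ln (cos x) \<le> - (x\<^sup>2 / 2 + x ^ 4 / 12)" by simp
    then show ?thesis using cos_pos_half[OF that] by (metis exp_le_cancel_iff exp_ln)
  qed
  show ?thesis using *[of x] *[of "- x"] assms by (cases "0 \<le> x") auto
qed

lemma cos_ge_exp:
  assumes "\<bar>x\<bar> \<le> pi / 4" shows "exp (- (x\<^sup>2 / 2 + x ^ 4 / 12 + x ^ 6 / 6)) \<le> cos x"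
proof -
  have *: "exp (- (x\<^sup>2 / 2 + x ^ 4 / 12 + x ^ 6 / 6)) \<le> cos x" if "0 \<le> x" "x \<le> pi / 4" for x
  proof -
    have c: "cos y > 0" if "0 \<le> y" "y \<le> x" for y
      using that \<open>x \<le> pi / 4\<close> pi_quarter_bounds by (intro cos_pos_half) linarith+
    have "ln (cos 0) + (0\<^sup>2 / 2 + 0 ^ 4 / 12 + 0 ^ 6 / 6) \<le> ln (cos x) + (x\<^sup>2 / 2 + x ^ 4 / 12 + x ^ 6 / 6)"
    proof (rule DERIV_nonneg_imp_nondecreasing[OF that(1), of "\<lambda>y. ln (cos y) + (y\<^sup>2 / 2 + y ^ 4 / 12 + y ^ 6 / 6)"])
      fix y assume y: "0 \<le> y" "y \<le> x"
      have "((\<lambda>y. ln (cos y) + (y\<^sup>2 / 2 + y ^ 4 / 12 + y ^ 6 / 6)) has_real_derivative (- tan y) + (y + y ^ 3 / 3 + y ^ 5)) (at y)"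
        by (rule DERIV_add[OF DERIV_ln_cos[OF c[OF y]]]) (auto intro!: derivative_eq_intros)
      then show "\<exists>z. ((\<lambda>y. ln (cos y) + (y\<^sup>2 / 2 + y ^ 4 / 12 + y ^ 6 / 6)) has_real_derivative z) (at y) \<and> 0 \<le> z"
        using tan_le_quintic[of y] y that by (intro exI[of _ "(- tan y) + (y + y ^ 3 / 3 + y ^ 5)"]) auto
    qed
    then have "- (x\<^sup>2 / 2 + x ^ 4 / 12 + x ^ 6 / 6) \<le> ln (cos x)" by simp
    then show ?thesis using c[of x] that by (metis exp_le_cancel_iff exp_ln order_refl)
  qed
  show ?thesis using *[of x] *[of "- x"] assms by (cases "0 \<le> x") auto
qed

section \<open>Products and power sums over pairs of angles\<close>

definition pairs :: "nat set \<Rightarrow> (nat \<times> nat) set" where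
  "pairs I = {(i, k). i \<in> I \<and> k \<in> I \<and> i < k}"

lemma pairs_empty [simp]: "pairs {} = {}" by (simp add: pairs_def)

lemma finite_pairs: "finite I \<Longrightarrow> finite (pairs I)"
  by (rule finite_subset[of _ "I \<times> I"]) (auto simp: pairs_def)

lemma pairs_insert:
  assumes "j \<notin> I"
  shows "pairs (insert j I) = pairs I \<union> (\<lambda>w. (min j w, max j w)) ` I"
    and "pairs I \<inter> (\<lambda>w. (min j w, max j w)) ` I = {}"
    and "inj_on (\<lambda>w. (min j w, max j w)) I"
proof -
  show "pairs (insert j I) = pairs I \<union> (\<lambda>w. (min j w, max j w)) ` I"
  proof (intro equalityI subsetI)
    fix p assume "p \<in> pairs (insert j I)"
    then obtain i k where p: "p = (i, k)" "i \<in> insert j I" "k \<in> insert j I" "i < k" by (auto simp: pairs_def)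
    show "p \<in> pairs I \<union> (\<lambda>w. (min j w, max j w)) ` I"
    proof (cases "i = j \<or> k = j")
      case True
      then show ?thesis
      proof
        assume "i = j" then show ?thesis using p by (intro UnI2 image_eqI[of _ _ k]) auto
      next
        assume "k = j" then show ?thesis using p by (intro UnI2 image_eqI[of _ _ i]) auto
      qed
    next
      case False
      then show ?thesis using p by (auto simp: pairs_def)
    qed
  next
    fix p assume "p \<in> pairs I \<union> (\<lambda>w. (min j w, max j w)) ` I"
    then show "p \<in> pairs (insert j I)"
    proof
      assume "p \<in> (\<lambda>w. (min j w, max j w)) ` I"
      then obtain w where w: "w \<in> I" "p = (min j w, max j w)" by blast
      then have "w < j \<or> j < w" using assms by (metis linorder_neqE_nat)
      then show ?thesis using w by (auto simp: pairs_def)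
    qed (auto simp: pairs_def)
  qed
  show "pairs I \<inter> (\<lambda>w. (min j w, max j w)) ` I = {}"
    using assms by (auto simp: pairs_def min_def max_def split: if_splits)
  show "inj_on (\<lambda>w. (min j w, max j w)) I"
    by (auto simp: inj_on_def min_def max_def split: if_splits)
qed

lemma prod_pairs_insert:
  assumes "j \<notin> I" "finite I" "\<And>i k. g i k = g k i"
  shows "(\<Prod>(i, k)\<in>pairs (insert j I). g i k) = (\<Prod>(i, k)\<in>pairs I. g i k) * (\<Prod>w\<in>I. g j w)"
proof -
  have "g (min j w) (max j w) = g j w" for w using assms(3) by (simp add: min_def max_def)
  then show ?thesis using pairs_insert[OF assms(1)] assms(2)
    by (simp add: prod.union_disjoint finite_pairs prod.reindex)
qed

lemma sum_pairs_insert: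
  assumes "j \<notin> I" "finite I" "\<And>i k. g i k = g k i"
  shows "(\<Sum>(i, k)\<in>pairs (insert j I). g i k) = (\<Sum>(i, k)\<in>pairs I. g i k) + (\<Sum>w\<in>I. g j w)"
proof -
  have "g (min j w) (max j w) = g j w" for w using assms(3) by (simp add: min_def max_def)
  then show ?thesis using pairs_insert[OF assms(1)] assms(2)
    by (simp add: sum.union_disjoint finite_pairs sum.reindex)
qed

lemma card_pairs: "finite I \<Longrightarrow> 2 * card (pairs I) = card I * (card I - 1)"
proof (induction I rule: finite_induct)
  case (insert j I)
  have "card (pairs (insert j I)) = card (pairs I) + card I"
    using pairs_insert[OF insert.hyps(2)] insert.hyps(1)
    by (simp add: card_Un_disjoint finite_pairs card_image)
  then show ?case using insert by (cases "card I") (auto simp: algebra_simps)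
qed simp

text \<open>Up to a factor \<open>2\<close> per pair, the Fourier polynomial that enumerates
  tournaments by their imbalances; \<open>sum_ori_cis\<close> makes this precise.\<close>

definition cosprod :: "nat set \<Rightarrow> (nat \<Rightarrow> real) \<Rightarrow> real" where
  "cosprod I \<theta> = (\<Prod>(i, k)\<in>pairs I. cos (\<theta> i - \<theta> k))"

definition diffpow :: "nat \<Rightarrow> nat set \<Rightarrow> (nat \<Rightarrow> real) \<Rightarrow> real" where
  "diffpow p I \<theta> = (\<Sum>(i, k)\<in>pairs I. (\<theta> i - \<theta> k) ^ p)"

lemma cosprod_insert:
  assumes "j \<notin> I" "finite I"
  shows "cosprod (insert j I) \<theta> = cosprod I \<theta> * (\<Prod>w\<in>I. cos (\<theta> j - \<theta> w))"
  unfolding cosprod_def using assms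
  by (intro prod_pairs_insert) (auto simp: cos_diff mult.commute add.commute)

text \<open>The quadratic form \<open>diffpow 2 I\<close> vanishes along common translations. Adding
  the square of the total angle repairs exactly this direction and leaves \<open>card I\<close>
  times a sum of squares, that is, independent normal variables of variance
  \<open>1 / card I\<close>.\<close>

lemma diffpow_sq: "finite I \<Longrightarrow> diffpow 2 I \<theta> + (\<Sum>i\<in>I. \<theta> i)\<^sup>2 = real (card I) * (\<Sum>i\<in>I. (\<theta> i)\<^sup>2)"
proof (induction I rule: finite_induct)
  case empty
  show ?case by (simp add: diffpow_def)
next
  case (insert j I)
  have "diffpow 2 (insert j I) \<theta> = diffpow 2 I \<theta> + (\<Sum>w\<in>I. (\<theta> j - \<theta> w)\<^sup>2)"
    unfolding diffpow_def using insert.hyps by (intro sum_pairs_insert) (auto simp: power2_commute)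
  also have "(\<Sum>w\<in>I. (\<theta> j - \<theta> w)\<^sup>2) = real (card I) * (\<theta> j)\<^sup>2 - 2 * \<theta> j * (\<Sum>w\<in>I. \<theta> w) + (\<Sum>w\<in>I. (\<theta> w)\<^sup>2)"
    by (simp add: power2_diff sum.distrib sum_subtractf sum_distrib_left)
  finally show ?case using insert by (simp add: power2_sum algebra_simps)
qed

lemma diffpow_nonneg: "even p \<Longrightarrow> 0 \<le> diffpow p I \<theta>"
  unfolding diffpow_def by (intro sum_nonneg) (auto simp: zero_le_even_power)

lemma cosprod_le_exp:
  assumes "\<And>i k. i \<in> I \<Longrightarrow> k \<in> I \<Longrightarrow> \<bar>\<theta> i - \<theta> k\<bar> < pi / 2"
  shows "0 \<le> cosprod I \<theta>" "cosprod I \<theta> \<le> exp (- diffpow 2 I \<theta> / 2) * exp (- diffpow 4 I \<theta> / 12)"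
proof -
  have c: "0 \<le> cos (\<theta> i - \<theta> k)" if "(i, k) \<in> pairs I" for i k
  proof -
    have "\<bar>\<theta> i - \<theta> k\<bar> < pi / 2" using assms[of i k] that by (simp add: pairs_def)
    then show ?thesis by (intro cos_ge_zero) linarith+
  qed
  then show "0 \<le> cosprod I \<theta>" unfolding cosprod_def by (intro prod_nonneg) auto
  have "cosprod I \<theta> \<le> (\<Prod>(i, k)\<in>pairs I. exp (- ((\<theta> i - \<theta> k)\<^sup>2 / 2 + (\<theta> i - \<theta> k) ^ 4 / 12)))"
    unfolding cosprod_def
  proof (intro prod_mono, safe)
    fix i k assume "(i, k) \<in> pairs I"
    then show "0 \<le> cos (\<theta> i - \<theta> k)" by (rule c)
    show "cos (\<theta> i - \<theta> k) \<le> exp (- ((\<theta> i - \<theta> k)\<^sup>2 / 2 + (\<theta> i - \<theta> k) ^ 4 / 12))"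
      using \<open>(i, k) \<in> pairs I\<close> assms[of i k] by (intro cos_le_exp) (simp add: pairs_def)
  qed
  also have "\<dots> = exp (\<Sum>(i, k)\<in>pairs I. - ((\<theta> i - \<theta> k)\<^sup>2 / 2 + (\<theta> i - \<theta> k) ^ 4 / 12))"
    by (cases "finite (pairs I)") (auto simp: exp_sum case_prod_beta)
  also have "(\<Sum>(i, k)\<in>pairs I. - ((\<theta> i - \<theta> k)\<^sup>2 / 2 + (\<theta> i - \<theta> k) ^ 4 / 12)) = - diffpow 2 I \<theta> / 2 + (- diffpow 4 I \<theta> / 12)"
    by (simp add: diffpow_def case_prod_beta sum_negf sum.distrib sum_subtractf sum_divide_distrib)
  finally show "cosprod I \<theta> \<le> exp (- diffpow 2 I \<theta> / 2) * exp (- diffpow 4 I \<theta> / 12)" by (simp only: exp_add)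
qed

lemma cosprod_ge_exp:
  assumes "\<And>i k. i \<in> I \<Longrightarrow> k \<in> I \<Longrightarrow> \<bar>\<theta> i - \<theta> k\<bar> \<le> pi / 4"
  shows "exp (- diffpow 2 I \<theta> / 2) * exp (- diffpow 4 I \<theta> / 12 - diffpow 6 I \<theta> / 6) \<le> cosprod I \<theta>"
proof -
  have "exp (- diffpow 2 I \<theta> / 2) * exp (- diffpow 4 I \<theta> / 12 - diffpow 6 I \<theta> / 6) =
    exp (\<Sum>(i, k)\<in>pairs I. - ((\<theta> i - \<theta> k)\<^sup>2 / 2 + (\<theta> i - \<theta> k) ^ 4 / 12 + (\<theta> i - \<theta> k) ^ 6 / 6))"
    unfolding exp_add[symmetric] by (simp add: diffpow_def case_prod_beta sum_negf sum.distrib sum_subtractf sum_divide_distrib)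
  also have "\<dots> = (\<Prod>(i, k)\<in>pairs I. exp (- ((\<theta> i - \<theta> k)\<^sup>2 / 2 + (\<theta> i - \<theta> k) ^ 4 / 12 + (\<theta> i - \<theta> k) ^ 6 / 6)))"
    by (cases "finite (pairs I)") (auto simp: exp_sum case_prod_beta)
  also have "\<dots> \<le> cosprod I \<theta>"
    unfolding cosprod_def
  proof (intro prod_mono, safe)
    fix i k assume "(i, k) \<in> pairs I"
    then show "exp (- ((\<theta> i - \<theta> k)\<^sup>2 / 2 + (\<theta> i - \<theta> k) ^ 4 / 12 + (\<theta> i - \<theta> k) ^ 6 / 6)) \<le> cos (\<theta> i - \<theta> k)"
      using assms[of i k] by (intro cos_ge_exp) (simp add: pairs_def)
  qed simp
  finally show ?thesis .
qed

lemma abs_cosprod_le_1: "\<bar>cosprod I \<theta>\<bar> \<le> 1"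
  unfolding cosprod_def abs_prod by (intro prod_le_1) auto

lemma abs_cos_shift: "\<bar>cos (x + pi * of_int k)\<bar> = \<bar>cos x\<bar>"
proof -
  have "\<bar>cos (pi * of_int k)\<bar> = (1 :: real)" by (simp add: cos_npi_int)
  moreover have "sin (pi * of_int k) = (0 :: real)" by (simp add: sin_npi_int)
  ultimately show ?thesis by (simp add: cos_add abs_mult)
qed

text \<open>The absolute value of a cosine has period \<open>pi\<close>, so angles may be reduced
  modulo \<open>pi\<close> after a common translation.\<close>

lemma abs_cosprod_shift:
  assumes "\<And>i. i \<in> I \<Longrightarrow> \<exists>k. \<theta>' i = \<theta> i + t + pi * of_int k"
  shows "\<bar>cosprod I \<theta>'\<bar> = \<bar>cosprod I \<theta>\<bar>"
proof -
  have "\<bar>cos (\<theta>' i - \<theta>' k)\<bar> = \<bar>cos (\<theta> i - \<theta> k)\<bar>" if "i \<in> I" "k \<in> I" for i k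
  proof -
    obtain a :: int where "\<theta>' i = \<theta> i + t + pi * of_int a" using assms[OF \<open>i \<in> I\<close>] by blast
    moreover obtain b :: int where "\<theta>' k = \<theta> k + t + pi * of_int b" using assms[OF \<open>k \<in> I\<close>] by blast
    ultimately have "\<theta>' i - \<theta>' k = (\<theta> i - \<theta> k) + pi * of_int (a - b)" by (simp add: algebra_simps)
    then show ?thesis by (simp only: abs_cos_shift)
  qed
  then show ?thesis unfolding cosprod_def abs_prod by (intro prod.cong) (auto simp: pairs_def)
qed

section \<open>Product measures\<close>

lemma measurable_PiM_borel:
  "sets M = sets borel \<Longrightarrow> measurable (PiM I (\<lambda>_. M)) N = measurable (PiM I (\<lambda>_. borel)) N"
  by (intro measurable_cong_sets sets_PiM_cong) auto

lemma component_borel: "i \<in> I \<Longrightarrow> (\<lambda>\<theta>. \<theta> i) \<in> borel_measurable (PiM I (\<lambda>_. borel))"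
  by (rule measurable_component_singleton)

lemma diffpow_measurable: "diffpow p I \<in> borel_measurable (PiM I (\<lambda>_. borel))"
proof -
  have "(\<lambda>\<theta> :: nat \<Rightarrow> real. \<Sum>q\<in>pairs I. (\<theta> (fst q) - \<theta> (snd q)) ^ p) \<in> borel_measurable (PiM I (\<lambda>_. borel))"
    by (intro borel_measurable_sum borel_measurable_power borel_measurable_diff component_borel) (auto simp: pairs_def)
  also have "(\<lambda>\<theta>. \<Sum>q\<in>pairs I. (\<theta> (fst q) - \<theta> (snd q)) ^ p) = diffpow p I"
    by (rule ext) (simp add: diffpow_def case_prod_beta)
  finally show ?thesis .
qed

lemma cosprod_measurable: "cosprod I \<in> borel_measurable (PiM I (\<lambda>_. borel))"
proof -
  have "(\<lambda>\<theta> :: nat \<Rightarrow> real. \<Prod>q\<in>pairs I. cos (\<theta> (fst q) - \<theta> (snd q))) \<in> borel_measurable (PiM I (\<lambda>_. borel))"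
    by (intro borel_measurable_prod borel_measurable_continuous_on[of cos] continuous_intros borel_measurable_diff component_borel)
       (auto simp: pairs_def)
  also have "(\<lambda>\<theta>. \<Prod>q\<in>pairs I. cos (\<theta> (fst q) - \<theta> (snd q))) = cosprod I"
    by (rule ext) (simp add: cosprod_def case_prod_beta)
  finally show ?thesis .
qed

lemma fun_upd_PiM_borel:
  "I = insert r J \<Longrightarrow> (\<lambda>\<theta>. \<theta>(r := c)) \<in> measurable (PiM J (\<lambda>_. borel)) (PiM I (\<lambda>_. borel :: real measure))"
  by (intro measurable_fun_upd[where J=J]) auto

lemma PiM_density_lborel:
  fixes f :: "real \<Rightarrow> ennreal"
  assumes I: "finite I" and f [measurable]: "f \<in> borel_measurable borel"
    and sf: "sigma_finite_measure (density lborel f)"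
  shows "PiM I (\<lambda>_. density lborel f) = density (PiM I (\<lambda>_. lborel)) (\<lambda>x. \<Prod>i\<in>I. f (x i))"
proof -
  interpret D: product_sigma_finite "\<lambda>_. density lborel f"
    using sf by (simp add: product_sigma_finite_def)
  interpret L: product_sigma_finite "\<lambda>_. lborel :: real measure"
    by (simp add: product_sigma_finite_def sigma_finite_lborel)
  have fm: "(\<lambda>x. \<Prod>i\<in>I. f (x i)) \<in> borel_measurable (PiM I (\<lambda>_. lborel))"
    unfolding measurable_PiM_borel[OF sets_lborel]
    by (intro borel_measurable_prod_ennreal measurable_compose[OF component_borel f])
  show ?thesis
  proof (rule D.PiM_eqI[OF I, symmetric])
    show "sets (density (PiM I (\<lambda>_. lborel)) (\<lambda>x. \<Prod>i\<in>I. f (x i))) = sets (PiM I (\<lambda>_. density lborel f))"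
      unfolding sets_density by (intro sets_PiM_cong) auto
    fix A :: "'a \<Rightarrow> real set" assume "\<And>i. i \<in> I \<Longrightarrow> A i \<in> sets (density lborel f)"
    then have A: "\<And>i. i \<in> I \<Longrightarrow> A i \<in> sets lborel" by simp
    have "emeasure (density (PiM I (\<lambda>_. lborel)) (\<lambda>x. \<Prod>i\<in>I. f (x i))) (PiE I A) =
      (\<integral>\<^sup>+x. (\<Prod>i\<in>I. f (x i)) * indicator (PiE I A) x \<partial>PiM I (\<lambda>_. lborel))"
      using A I by (intro emeasure_density fm sets_PiM_I_finite) auto
    also have "\<dots> = (\<integral>\<^sup>+x. (\<Prod>i\<in>I. f (x i) * indicator (A i) (x i)) \<partial>PiM I (\<lambda>_. lborel))"
    proof (rule nn_integral_cong)
      fix x assume x: "x \<in> space (PiM I (\<lambda>_. lborel :: real measure))"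
      have "indicator (PiE I A) x = (\<Prod>i\<in>I. indicator (A i) (x i) :: ennreal)"
      proof (cases "x \<in> PiE I A")
        case False
        then obtain i where "i \<in> I" "x i \<notin> A i" using x by (auto simp: space_PiM PiE_iff)
        then have "(\<Prod>i\<in>I. indicator (A i) (x i) :: ennreal) = 0" using I
            by (intro prod_zero bexI[of _ i]) auto
        then show ?thesis using False by simp
      qed (auto simp: PiE_iff)
      then show "(\<Prod>i\<in>I. f (x i)) * indicator (PiE I A) x = (\<Prod>i\<in>I. f (x i) * indicator (A i) (x i))"
        by (simp add: prod.distrib)
    qed
    also have "\<dots> = (\<Prod>i\<in>I. \<integral>\<^sup>+x. f x * indicator (A i) x \<partial>lborel)"
      using A by (intro L.product_nn_integral_prod I borel_measurable_times borel_measurable_indicator) auto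
    also have "\<dots> = (\<Prod>i\<in>I. emeasure (density lborel f) (A i))"
      using A by (intro prod.cong refl emeasure_density[symmetric]) auto
    finally show "emeasure (density (PiM I (\<lambda>_. lborel)) (\<lambda>x. \<Prod>i\<in>I. f (x i))) (PiE I A) =
      (\<Prod>i\<in>I. emeasure (density lborel f) (A i))" .
  qed
qed

lemma distr_PiM_compose:
  assumes J: "finite J" and M: "sigma_finite_measure M" and f: "f \<in> measurable M M" "distr M M f = M"
  shows "distr (PiM J (\<lambda>_. M)) (PiM J (\<lambda>_. M)) (compose J f) = PiM J (\<lambda>_. M)"
proof -
  interpret product_sigma_finite "\<lambda>_. M" using M by (simp add: product_sigma_finite_def)
  have c: "compose J f \<in> measurable (PiM J (\<lambda>_. M)) (PiM J (\<lambda>_. M))"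
    unfolding compose_def
    by (intro measurable_restrict measurable_compose[OF measurable_component_singleton[of _ J "\<lambda>_. M"] f(1)])
  show ?thesis
  proof (rule PiM_eqI[OF J])
    fix A assume A: "\<And>i. i \<in> J \<Longrightarrow> A i \<in> sets M"
    have "emeasure (distr (PiM J (\<lambda>_. M)) (PiM J (\<lambda>_. M)) (compose J f)) (PiE J A)
      = emeasure (PiM J (\<lambda>_. M)) (compose J f -` PiE J A \<inter> space (PiM J (\<lambda>_. M)))"
      using A J by (intro emeasure_distr c sets_PiM_I_finite) auto
    also have "compose J f -` PiE J A \<inter> space (PiM J (\<lambda>_. M)) = PiE J (\<lambda>i. f -` A i \<inter> space M)"
      by (auto simp: space_PiM PiE_iff compose_def)
    also have "emeasure (PiM J (\<lambda>_. M)) \<dots> = (\<Prod>i\<in>J. emeasure M (f -` A i \<inter> space M))"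
      using A f by (intro emeasure_PiM J measurable_sets) auto
    also have "\<dots> = (\<Prod>i\<in>J. emeasure (distr M M f) (A i))"
      using A by (intro prod.cong refl emeasure_distr[OF f(1), symmetric])
    finally show "emeasure (distr (PiM J (\<lambda>_. M)) (PiM J (\<lambda>_. M)) (compose J f)) (PiE J A) = (\<Prod>i\<in>J. emeasure M (A i))"
      by (simp add: f)
  qed simp
qed

lemma nn_integral_PiM_compose:
  assumes "finite J" "sigma_finite_measure M" "f \<in> measurable M M" "distr M M f = M"
    and g: "g \<in> borel_measurable (PiM J (\<lambda>_. M))"
  shows "(\<integral>\<^sup>+x. g (compose J f x) \<partial>PiM J (\<lambda>_. M)) = (\<integral>\<^sup>+x. g x \<partial>PiM J (\<lambda>_. M))"
proof -
  have c: "compose J f \<in> measurable (PiM J (\<lambda>_. M)) (PiM J (\<lambda>_. M))"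
    unfolding compose_def
    by (intro measurable_restrict measurable_compose[OF measurable_component_singleton[of _ J "\<lambda>_. M"] assms(3)])
  have "(\<integral>\<^sup>+x. g x \<partial>PiM J (\<lambda>_. M)) = (\<integral>\<^sup>+x. g x \<partial>distr (PiM J (\<lambda>_. M)) (PiM J (\<lambda>_. M)) (compose J f))"
    by (simp only: distr_PiM_compose[OF assms(1-4)])
  also have "\<dots> = (\<integral>\<^sup>+x. g (compose J f x) \<partial>PiM J (\<lambda>_. M))"
    using g by (intro nn_integral_distr[OF c]) simp
  finally show ?thesis by simp
qed

text \<open>One period has length \<open>pi\<close> rather than \<open>2 * pi\<close>: in a
  tournament on an odd number of vertices all imbalances are even, so only characters of period
  \<open>pi\<close> occur. A full circle would contain spurious copies of the main peak.\<close>

definition unif :: "real measure" where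
  "unif = density lborel (\<lambda>x. ennreal (indicator {-pi/2..<pi/2} x / pi))"

definition gauss :: "nat \<Rightarrow> real measure" where
  "gauss n = density lborel (\<lambda>x. ennreal (normal_density 0 (1 / sqrt n) x))"

lemma sets_unif [simp, measurable_cong]: "sets unif = sets borel" by (simp add: unif_def)
lemma sets_gauss [simp, measurable_cong]: "sets (gauss n) = sets borel" by (simp add: gauss_def)

lemma nn_integral_unif:
  assumes "g \<in> borel_measurable borel"
  shows "(\<integral>\<^sup>+x. g x \<partial>unif) = ennreal (1 / pi) * (\<integral>\<^sup>+x. g x * indicator {-pi/2..<pi/2} x \<partial>lborel)"
proof -
  have "(\<integral>\<^sup>+x. g x \<partial>unif) = (\<integral>\<^sup>+x. ennreal (indicator {-pi/2..<pi/2} x / pi) * g x \<partial>lborel)"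
    unfolding unif_def by (rule nn_integral_density, measurable) (use assms in simp)
  also have "\<dots> = (\<integral>\<^sup>+x. ennreal (1 / pi) * (g x * indicator {-pi/2..<pi/2} x) \<partial>lborel)"
    by (intro nn_integral_cong) (auto simp: indicator_def mult.commute)
  also have "\<dots> = ennreal (1 / pi) * (\<integral>\<^sup>+x. g x * indicator {-pi/2..<pi/2} x \<partial>lborel)"
    using assms by (intro nn_integral_cmult) auto
  finally show ?thesis .
qed

lemma prob_space_unif: "prob_space unif"
proof
  have "emeasure unif (space unif) = (\<integral>\<^sup>+x. 1 \<partial>unif)" by simp
  also have "\<dots> = ennreal (1 / pi) * (\<integral>\<^sup>+x. indicator {-pi/2..<pi/2} x \<partial>lborel)"
    by (subst nn_integral_unif) auto
  also have "(\<integral>\<^sup>+x. indicator {-pi/2..<pi/2} x \<partial>lborel) = ennreal pi" by (simp add: field_simps)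
  finally show "emeasure unif (space unif) = 1"
    by (simp add: ennreal_mult[symmetric] del: ennreal_1 flip: ennreal_1)
qed

lemma prob_space_gauss: "n > 0 \<Longrightarrow> prob_space (gauss n)"
  unfolding gauss_def by (rule prob_space_normal_density) simp

text \<open>Translation by \<open>t\<close> on the circle of length \<open>pi\<close>, with
  representatives in the support of \<open>unif\<close>.\<close>

definition wrap :: "real \<Rightarrow> real \<Rightarrow> real" where
  "wrap t x = (x + t) - pi * of_int \<lfloor>(x + t) / pi + 1 / 2\<rfloor>"

lemma wrap_measurable [measurable]: "wrap t \<in> borel_measurable borel"
  unfolding wrap_def[abs_def] by measurable

lemma wrap_shift: "wrap t (x + pi * of_int k) = wrap t x"
proof -
  have "(x + pi * of_int k + t) / pi + 1 / 2 = ((x + t) / pi + 1 / 2) + of_int k" by (simp add: field_simps)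
  then have "\<lfloor>(x + pi * of_int k + t) / pi + 1 / 2\<rfloor> = \<lfloor>(x + t) / pi + 1 / 2\<rfloor> + k"
    by (simp only: floor_add_int)
  then show ?thesis by (simp add: wrap_def algebra_simps)
qed

lemma wrap_id: "-pi/2 \<le> x \<Longrightarrow> x < pi/2 \<Longrightarrow> wrap 0 x = x"
proof -
  assume "-pi/2 \<le> x" "x < pi/2"
  then have "\<lfloor>x / pi + 1 / 2\<rfloor> = 0" by (intro floor_unique) (auto simp: field_simps)
  then show ?thesis by (simp add: wrap_def)
qed

text \<open>Reduce the shift to \<open>0 \<le> s < pi\<close>; the part of the translated window
  that sticks out on the right is moved back by one period and fills the gap on the left.\<close>

lemma nn_integral_unif_shift:
  assumes g [measurable]: "g \<in> borel_measurable borel" and per: "\<And>x k. g (x + pi * of_int k) = g x"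
  shows "(\<integral>\<^sup>+x. g (x + t) \<partial>unif) = (\<integral>\<^sup>+x. g x \<partial>unif)"
proof -
  define k where "k = \<lfloor>t / pi\<rfloor>"
  define s where "s = t - pi * of_int k"
  have s: "0 \<le> s" "s < pi"
    unfolding s_def k_def using floor_divide_lower[of pi t] floor_divide_upper[of pi t] by (auto simp: algebra_simps)
  have gs: "g (x + t) = g (x + s)" for x using per[of "x + s" k] by (simp add: s_def algebra_simps)
  have tr: "(\<integral>\<^sup>+x. h (x + c) \<partial>lborel) = (\<integral>\<^sup>+x. h x \<partial>lborel)" if "h \<in> borel_measurable borel"
    for h :: "real \<Rightarrow> ennreal" and c
    using nn_integral_real_affine[OF that, of 1 c] by (simp add: add.commute)
  let ?i = "\<lambda>a b x. indicator {a..<b} x :: ennreal"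
  have "(\<integral>\<^sup>+x. g (x + s) * ?i (-pi/2) (pi/2) x \<partial>lborel) = (\<integral>\<^sup>+x. g (x + s) * ?i (-pi/2 + s) (pi/2 + s) (x + s) \<partial>lborel)"
    by (intro nn_integral_cong) (auto simp: indicator_def)
  also have "\<dots> = (\<integral>\<^sup>+x. g x * ?i (-pi/2 + s) (pi/2 + s) x \<partial>lborel)" by (rule tr) measurable
  also have "\<dots> = (\<integral>\<^sup>+x. g x * ?i (-pi/2 + s) (pi/2) x + g x * ?i (pi/2) (pi/2 + s) x \<partial>lborel)"
    using s by (intro nn_integral_cong) (auto simp: indicator_def)
  also have "\<dots> = (\<integral>\<^sup>+x. g x * ?i (-pi/2 + s) (pi/2) x \<partial>lborel) + (\<integral>\<^sup>+x. g x * ?i (pi/2) (pi/2 + s) x \<partial>lborel)"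
    by (intro nn_integral_add) auto
  also have "(\<integral>\<^sup>+x. g x * ?i (pi/2) (pi/2 + s) x \<partial>lborel) = (\<integral>\<^sup>+x. g (x + pi) * ?i (pi/2) (pi/2 + s) (x + pi) \<partial>lborel)"
    by (rule tr[symmetric]) measurable
  also have "\<dots> = (\<integral>\<^sup>+x. g x * ?i (-pi/2) (-pi/2 + s) x \<partial>lborel)"
    using per[of _ 1] by (intro nn_integral_cong) (auto simp: indicator_def)
  also have "(\<integral>\<^sup>+x. g x * ?i (-pi/2 + s) (pi/2) x \<partial>lborel) + (\<integral>\<^sup>+x. g x * ?i (-pi/2) (-pi/2 + s) x \<partial>lborel)
    = (\<integral>\<^sup>+x. g x * ?i (-pi/2 + s) (pi/2) x + g x * ?i (-pi/2) (-pi/2 + s) x \<partial>lborel)"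
    by (intro nn_integral_add[symmetric]) auto
  also have "\<dots> = (\<integral>\<^sup>+x. g x * ?i (-pi/2) (pi/2) x \<partial>lborel)"
    using s by (intro nn_integral_cong) (auto simp: indicator_def)
  finally show ?thesis by (simp add: gs nn_integral_unif)
qed

lemma distr_unif_wrap: "distr unif unif (wrap t) = unif"
proof (rule measure_eqI)
  fix A assume "A \<in> sets (distr unif unif (wrap t))"
  then have A [measurable]: "A \<in> sets borel" by simp
  \<comment> \<open>Composing with \<open>wrap 0\<close> makes the indicator of \<open>A\<close>
    periodic without changing it on the support of \<open>unif\<close>, so the shift lemma for
    periodic functions applies.\<close>
  let ?g = "\<lambda>x. indicator A (wrap 0 x) :: ennreal"
  have w: "wrap t \<in> measurable unif unif" using wrap_measurable[of t] by (simp add: measurable_cong_sets[OF sets_unif sets_unif])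
  have "emeasure (distr unif unif (wrap t)) A = (\<integral>\<^sup>+x. indicator A x \<partial>distr unif unif (wrap t))"
    by (subst nn_integral_indicator) auto
  also have "\<dots> = (\<integral>\<^sup>+x. indicator A (wrap t x) \<partial>unif)"
    by (rule nn_integral_distr[OF w]) auto
  also have "\<dots> = (\<integral>\<^sup>+x. ?g (x + t) \<partial>unif)" by (simp add: wrap_def)
  also have "\<dots> = (\<integral>\<^sup>+x. ?g x \<partial>unif)"
    by (rule nn_integral_unif_shift) (auto simp: wrap_shift)
  also have "\<dots> = (\<integral>\<^sup>+x. indicator A x \<partial>unif)"
    by (subst (1 2) nn_integral_unif)
       (auto intro!: nn_integral_cong arg_cong[of _ _ "\<lambda>x. _ * x"] simp: indicator_def wrap_id)
  also have "\<dots> = emeasure unif A" by (subst nn_integral_indicator) auto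
  finally show "emeasure (distr unif unif (wrap t)) A = emeasure unif A" .
qed simp

lemma sigma_finite_unif: "sigma_finite_measure unif"
  using prob_space_unif by (simp add: prob_space_imp_sigma_finite)

lemma product_sigma_finite_const: "sigma_finite_measure M \<Longrightarrow> product_sigma_finite (\<lambda>_. M)"
  by (simp add: product_sigma_finite_def)

lemma nn_integral_exp_square:
  assumes "n > 0"
  shows "(\<integral>\<^sup>+t. ennreal (exp (- (real n * t + s)\<^sup>2 / 2)) \<partial>lborel) = ennreal (sqrt (2 * pi) / real n)"
proof -
  let ?f = "normal_density (- s / real n) (1 / real n)"
  interpret prob_space "density lborel (\<lambda>x. ennreal (?f x))"
    using assms by (intro prob_space_normal_density) simp
  have n0: "real n \<noteq> 0" using assms by simp
  have e: "exp (- (real n * t + s)\<^sup>2 / 2) = sqrt (2 * pi) / real n * ?f t" for t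
  proof -
    have "(t - - s / real n)\<^sup>2 / (2 * (1 / real n)\<^sup>2) = (real n * (t + s / real n))\<^sup>2 / 2"
      using n0 by (simp add: power_divide power_mult_distrib)
    also have "real n * (t + s / real n) = real n * t + s" using n0 by (simp add: field_simps)
    finally have "(t - - s / real n)\<^sup>2 / (2 * (1 / real n)\<^sup>2) = (real n * t + s)\<^sup>2 / 2" .
    moreover have "sqrt (2 * pi * (1 / real n)\<^sup>2) = sqrt (2 * pi) / real n"
      by (simp add: real_sqrt_mult real_sqrt_divide power_divide)
    ultimately show ?thesis using n0 by (simp add: normal_density_def)
  qed
  have "(\<integral>\<^sup>+t. ennreal (exp (- (real n * t + s)\<^sup>2 / 2)) \<partial>lborel) =
    (\<integral>\<^sup>+t. ennreal (sqrt (2 * pi) / real n) * ennreal (?f t) \<partial>lborel)"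
    unfolding e by (intro nn_integral_cong ennreal_mult) auto
  also have "\<dots> = ennreal (sqrt (2 * pi) / real n) * (\<integral>\<^sup>+t. ennreal (?f t) \<partial>lborel)"
    by (intro nn_integral_cmult) simp
  also have "(\<integral>\<^sup>+t. ennreal (?f t) \<partial>lborel) = 1"
    using emeasure_space_1 by (simp add: emeasure_density)
  finally show ?thesis by simp
qed

lemma PiM_gauss:
  assumes "finite I" "n > 0"
  shows "PiM I (\<lambda>_. gauss n) = density (PiM I (\<lambda>_. lborel))
    (\<lambda>x. ennreal (sqrt (real n / (2 * pi)) ^ card I * exp (- real n * (\<Sum>i\<in>I. (x i)\<^sup>2) / 2)))"
proof -
  have "normal_density 0 (1 / sqrt (real n)) x = sqrt (real n / (2 * pi)) * exp (- real n * x\<^sup>2 / 2)" for x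
    using assms(2) by (simp add: normal_density_def power_divide real_sqrt_divide mult.commute)
  then have "(\<Prod>i\<in>I. ennreal (normal_density 0 (1 / sqrt (real n)) (x i))) =
    ennreal (sqrt (real n / (2 * pi)) ^ card I * exp (- real n * (\<Sum>i\<in>I. (x i)\<^sup>2) / 2))" for x :: "'a \<Rightarrow> real"
    using assms(1)
    by (subst prod_ennreal)
       (auto simp: prod.distrib exp_sum[symmetric] sum_distrib_left sum_divide_distrib sum_negf)
  moreover have "PiM I (\<lambda>_. gauss n) = density (PiM I (\<lambda>_. lborel))
     (\<lambda>x. \<Prod>i\<in>I. ennreal (normal_density 0 (1 / sqrt (real n)) (x i)))"
    unfolding gauss_def using prob_space_imp_sigma_finite[OF prob_space_gauss[OF assms(2)]]
    by (intro PiM_density_lborel assms) (auto simp: gauss_def)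
  ultimately show ?thesis by simp
qed

text \<open>The integral of \<open>exp (- diffpow 2 I \<phi> / 2)\<close> over all \<open>\<phi>\<close> with one angle fixed, where \<open>n = card I\<close>.\<close>

definition gaugeconst :: "nat \<Rightarrow> real" where
  "gaugeconst n = real n / sqrt (2 * pi) * sqrt (2 * pi / real n) ^ n"

lemma gaugeconst_pos: "n > 0 \<Longrightarrow> gaugeconst n > 0"
  by (simp add: gaugeconst_def)

text \<open>The translation mode: inserting a Gaussian integral over the mean of all angles turns
  the integral with one angle fixed into an expectation over independent normal variables.\<close>

lemma nn_integral_gauge:
  fixes h :: "(nat \<Rightarrow> real) \<Rightarrow> ennreal"
  assumes I: "finite I" "r \<in> I" and J: "J = I - {r}" and n: "n = card I"
    and h: "h \<in> borel_measurable (PiM I (\<lambda>_. borel))"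
    and inv: "\<And>\<theta> \<theta>' t. (\<And>i. i \<in> I \<Longrightarrow> \<theta>' i = \<theta> i + t) \<Longrightarrow> h \<theta>' = h \<theta>"
  shows "(\<integral>\<^sup>+\<phi>. h (\<phi>(r := 0)) * ennreal (exp (- diffpow 2 I (\<phi>(r := 0)) / 2)) \<partial>PiM J (\<lambda>_. lborel))
    = ennreal (gaugeconst n) * (\<integral>\<^sup>+\<theta>. h \<theta> \<partial>PiM I (\<lambda>_. gauss n))"
proof -
  have n0: "n > 0" using I n by (auto simp: card_gt_0_iff)
  have IJ: "I = insert r J" "r \<notin> J" "finite J" using I J by auto
  have cJ: "real (card J) = real n - 1" using IJ n n0 by simp
  interpret L: product_sigma_finite "\<lambda>_::nat. lborel :: real measure"
    by (rule product_sigma_finite_const) (rule sigma_finite_lborel)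
  define e :: "real \<Rightarrow> ennreal" where "e x = ennreal (exp (- x\<^sup>2 / 2))" for x
  define k where "k \<theta> = h \<theta> * ennreal (exp (- diffpow 2 I \<theta> / 2))" for \<theta>
  define c where "c = sqrt (real n / (2 * pi)) ^ n"
  have em [measurable]: "e \<in> borel_measurable borel" unfolding e_def[abs_def] by measurable
  have sm: "(\<lambda>\<theta> :: nat \<Rightarrow> real. \<Sum>i\<in>K. \<theta> i) \<in> borel_measurable (PiM I (\<lambda>_. borel))" if "K \<subseteq> I" for K :: "nat set"
    using that by (intro borel_measurable_sum component_borel) auto
  have km: "k \<in> borel_measurable (PiM I (\<lambda>_. borel))"
    unfolding k_def[abs_def] using diffpow_measurable[of 2 I] h by measurable
  have kinv: "k \<theta>' = k \<theta>" if "\<And>i. i \<in> I \<Longrightarrow> \<theta>' i = \<theta> i + t" for \<theta> \<theta>' t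
  proof -
    have "diffpow 2 I \<theta>' = diffpow 2 I \<theta>" unfolding diffpow_def
      by (intro sum.cong refl) (auto simp: pairs_def that)
    then show ?thesis using inv[OF that] by (simp add: k_def)
  qed
  have mL: "measurable (PiM K (\<lambda>_::nat. lborel :: real measure)) N = measurable (PiM K (\<lambda>_. borel)) N" for K and N :: "'z measure"
    by (rule measurable_PiM_borel) simp
  have kem: "(\<lambda>\<theta>. k \<theta> * e (\<Sum>i\<in>I. \<theta> i)) \<in> borel_measurable (PiM I (\<lambda>_. borel))"
    using km sm[OF order_refl] by measurable
  have updm: "(\<lambda>\<phi>. \<phi>(r := t)) \<in> measurable (PiM J (\<lambda>_. borel)) (PiM I (\<lambda>_. borel :: real measure))" for t
    by (rule fun_upd_PiM_borel[OF IJ(1)])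
  have updm2: "(\<lambda>\<phi>. \<phi>(r := 0)) \<in> measurable (PiM I (\<lambda>_. borel)) (PiM I (\<lambda>_. borel :: real measure))"
    by (rule fun_upd_PiM_borel) (use IJ in auto)
  have Gm: "(\<lambda>\<theta>. k (\<theta>(r := 0)) * e (real n * \<theta> r + (\<Sum>i\<in>J. \<theta> i))) \<in> borel_measurable (PiM I (\<lambda>_. borel))"
  proof -
    have "(\<lambda>\<theta>. k (\<theta>(r := 0))) \<in> borel_measurable (PiM I (\<lambda>_. borel))" by (rule measurable_compose[OF updm2 km])
    moreover have "(\<lambda>\<theta>. e (real n * \<theta> r + (\<Sum>i\<in>J. \<theta> i))) \<in> borel_measurable (PiM I (\<lambda>_. borel))"
      using sm[of J] component_borel[OF I(2)] IJ by (intro measurable_compose[OF _ em]) auto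
    ultimately show ?thesis by (rule borel_measurable_times_ennreal)
  qed
  have fin: "(\<integral>\<^sup>+\<theta>. h \<theta> \<partial>PiM I (\<lambda>_. gauss n)) = (\<integral>\<^sup>+\<theta>. ennreal c * (k \<theta> * e (\<Sum>i\<in>I. \<theta> i)) \<partial>PiM I (\<lambda>_. lborel))"
  proof -
    let ?d = "\<lambda>x. sqrt (real n / (2 * pi)) ^ card I * exp (- real n * (\<Sum>i\<in>I. (x i)\<^sup>2) / 2)"
    have dm: "(\<lambda>x. ennreal (?d x)) \<in> borel_measurable (PiM I (\<lambda>_. lborel))"
      unfolding mL
      by (intro measurable_compose[OF _ measurable_ennreal] borel_measurable_times borel_measurable_const
          measurable_compose[OF _ borel_measurable_exp] borel_measurable_divide borel_measurable_sum
          borel_measurable_power component_borel) auto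
    have "(\<integral>\<^sup>+\<theta>. h \<theta> \<partial>PiM I (\<lambda>_. gauss n)) = (\<integral>\<^sup>+\<theta>. ennreal (?d \<theta>) * h \<theta> \<partial>PiM I (\<lambda>_. lborel))"
      unfolding PiM_gauss[OF I(1) n0] using h dm by (intro nn_integral_density) (auto simp: mL)
    also have "\<dots> = (\<integral>\<^sup>+\<theta>. ennreal c * (k \<theta> * e (\<Sum>i\<in>I. \<theta> i)) \<partial>PiM I (\<lambda>_. lborel))"
    proof (rule nn_integral_cong)
      fix \<theta> :: "nat \<Rightarrow> real"
      have "- real n * (\<Sum>i\<in>I. (\<theta> i)\<^sup>2) / 2 = - diffpow 2 I \<theta> / 2 + - (\<Sum>i\<in>I. \<theta> i)\<^sup>2 / 2"
        using diffpow_sq[OF I(1), of \<theta>] n by simp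
      then have "?d \<theta> = c * (exp (- diffpow 2 I \<theta> / 2) * exp (- (\<Sum>i\<in>I. \<theta> i)\<^sup>2 / 2))"
        by (simp only: exp_add c_def n)
      then show "ennreal (?d \<theta>) * h \<theta> = ennreal c * (k \<theta> * e (\<Sum>i\<in>I. \<theta> i))"
        by (simp add: ennreal_mult k_def e_def c_def ac_simps)
    qed
    finally show ?thesis .
  qed
  have "(\<integral>\<^sup>+\<theta>. k \<theta> * e (\<Sum>i\<in>I. \<theta> i) \<partial>PiM I (\<lambda>_. lborel))
    = (\<integral>\<^sup>+t. \<integral>\<^sup>+\<phi>. k (\<phi>(r := t)) * e (\<Sum>i\<in>I. (\<phi>(r := t)) i) \<partial>PiM J (\<lambda>_. lborel) \<partial>lborel)"
    unfolding IJ(1) using kem IJ by (intro L.product_nn_integral_insert_rev) (auto simp: mL)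
  \<comment> \<open>The inner integral is translated by \<open>t\<close> in every coordinate of
    \<open>J\<close>. By invariance \<open>k\<close> forgets \<open>t\<close>, while the sum of all
    \<open>n\<close> angles grows by \<open>n * t\<close>; after Fubini the variable
    \<open>t\<close> then occurs in a single Gaussian factor.\<close>
  also have "\<dots> = (\<integral>\<^sup>+t. \<integral>\<^sup>+\<phi>. k (\<phi>(r := 0)) * e (real n * t + (\<Sum>i\<in>J. \<phi> i)) \<partial>PiM J (\<lambda>_. lborel) \<partial>lborel)"
  proof (rule nn_integral_cong)
    fix t :: real
    let ?g = "\<lambda>\<phi>. k (\<phi>(r := t)) * e (\<Sum>i\<in>I. (\<phi>(r := t)) i)"
    have gm: "?g \<in> borel_measurable (PiM J (\<lambda>_. lborel))"
      unfolding mL by (rule measurable_compose[OF updm kem])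
    have "(\<integral>\<^sup>+\<phi>. ?g \<phi> \<partial>PiM J (\<lambda>_. lborel)) = (\<integral>\<^sup>+\<phi>. ?g (compose J ((+) t) \<phi>) \<partial>PiM J (\<lambda>_. lborel))"
    proof (rule nn_integral_PiM_compose[symmetric, OF IJ(3) sigma_finite_lborel _ _ gm])
      show "distr lborel lborel ((+) t) = lborel"
        using lborel_distr_plus[of t] distr_cong[of lborel lborel lborel borel "(+) t" "(+) t"] by simp
    qed simp
    also have "\<dots> = (\<integral>\<^sup>+\<phi>. k (\<phi>(r := 0)) * e (real n * t + (\<Sum>i\<in>J. \<phi> i)) \<partial>PiM J (\<lambda>_. lborel))"
    proof (rule nn_integral_cong)
      fix \<phi> :: "nat \<Rightarrow> real"
      let ?\<psi> = "(compose J ((+) t) \<phi>)(r := t)"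
      have "k ?\<psi> = k (\<phi>(r := 0))"
        by (rule kinv[of _ _ t]) (use IJ in \<open>auto simp: compose_def\<close>)
      moreover have "(\<Sum>i\<in>I. ?\<psi> i) = real n * t + (\<Sum>i\<in>J. \<phi> i)"
      proof -
        have "(\<Sum>i\<in>J. ?\<psi> i) = (\<Sum>i\<in>J. t + \<phi> i)" using IJ by (intro sum.cong) (auto simp: compose_def)
        then show ?thesis using IJ cJ by (simp add: sum.distrib algebra_simps)
      qed
      ultimately show "?g (compose J ((+) t) \<phi>) = k (\<phi>(r := 0)) * e (real n * t + (\<Sum>i\<in>J. \<phi> i))" by simp
    qed
    finally show "(\<integral>\<^sup>+\<phi>. ?g \<phi> \<partial>PiM J (\<lambda>_. lborel)) = \<dots>" .
  qed
  also have "\<dots> = (\<integral>\<^sup>+t. \<integral>\<^sup>+\<phi>. k ((\<phi>(r := t))(r := 0)) * e (real n * (\<phi>(r := t)) r + (\<Sum>i\<in>J. (\<phi>(r := t)) i)) \<partial>PiM J (\<lambda>_. lborel) \<partial>lborel)"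
    using IJ by (intro nn_integral_cong arg_cong2[of _ _ _ _ "(*)"] arg_cong[of _ _ e] arg_cong2[of _ _ _ _ "(+)"] sum.cong) auto
  also have "\<dots> = (\<integral>\<^sup>+\<theta>. k (\<theta>(r := 0)) * e (real n * \<theta> r + (\<Sum>i\<in>J. \<theta> i)) \<partial>PiM I (\<lambda>_. lborel))"
    unfolding IJ(1) using Gm IJ by (intro L.product_nn_integral_insert_rev[symmetric]) (auto simp: mL)
  also have "\<dots> = (\<integral>\<^sup>+\<phi>. \<integral>\<^sup>+t. k ((\<phi>(r := t))(r := 0)) * e (real n * (\<phi>(r := t)) r + (\<Sum>i\<in>J. (\<phi>(r := t)) i)) \<partial>lborel \<partial>PiM J (\<lambda>_. lborel))"
    unfolding IJ(1) using Gm IJ by (intro L.product_nn_integral_insert) (auto simp: mL)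
  also have "\<dots> = (\<integral>\<^sup>+\<phi>. k (\<phi>(r := 0)) * ennreal (sqrt (2 * pi) / real n) \<partial>PiM J (\<lambda>_. lborel))"
  proof (rule nn_integral_cong)
    fix \<phi> :: "nat \<Rightarrow> real"
    have "(\<integral>\<^sup>+t. k ((\<phi>(r := t))(r := 0)) * e (real n * (\<phi>(r := t)) r + (\<Sum>i\<in>J. (\<phi>(r := t)) i)) \<partial>lborel)
      = (\<integral>\<^sup>+t. k (\<phi>(r := 0)) * e (real n * t + (\<Sum>i\<in>J. \<phi> i)) \<partial>lborel)"
      using IJ by (intro nn_integral_cong arg_cong2[of _ _ _ _ "(*)"] arg_cong[of _ _ e] arg_cong2[of _ _ _ _ "(+)"] sum.cong) auto
    also have "\<dots> = k (\<phi>(r := 0)) * (\<integral>\<^sup>+t. e (real n * t + (\<Sum>i\<in>J. \<phi> i)) \<partial>lborel)"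
      by (intro nn_integral_cmult measurable_compose[OF _ em]) simp
    also have "(\<integral>\<^sup>+t. e (real n * t + (\<Sum>i\<in>J. \<phi> i)) \<partial>lborel) = ennreal (sqrt (2 * pi) / real n)"
      unfolding e_def by (rule nn_integral_exp_square[OF n0])
    finally show "(\<integral>\<^sup>+t. k ((\<phi>(r := t))(r := 0)) * e (real n * (\<phi>(r := t)) r + (\<Sum>i\<in>J. (\<phi>(r := t)) i)) \<partial>lborel)
      = k (\<phi>(r := 0)) * ennreal (sqrt (2 * pi) / real n)" .
  qed
  also have "\<dots> = (\<integral>\<^sup>+\<phi>. k (\<phi>(r := 0)) \<partial>PiM J (\<lambda>_. lborel)) * ennreal (sqrt (2 * pi) / real n)"
    by (intro nn_integral_multc) (simp add: mL measurable_compose[OF updm km])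
  finally have main: "(\<integral>\<^sup>+\<theta>. k \<theta> * e (\<Sum>i\<in>I. \<theta> i) \<partial>PiM I (\<lambda>_. lborel)) =
    (\<integral>\<^sup>+\<phi>. k (\<phi>(r := 0)) \<partial>PiM J (\<lambda>_. lborel)) * ennreal (sqrt (2 * pi) / real n)" .
  have "ennreal (gaugeconst n) * (\<integral>\<^sup>+\<theta>. h \<theta> \<partial>PiM I (\<lambda>_. gauss n)) =
    ennreal (gaugeconst n) * (ennreal c * ((\<integral>\<^sup>+\<phi>. k (\<phi>(r := 0)) \<partial>PiM J (\<lambda>_. lborel)) * ennreal (sqrt (2 * pi) / real n)))"
    unfolding fin main[symmetric] using kem by (subst nn_integral_cmult) (auto simp: mL)
  also have "\<dots> = ennreal (gaugeconst n * c * (sqrt (2 * pi) / real n)) * (\<integral>\<^sup>+\<phi>. k (\<phi>(r := 0)) \<partial>PiM J (\<lambda>_. lborel))"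
  proof -
    have ab: "ennreal a * (ennreal b * (X * ennreal d)) = ennreal (a * b * d) * X"
      if "0 \<le> a" "0 \<le> b" "0 \<le> d" for a b d X
      using that by (simp add: ennreal_mult ac_simps)
    show ?thesis using gaugeconst_pos[OF n0] by (intro ab) (auto simp: c_def)
  qed
  also have "gaugeconst n * c * (sqrt (2 * pi) / real n) = 1"
  proof -
    have "sqrt (2 * pi / real n) * sqrt (real n / (2 * pi)) = 1"
      using n0 by (simp add: real_sqrt_mult[symmetric])
    then have "sqrt (2 * pi / real n) ^ n * c = 1" unfolding c_def by (simp only: power_mult_distrib[symmetric]) simp
    then show ?thesis using n0 by (simp add: gaugeconst_def)
  qed
  finally show ?thesis by (simp only: k_def ennreal_1 mult_1)
qed

text \<open>Because \<open>g\<close> vanishes off the open cube, the uniform density may be replaced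
  by a constant without truncating the Lebesgue integral.\<close>

lemma nn_integral_unif_PiM:
  fixes g :: "(nat \<Rightarrow> real) \<Rightarrow> ennreal"
  assumes "finite J" "g \<in> borel_measurable (PiM J (\<lambda>_. borel))"
    and "\<And>\<phi> j. j \<in> J \<Longrightarrow> \<not> \<bar>\<phi> j\<bar> < pi / 2 \<Longrightarrow> g \<phi> = 0"
  shows "(\<integral>\<^sup>+\<phi>. g \<phi> \<partial>PiM J (\<lambda>_. unif)) = ennreal ((1 / pi) ^ card J) * (\<integral>\<^sup>+\<phi>. g \<phi> \<partial>PiM J (\<lambda>_. lborel))"
proof -
  let ?d = "\<lambda>x. ennreal (indicator {-pi/2..<pi/2} x / pi)"
  have mL: "measurable (PiM J (\<lambda>_::nat. lborel :: real measure)) N = measurable (PiM J (\<lambda>_. borel)) N" for N :: "'z measure"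
    by (rule measurable_PiM_borel) simp
  have dm: "?d \<in> borel_measurable borel" by measurable
  have P: "PiM J (\<lambda>_. unif) = density (PiM J (\<lambda>_. lborel)) (\<lambda>x. \<Prod>i\<in>J. ?d (x i))"
    unfolding unif_def using sigma_finite_unif
    by (intro PiM_density_lborel assms dm) (simp add: unif_def)
  have "(\<integral>\<^sup>+\<phi>. g \<phi> \<partial>PiM J (\<lambda>_. unif)) = (\<integral>\<^sup>+\<phi>. (\<Prod>i\<in>J. ?d (\<phi> i)) * g \<phi> \<partial>PiM J (\<lambda>_. lborel))"
    unfolding P using assms(2)
    by (intro nn_integral_density) (auto simp: mL intro!: borel_measurable_prod_ennreal measurable_compose[OF component_borel dm])
  also have "\<dots> = (\<integral>\<^sup>+\<phi>. ennreal ((1 / pi) ^ card J) * g \<phi> \<partial>PiM J (\<lambda>_. lborel))"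
  proof (rule nn_integral_cong)
    fix \<phi> :: "nat \<Rightarrow> real"
    show "(\<Prod>i\<in>J. ?d (\<phi> i)) * g \<phi> = ennreal ((1 / pi) ^ card J) * g \<phi>"
    proof (cases "\<forall>j\<in>J. \<bar>\<phi> j\<bar> < pi / 2")
      case True
      then have "(\<Prod>i\<in>J. ?d (\<phi> i)) = (\<Prod>i\<in>J. ennreal (1 / pi))"
        by (intro prod.cong) (auto simp: indicator_def abs_less_iff)
      then show ?thesis by (simp add: ennreal_power)
    next
      case False
      then show ?thesis using assms(3) by auto
    qed
  qed
  also have "\<dots> = ennreal ((1 / pi) ^ card J) * (\<integral>\<^sup>+\<phi>. g \<phi> \<partial>PiM J (\<lambda>_. lborel))"
    using assms(2) by (intro nn_integral_cmult) (simp add: mL)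
  finally show ?thesis .
qed

text \<open>The Gaussian approximation, without the quartic correction, to the normalised torus
  integral with one angle fixed; all errors are measured relative to it.\<close>

definition volconst :: "nat \<Rightarrow> real" where
  "volconst n = (1 / pi) ^ (n - 1) * gaugeconst n"

lemma volconst_pos: "n > 0 \<Longrightarrow> volconst n > 0"
  by (simp add: volconst_def gaugeconst_pos)

lemma nn_integral_unif_gauge:
  fixes h :: "(nat \<Rightarrow> real) \<Rightarrow> ennreal"
  assumes I: "finite I" "r \<in> I" and J: "J = I - {r}" and n: "n = card I"
    and h: "h \<in> borel_measurable (PiM I (\<lambda>_. borel))"
    and inv: "\<And>\<theta> \<theta>' t. (\<And>i. i \<in> I \<Longrightarrow> \<theta>' i = \<theta> i + t) \<Longrightarrow> h \<theta>' = h \<theta>"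
    and zero: "\<And>\<theta> j. j \<in> J \<Longrightarrow> \<not> \<bar>\<theta> j - \<theta> r\<bar> < pi / 2 \<Longrightarrow> h \<theta> = 0"
  shows "(\<integral>\<^sup>+\<phi>. h (\<phi>(r := 0)) * ennreal (exp (- diffpow 2 I (\<phi>(r := 0)) / 2)) \<partial>PiM J (\<lambda>_. unif))
    = ennreal (volconst n) * (\<integral>\<^sup>+\<theta>. h \<theta> \<partial>PiM I (\<lambda>_. gauss n))"
proof -
  let ?g = "\<lambda>\<phi>. h (\<phi>(r := 0)) * ennreal (exp (- diffpow 2 I (\<phi>(r := 0)) / 2))"
  have n0: "n > 0" using I n by (auto simp: card_gt_0_iff)
  have cJ: "card J = n - 1" using I J n by simp
  have upd: "(\<lambda>\<phi>. \<phi>(r := 0)) \<in> measurable (PiM J (\<lambda>_. borel)) (PiM I (\<lambda>_. borel :: real measure))"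
    by (rule fun_upd_PiM_borel) (use I J in auto)
  have "?g \<in> borel_measurable (PiM J (\<lambda>_. borel))"
    by (intro borel_measurable_times_ennreal measurable_compose[OF upd h]
        measurable_compose[OF _ measurable_ennreal] measurable_compose[OF _ borel_measurable_exp]
        borel_measurable_divide borel_measurable_uminus measurable_compose[OF upd diffpow_measurable]
        borel_measurable_const)
  moreover have "?g \<phi> = 0" if "j \<in> J" "\<not> \<bar>\<phi> j\<bar> < pi / 2" for \<phi> j
    using zero[of j "\<phi>(r := 0)"] that J by auto
  ultimately have "(\<integral>\<^sup>+\<phi>. ?g \<phi> \<partial>PiM J (\<lambda>_. unif)) = ennreal ((1 / pi) ^ card J) * (\<integral>\<^sup>+\<phi>. ?g \<phi> \<partial>PiM J (\<lambda>_. lborel))"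
    using I J by (intro nn_integral_unif_PiM) auto
  also have "\<dots> = ennreal ((1 / pi) ^ card J) * (ennreal (gaugeconst n) * (\<integral>\<^sup>+\<theta>. h \<theta> \<partial>PiM I (\<lambda>_. gauss n)))"
    by (simp only: nn_integral_gauge[OF assms(1-5) inv])
  finally show ?thesis
    using gaugeconst_pos[OF n0] by (simp add: volconst_def cJ ennreal_mult mult.assoc)
qed

section \<open>Moments of Gaussian differences\<close>

lemma prob_space_PiM_gauss: "n > 0 \<Longrightarrow> prob_space (PiM I (\<lambda>_. gauss n))"
  by (intro prob_space_PiM prob_space_gauss)

lemma indep_components:
  assumes "I \<noteq> {}" "n > 0"
  shows "prob_space.indep_vars (PiM I (\<lambda>_. gauss n)) (\<lambda>_. borel) (\<lambda>i \<omega>. \<omega> i) I"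
proof -
  interpret prob_space "PiM I (\<lambda>_. gauss n)" by (rule prob_space_PiM_gauss[OF assms(2)])
  have "distr (PiM I (\<lambda>_. gauss n)) (PiM I (\<lambda>_. gauss n)) (\<lambda>x. \<lambda>i\<in>I. x i) = PiM I (\<lambda>_. gauss n)"
  proof -
    have "distr (PiM I (\<lambda>_. gauss n)) (PiM I (\<lambda>_. gauss n)) (\<lambda>x. \<lambda>i\<in>I. x i)
      = distr (PiM I (\<lambda>_. gauss n)) (PiM I (\<lambda>_. gauss n)) (\<lambda>x. x)"
      by (intro distr_cong) (auto simp: space_PiM PiE_iff extensional_restrict restrict_def extensional_def fun_eq_iff)
    then show ?thesis by (simp add: distr_id)
  qed
  also have "PiM I (\<lambda>_. gauss n) = PiM I (\<lambda>i. distr (PiM I (\<lambda>_. gauss n)) (gauss n) (\<lambda>\<omega>. \<omega> i))"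
    using assms by (intro PiM_cong refl distr_PiM_component[symmetric] prob_space_gauss)
  finally have "indep_vars (\<lambda>_. gauss n) (\<lambda>i \<omega>. \<omega> i) I"
    using assms by (subst indep_vars_iff_distr_eq_PiM') auto
  then have "indep_vars (\<lambda>_. borel) (\<lambda>i \<omega>. (\<lambda>x. x) (\<omega> i)) I"
    by (rule indep_vars_compose2) (simp add: measurable_cong_sets[OF sets_gauss refl])
  then show ?thesis by simp
qed

lemma indep_component_functions:
  assumes "n > 0" "A \<subseteq> I" "B \<subseteq> I" "A \<inter> B = {}" "I \<noteq> {}"
    and "f \<in> borel_measurable (PiM A (\<lambda>_. borel))" "g \<in> borel_measurable (PiM B (\<lambda>_. borel))"
  shows "prob_space.indep_var (PiM I (\<lambda>_. gauss n)) borel (\<lambda>\<omega>. f (restrict \<omega> A)) borel (\<lambda>\<omega>. g (restrict \<omega> B))"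
proof -
  interpret prob_space "PiM I (\<lambda>_. gauss n)" by (rule prob_space_PiM_gauss[OF assms(1)])
  have "indep_var (PiM A (\<lambda>_. borel)) (\<lambda>\<omega>. restrict \<omega> A) (PiM B (\<lambda>_. borel)) (\<lambda>\<omega>. restrict \<omega> B)"
    using indep_var_restrict[OF indep_components[OF assms(5,1)] assms(4,2,3)] by simp
  from indep_var_compose[OF this assms(6,7)] show ?thesis by (simp add: comp_def)
qed

lemma gauss_diff_distributed:
  assumes "n > 0" "i \<in> I" "j \<in> I" "i \<noteq> j"
  shows "distributed (PiM I (\<lambda>_. gauss n)) lborel (\<lambda>\<omega>. \<omega> i - \<omega> j)
    (\<lambda>x. ennreal (normal_density 0 (sqrt (2 / real n)) x))"
proof -
  interpret prob_space "PiM I (\<lambda>_. gauss n)" by (rule prob_space_PiM_gauss[OF assms(1)])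
  have "indep_var borel (\<lambda>\<omega>. (\<lambda>x. x i) (restrict \<omega> {i})) borel (\<lambda>\<omega>. (\<lambda>x. x j) (restrict \<omega> {j}))"
    using assms by (intro indep_component_functions component_borel) auto
  then have indep: "indep_var borel (\<lambda>\<omega>. \<omega> i) borel (\<lambda>\<omega>. \<omega> j)" by simp
  have comp: "distributed (PiM I (\<lambda>_. gauss n)) lborel (\<lambda>\<omega>. \<omega> k) (\<lambda>x. ennreal (normal_density 0 (1 / sqrt (real n)) x))"
    if k: "k \<in> I" for k
  proof -
    have "distr (PiM I (\<lambda>_. gauss n)) lborel (\<lambda>\<omega>. \<omega> k) = distr (PiM I (\<lambda>_. gauss n)) (gauss n) (\<lambda>\<omega>. \<omega> k)"
      by (intro distr_cong) auto
    also have "\<dots> = gauss n" using k assms(1) by (intro distr_PiM_component prob_space_gauss)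
    also have "\<dots> = density lborel (\<lambda>x. ennreal (normal_density 0 (1 / sqrt (real n)) x))" by (simp add: gauss_def)
    moreover have "(\<lambda>\<omega>. \<omega> k) \<in> measurable (PiM I (\<lambda>_. gauss n)) lborel"
      using measurable_component_singleton[OF k, of "\<lambda>_. gauss n"]
      by (simp add: measurable_cong_sets[OF refl sets_gauss])
    ultimately show ?thesis by (simp add: distributed_def)
  qed
  have "distributed (PiM I (\<lambda>_. gauss n)) lborel (\<lambda>\<omega>. \<omega> i - \<omega> j)
    (\<lambda>x. ennreal (normal_density (0 - 0) (sqrt ((1 / sqrt (real n))\<^sup>2 + (1 / sqrt (real n))\<^sup>2)) x))"
    using assms by (intro diff_indep_normal indep comp) auto
  then show ?thesis by (simp add: power_divide)
qed

text \<open>The difference has variance \<open>2 / n\<close>, and the even moment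
  \<open>(2k - 1)!!\<close> of the standard normal times \<open>(2 / n) ^ k\<close> simplifies to
  the stated quotient.\<close>

lemma gauss_diff_moment:
  assumes "n > 0" "i \<in> I" "j \<in> I" "i \<noteq> j"
  shows "integrable (PiM I (\<lambda>_. gauss n)) (\<lambda>\<omega>. (\<omega> i - \<omega> j) ^ (2 * k))"
    and "(\<integral>\<omega>. (\<omega> i - \<omega> j) ^ (2 * k) \<partial>PiM I (\<lambda>_. gauss n)) = fact (2 * k) / (real n ^ k * fact k)"
proof -
  have s: "sqrt (2 / real n) > 0" using assms by simp
  note d = gauss_diff_distributed[OF assms]
  show "integrable (PiM I (\<lambda>_. gauss n)) (\<lambda>\<omega>. (\<omega> i - \<omega> j) ^ (2 * k))"
    using distributed_integrable[OF d, of "\<lambda>x. x ^ (2 * k)"] integrable_normal_moment[OF s, of 0 "2 * k"] by simp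
  have "(\<integral>\<omega>. (\<omega> i - \<omega> j) ^ (2 * k) \<partial>PiM I (\<lambda>_. gauss n)) =
    (\<integral>x. normal_density 0 (sqrt (2 / real n)) x * (x - 0) ^ (2 * k) \<partial>lborel)"
    using distributed_integral[OF d, of "\<lambda>x. x ^ (2 * k)"] by simp
  also have "\<dots> = fact (2 * k) / (real n ^ k * fact k)"
    unfolding integral_normal_moment_even[OF s] using assms(1) by simp
  finally show "(\<integral>\<omega>. (\<omega> i - \<omega> j) ^ (2 * k) \<partial>PiM I (\<lambda>_. gauss n)) = fact (2 * k) / (real n ^ k * fact k)" .
qed

lemma gauss_diff_moments:
  assumes "n > 0" "i \<in> I" "j \<in> I" "i \<noteq> j"
  shows "integrable (PiM I (\<lambda>_. gauss n)) (\<lambda>\<omega>. (\<omega> i - \<omega> j) ^ 4)"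
    "(\<integral>\<omega>. (\<omega> i - \<omega> j) ^ 4 \<partial>PiM I (\<lambda>_. gauss n)) = 12 / real n ^ 2"
    "integrable (PiM I (\<lambda>_. gauss n)) (\<lambda>\<omega>. (\<omega> i - \<omega> j) ^ 6)"
    "(\<integral>\<omega>. (\<omega> i - \<omega> j) ^ 6 \<partial>PiM I (\<lambda>_. gauss n)) = 120 / real n ^ 3"
    "integrable (PiM I (\<lambda>_. gauss n)) (\<lambda>\<omega>. (\<omega> i - \<omega> j) ^ 8)"
    "(\<integral>\<omega>. (\<omega> i - \<omega> j) ^ 8 \<partial>PiM I (\<lambda>_. gauss n)) = 1680 / real n ^ 4"
  using gauss_diff_moment[OF assms, of 2] gauss_diff_moment[OF assms, of 3] gauss_diff_moment[OF assms, of 4]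
  by (simp_all add: fact_numeral)

lemma diffpow_expectation:
  assumes I: "finite I" "I \<noteq> {}" and n: "n = card I"
  shows "integrable (PiM I (\<lambda>_. gauss n)) (diffpow 4 I)"
    "(\<integral>\<omega>. diffpow 4 I \<omega> \<partial>PiM I (\<lambda>_. gauss n)) = 6 * (real n - 1) / real n"
    "integrable (PiM I (\<lambda>_. gauss n)) (diffpow 6 I)"
    "(\<integral>\<omega>. diffpow 6 I \<omega> \<partial>PiM I (\<lambda>_. gauss n)) = 60 * (real n - 1) / real n ^ 2"
proof -
  let ?P = "PiM I (\<lambda>_. gauss n)"
  have n0: "n > 0" using I n by (simp add: card_gt_0_iff)
  have m: "fst q \<in> I" "snd q \<in> I" "fst q \<noteq> snd q" if "q \<in> pairs I" for q using that by (auto simp: pairs_def)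
  have D: "diffpow p I = (\<lambda>\<omega>. \<Sum>q\<in>pairs I. (\<omega> (fst q) - \<omega> (snd q)) ^ p)" for p
    by (rule ext) (simp add: diffpow_def case_prod_beta)
  have c: "2 * real (card (pairs I)) = real n * (real n - 1)"
  proof -
    have "real (2 * card (pairs I)) = real (n * (n - 1))" by (simp only: card_pairs[OF I(1)] n)
    then show ?thesis using n0 by (simp add: of_nat_diff)
  qed
  have c': "(\<Sum>q\<in>pairs I. x) = real n * (real n - 1) / 2 * x" for x using c by simp
  show "integrable ?P (diffpow 4 I)" "integrable ?P (diffpow 6 I)"
    unfolding D using m n0 by (auto intro!: Bochner_Integration.integrable_sum gauss_diff_moments)
  have "(\<integral>\<omega>. diffpow 4 I \<omega> \<partial>?P) = (\<Sum>q\<in>pairs I. \<integral>\<omega>. (\<omega> (fst q) - \<omega> (snd q)) ^ 4 \<partial>?P)"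
    unfolding D using m n0 by (intro Bochner_Integration.integral_sum gauss_diff_moments) auto
  also have "\<dots> = (\<Sum>q\<in>pairs I. 12 / real n ^ 2)"
    using m n0 by (intro sum.cong refl gauss_diff_moments) auto
  also have "\<dots> = real n * (real n - 1) / 2 * (12 / real n ^ 2)" unfolding c' by simp
  also have "\<dots> = 6 * (real n - 1) / real n" using n0 by (simp add: field_simps power2_eq_square)
  finally show "(\<integral>\<omega>. diffpow 4 I \<omega> \<partial>?P) = 6 * (real n - 1) / real n" .
  have "(\<integral>\<omega>. diffpow 6 I \<omega> \<partial>?P) = (\<Sum>q\<in>pairs I. \<integral>\<omega>. (\<omega> (fst q) - \<omega> (snd q)) ^ 6 \<partial>?P)"
    unfolding D using m n0 by (intro Bochner_Integration.integral_sum gauss_diff_moments) auto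
  also have "\<dots> = (\<Sum>q\<in>pairs I. 120 / real n ^ 3)"
    using m n0 by (intro sum.cong refl gauss_diff_moments) auto
  also have "\<dots> = real n * (real n - 1) / 2 * (120 / real n ^ 3)" unfolding c' by simp
  also have "\<dots> = 60 * (real n - 1) / real n ^ 2"
    using n0 by (simp add: field_simps power2_eq_square power3_eq_cube)
  finally show "(\<integral>\<omega>. diffpow 6 I \<omega> \<partial>?P) = 60 * (real n - 1) / real n ^ 2" .
qed

text \<open>Only pairs sharing an index contribute to the variance, which makes it \<open>O(1/n)\<close>.\<close>

lemma diffpow_variance:
  assumes I: "finite I" "I \<noteq> {}" and n: "n = card I"
  shows "integrable (PiM I (\<lambda>_. gauss n)) (\<lambda>\<omega>. (diffpow 4 I \<omega> - 6 * (real n - 1) / real n)\<^sup>2)"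
    "(\<integral>\<omega>. (diffpow 4 I \<omega> - 6 * (real n - 1) / real n)\<^sup>2 \<partial>PiM I (\<lambda>_. gauss n)) \<le> 6720 / real n"
proof -
  let ?P = "PiM I (\<lambda>_. gauss n)"
  have n0: "n > 0" using I n by (simp add: card_gt_0_iff)
  interpret prob_space ?P by (rule prob_space_PiM_gauss[OF n0])
  define \<mu> where "\<mu> = 12 / real n ^ 2"
  define Z where "Z q \<omega> = (\<omega> (fst q) - \<omega> (snd q)) ^ 4 - \<mu>" for q and \<omega> :: "nat \<Rightarrow> real"
  have m: "fst q \<in> I" "snd q \<in> I" "fst q \<noteq> snd q" if "q \<in> pairs I" for q using that by (auto simp: pairs_def)
  have Zi: "integrable ?P (Z q)" "(\<integral>\<omega>. Z q \<omega> \<partial>?P) = 0" if "q \<in> pairs I" for q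
    using gauss_diff_moments(1,2)[OF n0 m[OF that]]
    by (auto simp: Z_def[abs_def] \<mu>_def Bochner_Integration.integral_diff prob_space)
  have Z2: "integrable ?P (\<lambda>\<omega>. (Z q \<omega>)\<^sup>2)" "(\<integral>\<omega>. (Z q \<omega>)\<^sup>2 \<partial>?P) \<le> 1680 / real n ^ 4" if "q \<in> pairs I" for q
  proof -
    note M = gauss_diff_moments[OF n0 m[OF that]]
    have e: "(Z q \<omega>)\<^sup>2 = (\<omega> (fst q) - \<omega> (snd q)) ^ 8 - 2 * \<mu> * (\<omega> (fst q) - \<omega> (snd q)) ^ 4 + \<mu>\<^sup>2" for \<omega>
      by (simp add: Z_def power2_diff power_mult[symmetric] algebra_simps)
    show "integrable ?P (\<lambda>\<omega>. (Z q \<omega>)\<^sup>2)" unfolding e using M by auto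
    have "(\<integral>\<omega>. (Z q \<omega>)\<^sup>2 \<partial>?P) = 1680 / real n ^ 4 - 2 * \<mu> * \<mu> + \<mu>\<^sup>2"
      unfolding e using M by (simp add: prob_space \<mu>_def)
    also have "\<dots> \<le> 1680 / real n ^ 4" by (simp add: power2_eq_square)
    finally show "(\<integral>\<omega>. (Z q \<omega>)\<^sup>2 \<partial>?P) \<le> 1680 / real n ^ 4" .
  qed
  \<comment> \<open>A crude bound for pairs sharing an index, from
    \<open>2 a b \<le> a^2 + b^2\<close> and the eighth moment.\<close>
  have ZZ: "integrable ?P (\<lambda>\<omega>. Z p \<omega> * Z q \<omega>)" "(\<integral>\<omega>. Z p \<omega> * Z q \<omega> \<partial>?P) \<le> 1680 / real n ^ 4"
    if "p \<in> pairs I" "q \<in> pairs I" for p q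
  proof -
    have i: "integrable ?P (\<lambda>\<omega>. (Z p \<omega>)\<^sup>2 / 2 + (Z q \<omega>)\<^sup>2 / 2)" using Z2(1) that by auto
    have b: "\<bar>Z p \<omega> * Z q \<omega>\<bar> \<le> (Z p \<omega>)\<^sup>2 / 2 + (Z q \<omega>)\<^sup>2 / 2" for \<omega>
      using sum_squares_bound[of "\<bar>Z p \<omega>\<bar>" "\<bar>Z q \<omega>\<bar>"] by (simp add: abs_mult)
    show "integrable ?P (\<lambda>\<omega>. Z p \<omega> * Z q \<omega>)"
      using b Zi(1)[OF that(1)] Zi(1)[OF that(2)]
      by (intro Bochner_Integration.integrable_bound[OF i])
         (auto intro!: borel_measurable_times simp: abs_of_nonneg)
    then have "(\<integral>\<omega>. Z p \<omega> * Z q \<omega> \<partial>?P) \<le> (\<integral>\<omega>. (Z p \<omega>)\<^sup>2 / 2 + (Z q \<omega>)\<^sup>2 / 2 \<partial>?P)"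
      using b by (intro integral_mono i) (auto dest: abs_le_D1)
    also have "\<dots> = (\<integral>\<omega>. (Z p \<omega>)\<^sup>2 \<partial>?P) / 2 + (\<integral>\<omega>. (Z q \<omega>)\<^sup>2 \<partial>?P) / 2"
      using Z2(1) that by (subst Bochner_Integration.integral_add) auto
    finally show "(\<integral>\<omega>. Z p \<omega> * Z q \<omega> \<partial>?P) \<le> 1680 / real n ^ 4"
      using Z2(2)[OF that(1)] Z2(2)[OF that(2)] by simp
  qed
  define adj where "adj p q \<longleftrightarrow> {fst p, snd p} \<inter> {fst q, snd q} \<noteq> {}" for p q :: "nat \<times> nat"
  have indep0: "(\<integral>\<omega>. Z p \<omega> * Z q \<omega> \<partial>?P) = 0"
    if "p \<in> pairs I" "q \<in> pairs I" "\<not> adj p q" for p q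
  proof -
    have Zm: "Z r \<in> borel_measurable (PiM {fst r, snd r} (\<lambda>_. borel))" for r
      unfolding Z_def[abs_def]
      by (intro borel_measurable_diff borel_measurable_power component_borel borel_measurable_const) auto
    have "indep_var borel (\<lambda>\<omega>. Z p (restrict \<omega> {fst p, snd p})) borel (\<lambda>\<omega>. Z q (restrict \<omega> {fst q, snd q}))"
      using that m I by (intro indep_component_functions n0 Zm) (auto simp: adj_def)
    then have "indep_var borel (Z p) borel (Z q)" by (simp add: Z_def[abs_def])
    then show ?thesis using indep_var_lebesgue_integral[of "Z p" "Z q"] Zi that by simp
  qed
  have D: "(diffpow 4 I \<omega> - 6 * (real n - 1) / real n)\<^sup>2 = (\<Sum>p\<in>pairs I. \<Sum>q\<in>pairs I. Z p \<omega> * Z q \<omega>)" for \<omega>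
  proof -
    have "real (2 * card (pairs I)) = real (n * (n - 1))" by (simp only: card_pairs[OF I(1)] n)
    then have "2 * real (card (pairs I)) = real n * (real n - 1)" using n0 by (simp add: of_nat_diff)
    then have "real (card (pairs I)) * \<mu> = 6 * (real n - 1) / real n"
      using n0 by (simp add: \<mu>_def field_simps power2_eq_square)
    then have "diffpow 4 I \<omega> - 6 * (real n - 1) / real n = (\<Sum>q\<in>pairs I. Z q \<omega>)"
      by (simp add: Z_def diffpow_def case_prod_beta sum_subtractf)
    then show ?thesis by (simp add: power2_eq_square sum_product)
  qed
  show "integrable ?P (\<lambda>\<omega>. (diffpow 4 I \<omega> - 6 * (real n - 1) / real n)\<^sup>2)"
    unfolding D using ZZ(1) by (intro Bochner_Integration.integrable_sum) auto
  have "(\<integral>\<omega>. (diffpow 4 I \<omega> - 6 * (real n - 1) / real n)\<^sup>2 \<partial>?P) =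
    (\<Sum>p\<in>pairs I. \<Sum>q\<in>pairs I. \<integral>\<omega>. Z p \<omega> * Z q \<omega> \<partial>?P)"
    unfolding D using ZZ(1)
    by (subst Bochner_Integration.integral_sum)
       (auto intro!: Bochner_Integration.integrable_sum sum.cong Bochner_Integration.integral_sum)
  \<comment> \<open>At most \<open>4 * n\<close> pairs meet a given one. With fewer than
    \<open>n^2\<close> pairs in all and \<open>1680 / n^4\<close> per product, the total is
    \<open>6720 / n\<close>.\<close>
  also have "\<dots> \<le> (\<Sum>p\<in>pairs I. 4 * real n * (1680 / real n ^ 4))"
  proof (rule sum_mono)
    fix p assume p: "p \<in> pairs I"
    let ?A = "{q \<in> pairs I. adj p q}"
    have "?A \<subseteq> ({fst p, snd p} \<times> I) \<union> (I \<times> {fst p, snd p})"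
      by (auto simp: adj_def pairs_def)
    then have "card ?A \<le> card (({fst p, snd p} \<times> I) \<union> (I \<times> {fst p, snd p}))"
      using I by (intro card_mono) auto
    also have "\<dots> \<le> 4 * n"
      using card_Un_le[of "{fst p, snd p} \<times> I" "I \<times> {fst p, snd p}"] n m(3)[OF p]
      by (simp add: card_cartesian_product)
    finally have cA: "card ?A \<le> 4 * n" .
    have "(\<Sum>q\<in>pairs I. \<integral>\<omega>. Z p \<omega> * Z q \<omega> \<partial>?P) = (\<Sum>q\<in>?A. \<integral>\<omega>. Z p \<omega> * Z q \<omega> \<partial>?P)"
      using p finite_pairs[OF I(1)] by (intro sum.mono_neutral_right) (auto simp: indep0)
    also have "\<dots> \<le> (\<Sum>q\<in>?A. 1680 / real n ^ 4)" using p by (intro sum_mono ZZ(2)) auto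
    also have "\<dots> = real (card ?A) * (1680 / real n ^ 4)" by simp
    also have "\<dots> \<le> real (4 * n) * (1680 / real n ^ 4)" using cA by (intro mult_right_mono) (auto simp: of_nat_mono)
    finally show "(\<Sum>q\<in>pairs I. \<integral>\<omega>. Z p \<omega> * Z q \<omega> \<partial>?P) \<le> 4 * real n * (1680 / real n ^ 4)" by simp
  qed
  also have "\<dots> = real (card (pairs I)) * (6720 / real n ^ 3)"
    using n0 by (simp add: field_simps eval_nat_numeral)
  also have "\<dots> \<le> (real n)\<^sup>2 * (6720 / real n ^ 3)"
  proof (rule mult_right_mono)
    have "card (pairs I) \<le> card (I \<times> I)" using I by (intro card_mono) (auto simp: pairs_def)
    then show "real (card (pairs I)) \<le> (real n)\<^sup>2"
      by (simp add: n card_cartesian_product power2_eq_square flip: of_nat_mult)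
  qed simp
  also have "\<dots> = 6720 / real n" using n0 by (simp add: field_simps eval_nat_numeral)
  finally show "(\<integral>\<omega>. (diffpow 4 I \<omega> - 6 * (real n - 1) / real n)\<^sup>2 \<partial>?P) \<le> 6720 / real n" .
qed

text \<open>Valid for all negative \<open>z\<close>, hence usable although the quartic sum is
  unbounded above. For \<open>z = - w\<close> it follows from
  \<open>1 \<le> (1 - w + w^2) (1 + w + w^2 / 2)\<close>, the second factor being a lower bound for
  \<open>exp w\<close>.\<close>

lemma exp_le_quadratic: "z \<le> 1 \<Longrightarrow> exp z \<le> 1 + z + z\<^sup>2" for z :: real
proof (cases "0 \<le> z")
  case False
  define w where "w = - z"
  have w: "w \<ge> 0" using False by (simp add: w_def)
  have "1 \<le> 1 + w\<^sup>2 / 2 + w ^ 3 / 2 + w ^ 4 / 2" using w by simp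
  also have "\<dots> = (1 - w + w\<^sup>2) * (1 + w + w\<^sup>2 / 2)" by (simp add: field_simps eval_nat_numeral)
  also have "\<dots> \<le> (1 - w + w\<^sup>2) * exp w"
  proof (rule mult_left_mono[OF exp_lower_Taylor_quadratic[OF w]])
    have "1 - w + w\<^sup>2 = (1 - w / 2)\<^sup>2 + 3 / 4 * w\<^sup>2" by (simp add: power2_diff algebra_simps power_divide)
    then show "0 \<le> 1 - w + w\<^sup>2" by simp
  qed
  finally have "exp (- w) \<le> 1 - w + w\<^sup>2" by (simp add: exp_minus divide_simps mult.commute)
  then show ?thesis by (simp add: w_def)
qed (use exp_bound[of z] in auto)

text \<open>The Gaussian mean of \<open>diffpow 4 I / 12\<close>, the quartic term of \<open>- ln (cosprod I)\<close>.\<close>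

definition quartic_mean :: "nat \<Rightarrow> real" where
  "quartic_mean n = (real n - 1) / (2 * real n)"

lemma quartic_mean_bounds: "n > 0 \<Longrightarrow> 0 \<le> quartic_mean n" "n > 0 \<Longrightarrow> quartic_mean n \<le> 1 / 2"
  by (auto simp: quartic_mean_def field_simps)

text \<open>The exponential is expanded around the mean of its exponent: the linear term averages to
  zero and the quadratic one is the variance. As \<open>6720 / 144\<close> lies below
  \<open>47\<close>, this gives the constant.\<close>

lemma expectation_exp_quartic_le:
  assumes I: "finite I" "I \<noteq> {}" and n: "n = card I"
  shows "integrable (PiM I (\<lambda>_. gauss n)) (\<lambda>\<omega>. exp (- diffpow 4 I \<omega> / 12))"
    "(\<integral>\<omega>. exp (- diffpow 4 I \<omega> / 12) \<partial>PiM I (\<lambda>_. gauss n)) \<le> exp (- quartic_mean n) * (1 + 47 / real n)"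
proof -
  let ?P = "PiM I (\<lambda>_. gauss n)"
  let ?a = "quartic_mean n"
  have n0: "n > 0" using I n by (simp add: card_gt_0_iff)
  interpret prob_space ?P by (rule prob_space_PiM_gauss[OF n0])
  have Dm: "diffpow 4 I \<in> borel_measurable ?P"
    unfolding measurable_PiM_borel[OF sets_gauss] by (rule diffpow_measurable)
  show int: "integrable ?P (\<lambda>\<omega>. exp (- diffpow 4 I \<omega> / 12))"
    using Dm diffpow_nonneg[of 4 I]
    by (intro integrable_const_bound[of _ 1] AE_I2) (auto intro!: measurable_compose[OF _ borel_measurable_exp])
  let ?v = "\<lambda>\<omega>. diffpow 4 I \<omega> - 6 * (real n - 1) / real n"
  have pw: "exp (- diffpow 4 I \<omega> / 12) \<le> exp (- ?a) * (1 - ?v \<omega> / 12 + (?v \<omega>)\<^sup>2 / 144)" for \<omega>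
  proof -
    have a: "?v \<omega> / 12 = diffpow 4 I \<omega> / 12 - ?a" using n0 by (simp add: quartic_mean_def field_simps)
    have "exp (- (?v \<omega> / 12)) \<le> 1 + - (?v \<omega> / 12) + (- (?v \<omega> / 12))\<^sup>2"
      using diffpow_nonneg[of 4 I \<omega>] quartic_mean_bounds[OF n0] unfolding a by (intro exp_le_quadratic) simp
    then have "exp (- ?a) * exp (- (?v \<omega> / 12)) \<le> exp (- ?a) * (1 - ?v \<omega> / 12 + (?v \<omega>)\<^sup>2 / 144)"
      by (intro mult_left_mono) (simp_all add: power_divide)
    moreover have "exp (- ?a) * exp (- (?v \<omega> / 12)) = exp (- diffpow 4 I \<omega> / 12)"
      unfolding a exp_add[symmetric] by simp
    ultimately show ?thesis by (simp only:)
  qed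
  note D = diffpow_expectation[OF I n] and V = diffpow_variance[OF I n]
  have iv: "integrable ?P ?v" using D(1) by simp
  have "(\<integral>\<omega>. exp (- diffpow 4 I \<omega> / 12) \<partial>?P) \<le> (\<integral>\<omega>. exp (- ?a) * (1 - ?v \<omega> / 12 + (?v \<omega>)\<^sup>2 / 144) \<partial>?P)"
    using iv V(1) by (intro integral_mono int pw) auto
  also have "\<dots> = exp (- ?a) * (1 - (\<integral>\<omega>. ?v \<omega> \<partial>?P) / 12 + (\<integral>\<omega>. (?v \<omega>)\<^sup>2 \<partial>?P) / 144)"
    using iv V(1) by (simp add: prob_space del: power2_diff)
  also have "(\<integral>\<omega>. ?v \<omega> \<partial>?P) = 0" using D(1,2) by (simp add: prob_space)
  also have "exp (- ?a) * (1 - 0 / 12 + (\<integral>\<omega>. (?v \<omega>)\<^sup>2 \<partial>?P) / 144) \<le> exp (- ?a) * (1 + 47 / real n)"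
  proof (rule mult_left_mono)
    have "6720 / real n / 144 \<le> 47 / real n" using n0 by (simp add: divide_simps)
    then have "(\<integral>\<omega>. (?v \<omega>)\<^sup>2 \<partial>?P) / 144 \<le> 47 / real n"
      by (rule order_trans[OF divide_right_mono[OF V(2)], rotated]) simp
    then show "1 - 0 / 12 + (\<integral>\<omega>. (?v \<omega>)\<^sup>2 \<partial>?P) / 144 \<le> 1 + 47 / real n" by simp
  qed simp
  finally show "(\<integral>\<omega>. exp (- diffpow 4 I \<omega> / 12) \<partial>?P) \<le> exp (- ?a) * (1 + 47 / real n)" .
qed

text \<open>The exponential is bounded below by its tangent \<open>1 + z\<close>, so means suffice.
  The cost of the indicator is estimated as in Markov's inequality with fourth powers.\<close>

lemma expectation_exp_near_ge:
  assumes I: "finite I" "r \<in> I" and n: "n = card I"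
  shows "exp (- quartic_mean n) * (1 - 1000 / real n) \<le>
    (\<integral>\<omega>. indicator {\<omega>. \<forall>j\<in>I. \<bar>\<omega> j - \<omega> r\<bar> \<le> pi / 8} \<omega> * exp (- diffpow 4 I \<omega> / 12 - diffpow 6 I \<omega> / 6) \<partial>PiM I (\<lambda>_. gauss n))"
    (is "_ \<le> (\<integral>\<omega>. ?h \<omega> \<partial>_)")
proof -
  let ?P = "PiM I (\<lambda>_. gauss n)"
  let ?a = "quartic_mean n"
  have n0: "n > 0" using I n by (auto simp: card_gt_0_iff)
  have Ine: "I \<noteq> {}" using I by auto
  interpret prob_space ?P by (rule prob_space_PiM_gauss[OF n0])
  let ?J = "I - {r}"
  \<comment> \<open>Off the window some difference exceeds \<open>pi / 8 > 3 / 8\<close>, so the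
    scaled fourth powers sum to at least \<open>1\<close>; the weight \<open>3 / 2\<close> then
    outweighs \<open>1 + ?a\<close> because \<open>?a \<le> 1 / 2\<close>, and \<open>L\<close> is
    negative or zero there.\<close>
  define L where "L \<omega> = exp (- ?a) * (1 + ?a - diffpow 4 I \<omega> / 12 - diffpow 6 I \<omega> / 6
      - 3 / 2 * ((8 / 3) ^ 4 * (\<Sum>j\<in>?J. (\<omega> j - \<omega> r) ^ 4)))" for \<omega>
  have pw: "L \<omega> \<le> ?h \<omega>" for \<omega>
  proof -
    let ?x = "diffpow 4 I \<omega> / 12 + diffpow 6 I \<omega> / 6"
    have x0: "0 \<le> ?x" using diffpow_nonneg[of 4 I \<omega>] diffpow_nonneg[of 6 I \<omega>] by simp
    have S0: "0 \<le> (\<Sum>j\<in>?J. (\<omega> j - \<omega> r) ^ 4)" by (intro sum_nonneg) simp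
    show ?thesis
    proof (cases "\<forall>j\<in>I. \<bar>\<omega> j - \<omega> r\<bar> \<le> pi / 8")
      case True
      have "1 + ?a - ?x \<le> exp (?a - ?x)" using exp_ge_add_one_self[of "?a - ?x"] by linarith
      moreover have "0 \<le> (8 / 3) ^ 4 * (\<Sum>j\<in>?J. (\<omega> j - \<omega> r) ^ 4)" using S0 by (intro mult_nonneg_nonneg) auto
      ultimately have "L \<omega> \<le> exp (- ?a) * exp (?a - ?x)"
        unfolding L_def by (intro mult_left_mono) (linarith, simp)
      also have "\<dots> = ?h \<omega>" using True unfolding exp_add[symmetric] by simp
      finally show ?thesis .
    next
      case False
      then obtain j where j: "j \<in> I" "pi / 8 < \<bar>\<omega> j - \<omega> r\<bar>" by auto
      then have jJ: "j \<in> ?J" by auto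
      have "(3 / 8) ^ 4 \<le> \<bar>\<omega> j - \<omega> r\<bar> ^ 4" using j pi_gt3 by (intro power_mono) auto
      also have "\<dots> = (\<omega> j - \<omega> r) ^ 4" by simp
      also have "\<dots> \<le> (\<Sum>j\<in>?J. (\<omega> j - \<omega> r) ^ 4)"
        using I jJ by (intro member_le_sum) auto
      finally have "1 \<le> (8 / 3) ^ 4 * (\<Sum>j\<in>?J. (\<omega> j - \<omega> r) ^ 4)" by (simp add: power_divide field_simps)
      then have "L \<omega> \<le> 0" unfolding L_def using x0 quartic_mean_bounds[OF n0]
        by (intro mult_nonneg_nonpos) auto
      also have "0 \<le> ?h \<omega>" by simp
      finally show ?thesis .
    qed
  qed
  note D = diffpow_expectation[OF I(1) Ine n]
  have S: "integrable ?P (\<lambda>\<omega>. (\<omega> j - \<omega> r) ^ 4)" "(\<integral>\<omega>. (\<omega> j - \<omega> r) ^ 4 \<partial>?P) = 12 / real n ^ 2" if "j \<in> ?J" for j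
    using gauss_diff_moments(1,2)[OF n0, of j I r] that I by auto
  have Si: "integrable ?P (\<lambda>\<omega>. \<Sum>j\<in>?J. (\<omega> j - \<omega> r) ^ 4)" using S by (intro Bochner_Integration.integrable_sum) auto
  have Sv: "(\<integral>\<omega>. (\<Sum>j\<in>?J. (\<omega> j - \<omega> r) ^ 4) \<partial>?P) = (real n - 1) * (12 / real n ^ 2)"
    using S I n n0 by (subst Bochner_Integration.integral_sum) (auto simp: of_nat_diff)
  have Li: "integrable ?P L" unfolding L_def[abs_def] using D Si by auto
  have hi: "integrable ?P ?h"
  proof (rule integrable_const_bound[of _ 1])
    show "AE \<omega> in ?P. norm (?h \<omega>) \<le> 1"
    proof (intro AE_I2)
      fix \<omega>
      have "exp (- diffpow 4 I \<omega> / 12 - diffpow 6 I \<omega> / 6) \<le> 1"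
        unfolding exp_le_one_iff using diffpow_nonneg[of 4 I \<omega>, OF even_numeral] diffpow_nonneg[of 6 I \<omega>, OF even_numeral] by linarith
      then show "norm (?h \<omega>) \<le> 1" by (simp add: indicator_def del: exp_le_one_iff)
    qed
    have "{\<omega> \<in> space (PiM I (\<lambda>_. borel)). \<forall>j\<in>I. \<bar>\<omega> j - \<omega> r\<bar> \<le> pi / 8} \<in> sets (PiM I (\<lambda>_. borel))"
      using I by (intro sets.sets_Collect_finite_All borel_measurable_le borel_measurable_abs borel_measurable_diff
         component_borel borel_measurable_const) auto
    then have "(\<lambda>\<omega>. indicator {\<omega> \<in> space (PiM I (\<lambda>_. borel)). \<forall>j\<in>I. \<bar>\<omega> j - \<omega> r\<bar> \<le> pi / 8} \<omega> :: real)
        \<in> borel_measurable (PiM I (\<lambda>_. borel))"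
      by (rule borel_measurable_indicator)
    then have "(\<lambda>\<omega>. indicator {\<omega>. \<forall>j\<in>I. \<bar>\<omega> j - \<omega> r\<bar> \<le> pi / 8} \<omega> :: real) \<in> borel_measurable (PiM I (\<lambda>_. borel))"
      by (rule measurable_cong[THEN iffD1, rotated]) (auto simp: indicator_def)
    then show "?h \<in> borel_measurable ?P"
      unfolding measurable_PiM_borel[OF sets_gauss]
      by (intro borel_measurable_times measurable_compose[OF _ borel_measurable_exp] borel_measurable_diff
          borel_measurable_divide borel_measurable_uminus diffpow_measurable borel_measurable_const)
  qed
  have "exp (- ?a) * (1 - 1000 / real n) \<le> exp (- ?a) * (1 + ?a - (6 * (real n - 1) / real n) / 12
     - (60 * (real n - 1) / real n ^ 2) / 6 - 3 / 2 * ((8 / 3) ^ 4 * ((real n - 1) * (12 / real n ^ 2))))"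
  proof (rule mult_left_mono)
    have e1: "(6 * (real n - 1) / real n) / 12 = ?a" using n0 by (simp add: quartic_mean_def field_simps)
    have z: "(real n - 1) / real n ^ 2 \<le> 1 / real n" using n0 by (simp add: divide_simps power2_eq_square)
    have e2: "(60 * (real n - 1) / real n ^ 2) / 6 = 10 * ((real n - 1) / real n ^ 2)"
      using n0 by (simp add: field_simps)
    have e3: "3 / 2 * ((8 / 3) ^ 4 * ((real n - 1) * (12 / real n ^ 2))) = 8192 / 9 * ((real n - 1) / real n ^ 2)"
    proof -
      have "(real n - 1) * (12 / real n ^ 2) = 12 * ((real n - 1) / real n ^ 2)" by simp
      moreover have "(8 / 3) ^ 4 = (4096 / 81 :: real)" by (simp add: power_divide)
      moreover have "3 / 2 * (4096 / 81 * (12 * z)) = 8192 / 9 * z" for z :: real by simp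
      ultimately show ?thesis by (simp only:)
    qed
    \<comment> \<open>The mean of the sextic term contributes \<open>10\<close> and the window
      \<open>8192 / 9\<close>, together below \<open>1000\<close>.\<close>
    have "0 \<le> 1 / real n" "1000 / real n = 1000 * (1 / real n)" by simp_all
    then show "1 - 1000 / real n \<le> 1 + ?a - (6 * (real n - 1) / real n) / 12
     - (60 * (real n - 1) / real n ^ 2) / 6 - 3 / 2 * ((8 / 3) ^ 4 * ((real n - 1) * (12 / real n ^ 2)))"
      unfolding e1 e2 e3 using z by linarith
  qed simp
  also have "\<dots> = (\<integral>\<omega>. L \<omega> \<partial>?P)"
    unfolding L_def using D Si Sv by (simp add: prob_space)
  also have "\<dots> \<le> (\<integral>\<omega>. ?h \<omega> \<partial>?P)" by (intro integral_mono Li hi pw)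
  finally show ?thesis .
qed

section \<open>The tail of the torus integral\<close>

text \<open>Absolute values discard the cancellation between signs but make the integrand invariant
  under shifts modulo \<open>pi\<close>; this is the quantity the tail recursion controls.\<close>

definition torus :: "nat set \<Rightarrow> ennreal" where
  "torus I = (\<integral>\<^sup>+\<theta>. ennreal \<bar>cosprod I \<theta>\<bar> \<partial>PiM I (\<lambda>_. unif))"

text \<open>The maximum of \<open>(1 + \<bar>cos a\<bar>) / 2\<close> over angles \<open>a\<close> with \<open>\<bar>cos a\<bar> \<le> cos (pi / 4)\<close>.\<close>

definition farconst :: real where
  "farconst = (1 + sqrt 2 / 2) / 2"

lemma farconst_bounds: "0 < farconst" "farconst < 1"
proof -
  have "sqrt 2 < sqrt 4" by (rule real_sqrt_less_mono) simp
  then show "farconst < 1" by (simp add: farconst_def)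
  show "0 < farconst" by (simp add: farconst_def add_pos_nonneg)
qed

lemma measurable_unif: "measurable (PiM I (\<lambda>_. unif)) N = measurable (PiM I (\<lambda>_. borel)) N"
  by (rule measurable_PiM_borel) simp

lemma cosprod_measurable_superset:
  assumes "K \<subseteq> I" shows "cosprod K \<in> borel_measurable (PiM I (\<lambda>_. borel))"
proof -
  have "(\<lambda>\<theta> :: nat \<Rightarrow> real. \<Prod>q\<in>pairs K. cos (\<theta> (fst q) - \<theta> (snd q))) \<in> borel_measurable (PiM I (\<lambda>_. borel))"
    using assms
    by (intro borel_measurable_prod borel_measurable_continuous_on[of cos] continuous_intros borel_measurable_diff component_borel)
       (auto simp: pairs_def)
  also have "(\<lambda>\<theta>. \<Prod>q\<in>pairs K. cos (\<theta> (fst q) - \<theta> (snd q))) = cosprod K"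
    by (rule ext) (simp add: cosprod_def case_prod_beta)
  finally show ?thesis .
qed

lemma cosprod_cong: "(\<And>i. i \<in> I \<Longrightarrow> \<theta> i = \<theta>' i) \<Longrightarrow> cosprod I \<theta> = cosprod I \<theta>'"
  unfolding cosprod_def by (intro prod.cong) (auto simp: pairs_def)

lemma torus_le_1: "torus I \<le> 1"
proof -
  interpret prob_space "PiM I (\<lambda>_. unif)" by (intro prob_space_PiM prob_space_unif)
  have "torus I \<le> (\<integral>\<^sup>+\<theta>. 1 \<partial>PiM I (\<lambda>_. unif))"
    unfolding torus_def using abs_cosprod_le_1[of I] by (intro nn_integral_mono) (simp add: ennreal_le_1)
  then show ?thesis by (simp add: emeasure_space_1)
qed

lemma abs_cosprod_abs_measurable:
  "K \<subseteq> I \<Longrightarrow> (\<lambda>\<theta>. ennreal \<bar>cosprod K \<theta>\<bar>) \<in> borel_measurable (PiM I (\<lambda>_. borel))"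
  by (intro measurable_compose[OF _ measurable_ennreal] borel_measurable_abs cosprod_measurable_superset)

text \<open>For each value \<open>t\<close> of the angle at \<open>r\<close>, the remaining angles
  are translated by \<open>t\<close> modulo \<open>pi\<close>; this preserves the measure and the
  integrand, so the angle at \<open>r\<close> may be set to \<open>0\<close>.\<close>

lemma torus_gauge:
  assumes I: "finite I" "r \<in> I" and J: "J = I - {r}"
  shows "torus I = (\<integral>\<^sup>+\<phi>. ennreal \<bar>cosprod I (\<phi>(r := 0))\<bar> \<partial>PiM J (\<lambda>_. unif))"
proof -
  have IJ: "I = insert r J" "r \<notin> J" "finite J" using I J by auto
  interpret product_sigma_finite "\<lambda>_::nat. unif" by (rule product_sigma_finite_const[OF sigma_finite_unif])
  interpret U: prob_space unif by (rule prob_space_unif)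
  have upd: "(\<lambda>\<phi>. \<phi>(r := t)) \<in> measurable (PiM J (\<lambda>_. borel)) (PiM I (\<lambda>_. borel :: real measure))" for t
    by (rule fun_upd_PiM_borel[OF IJ(1)])
  have "torus I = (\<integral>\<^sup>+t. \<integral>\<^sup>+\<phi>. ennreal \<bar>cosprod I (\<phi>(r := t))\<bar> \<partial>PiM J (\<lambda>_. unif) \<partial>unif)"
    unfolding torus_def IJ(1) using IJ(2,3) abs_cosprod_abs_measurable[of "insert r J" "insert r J"]
    by (intro product_nn_integral_insert_rev) (simp_all only: measurable_unif order_refl simp_thms)
  also have "\<dots> = (\<integral>\<^sup>+t. \<integral>\<^sup>+\<phi>. ennreal \<bar>cosprod I (\<phi>(r := 0))\<bar> \<partial>PiM J (\<lambda>_. unif) \<partial>unif)"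
  proof (rule nn_integral_cong)
    fix t :: real
    let ?g = "\<lambda>\<phi>. ennreal \<bar>cosprod I (\<phi>(r := t))\<bar>"
    have gm: "?g \<in> borel_measurable (PiM J (\<lambda>_. unif))"
      unfolding measurable_unif by (rule measurable_compose[OF upd abs_cosprod_abs_measurable[OF order_refl]])
    have w: "wrap t \<in> measurable unif unif" by (simp add: measurable_cong_sets[OF sets_unif sets_unif])
    have "(\<integral>\<^sup>+\<phi>. ?g \<phi> \<partial>PiM J (\<lambda>_. unif)) = (\<integral>\<^sup>+\<phi>. ?g (compose J (wrap t) \<phi>) \<partial>PiM J (\<lambda>_. unif))"
      by (rule nn_integral_PiM_compose[symmetric, OF IJ(3) sigma_finite_unif w distr_unif_wrap gm])
    also have "\<dots> = (\<integral>\<^sup>+\<phi>. ennreal \<bar>cosprod I (\<phi>(r := 0))\<bar> \<partial>PiM J (\<lambda>_. unif))"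
    proof (rule nn_integral_cong)
      fix \<phi> :: "nat \<Rightarrow> real"
      have "\<bar>cosprod I ((compose J (wrap t) \<phi>)(r := t))\<bar> = \<bar>cosprod I (\<phi>(r := 0))\<bar>"
      proof (rule abs_cosprod_shift[of _ _ _ t])
        fix i assume "i \<in> I"
        then consider "i = r" | "i \<in> J" "i \<noteq> r" using IJ by auto
        then show "\<exists>k. ((compose J (wrap t) \<phi>)(r := t)) i = (\<phi>(r := 0)) i + t + pi * of_int k"
        proof cases
          case 2
          then show ?thesis
            by (intro exI[of _ "- \<lfloor>(\<phi> i + t) / pi + 1 / 2\<rfloor>"]) (simp add: compose_def wrap_def)
        qed (auto intro: exI[of _ 0])
      qed
      then show "?g (compose J (wrap t) \<phi>) = ennreal \<bar>cosprod I (\<phi>(r := 0))\<bar>" by simp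
    qed
    finally show "(\<integral>\<^sup>+\<phi>. ?g \<phi> \<partial>PiM J (\<lambda>_. unif)) = \<dots>" .
  qed
  also have "\<dots> = (\<integral>\<^sup>+\<phi>. ennreal \<bar>cosprod I (\<phi>(r := 0))\<bar> \<partial>PiM J (\<lambda>_. unif))"
    using U.emeasure_space_1 by (simp add: nn_integral_const)
  finally show ?thesis .
qed

lemma AE_unif: "AE x in unif. -pi/2 \<le> x \<and> x < pi/2"
  unfolding unif_def by (subst AE_density) (auto intro!: AE_I2 simp: indicator_def split: if_splits)

lemma AE_PiM_unif:
  assumes "finite J" shows "AE \<phi> in PiM J (\<lambda>_. unif). \<forall>j\<in>J. -pi/2 \<le> \<phi> j \<and> \<phi> j < pi/2"
  using assms by (intro AE_finite_allI AE_PiM_component[where P="\<lambda>x. -pi/2 \<le> x \<and> x < pi/2"] prob_space_unif AE_unif)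

text \<open>If the angle of \<open>j\<close> is far from the fixed angle \<open>0\<close>, each remaining angle \<open>b\<close> loses a constant
  factor, because \<open>\<bar>cos (a - b) cos b\<bar> \<le> (1 + \<bar>cos a\<bar>) / 2\<close>.\<close>

lemma far_integral_le:
  assumes I: "finite I" "r \<in> I" and j: "j \<in> I" "j \<noteq> r"
  shows "(\<integral>\<^sup>+\<phi>. ennreal \<bar>cosprod I (\<phi>(r := 0))\<bar> * indicator {\<phi>. \<bar>cos (\<phi> j)\<bar> \<le> sqrt 2 / 2} \<phi> \<partial>PiM (I - {r}) (\<lambda>_. unif))
    \<le> ennreal (farconst ^ (card I - 2)) * torus (I - {r, j})"
proof -
  let ?K = "I - {r, j}"
  have K: "finite ?K" "I - {r} = insert j ?K" "j \<notin> ?K" "I = insert r (insert j ?K)" "r \<notin> insert j ?K"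
    using I j by auto
  have cK: "card ?K = card I - 2" using I j by (simp add: card_Diff_subset)
  interpret product_sigma_finite "\<lambda>_::nat. unif" by (rule product_sigma_finite_const[OF sigma_finite_unif])
  interpret U: prob_space unif by (rule prob_space_unif)
  have pw: "\<bar>cosprod I (\<phi>(r := 0))\<bar> \<le> farconst ^ card ?K * \<bar>cosprod ?K \<phi>\<bar>" if c: "\<bar>cos (\<phi> j)\<bar> \<le> sqrt 2 / 2" for \<phi>
  proof -
    let ?\<theta> = "\<phi>(r := 0)"
    have "cosprod I ?\<theta> = cosprod (insert j ?K) ?\<theta> * (\<Prod>w\<in>insert j ?K. cos (?\<theta> r - ?\<theta> w))"
      using cosprod_insert[OF K(5), of ?\<theta>] K(1,4) by simp
    also have "cosprod (insert j ?K) ?\<theta> = cosprod ?K ?\<theta> * (\<Prod>w\<in>?K. cos (?\<theta> j - ?\<theta> w))"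
      using cosprod_insert[OF K(3,1), of ?\<theta>] by simp
    also have "cosprod ?K ?\<theta> = cosprod ?K \<phi>" by (rule cosprod_cong) auto
    also have "(\<Prod>w\<in>?K. cos (?\<theta> j - ?\<theta> w)) = (\<Prod>w\<in>?K. cos (\<phi> j - \<phi> w))"
      using j by (intro prod.cong) auto
    also have "(\<Prod>w\<in>insert j ?K. cos (?\<theta> r - ?\<theta> w)) = cos (\<phi> j) * (\<Prod>w\<in>?K. cos (\<phi> w))"
      using K(1,3) j by (simp add: prod.insert cong: prod.cong) (auto intro!: prod.cong)
    finally have "\<bar>cosprod I ?\<theta>\<bar> = \<bar>cosprod ?K \<phi>\<bar> * \<bar>cos (\<phi> j)\<bar> * (\<Prod>w\<in>?K. \<bar>cos (\<phi> j - \<phi> w) * cos (\<phi> w)\<bar>)"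
      by (simp add: abs_mult abs_prod prod.distrib ac_simps del: fun_upd_apply)
    also have "\<dots> \<le> \<bar>cosprod ?K \<phi>\<bar> * 1 * (\<Prod>w\<in>?K. farconst)"
    proof (intro mult_mono prod_mono conjI)
      fix w
      \<comment> \<open>The product formula isolates \<open>cos (\<phi> j)\<close>, which is bounded
        away from \<open>1\<close> in absolute value, whatever the angle \<open>\<phi> w\<close>
        is.\<close>
      have e: "cos (\<phi> j - \<phi> w) * cos (\<phi> w) = (cos (\<phi> j - 2 * \<phi> w) + cos (\<phi> j)) / 2"
        using cos_times_cos[of "\<phi> j - \<phi> w" "\<phi> w"] by (simp add: algebra_simps)
      have "\<bar>cos (\<phi> j - 2 * \<phi> w) + cos (\<phi> j)\<bar> \<le> 1 + sqrt 2 / 2"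
        by (rule order_trans[OF abs_triangle_ineq add_mono[OF abs_cos_le_one c]])
      then show "\<bar>cos (\<phi> j - \<phi> w) * cos (\<phi> w)\<bar> \<le> farconst"
        unfolding farconst_def e abs_divide by simp
    qed (auto intro!: prod_nonneg mult_nonneg_nonneg)
    finally show ?thesis by (simp add: mult.commute)
  qed
  have "(\<integral>\<^sup>+\<phi>. ennreal \<bar>cosprod I (\<phi>(r := 0))\<bar> * indicator {\<phi>. \<bar>cos (\<phi> j)\<bar> \<le> sqrt 2 / 2} \<phi> \<partial>PiM (I - {r}) (\<lambda>_. unif))
    \<le> (\<integral>\<^sup>+\<phi>. ennreal (farconst ^ card ?K) * ennreal \<bar>cosprod ?K \<phi>\<bar> \<partial>PiM (I - {r}) (\<lambda>_. unif))"
  proof (rule nn_integral_mono)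
    fix \<phi> :: "nat \<Rightarrow> real"
    show "ennreal \<bar>cosprod I (\<phi>(r := 0))\<bar> * indicator {\<phi>. \<bar>cos (\<phi> j)\<bar> \<le> sqrt 2 / 2} \<phi>
      \<le> ennreal (farconst ^ card ?K) * ennreal \<bar>cosprod ?K \<phi>\<bar>"
    proof (cases "\<bar>cos (\<phi> j)\<bar> \<le> sqrt 2 / 2")
      case True
      have "ennreal \<bar>cosprod I (\<phi>(r := 0))\<bar> \<le> ennreal (farconst ^ card ?K * \<bar>cosprod ?K \<phi>\<bar>)"
        by (rule ennreal_leI[OF pw[of \<phi>, OF True]])
      also have "\<dots> = ennreal (farconst ^ card ?K) * ennreal \<bar>cosprod ?K \<phi>\<bar>"
        using farconst_bounds by (intro ennreal_mult) auto
      finally show ?thesis using True by (simp add: indicator_def del: fun_upd_apply)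
    qed (simp add: indicator_def)
  qed
  also have "\<dots> = ennreal (farconst ^ card ?K) * (\<integral>\<^sup>+\<phi>. ennreal \<bar>cosprod ?K \<phi>\<bar> \<partial>PiM (I - {r}) (\<lambda>_. unif))"
    unfolding K(2)
    by (intro nn_integral_cmult) (simp only: measurable_unif abs_cosprod_abs_measurable[OF subset_insertI])
  also have "(\<integral>\<^sup>+\<phi>. ennreal \<bar>cosprod ?K \<phi>\<bar> \<partial>PiM (I - {r}) (\<lambda>_. unif)) = torus ?K"
  proof -
    have "(\<integral>\<^sup>+\<phi>. ennreal \<bar>cosprod ?K \<phi>\<bar> \<partial>PiM (I - {r}) (\<lambda>_. unif)) =
      (\<integral>\<^sup>+\<phi>. \<integral>\<^sup>+t. ennreal \<bar>cosprod ?K (\<phi>(j := t))\<bar> \<partial>unif \<partial>PiM ?K (\<lambda>_. unif))"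
      unfolding K(2) using K(1,3)
        abs_cosprod_abs_measurable[OF subset_insertI[of ?K j]]
      by (intro product_nn_integral_insert) (simp_all only: measurable_unif simp_thms)
    also have "\<dots> = (\<integral>\<^sup>+\<phi>. \<integral>\<^sup>+t. ennreal \<bar>cosprod ?K \<phi>\<bar> \<partial>unif \<partial>PiM ?K (\<lambda>_. unif))"
      by (intro nn_integral_cong arg_cong[of _ _ ennreal] arg_cong[of _ _ abs] cosprod_cong) auto
    also have "\<dots> = torus ?K" using U.emeasure_space_1 by (simp add: torus_def)
    finally show ?thesis .
  qed
  finally show ?thesis by (simp only: cK)
qed

text \<open>With the angle at \<open>r\<close> equal to \<open>0\<close>, a radius
  \<open>pi / 4\<close> keeps all mutual differences below \<open>pi / 2\<close>, so every cosine is
  positive and the Gaussian upper bound holds. Outside, some angle satisfies the hypothesis of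
  \<open>far_integral_le\<close>.\<close>

definition nearset :: "nat set \<Rightarrow> (nat \<Rightarrow> real) set" where
  "nearset J = {\<phi>. \<forall>j\<in>J. \<bar>\<phi> j\<bar> < pi / 4}"

lemma far_cos: "-pi/2 \<le> x \<Longrightarrow> x < pi/2 \<Longrightarrow> \<not> \<bar>x\<bar> < pi / 4 \<Longrightarrow> \<bar>cos x\<bar> \<le> sqrt 2 / 2"
proof -
  assume x: "-pi/2 \<le> x" "x < pi/2" "\<not> \<bar>x\<bar> < pi / 4"
  then have "cos \<bar>x\<bar> \<le> cos (pi / 4)" by (intro cos_monotone_0_pi_le) auto
  moreover have "0 \<le> cos x" using x by (intro cos_ge_zero) auto
  ultimately show ?thesis by (simp add: cos_45)
qed

lemma indicator_nearset_measurable: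
  assumes "finite J"
  shows "(\<lambda>\<phi>. indicator (nearset J) \<phi> :: 'b :: {zero_neq_one, second_countable_topology, real_normed_algebra_1}) \<in> borel_measurable (PiM J (\<lambda>_. borel))"
    and "(\<lambda>\<phi>. indicator (nearset J) \<phi> :: ennreal) \<in> borel_measurable (PiM J (\<lambda>_. borel))"
proof -
  let ?S = "{\<phi> \<in> space (PiM J (\<lambda>_. borel)). \<forall>j\<in>J. \<bar>\<phi> j\<bar> < pi / 4}"
  have S: "?S \<in> sets (PiM J (\<lambda>_. borel))"
    using assms by (intro sets.sets_Collect_finite_All borel_measurable_less borel_measurable_abs component_borel borel_measurable_const) auto
  have "(\<lambda>\<phi>. indicator ?S \<phi> :: 'b) \<in> borel_measurable (PiM J (\<lambda>_. borel))" by (rule borel_measurable_indicator[OF S])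
  then show "(\<lambda>\<phi>. indicator (nearset J) \<phi> :: 'b) \<in> borel_measurable (PiM J (\<lambda>_. borel))"
    by (rule measurable_cong[THEN iffD1, rotated]) (auto simp: indicator_def nearset_def)
  have "(\<lambda>\<phi>. indicator ?S \<phi> :: ennreal) \<in> borel_measurable (PiM J (\<lambda>_. borel))" by (rule borel_measurable_indicator[OF S])
  then show "(\<lambda>\<phi>. indicator (nearset J) \<phi> :: ennreal) \<in> borel_measurable (PiM J (\<lambda>_. borel))"
    by (rule measurable_cong[THEN iffD1, rotated]) (auto simp: indicator_def nearset_def)
qed

text \<open>Union bound over the far angle. It holds only almost everywhere pointwise, since
  \<open>far_cos\<close> needs the angles inside the support of \<open>unif\<close>.\<close>

lemma far_total_le:
  assumes I: "finite I" "r \<in> I"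
  shows "(\<integral>\<^sup>+\<phi>. ennreal \<bar>cosprod I (\<phi>(r := 0))\<bar> * indicator (- nearset (I - {r})) \<phi> \<partial>PiM (I - {r}) (\<lambda>_. unif))
    \<le> (\<Sum>j\<in>I - {r}. ennreal (farconst ^ (card I - 2)) * torus (I - {r, j}))"
proof -
  let ?J = "I - {r}"
  let ?f = "\<lambda>\<phi>. ennreal \<bar>cosprod I (\<phi>(r := 0))\<bar>"
  have upd: "(\<lambda>\<phi>. \<phi>(r := 0)) \<in> measurable (PiM ?J (\<lambda>_. borel)) (PiM I (\<lambda>_. borel :: real measure))"
    by (rule fun_upd_PiM_borel) (use I in auto)
  have fm: "?f \<in> borel_measurable (PiM ?J (\<lambda>_. borel))"
    by (rule measurable_compose[OF upd abs_cosprod_abs_measurable[OF order_refl]])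
  have im: "(\<lambda>\<phi>. indicator {\<phi>. \<bar>cos (\<phi> j)\<bar> \<le> sqrt 2 / 2} \<phi> :: ennreal) \<in> borel_measurable (PiM ?J (\<lambda>_. borel))"
    if "j \<in> ?J" for j
  proof -
    have "(\<lambda>x::real. indicator {x. \<bar>cos x\<bar> \<le> sqrt 2 / 2} x :: ennreal) \<in> borel_measurable borel" by measurable
    from measurable_compose[OF component_borel[OF that] this] show ?thesis by (simp add: indicator_def)
  qed
  have "(\<integral>\<^sup>+\<phi>. ?f \<phi> * indicator (- nearset ?J) \<phi> \<partial>PiM ?J (\<lambda>_. unif))
    \<le> (\<integral>\<^sup>+\<phi>. (\<Sum>j\<in>?J. ?f \<phi> * indicator {\<phi>. \<bar>cos (\<phi> j)\<bar> \<le> sqrt 2 / 2} \<phi>) \<partial>PiM ?J (\<lambda>_. unif))"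
  proof (rule nn_integral_mono_AE)
    have "finite ?J" using I by simp
    from AE_PiM_unif[OF this]
    show "AE \<phi> in PiM ?J (\<lambda>_. unif). ?f \<phi> * indicator (- nearset ?J) \<phi> \<le> (\<Sum>j\<in>?J. ?f \<phi> * indicator {\<phi>. \<bar>cos (\<phi> j)\<bar> \<le> sqrt 2 / 2} \<phi>)"
    proof eventually_elim
      case (elim \<phi>)
      show ?case
      proof (cases "\<phi> \<in> nearset ?J")
        case False
        then obtain j where j: "j \<in> ?J" "\<not> \<bar>\<phi> j\<bar> < pi / 4" by (auto simp: nearset_def)
        then have "\<bar>cos (\<phi> j)\<bar> \<le> sqrt 2 / 2" using elim by (intro far_cos) auto
        then have "?f \<phi> * indicator (- nearset ?J) \<phi> \<le> ?f \<phi> * indicator {\<phi>. \<bar>cos (\<phi> j)\<bar> \<le> sqrt 2 / 2} \<phi>"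
          by (simp add: indicator_def)
        also have "\<dots> \<le> (\<Sum>j\<in>?J. ?f \<phi> * indicator {\<phi>. \<bar>cos (\<phi> j)\<bar> \<le> sqrt 2 / 2} \<phi>)"
          using I j by (intro member_le_sum) auto
        finally show ?thesis .
      qed simp
    qed
  qed
  also have "\<dots> = (\<Sum>j\<in>?J. \<integral>\<^sup>+\<phi>. ?f \<phi> * indicator {\<phi>. \<bar>cos (\<phi> j)\<bar> \<le> sqrt 2 / 2} \<phi> \<partial>PiM ?J (\<lambda>_. unif))"
    using im by (intro nn_integral_sum) (auto simp: measurable_unif intro!: borel_measurable_times_ennreal fm)
  also have "\<dots> \<le> (\<Sum>j\<in>?J. ennreal (farconst ^ (card I - 2)) * torus (I - {r, j}))"
    using I by (intro sum_mono far_integral_le) auto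
  finally show ?thesis .
qed

lemma near_integral_le:
  assumes I: "finite I" "r \<in> I" and n: "n = card I"
  shows "(\<integral>\<^sup>+\<phi>. ennreal \<bar>cosprod I (\<phi>(r := 0))\<bar> * indicator (nearset (I - {r})) \<phi> \<partial>PiM (I - {r}) (\<lambda>_. unif))
    \<le> ennreal (volconst n * (\<integral>\<omega>. exp (- diffpow 4 I \<omega> / 12) \<partial>PiM I (\<lambda>_. gauss n)))"
proof -
  let ?J = "I - {r}"
  have n0: "n > 0" and Ine: "I \<noteq> {}" using I n by (auto simp: card_gt_0_iff)
  \<comment> \<open>Stated through differences from the angle at \<open>r\<close>, so that
    \<open>h\<close> is translation invariant and vanishes where the gauge lemma demands it. The
    restriction is dropped once the integral has become Gaussian.\<close>
  define N where "N = {\<theta>. \<forall>j\<in>?J. \<bar>\<theta> j - \<theta> r\<bar> < pi / 4}"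
  define h :: "(nat \<Rightarrow> real) \<Rightarrow> ennreal" where "h \<theta> = ennreal (exp (- diffpow 4 I \<theta> / 12)) * indicator N \<theta>" for \<theta>
  have em: "(\<lambda>\<theta>. ennreal (exp (- diffpow 4 I \<theta> / 12))) \<in> borel_measurable (PiM I (\<lambda>_. borel))"
    by (intro measurable_compose[OF _ measurable_ennreal] measurable_compose[OF _ borel_measurable_exp]
        borel_measurable_divide borel_measurable_uminus diffpow_measurable borel_measurable_const)
  have hm: "h \<in> borel_measurable (PiM I (\<lambda>_. borel))"
  proof -
    have "{\<theta> \<in> space (PiM I (\<lambda>_. borel)). \<forall>j\<in>?J. \<bar>\<theta> j - \<theta> r\<bar> < pi / 4} \<in> sets (PiM I (\<lambda>_. borel))"
      using I by (intro sets.sets_Collect_finite_All borel_measurable_less borel_measurable_abs borel_measurable_diff component_borel borel_measurable_const) auto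
    then have "(\<lambda>\<theta>. indicator {\<theta> \<in> space (PiM I (\<lambda>_. borel)). \<forall>j\<in>?J. \<bar>\<theta> j - \<theta> r\<bar> < pi / 4} \<theta> :: ennreal) \<in> borel_measurable (PiM I (\<lambda>_. borel))"
      by (rule borel_measurable_indicator)
    then have "(\<lambda>\<theta>. indicator N \<theta> :: ennreal) \<in> borel_measurable (PiM I (\<lambda>_. borel))"
      by (rule measurable_cong[THEN iffD1, rotated]) (auto simp: indicator_def N_def)
    then show ?thesis unfolding h_def[abs_def] by (intro borel_measurable_times_ennreal em)
  qed
  have hinv: "h \<theta>' = h \<theta>" if "\<And>i. i \<in> I \<Longrightarrow> \<theta>' i = \<theta> i + t" for \<theta> \<theta>' t
  proof -
    have "diffpow 4 I \<theta>' = diffpow 4 I \<theta>" unfolding diffpow_def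
      by (intro sum.cong refl) (auto simp: pairs_def that)
    moreover have "\<theta>' \<in> N \<longleftrightarrow> \<theta> \<in> N" using that I by (simp add: N_def)
    ultimately show ?thesis by (simp add: h_def indicator_def)
  qed
  have pw: "ennreal \<bar>cosprod I (\<phi>(r := 0))\<bar> * indicator (nearset ?J) \<phi>
      \<le> h (\<phi>(r := 0)) * ennreal (exp (- diffpow 2 I (\<phi>(r := 0)) / 2))" for \<phi>
  proof (cases "\<phi> \<in> nearset ?J")
    case True
    let ?\<theta> = "\<phi>(r := 0)"
    have q: "\<bar>?\<theta> i\<bar> < pi / 4" if "i \<in> I" for i using True that by (auto simp: nearset_def)
    have "\<bar>?\<theta> i - ?\<theta> k\<bar> < pi / 2" if "i \<in> I" "k \<in> I" for i k
      using q[OF that(1)] q[OF that(2)] by linarith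
    note c = cosprod_le_exp[of I ?\<theta>, OF this]
    have "?\<theta> \<in> N" using True by (auto simp: N_def nearset_def)
    then show ?thesis using True c
      by (simp add: h_def ennreal_mult[symmetric] mult.commute abs_of_nonneg del: fun_upd_apply)
  qed simp
  have "(\<integral>\<^sup>+\<phi>. ennreal \<bar>cosprod I (\<phi>(r := 0))\<bar> * indicator (nearset ?J) \<phi> \<partial>PiM ?J (\<lambda>_. unif))
    \<le> (\<integral>\<^sup>+\<phi>. h (\<phi>(r := 0)) * ennreal (exp (- diffpow 2 I (\<phi>(r := 0)) / 2)) \<partial>PiM ?J (\<lambda>_. unif))"
    by (intro nn_integral_mono pw)
  also have "\<dots> = ennreal (volconst n) * (\<integral>\<^sup>+\<theta>. h \<theta> \<partial>PiM I (\<lambda>_. gauss n))"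
  proof (rule nn_integral_unif_gauge[OF I refl n hm hinv])
    fix \<theta> j assume "j \<in> ?J" "\<not> \<bar>\<theta> j - \<theta> r\<bar> < pi / 2"
    have "\<theta> \<notin> N"
    proof
      assume "\<theta> \<in> N"
      then have "\<bar>\<theta> j - \<theta> r\<bar> < pi / 4" using \<open>j \<in> ?J\<close> by (auto simp: N_def)
      with \<open>\<not> \<bar>\<theta> j - \<theta> r\<bar> < pi / 2\<close> show False using pi_gt_zero by linarith
    qed
    then show "h \<theta> = 0" by (simp add: h_def)
  qed
  also have "\<dots> \<le> ennreal (volconst n) * (\<integral>\<^sup>+\<theta>. ennreal (exp (- diffpow 4 I \<theta> / 12)) \<partial>PiM I (\<lambda>_. gauss n))"
    by (intro mult_left_mono nn_integral_mono) (auto simp: h_def indicator_def)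
  also have "(\<integral>\<^sup>+\<theta>. ennreal (exp (- diffpow 4 I \<theta> / 12)) \<partial>PiM I (\<lambda>_. gauss n)) =
    ennreal (\<integral>\<omega>. exp (- diffpow 4 I \<omega> / 12) \<partial>PiM I (\<lambda>_. gauss n))"
    using expectation_exp_quartic_le(1)[OF I(1) Ine n] by (intro nn_integral_eq_integral) auto
  finally show ?thesis by (simp only: ennreal_mult'[OF less_imp_le[OF volconst_pos[OF n0]]])
qed

text \<open>The narrower radius \<open>pi / 8\<close> keeps all mutual differences within
  \<open>pi / 4\<close>, the range in which \<open>cos_ge_exp\<close> holds.\<close>

lemma near_integral_ge:
  assumes I: "finite I" "r \<in> I" and n: "n = card I"
  shows "ennreal (volconst n * (exp (- quartic_mean n) * (1 - 1000 / real n)))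
    \<le> (\<integral>\<^sup>+\<phi>. ennreal (cosprod I (\<phi>(r := 0))) * indicator (nearset (I - {r})) \<phi> \<partial>PiM (I - {r}) (\<lambda>_. unif))"
proof -
  let ?J = "I - {r}"
  have n0: "n > 0" and Ine: "I \<noteq> {}" using I n by (auto simp: card_gt_0_iff)
  define N where "N = {\<theta>. \<forall>j\<in>I. \<bar>\<theta> j - \<theta> r\<bar> \<le> pi / 8}"
  define g :: "(nat \<Rightarrow> real) \<Rightarrow> real" where
    "g \<theta> = indicator N \<theta> * exp (- diffpow 4 I \<theta> / 12 - diffpow 6 I \<theta> / 6)" for \<theta>
  have gm: "g \<in> borel_measurable (PiM I (\<lambda>_. borel))"
  proof -
    have "{\<theta> \<in> space (PiM I (\<lambda>_. borel)). \<forall>j\<in>I. \<bar>\<theta> j - \<theta> r\<bar> \<le> pi / 8} \<in> sets (PiM I (\<lambda>_. borel))"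
      using I by (intro sets.sets_Collect_finite_All borel_measurable_le borel_measurable_abs borel_measurable_diff component_borel borel_measurable_const) auto
    then have "(\<lambda>\<theta>. indicator {\<theta> \<in> space (PiM I (\<lambda>_. borel)). \<forall>j\<in>I. \<bar>\<theta> j - \<theta> r\<bar> \<le> pi / 8} \<theta> :: real) \<in> borel_measurable (PiM I (\<lambda>_. borel))"
      by (rule borel_measurable_indicator)
    then have "(\<lambda>\<theta>. indicator N \<theta> :: real) \<in> borel_measurable (PiM I (\<lambda>_. borel))"
      by (rule measurable_cong[THEN iffD1, rotated]) (auto simp: indicator_def N_def)
    then show ?thesis unfolding g_def[abs_def]
      by (intro borel_measurable_times measurable_compose[OF _ borel_measurable_exp] borel_measurable_diff
        borel_measurable_divide borel_measurable_uminus diffpow_measurable borel_measurable_const)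
  qed
  have g0: "0 \<le> g \<theta>" "g \<theta> \<le> 1" for \<theta>
  proof -
    have "exp (- diffpow 4 I \<theta> / 12 - diffpow 6 I \<theta> / 6) \<le> 1"
      unfolding exp_le_one_iff using diffpow_nonneg[of 4 I \<theta>, OF even_numeral] diffpow_nonneg[of 6 I \<theta>, OF even_numeral] by linarith
    then show "0 \<le> g \<theta>" "g \<theta> \<le> 1" by (simp_all add: g_def indicator_def del: exp_le_one_iff)
  qed
  have ginv: "ennreal (g \<theta>') = ennreal (g \<theta>)" if "\<And>i. i \<in> I \<Longrightarrow> \<theta>' i = \<theta> i + t" for \<theta> \<theta>' t
  proof -
    have "diffpow p I \<theta>' = diffpow p I \<theta>" for p unfolding diffpow_def
      by (intro sum.cong refl) (auto simp: pairs_def that)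
    moreover have "\<theta>' \<in> N \<longleftrightarrow> \<theta> \<in> N" using that I by (simp add: N_def)
    ultimately show ?thesis by (simp add: g_def indicator_def)
  qed
  have pw: "ennreal (g (\<phi>(r := 0))) * ennreal (exp (- diffpow 2 I (\<phi>(r := 0)) / 2))
    \<le> ennreal (cosprod I (\<phi>(r := 0))) * indicator (nearset ?J) \<phi>" for \<phi>
  proof (cases "\<phi>(r := 0) \<in> N")
    case True
    let ?\<theta> = "\<phi>(r := 0)"
    have q: "\<bar>?\<theta> i\<bar> \<le> pi / 8" if "i \<in> I" for i using True that by (auto simp: N_def)
    have "\<bar>?\<theta> i - ?\<theta> k\<bar> \<le> pi / 4" if "i \<in> I" "k \<in> I" for i k
      using q[OF that(1)] q[OF that(2)] by linarith
    note c = cosprod_ge_exp[of I ?\<theta>, OF this]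
    have "\<bar>\<phi> j\<bar> < pi / 4" if "j \<in> ?J" for j
    proof -
      have "\<bar>\<phi> j\<bar> \<le> pi / 8" using q[of j] that by auto
      then show ?thesis using pi_gt_zero by linarith
    qed
    then have "\<phi> \<in> nearset ?J" by (simp add: nearset_def)
    then show ?thesis using True c
      by (simp add: g_def ennreal_mult[symmetric] mult.commute del: fun_upd_apply) (auto intro!: ennreal_leI)
  next
    case False
    then show ?thesis by (simp add: g_def)
  qed
  have "ennreal (volconst n * (exp (- quartic_mean n) * (1 - 1000 / real n)))
     \<le> ennreal (volconst n * (\<integral>\<omega>. g \<omega> \<partial>PiM I (\<lambda>_. gauss n)))"
    using expectation_exp_near_ge[OF I n] volconst_pos[OF n0]
    by (intro ennreal_leI mult_left_mono) (auto simp: g_def[abs_def] N_def)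
  also have "\<dots> = ennreal (volconst n) * ennreal (\<integral>\<omega>. g \<omega> \<partial>PiM I (\<lambda>_. gauss n))"
    using volconst_pos[OF n0] by (simp add: ennreal_mult')
  also have "ennreal (\<integral>\<omega>. g \<omega> \<partial>PiM I (\<lambda>_. gauss n)) = (\<integral>\<^sup>+\<omega>. ennreal (g \<omega>) \<partial>PiM I (\<lambda>_. gauss n))"
  proof (rule nn_integral_eq_integral[symmetric])
    interpret prob_space "PiM I (\<lambda>_. gauss n)" by (rule prob_space_PiM_gauss[OF n0])
    show "integrable (PiM I (\<lambda>_. gauss n)) g"
      using gm g0 by (intro integrable_const_bound[of _ 1] AE_I2) (auto simp: measurable_PiM_borel[OF sets_gauss])
  qed (use g0 in simp)
  also have "ennreal (volconst n) * (\<integral>\<^sup>+\<omega>. ennreal (g \<omega>) \<partial>PiM I (\<lambda>_. gauss n)) =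
    (\<integral>\<^sup>+\<phi>. ennreal (g (\<phi>(r := 0))) * ennreal (exp (- diffpow 2 I (\<phi>(r := 0)) / 2)) \<partial>PiM ?J (\<lambda>_. unif))"
  proof (rule nn_integral_unif_gauge[OF I refl n _ ginv, symmetric])
    show "(\<lambda>\<theta>. ennreal (g \<theta>)) \<in> borel_measurable (PiM I (\<lambda>_. borel))"
      by (rule measurable_compose[OF gm measurable_ennreal])
    fix \<theta> j assume j: "j \<in> ?J" "\<not> \<bar>\<theta> j - \<theta> r\<bar> < pi / 2"
    then have "\<not> \<bar>\<theta> j - \<theta> r\<bar> \<le> pi / 8" using pi_gt_zero by linarith
    then have "\<theta> \<notin> N" using j by (auto simp: N_def)
    then show "ennreal (g \<theta>) = 0" by (simp add: g_def)
  qed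
  also have "\<dots> \<le> (\<integral>\<^sup>+\<phi>. ennreal (cosprod I (\<phi>(r := 0))) * indicator (nearset ?J) \<phi> \<partial>PiM ?J (\<lambda>_. unif))"
    by (intro nn_integral_mono pw)
  finally show ?thesis .
qed

text \<open>Removing two angles raises the main term by at most a linear factor, which the
  exponential gain of the far region absorbs. The constant uses
  \<open>(1 + 2 / k) ^ (k / 2) \<le> exp 1 \<le> 3\<close> and \<open>pi < 4\<close>.\<close>

lemma volconst_add2:
  assumes "k > 0"
  shows "volconst k \<le> 6 * real (k + 2) * volconst (k + 2)"
proof -
  let ?n = "k + 2"
  define a where "a = sqrt (2 * pi / real ?n) ^ k"
  have a0: "a > 0" by (simp add: a_def)
  have "sqrt (2 * pi / real k) ^ k = a * sqrt (real ?n / real k) ^ k"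
    unfolding a_def power_mult_distrib[symmetric] real_sqrt_mult[symmetric] using assms by simp
  also have "sqrt (real ?n / real k) ^ k \<le> exp 1"
  proof -
    have "(1 + 2 / real k) ^ k \<le> exp 2"
      using assms exp_ge_one_plus_x_over_n_power_n[of k 2] by simp
    moreover have "real ?n / real k = 1 + 2 / real k" using assms by (simp add: field_simps)
    ultimately have "sqrt ((real ?n / real k) ^ k) \<le> sqrt (exp 2)" by (intro real_sqrt_le_mono) (simp only:)
    moreover have "exp 2 = (exp 1 :: real)\<^sup>2" by (simp add: exp_of_nat_mult[symmetric] flip: exp_double)
    ultimately show ?thesis by (simp add: real_sqrt_power)
  qed
  finally have 1: "sqrt (2 * pi / real k) ^ k \<le> a * exp 1" using a0 by simp
  have 2: "sqrt (2 * pi / real ?n) ^ ?n = a * (2 * pi / real ?n)"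
  proof -
    have "sqrt (2 * pi / real ?n) ^ ?n = a * (sqrt (2 * pi / real ?n))\<^sup>2" by (simp only: a_def power_add)
    also have "(sqrt (2 * pi / real ?n))\<^sup>2 = 2 * pi / real ?n" by simp
    finally show ?thesis .
  qed
  have "volconst k \<le> (1 / pi) ^ (k - 1) * (real k / sqrt (2 * pi) * (a * exp 1))"
    unfolding volconst_def gaugeconst_def using 1 by (intro mult_left_mono) auto
  also have "\<dots> = (1 / pi) ^ (k + 1) * (real k * pi\<^sup>2 / sqrt (2 * pi) * (a * exp 1))"
  proof -
    have "(1 / pi) ^ (k + 1) = (1 / pi) ^ (k - 1) * (1 / pi)\<^sup>2" using assms by (simp flip: power_add)
    then show ?thesis by (simp add: power_divide)
  qed
  also have "\<dots> \<le> (1 / pi) ^ (k + 1) * (6 * real ?n * (2 * pi / sqrt (2 * pi) * a))"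
  proof (rule mult_left_mono)
    have e3: "exp 1 \<le> (3 :: real)" by (rule exp_le)
    have "real k * pi * exp 1 \<le> real ?n * 4 * 3"
      using e3 pi_less_4 by (intro mult_mono) auto
    then have "(real k * pi * exp 1) * (pi / sqrt (2 * pi) * a) \<le> (real ?n * 4 * 3) * (pi / sqrt (2 * pi) * a)"
      using a0 by (intro mult_right_mono) auto
    then show "real k * pi\<^sup>2 / sqrt (2 * pi) * (a * exp 1) \<le> 6 * real ?n * (2 * pi / sqrt (2 * pi) * a)"
      by (simp add: power2_eq_square mult_ac)
  qed simp
  also have "\<dots> = 6 * real ?n * volconst ?n"
  proof -
    have "X / s * (a * (p / X)) = p / s * a" if "X \<noteq> 0" for X s p :: real
      using that by (simp add: field_simps)
    from this[of "real ?n" "sqrt (2 * pi)" "2 * pi"] show ?thesis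
      unfolding volconst_def gaugeconst_def 2 by simp
  qed
  finally show ?thesis .
qed

lemma farconst_poly:
  obtains C where "C > 0" "\<And>n. real n ^ 3 * farconst ^ n \<le> C"
proof -
  obtain p where p: "farconst ^ x * of_nat x ^ 3 \<le> p" for x
    using poly_exp_bound[of farconst 3] farconst_bounds by auto
  show ?thesis by (rule that[of "max p 1"]) (use p in \<open>auto simp: mult.commute le_max_iff_disj\<close>)
qed

lemma torus_le_step:
  assumes I: "finite I" "card I = n" "n \<ge> 1"
    and IH: "\<And>K. finite K \<Longrightarrow> card K = n - 2 \<Longrightarrow> torus K \<le> ennreal b" and b: "b \<ge> 0"
  shows "torus I \<le> ennreal (volconst n + real n * farconst ^ (n - 2) * b)"
proof -
  obtain r where r: "r \<in> I" using I by fastforce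
  let ?J = "I - {r}"
  have n0: "n > 0" and Ine: "I \<noteq> {}" using I r by auto
  have upd: "(\<lambda>\<phi>. \<phi>(r := 0)) \<in> measurable (PiM ?J (\<lambda>_. borel)) (PiM I (\<lambda>_. borel :: real measure))"
    by (rule fun_upd_PiM_borel) (use r in auto)
  have fm: "(\<lambda>\<phi>. ennreal \<bar>cosprod I (\<phi>(r := 0))\<bar>) \<in> borel_measurable (PiM ?J (\<lambda>_. borel))"
    by (rule measurable_compose[OF upd abs_cosprod_abs_measurable[OF order_refl]])
  have nm: "(\<lambda>\<phi>. indicator (nearset ?J) \<phi> :: ennreal) \<in> borel_measurable (PiM ?J (\<lambda>_. borel))"
    using I by (intro indicator_nearset_measurable(2)) simp
  have nm': "(\<lambda>\<phi>. indicator (- nearset ?J) \<phi> :: ennreal) \<in> borel_measurable (PiM ?J (\<lambda>_. borel))"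
  proof -
    have "(\<lambda>\<phi>. 1 - indicator (nearset ?J) \<phi> :: ennreal) \<in> borel_measurable (PiM ?J (\<lambda>_. borel))"
      using nm by (intro borel_measurable_minus_ennreal borel_measurable_const)
    moreover have "(\<lambda>\<phi>. 1 - indicator (nearset ?J) \<phi> :: ennreal) = indicator (- nearset ?J)"
      by (auto simp: indicator_def fun_eq_iff)
    ultimately show ?thesis by simp
  qed
  have "torus I = (\<integral>\<^sup>+\<phi>. ennreal \<bar>cosprod I (\<phi>(r := 0))\<bar> * indicator (nearset ?J) \<phi>
      + ennreal \<bar>cosprod I (\<phi>(r := 0))\<bar> * indicator (- nearset ?J) \<phi> \<partial>PiM ?J (\<lambda>_. unif))"
    unfolding torus_gauge[OF I(1) r refl] by (intro nn_integral_cong) (auto simp: indicator_def)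
  also have "\<dots> = (\<integral>\<^sup>+\<phi>. ennreal \<bar>cosprod I (\<phi>(r := 0))\<bar> * indicator (nearset ?J) \<phi> \<partial>PiM ?J (\<lambda>_. unif))
      + (\<integral>\<^sup>+\<phi>. ennreal \<bar>cosprod I (\<phi>(r := 0))\<bar> * indicator (- nearset ?J) \<phi> \<partial>PiM ?J (\<lambda>_. unif))"
    using fm nm nm' by (intro nn_integral_add) (auto simp only: measurable_unif intro!: borel_measurable_times_ennreal)
  also have "\<dots> \<le> ennreal (volconst n) + ennreal (real n * farconst ^ (n - 2) * b)"
  proof (rule add_mono)
    have "(\<integral>\<omega>. exp (- diffpow 4 I \<omega> / 12) \<partial>PiM I (\<lambda>_. gauss n)) \<le> 1"
    proof -
      interpret prob_space "PiM I (\<lambda>_. gauss n)" by (rule prob_space_PiM_gauss[OF n0])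
      have "(\<integral>\<omega>. exp (- diffpow 4 I \<omega> / 12) \<partial>PiM I (\<lambda>_. gauss n)) \<le> (\<integral>\<omega>. 1 \<partial>PiM I (\<lambda>_. gauss n))"
        using expectation_exp_quartic_le(1)[OF I(1) Ine I(2)[symmetric]] diffpow_nonneg[of 4 I, OF even_numeral]
        by (intro integral_mono) auto
      then show ?thesis by (simp add: prob_space)
    qed
    then have "volconst n * (\<integral>\<omega>. exp (- diffpow 4 I \<omega> / 12) \<partial>PiM I (\<lambda>_. gauss n)) \<le> volconst n"
      using volconst_pos[OF n0] by (intro mult_left_le) auto
    then show "(\<integral>\<^sup>+\<phi>. ennreal \<bar>cosprod I (\<phi>(r := 0))\<bar> * indicator (nearset ?J) \<phi> \<partial>PiM ?J (\<lambda>_. unif)) \<le> ennreal (volconst n)"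
      by (intro order_trans[OF near_integral_le[OF I(1) r I(2)[symmetric]]] ennreal_leI)
    have "(\<integral>\<^sup>+\<phi>. ennreal \<bar>cosprod I (\<phi>(r := 0))\<bar> * indicator (- nearset ?J) \<phi> \<partial>PiM ?J (\<lambda>_. unif))
      \<le> (\<Sum>j\<in>?J. ennreal (farconst ^ (card I - 2)) * torus (I - {r, j}))" by (rule far_total_le[OF I(1) r])
    also have "\<dots> \<le> (\<Sum>j\<in>?J. ennreal (farconst ^ (n - 2)) * ennreal b)"
    proof (rule sum_mono)
      fix j assume "j \<in> ?J"
      then have "card (I - {r, j}) = n - 2" using I r by (simp add: card_Diff_subset)
      then show "ennreal (farconst ^ (card I - 2)) * torus (I - {r, j}) \<le> ennreal (farconst ^ (n - 2)) * ennreal b"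
        unfolding I(2) using I by (intro mult_left_mono IH) auto
    qed
    also have "\<dots> = ennreal (real (n - 1) * (farconst ^ (n - 2) * b))"
      using I r b farconst_bounds by (simp add: ennreal_mult ennreal_of_nat_eq_real_of_nat)
    also have "\<dots> \<le> ennreal (real n * farconst ^ (n - 2) * b)"
      using b farconst_bounds by (intro ennreal_leI) (simp add: mult.assoc mult_right_mono)
    finally show "(\<integral>\<^sup>+\<phi>. ennreal \<bar>cosprod I (\<phi>(r := 0))\<bar> * indicator (- nearset ?J) \<phi> \<partial>PiM ?J (\<lambda>_. unif))
      \<le> ennreal (real n * farconst ^ (n - 2) * b)" .
  qed
  also have "\<dots> = ennreal (volconst n + real n * farconst ^ (n - 2) * b)"
    using volconst_pos[OF n0] b farconst_bounds by (intro ennreal_plus[symmetric]) auto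
  finally show ?thesis .
qed

text \<open>Induction from \<open>n - 2\<close> to \<open>n\<close>: the near part is at most
  \<open>volconst n\<close>, hence at most half of the claim because \<open>C \<ge> 2\<close>, and
  for large \<open>n\<close> the far part takes at most the other half. Small \<open>n\<close> are
  covered by \<open>torus I \<le> 1\<close> through the sum in \<open>C\<close>.\<close>

lemma torus_bound:
  obtains C where "C \<ge> 1" "\<And>I. finite I \<Longrightarrow> I \<noteq> {} \<Longrightarrow> torus I \<le> ennreal (C * volconst (card I))"
proof -
  obtain B where B: "B > 0" "\<And>n. real n ^ 3 * farconst ^ n \<le> B" using farconst_poly by blast
  \<comment> \<open>From \<open>n \<ge> N\<close> and \<open>n^3 * farconst ^ n \<le> B\<close> one
    gets \<open>6 * n^2 * farconst ^ (n - 2) \<le> 1 / 2\<close>, which is what the far part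
    requires.\<close>
  define N where "N = nat \<lceil>12 * B / farconst ^ 2\<rceil> + 3"
  define C where "C = 2 + (\<Sum>n<N. 1 / volconst n)"
  have v0: "0 \<le> volconst n" for n by (cases "n = 0") (auto simp: volconst_pos less_imp_le volconst_def gaugeconst_def)
  have C2: "C \<ge> 2" unfolding C_def using v0 by (simp add: sum_nonneg)
  have "torus I \<le> ennreal (C * volconst (card I))" if "finite I" "I \<noteq> {}" for I
    using that
  proof (induction "card I" arbitrary: I rule: less_induct)
    case less
    define n where "n = card I"
    have n0: "n > 0" using less.prems by (simp add: n_def card_gt_0_iff)
    show ?case
    proof (cases "n < N")
      case True
      have "1 / volconst n \<le> C" unfolding C_def using True v0
        by (intro order_trans[OF member_le_sum[of n "{..<N}" "\<lambda>n. 1 / volconst n"]]) auto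
      then have "1 \<le> C * volconst n" using volconst_pos[OF n0] by (simp add: field_simps)
      then have "(1 :: ennreal) \<le> ennreal (C * volconst n)" by (simp add: ennreal_1[symmetric] ennreal_leI del: ennreal_1)
      then show ?thesis using torus_le_1[of I] unfolding n_def by (rule order_trans[rotated])
    next
      case False
      then have n3: "n \<ge> 3" by (simp add: N_def)
      obtain k where k: "n = k + 2" "k > 0" by (rule that[of "n - 2"]) (use n3 in auto)
      have IH: "torus K \<le> ennreal (C * volconst k)" if "finite K" "card K = n - 2" for K
      proof -
        have "card K = k" using that k by simp
        moreover from this k have "K \<noteq> {}" by auto
        ultimately show ?thesis using less.hyps[of K] that k n_def by simp
      qed
      have "torus I \<le> ennreal (volconst n + real n * farconst ^ (n - 2) * (C * volconst k))"
        using less.prems n0 IH C2 v0 by (intro torus_le_step) (auto simp: n_def)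
      also have "\<dots> \<le> ennreal (C * volconst n)"
      proof (rule ennreal_leI)
        have "12 * B / farconst ^ 2 \<le> real n" using False unfolding N_def by linarith
        then have n12: "12 * B \<le> real n * farconst ^ 2" using farconst_bounds by (simp add: field_simps)
        have "real n * (6 * (real n)\<^sup>2 * farconst ^ k * farconst ^ 2) = 6 * (real n ^ 3 * farconst ^ n)"
          by (simp add: k power_add eval_nat_numeral)
        also have "\<dots> \<le> 6 * B" using B(2)[of n] by simp
        also have "\<dots> \<le> real n * farconst ^ 2 / 2" using n12 by simp
        finally have "real n * (6 * (real n)\<^sup>2 * farconst ^ k * farconst ^ 2) \<le> real n * (farconst ^ 2 / 2)" by simp
        then have "6 * (real n)\<^sup>2 * farconst ^ k * farconst ^ 2 \<le> farconst ^ 2 / 2" using n0 by simp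
        then have half: "6 * (real n)\<^sup>2 * farconst ^ k \<le> 1 / 2" using farconst_bounds by simp
        have "real n * farconst ^ (n - 2) * (C * volconst k) \<le> real n * farconst ^ k * (C * (6 * real n * volconst n))"
          using volconst_add2[OF k(2)] C2 farconst_bounds k(1) by (intro mult_mono) (auto simp: v0)
        also have "\<dots> = (6 * (real n)\<^sup>2 * farconst ^ k) * (C * volconst n)" by (simp add: power2_eq_square)
        also have "\<dots> \<le> 1 / 2 * (C * volconst n)" using half C2 v0 by (intro mult_right_mono) auto
        finally show "volconst n + real n * farconst ^ (n - 2) * (C * volconst k) \<le> C * volconst n"
          using mult_right_mono[OF C2, of "volconst n"] v0 by simp
      qed
      finally show ?thesis by (simp add: n_def)
    qed
  qed
  then show ?thesis using that[of C] C2 by simp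
qed

section \<open>Asymptotics of the number of regular tournaments\<close>

text \<open>Here the signs are kept: this is the exact Fourier integral for regular tournaments, up
  to a power of \<open>2\<close>.\<close>

definition gaugeint :: "nat set \<Rightarrow> nat \<Rightarrow> real" where
  "gaugeint I r = (\<integral>\<phi>. cosprod I (\<phi>(r := 0)) \<partial>PiM (I - {r}) (\<lambda>_. unif))"

text \<open>The near part is known up to relative error \<open>O(1/n)\<close> from above and below.
  The far part is estimated through \<open>torus_bound\<close> on two angles fewer, which makes it
  exponentially small relative to \<open>volconst\<close>.\<close>

lemma gaugeint_asymp:
  obtains C where "C > 0"
    "\<And>I r. finite I \<Longrightarrow> r \<in> I \<Longrightarrow> card I \<ge> 3 \<Longrightarrow>
      \<bar>gaugeint I r - volconst (card I) * exp (- quartic_mean (card I))\<bar> \<le> C / real (card I) * volconst (card I)"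
proof -
  obtain T where T: "T \<ge> 1" "\<And>I. finite I \<Longrightarrow> I \<noteq> {} \<Longrightarrow> torus I \<le> ennreal (T * volconst (card I))"
    using torus_bound by blast
  obtain B where B: "B > 0" "\<And>n. real n ^ 3 * farconst ^ n \<le> B" using farconst_poly by blast
  \<comment> \<open>The far part is at most \<open>6 * T * n^2 * farconst ^ (n - 2)\<close> times
    \<open>volconst n\<close>; trading one factor \<open>n\<close> for \<open>1 / n\<close> and
    using \<open>B\<close> gives \<open>D / n\<close>.\<close>
  define D where "D = 6 * T * B / farconst ^ 2"
  have D0: "D \<ge> 0" using T B farconst_bounds by (simp add: D_def)
  show ?thesis
  proof (rule that[of "1000 + D"])
    fix I :: "nat set" and r assume I: "finite I" "r \<in> I" "card I \<ge> 3"
    define n where "n = card I"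
    let ?J = "I - {r}"
    let ?P = "PiM ?J (\<lambda>_. unif)"
    let ?g = "\<lambda>\<phi>. cosprod I (\<phi>(r := 0))"
    let ?ind = "indicator (nearset ?J) :: (nat \<Rightarrow> real) \<Rightarrow> real"
    let ?v = "volconst n * exp (- quartic_mean n)"
    have n0: "n > 0" "n \<ge> 3" and Ine: "I \<noteq> {}" using I by (auto simp: n_def)
    obtain k where k: "n = k + 2" "k > 0" by (rule that[of "n - 2"]) (use n0 in auto)
    interpret prob_space ?P by (intro prob_space_PiM prob_space_unif)
    have v0: "0 < volconst n" "0 < volconst k" using volconst_pos n0 k by auto
    have upd: "(\<lambda>\<phi>. \<phi>(r := 0)) \<in> measurable (PiM ?J (\<lambda>_. borel)) (PiM I (\<lambda>_. borel :: real measure))"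
      by (rule fun_upd_PiM_borel) (use I in auto)
    have gm: "?g \<in> borel_measurable ?P"
      unfolding measurable_unif by (rule measurable_compose[OF upd cosprod_measurable])
    have im: "?ind \<in> borel_measurable ?P"
      unfolding measurable_unif using I by (intro indicator_nearset_measurable(1)) simp
    have gi: "integrable ?P ?g"
      using abs_cosprod_le_1 gm by (intro integrable_const_bound[of _ 1] AE_I2) auto
    have ni: "integrable ?P (\<lambda>\<phi>. ?g \<phi> * ?ind \<phi>)"
      using abs_cosprod_le_1 gm im
    proof (intro integrable_const_bound[of _ 1] AE_I2 borel_measurable_times gm im)
      fix \<phi> show "norm (?g \<phi> * ?ind \<phi>) \<le> 1" using abs_cosprod_le_1[of I] by (simp add: indicator_def)
    qed
    have fi: "integrable ?P (\<lambda>\<phi>. ?g \<phi> * (1 - ?ind \<phi>))"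
      using gi ni by (simp add: algebra_simps)
    have split: "gaugeint I r = (\<integral>\<phi>. ?g \<phi> * ?ind \<phi> \<partial>?P) + (\<integral>\<phi>. ?g \<phi> * (1 - ?ind \<phi>) \<partial>?P)"
      unfolding gaugeint_def Bochner_Integration.integral_add[OF ni fi, symmetric]
      by (intro Bochner_Integration.integral_cong) (auto simp: algebra_simps)
    have pos: "0 \<le> ?g \<phi> * ?ind \<phi>" for \<phi>
    proof (cases "\<phi> \<in> nearset ?J")
      case True
      let ?\<theta> = "\<phi>(r := 0)"
      have q: "\<bar>?\<theta> i\<bar> < pi / 4" if "i \<in> I" for i using True that by (auto simp: nearset_def)
      have "\<bar>?\<theta> i - ?\<theta> k\<bar> < pi / 2" if "i \<in> I" "k \<in> I" for i k
        using q[OF that(1)] q[OF that(2)] by linarith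
      from cosprod_le_exp(1)[of I ?\<theta>, OF this] show ?thesis by simp
    qed simp
    have near: "ennreal (\<integral>\<phi>. ?g \<phi> * ?ind \<phi> \<partial>?P) = (\<integral>\<^sup>+\<phi>. ennreal (?g \<phi>) * indicator (nearset ?J) \<phi> \<partial>?P)"
    proof -
      have "(\<integral>\<^sup>+\<phi>. ennreal (?g \<phi> * ?ind \<phi>) \<partial>?P) = ennreal (\<integral>\<phi>. ?g \<phi> * ?ind \<phi> \<partial>?P)"
        by (rule nn_integral_eq_integral[OF ni]) (use pos in auto)
      moreover have "ennreal (?g \<phi> * ?ind \<phi>) = ennreal (?g \<phi>) * indicator (nearset ?J) \<phi>" for \<phi>
        by (auto simp: indicator_def)
      ultimately show ?thesis by simp
    qed
    have near_nonneg: "0 \<le> (\<integral>\<phi>. ?g \<phi> * ?ind \<phi> \<partial>?P)" using pos by (intro integral_nonneg_AE) auto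
    have upper: "(\<integral>\<phi>. ?g \<phi> * ?ind \<phi> \<partial>?P) \<le> ?v * (1 + 47 / real n)"
    proof -
      have "ennreal (\<integral>\<phi>. ?g \<phi> * ?ind \<phi> \<partial>?P) \<le> (\<integral>\<^sup>+\<phi>. ennreal \<bar>?g \<phi>\<bar> * indicator (nearset ?J) \<phi> \<partial>?P)"
        unfolding near by (intro nn_integral_mono mult_right_mono ennreal_leI) auto
      also have "\<dots> \<le> ennreal (volconst n * (\<integral>\<omega>. exp (- diffpow 4 I \<omega> / 12) \<partial>PiM I (\<lambda>_. gauss n)))"
        by (rule near_integral_le[OF I(1,2) n_def])
      also have "\<dots> \<le> ennreal (volconst n * (exp (- quartic_mean n) * (1 + 47 / real n)))"
        using expectation_exp_quartic_le(2)[OF I(1) Ine n_def] v0 by (intro ennreal_leI mult_left_mono) auto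
      finally show ?thesis using v0 by (subst (asm) ennreal_le_iff) (auto simp: mult.assoc)
    qed
    have lower: "?v * (1 - 1000 / real n) \<le> (\<integral>\<phi>. ?g \<phi> * ?ind \<phi> \<partial>?P)"
    proof -
      have "ennreal (volconst n * (exp (- quartic_mean n) * (1 - 1000 / real n))) \<le> ennreal (\<integral>\<phi>. ?g \<phi> * ?ind \<phi> \<partial>?P)"
        unfolding near by (rule near_integral_ge[OF I(1,2) n_def])
      then show ?thesis using near_nonneg by (subst (asm) ennreal_le_iff) (auto simp: mult.assoc)
    qed
    have far: "\<bar>\<integral>\<phi>. ?g \<phi> * (1 - ?ind \<phi>) \<partial>?P\<bar> \<le> D / real n * volconst n"
    proof -
      have "\<bar>\<integral>\<phi>. ?g \<phi> * (1 - ?ind \<phi>) \<partial>?P\<bar> \<le> (\<integral>\<phi>. \<bar>?g \<phi> * (1 - ?ind \<phi>)\<bar> \<partial>?P)"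
        using integral_norm_bound[of ?P "\<lambda>\<phi>. ?g \<phi> * (1 - ?ind \<phi>)"] by simp
      moreover have "(\<integral>\<phi>. \<bar>?g \<phi> * (1 - ?ind \<phi>)\<bar> \<partial>?P) \<le> D / real n * volconst n"
      proof -
        have "ennreal (\<integral>\<phi>. \<bar>?g \<phi> * (1 - ?ind \<phi>)\<bar> \<partial>?P) = (\<integral>\<^sup>+\<phi>. ennreal \<bar>?g \<phi> * (1 - ?ind \<phi>)\<bar> \<partial>?P)"
          using fi by (intro nn_integral_eq_integral[symmetric] integrable_abs) auto
        also have "\<dots> = (\<integral>\<^sup>+\<phi>. ennreal \<bar>?g \<phi>\<bar> * indicator (- nearset ?J) \<phi> \<partial>?P)"
          by (intro nn_integral_cong) (auto simp: indicator_def)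
        also have "\<dots> \<le> (\<Sum>j\<in>?J. ennreal (farconst ^ (card I - 2)) * torus (I - {r, j}))"
          by (rule far_total_le[OF I(1,2)])
        also have "\<dots> \<le> (\<Sum>j\<in>?J. ennreal (farconst ^ k) * ennreal (T * volconst k))"
        proof (rule sum_mono)
          fix j assume "j \<in> ?J"
          then have cK: "card (I - {r, j}) = k" using I k by (simp add: card_Diff_subset n_def)
          then have "I - {r, j} \<noteq> {}" using k by (intro notI) simp
          then have "torus (I - {r, j}) \<le> ennreal (T * volconst k)"
            using T(2)[of "I - {r, j}"] I cK by simp
          then show "ennreal (farconst ^ (card I - 2)) * torus (I - {r, j}) \<le> ennreal (farconst ^ k) * ennreal (T * volconst k)"
            using k n_def by (intro mult_mono) auto
        qed
        also have "\<dots> = ennreal (real (n - 1) * (farconst ^ k * (T * volconst k)))"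
          using I T v0 farconst_bounds by (simp add: ennreal_mult ennreal_of_nat_eq_real_of_nat n_def)
        also have "\<dots> \<le> ennreal (D / real n * volconst n)"
        proof (rule ennreal_leI)
          have "real (n - 1) * (farconst ^ k * (T * volconst k)) \<le> real n * (farconst ^ k * (T * (6 * real n * volconst n)))"
            using volconst_add2[OF k(2)] T farconst_bounds k(1) v0
            by (intro mult_mono mult_left_mono) auto
          also have "\<dots> = (6 * T * (real n ^ 3 * farconst ^ n) / farconst ^ 2) / real n * volconst n"
          proof -
            have gen: "x * (F * (T * (6 * x * v))) = (6 * T * (x ^ 3 * (F * f ^ 2)) / f ^ 2) / x * v"
              if "x \<noteq> 0" "f \<noteq> 0" for x F T v f :: real
              using that by (simp add: field_simps eval_nat_numeral)
            have "farconst ^ n = farconst ^ k * farconst ^ 2" by (simp only: k(1) power_add)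
            then show ?thesis using gen[of "real n" farconst] farconst_bounds n0 by simp
          qed
          also have "\<dots> \<le> D / real n * volconst n" unfolding D_def
            using B(2)[of n] T v0 farconst_bounds
            by (intro mult_right_mono divide_right_mono mult_left_mono) auto
          finally show "real (n - 1) * (farconst ^ k * (T * volconst k)) \<le> D / real n * volconst n" .
        qed
        finally show ?thesis using D0 v0 by (subst (asm) ennreal_le_iff) auto
      qed
      ultimately show ?thesis by linarith
    qed
    have "?v \<le> volconst n * 1" using v0 quartic_mean_bounds[OF n0(1)] by (intro mult_left_mono) auto
    then have "?v * (1000 / real n) \<le> volconst n * (1000 / real n)" "?v * (47 / real n) \<le> volconst n * (47 / real n)"
      by (intro mult_right_mono; simp)+
    moreover have "volconst n * (47 / real n) \<le> volconst n * (1000 / real n)"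
      using v0 by (intro mult_left_mono divide_right_mono) auto
    ultimately have "\<bar>(\<integral>\<phi>. ?g \<phi> * ?ind \<phi> \<partial>?P) - ?v\<bar> \<le> volconst n * (1000 / real n)"
      using upper lower by (simp add: algebra_simps abs_le_iff)
    then have "\<bar>gaugeint I r - ?v\<bar> \<le> volconst n * (1000 / real n) + D / real n * volconst n"
      unfolding split using far by linarith
    also have "\<dots> = (1000 + D) / real n * volconst n" by (simp add: field_simps add_divide_distrib)
    finally show "\<bar>gaugeint I r - volconst (card I) * exp (- quartic_mean (card I))\<bar> \<le> (1000 + D) / real (card I) * volconst (card I)"
      by (simp add: n_def)
  qed (use D0 in simp)
qed

text \<open>Each factor \<open>2 * cos (\<theta> i - \<theta> k)\<close> is the sum of two
  exponentials, one for each direction of the edge; multiplying out selects an orientation.\<close>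

lemma sum_ori_cis:
  assumes "finite P" "P \<subseteq> pairs {..<m}"
  shows "(\<Sum>D\<in>ori ((\<lambda>(i, k). {i, k}) ` P). cis (\<Sum>v<m. of_int (imb D v) * \<theta> v))
    = (\<Prod>(i, k)\<in>P. complex_of_real (2 * cos (\<theta> i - \<theta> k)))"
  using assms
proof (induction P rule: finite_induct)
  case empty
  have "imb {} v = 0" for v :: nat by (simp add: imb_def)
  then show ?case by (simp add: ori_empty)
next
  case (insert p P)
  obtain i k where p: "p = (i, k)" by fastforce
  then have ik: "i < m" "k < m" "i < k" using insert.prems by (auto simp: pairs_def)
  let ?E = "(\<lambda>(i, k). {i, k}) ` P"
  let ?S = "\<lambda>D. \<Sum>v<m. of_int (imb D v) * \<theta> v"
  have ni: "{i, k} \<notin> ?E"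
  proof
    assume "{i, k} \<in> ?E"
    then obtain a b where ab: "(a, b) \<in> P" "{i, k} = {a, b}" by auto
    then have "a < b" using insert.prems by (auto simp: pairs_def)
    then have "(a, b) = (i, k)" using ab ik by (auto simp: doubleton_eq_iff)
    then show False using ab insert.hyps p by simp
  qed
  have wf: "wf_edges ?E" using insert.hyps insert.prems by (auto simp: wf_edges_def pairs_def card_insert_if)
  have S: "?S (insert (x, y) D) = ?S D + (\<theta> x - \<theta> y)"
    if D: "D \<in> ori ?E" and xy: "{x, y} = {i, k}" for x y D
  proof -
    have "(x, y) \<notin> D" using ori_arc[OF D, of "(x, y)"] ni xy by auto
    moreover have xy': "x \<noteq> y" "x < m" "y < m" using xy ik by (auto simp: doubleton_eq_iff)
    ultimately have "imb (insert (x, y) D) = (imb D)(x := imb D x + 1, y := imb D y - 1)"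
      using finite_ori(2)[OF wf D] by (intro imb_insert)
    then have "of_int (imb (insert (x, y) D) v) * \<theta> v =
      of_int (imb D v) * \<theta> v + ((if v = x then \<theta> v else 0) - (if v = y then \<theta> v else 0))" for v
      using xy' by (auto simp: algebra_simps)
    then show ?thesis using xy' by (simp add: sum.distrib sum_subtractf)
  qed
  have "(\<Sum>D\<in>ori ((\<lambda>(i, k). {i, k}) ` insert p P). cis (?S D))
    = (\<Sum>D\<in>ori ?E. cis (?S (insert (i, k) D)) + cis (?S (insert (k, i) D)))"
    unfolding p image_insert prod.case using ik by (intro sum_ori_insert ni wf) auto
  also have "\<dots> = (\<Sum>D\<in>ori ?E. cis (?S D) * complex_of_real (2 * cos (\<theta> i - \<theta> k)))"
  proof (rule sum.cong[OF refl])
    fix D assume D: "D \<in> ori ?E"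
    have "cis (\<theta> i - \<theta> k) + cis (\<theta> k - \<theta> i) = complex_of_real (2 * cos (\<theta> i - \<theta> k))"
      using cos_minus[of "\<theta> i - \<theta> k"] sin_minus[of "\<theta> i - \<theta> k"] by (simp add: complex_eq_iff)
    then show "cis (?S (insert (i, k) D)) + cis (?S (insert (k, i) D)) = cis (?S D) * complex_of_real (2 * cos (\<theta> i - \<theta> k))"
      using S[OF D refl] S[OF D insert_commute] by (simp only: cis_mult[symmetric] distrib_left[symmetric])
  qed
  also have "\<dots> = (\<Sum>D\<in>ori ?E. cis (?S D)) * complex_of_real (2 * cos (\<theta> i - \<theta> k))"
    by (rule sum_distrib_right[symmetric])
  finally show ?case using insert p by (simp add: mult.commute)
qed

lemma edges_complete_pairs: "edges (complete_graph m) = (\<lambda>(i, k). {i, k}) ` pairs {..<m}"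
proof
  show "edges (complete_graph m) \<subseteq> (\<lambda>(i, k). {i, k}) ` pairs {..<m}"
  proof
    fix e assume "e \<in> edges (complete_graph m)"
    then obtain u v where "e = {u, v}" "u < m" "v < m" "u \<noteq> v" by (auto simp: edges_complete_graph)
    then have "(u, v) \<in> pairs {..<m} \<or> (v, u) \<in> pairs {..<m}" by (auto simp: pairs_def)
    moreover have "e = (\<lambda>(i, k). {i, k}) (u, v)" "e = (\<lambda>(i, k). {i, k}) (v, u)" using \<open>e = {u, v}\<close> by auto
    ultimately show "e \<in> (\<lambda>(i, k). {i, k}) ` pairs {..<m}" by (metis image_eqI)
  qed
qed (auto simp: pairs_def edges_complete_graph)

text \<open>Out-degree and in-degree add up to \<open>m - 1\<close>, which is even.\<close>

lemma even_imb_complete: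
  assumes "odd m" "D \<in> ori (edges (complete_graph m))" "v < m"
  shows "even (imb D v)"
proof -
  let ?O = "{u. (v, u) \<in> D}" and ?I = "{u. (u, v) \<in> D}"
  have fin: "finite D" using finite_ori(2)[OF wf_edges_complete assms(2)] .
  have f: "finite ?O" "finite ?I"
    using fin finite_subset[of ?O "snd ` D"] finite_subset[of ?I "fst ` D"] by force+
  have un: "?O \<union> ?I = {..<m} - {v}"
  proof (intro equalityI subsetI)
    fix u assume "u \<in> ?O \<union> ?I"
    then have "{u, v} \<in> edges (complete_graph m)"
      using ori_arc[OF assms(2), of "(v, u)"] ori_arc[OF assms(2), of "(u, v)"] by (auto simp: insert_commute)
    then show "u \<in> {..<m} - {v}" by (auto simp: edges_complete_graph doubleton_eq_iff)
  next
    fix u assume "u \<in> {..<m} - {v}"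
    then have "{u, v} \<in> edges (complete_graph m)" using assms(3) by (auto simp: edges_complete_graph)
    then obtain b where "b \<in> D" "{fst b, snd b} = {u, v}" by (rule ori_ex1[OF assms(2)])
    then show "u \<in> ?O \<union> ?I" by (cases b) (auto simp: doubleton_eq_iff)
  qed
  have dis: "?O \<inter> ?I = {}"
  proof (rule ccontr)
    assume "?O \<inter> ?I \<noteq> {}"
    then obtain u where u: "(v, u) \<in> D" "(u, v) \<in> D" by auto
    then have e: "{u, v} \<in> edges (complete_graph m)" using ori_arc[OF assms(2), of "(u, v)"] by simp
    obtain b where b: "\<And>c. c \<in> D \<Longrightarrow> {fst c, snd c} = {u, v} \<Longrightarrow> c = b" by (rule ori_ex1[OF assms(2) e]) blast
    have "(v, u) = b" by (rule b[OF u(1)]) auto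
    also have "b = (u, v)" by (rule b[OF u(2), symmetric]) auto
    finally have "(v, u) = (u, v)" .
    then have "u = v" by (elim Pair_inject)
    with e have "{v} \<in> edges (complete_graph m)" by simp
    then show False by (auto simp: edges_complete_graph)
  qed
  have "card ?O + card ?I = m - 1"
    using card_Un_disjoint[OF f dis] un assms(3) by simp
  then have "imb D v = int (m - 1) - 2 * int (card ?I)" by (simp add: imb_def)
  then show ?thesis using assms(1) by simp
qed

lemma sum_imb_zero:
  assumes "wf_edges E" "\<Union>E \<subseteq> V" "finite V" "D \<in> ori E"
  shows "sum (imb D) V = 0"
proof (rule ccontr)
  assume "sum (imb D) V \<noteq> 0"
  then have "orn E (imb D) = 0" by (rule orn_sum_nonzero[OF assms(1-3)])
  then show False using assms(4) finite_ori(1)[OF assms(1)] by (auto simp: orn_def)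
qed

text \<open>For \<open>k \<noteq> 0\<close>, translation by \<open>pi / k\<close> preserves the
  measure and negates the integrand. Evenness of \<open>k\<close> is what makes the integrand
  insensitive to reduction modulo \<open>pi\<close>.\<close>

lemma integral_cis_unif:
  assumes "even k"
  shows "integrable unif (\<lambda>x. cis (of_int k * x))" "(\<integral>x. cis (of_int k * x) \<partial>unif) = of_bool (k = 0)"
proof -
  interpret prob_space unif by (rule prob_space_unif)
  let ?g = "\<lambda>x. cis (of_int k * x)"
  have gm: "?g \<in> borel_measurable borel"
    by (intro borel_measurable_continuous_onI continuous_intros)
  then have gm': "?g \<in> borel_measurable unif" by (simp add: measurable_cong_sets[OF sets_unif refl])
  show "integrable unif ?g" using gm' by (intro integrable_const_bound[of _ 1]) auto
  show "(\<integral>x. ?g x \<partial>unif) = of_bool (k = 0)"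
  proof (cases "k = 0")
    case False
    define t where "t = pi / of_int k"
    have w: "wrap t \<in> measurable unif unif" by (simp add: measurable_cong_sets[OF sets_unif sets_unif])
    obtain j where j: "k = 2 * j" using assms by (elim evenE)
    have gw: "?g (wrap t x) = - ?g x" for x
    proof -
      define n where "n = \<lfloor>(x + t) / pi + 1 / 2\<rfloor>"
      have w: "wrap t x = x + t - pi * of_int n" by (simp add: wrap_def n_def)
      have "of_int k * t = pi" using False by (simp add: t_def)
      then have "of_int k * wrap t x = of_int k * x + (pi + 2 * pi * of_int (- j * n))"
        by (simp add: w j algebra_simps)
      then have "?g (wrap t x) = ?g x * (cis pi * cis (2 * pi * of_int (- j * n)))"
        by (simp only: cis_mult)
      also have "cis (2 * pi * of_int (- j * n)) = 1" by (rule cis_multiple_2pi) simp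
      finally show ?thesis by (simp add: cis_pi)
    qed
    have "(\<integral>x. ?g x \<partial>unif) = (\<integral>x. ?g x \<partial>distr unif unif (wrap t))" by (simp only: distr_unif_wrap)
    also have "\<dots> = (\<integral>x. ?g (wrap t x) \<partial>unif)" by (rule integral_distr[OF w gm'])
    also have "\<dots> = - (\<integral>x. ?g x \<partial>unif)" unfolding gw by (rule Bochner_Integration.integral_minus)
    finally have "(\<integral>x. ?g x \<partial>unif) = 0" by (simp only: eq_neg_iff_add_eq_0 mult_2[symmetric]) simp
    then show ?thesis using False by simp
  qed (use prob_space in simp)
qed

text \<open>Fourier inversion. Fixing the last angle drops the balance condition at the last vertex,
  but that one follows from the others because the imbalances sum to zero.\<close>

lemma rtour_gaugeint:
  assumes "odd m"
  shows "real (rtour m) = 2 ^ card (pairs {..<m}) * gaugeint {..<m} (m - 1)"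
proof -
  let ?r = "m - 1"
  let ?J = "{..<m} - {?r}"
  let ?P = "PiM ?J (\<lambda>_. unif)"
  let ?E = "edges (complete_graph m)"
  have m0: "m > 0" using assms by (cases m) auto
  have J: "{..<m} = insert ?r ?J" "?r \<notin> ?J" "finite ?J" using m0 by auto
  interpret product_sigma_finite "\<lambda>_::nat. unif" by (rule product_sigma_finite_const[OF sigma_finite_unif])
  have fin: "finite (ori ?E)" by (rule finite_ori[OF wf_edges_complete])
  have ev: "even (imb D v)" if "D \<in> ori ?E" "v \<in> ?J" for D v
    using even_imb_complete[OF assms that(1)] that(2) by auto
  have F: "complex_of_real (2 ^ card (pairs {..<m}) * cosprod {..<m} (\<phi>(?r := 0)))
    = (\<Sum>D\<in>ori ?E. \<Prod>v\<in>?J. cis (of_int (imb D v) * \<phi> v))" for \<phi>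
  proof -
    let ?\<theta> = "\<phi>(?r := 0)"
    have "complex_of_real (2 ^ card (pairs {..<m}) * cosprod {..<m} ?\<theta>)
      = (\<Prod>(i, k)\<in>pairs {..<m}. complex_of_real (2 * cos (?\<theta> i - ?\<theta> k)))"
      by (simp add: cosprod_def case_prod_beta prod.distrib)
    also have "\<dots> = (\<Sum>D\<in>ori ?E. cis (\<Sum>v<m. of_int (imb D v) * ?\<theta> v))"
      unfolding edges_complete_pairs by (rule sum_ori_cis[symmetric]) (auto simp: finite_pairs)
    also have "\<dots> = (\<Sum>D\<in>ori ?E. \<Prod>v\<in>?J. cis (of_int (imb D v) * \<phi> v))"
    proof (rule sum.cong[OF refl])
      fix D
      have "(\<Sum>v<m. of_int (imb D v) * ?\<theta> v) = of_int (imb D ?r) * ?\<theta> ?r + (\<Sum>v\<in>?J. of_int (imb D v) * ?\<theta> v)"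
        using m0 by (intro sum.remove) auto
      also have "\<dots> = (\<Sum>v\<in>?J. of_int (imb D v) * \<phi> v)" by (auto intro!: sum.cong)
      finally show "cis (\<Sum>v<m. of_int (imb D v) * ?\<theta> v) = (\<Prod>v\<in>?J. cis (of_int (imb D v) * \<phi> v))"
        by (simp add: cis_conv_exp exp_sum[symmetric] sum_distrib_left J(3))
    qed
    finally show ?thesis .
  qed
  have pint: "integrable ?P (\<lambda>\<phi>. \<Prod>v\<in>?J. cis (of_int (imb D v) * \<phi> v))" if "D \<in> ori ?E" for D
    using J(3) ev that by (intro product_integrable_prod integral_cis_unif) auto
  have "complex_of_real (2 ^ card (pairs {..<m}) * gaugeint {..<m} ?r)
    = (\<integral>\<phi>. complex_of_real (2 ^ card (pairs {..<m}) * cosprod {..<m} (\<phi>(?r := 0))) \<partial>?P)"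
    unfolding gaugeint_def by (simp only: integral_complex_of_real integral_mult_right_zero)
  also have "\<dots> = (\<Sum>D\<in>ori ?E. \<integral>\<phi>. (\<Prod>v\<in>?J. cis (of_int (imb D v) * \<phi> v)) \<partial>?P)"
    unfolding F using pint by (intro Bochner_Integration.integral_sum)
  also have "\<dots> = (\<Sum>D\<in>ori ?E. \<Prod>v\<in>?J. \<integral>x. cis (of_int (imb D v) * x) \<partial>unif)"
    using J(3) ev by (intro sum.cong refl product_integral_prod integral_cis_unif) auto
  also have "\<dots> = (\<Sum>D\<in>ori ?E. of_bool (imb D = (\<lambda>_. 0)))"
  proof (rule sum.cong[OF refl])
    fix D assume D: "D \<in> ori ?E"
    have "(\<Prod>v\<in>?J. \<integral>x. cis (of_int (imb D v) * x) \<partial>unif) = (\<Prod>v\<in>?J. of_bool (imb D v = 0))"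
      using ev[OF D] by (intro prod.cong refl integral_cis_unif) auto
    also have "\<dots> = of_bool (\<forall>v\<in>?J. imb D v = 0)" using J(3) by (induction ?J rule: finite_induct) auto
    also have "(\<forall>v\<in>?J. imb D v = 0) \<longleftrightarrow> imb D = (\<lambda>_. 0)"
    proof
      assume a: "\<forall>v\<in>?J. imb D v = 0"
      have "sum (imb D) {..<m} = 0" by (rule sum_imb_zero[OF wf_edges_complete Union_complete _ D]) simp
      then have "imb D ?r + sum (imb D) ?J = 0" using J by (metis sum.insert)
      then have "imb D ?r = 0" using a by simp
      moreover have "imb D v = 0" if "v \<notin> {..<m}" for v
        using imb_outside[OF D, of v] Union_complete[of m] that by blast
      ultimately show "imb D = (\<lambda>_. 0)" using a by (auto simp: fun_eq_iff)
    qed auto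
    finally show "(\<Prod>v\<in>?J. \<integral>x. cis (of_int (imb D v) * x) \<partial>unif) = of_bool (imb D = (\<lambda>_. 0))" .
  qed
  also have "\<dots> = of_nat (rtour m)"
    unfolding rtour_def orn_def using fin by (simp add: of_bool_def sum.If_cases Int_def)
  finally have "complex_of_real (2 ^ card (pairs {..<m}) * gaugeint {..<m} ?r) = complex_of_real (real (rtour m))" by simp
  then show ?thesis by (simp only: of_real_eq_iff)
qed

section \<open>Passing to the logarithm of the tournament count\<close>

lemma abs_ln_one_plus_le:
  fixes x :: real assumes "\<bar>x\<bar> \<le> 1 / 2" shows "\<bar>ln (1 + x)\<bar> \<le> 2 * \<bar>x\<bar>"
proof -
  have "\<bar>ln (1 + x) - x\<bar> \<le> 2 * x\<^sup>2" by (rule abs_ln_one_plus_x_minus_x_bound[OF assms])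
  also have "2 * x\<^sup>2 = 2 * \<bar>x\<bar> * \<bar>x\<bar>" by (simp add: power2_eq_square)
  also have "\<dots> \<le> 1 * \<bar>x\<bar>" using assms by (intro mult_right_mono) auto
  finally show ?thesis by linarith
qed

lemma ln_volconst:
  assumes "n > 0"
  shows "ln (volconst n) = ln (real n) - ln (2 * pi) / 2 - (real n - 1) * ln pi + real n / 2 * (ln (2 * pi) - ln (real n))"
proof -
  have "ln ((1 / pi) ^ (n - 1)) = - (real n - 1) * ln pi"
    using assms by (simp add: ln_realpow ln_div of_nat_diff algebra_simps)
  moreover have "ln (sqrt (2 * pi / real n) ^ n) = real n / 2 * (ln (2 * pi) - ln (real n))"
    using assms by (simp add: ln_realpow ln_sqrt ln_div)
  moreover have "ln (real n / sqrt (2 * pi)) = ln (real n) - ln (2 * pi) / 2"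
    using assms by (simp add: ln_div ln_sqrt)
  moreover have "ln (a * (b * c)) = ln a + (ln b + ln c)" if "a > 0" "b > 0" "c > 0" for a b c :: real
    using that by (simp add: ln_mult)
  from this[of "(1 / pi) ^ (n - 1)" "real n / sqrt (2 * pi)" "sqrt (2 * pi / real n) ^ n"]
  have "ln (volconst n) = ln ((1 / pi) ^ (n - 1)) + (ln (real n / sqrt (2 * pi)) + ln (sqrt (2 * pi / real n) ^ n))"
    using assms unfolding volconst_def gaugeconst_def by simp
  ultimately show ?thesis by (simp only:)
qed

text \<open>The constant \<open>- 1 / 2\<close> is the limit of \<open>- quartic_mean m\<close>; the
  remainder \<open>1 / (2 * m)\<close> joins the error.\<close>

lemma ln_rtour_asymp:
  obtains C M where "C > 0" "\<And>m. odd m \<Longrightarrow> m \<ge> M \<Longrightarrow> rtour m > 0 \<and>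
    \<bar>ln (real (rtour m)) - (((real m)\<^sup>2 - 1) / 2 * ln 2 - (real m - 1) / 2 * ln pi - (real m - 2) / 2 * ln (real m) - 1 / 2)\<bar> \<le> C / real m"
proof -
  obtain C where C: "C > 0" "\<And>I r. finite I \<Longrightarrow> r \<in> I \<Longrightarrow> card I \<ge> 3 \<Longrightarrow>
      \<bar>gaugeint I r - volconst (card I) * exp (- quartic_mean (card I))\<bar> \<le> C / real (card I) * volconst (card I)"
    using gaugeint_asymp by blast
  show ?thesis
  proof (rule that[of "4 * C + 1 / 2" "nat \<lceil>4 * C\<rceil> + 3"])
    fix m assume m: "odd m" "m \<ge> nat \<lceil>4 * C\<rceil> + 3"
    have m3: "m \<ge> 3" "m > 0" and mC: "4 * C \<le> real m" using m by linarith+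
    let ?V = "volconst m" and ?a = "quartic_mean m"
    let ?v = "gaugeint {..<m} (m - 1)"
    have V0: "?V > 0" using volconst_pos m3 by simp
    have d: "\<bar>?v - ?V * exp (- ?a)\<bar> \<le> C / real m * ?V" using C(2)[of "{..<m}" "m - 1"] m3 by simp
    \<comment> \<open>The relative error of the integral. It is at most \<open>2 * C / m\<close>
      because \<open>exp (- ?a) \<ge> 1 / 2\<close>, and the threshold \<open>4 * C\<close> for
      \<open>m\<close> makes it at most \<open>1 / 2\<close>.\<close>
    define x where "x = (?v - ?V * exp (- ?a)) / (?V * exp (- ?a))"
    have e: "1 / 2 \<le> exp (- ?a)"
      using exp_ge_add_one_self[of "- ?a"] quartic_mean_bounds[OF m3(2)] by linarith
    have x: "\<bar>x\<bar> \<le> 2 * C / real m"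
    proof -
      have "\<bar>x\<bar> = \<bar>?v - ?V * exp (- ?a)\<bar> / (?V * exp (- ?a))" using V0 by (simp add: x_def abs_mult)
      also have "\<dots> \<le> (C / real m * ?V) / (?V * (1 / 2))" using d e V0 C(1) by (intro frac_le mult_left_mono) auto
      finally show ?thesis using V0 by (simp add: mult.commute)
    qed
    also have "2 * C / real m \<le> 1 / 2" using mC m3 by (simp add: field_simps)
    finally have xh: "\<bar>x\<bar> \<le> 1 / 2" .
    have v: "?v = ?V * exp (- ?a) * (1 + x)" using V0 by (simp add: x_def field_simps)
    have x1: "1 + x > 0" using xh by linarith
    have vpos: "?v > 0" unfolding v using V0 x1 by simp
    have rt: "real (rtour m) = 2 ^ card (pairs {..<m}) * ?v" by (rule rtour_gaugeint[OF m(1)])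
    then have "real (rtour m) > 0" using vpos by simp
    then have rpos: "rtour m > 0" by simp
    have cp: "real (card (pairs {..<m})) = real m * (real m - 1) / 2"
    proof -
      have "real (2 * card (pairs {..<m})) = real (m * (m - 1))" using card_pairs[of "{..<m}"] by simp
      then show ?thesis using m3 by (simp add: of_nat_diff)
    qed
    have "ln (real (rtour m)) = real m * (real m - 1) / 2 * ln 2 + (ln ?V + - ?a + ln (1 + x))"
      unfolding rt v using V0 x1 by (simp add: ln_mult ln_realpow cp)
    also have "\<dots> = (((real m)\<^sup>2 - 1) / 2 * ln 2 - (real m - 1) / 2 * ln pi - (real m - 2) / 2 * ln (real m) - 1 / 2)
       + (1 / (2 * real m) + ln (1 + x))"
    proof -
      have "- ?a = - 1 / 2 + 1 / (2 * real m)" using m3 by (simp add: quartic_mean_def field_simps)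
      moreover have "ln (2 * pi) = ln 2 + ln pi" by (simp add: ln_mult)
      ultimately show ?thesis unfolding ln_volconst[OF m3(2)]
        by (simp add: power2_eq_square algebra_simps diff_divide_distrib add_divide_distrib)
    qed
    finally have "\<bar>ln (real (rtour m)) - (((real m)\<^sup>2 - 1) / 2 * ln 2 - (real m - 1) / 2 * ln pi - (real m - 2) / 2 * ln (real m) - 1 / 2)\<bar>
      = \<bar>1 / (2 * real m) + ln (1 + x)\<bar>" by simp
    also have "\<dots> \<le> 1 / (2 * real m) + 2 * \<bar>x\<bar>"
      using abs_triangle_ineq[of "1 / (2 * real m)" "ln (1 + x)"] abs_ln_one_plus_le[OF xh] by simp
    also have "\<dots> \<le> 1 / (2 * real m) + 2 * (2 * C / real m)" using x by simp
    also have "\<dots> = (4 * C + 1 / 2) / real m" using m3 by (simp add: field_simps)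
    finally show "rtour m > 0 \<and>
      \<bar>ln (real (rtour m)) - (((real m)\<^sup>2 - 1) / 2 * ln 2 - (real m - 1) / 2 * ln pi - (real m - 2) / 2 * ln (real m) - 1 / 2)\<bar> \<le> (4 * C + 1 / 2) / real m"
      using rpos by simp
  qed (use C in simp)
qed

section \<open>Spanning trees as functional graphs\<close>

text \<open>A spanning tree is encoded by the map sending each vertex to the next one on its path to \<open>r\<close>.\<close>

definition rmaps :: "'a set \<Rightarrow> 'a set set \<Rightarrow> 'a \<Rightarrow> ('a \<Rightarrow> 'a) set" where
  "rmaps V E r = {f. (\<forall>v. v \<notin> V \<or> v = r \<longrightarrow> f v = v) \<and> (\<forall>v\<in>V - {r}. {v, f v} \<in> E) \<and>
     (\<forall>v\<in>V. \<exists>k. (f ^^ k) v = r)}"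

definition map_edges :: "'a set \<Rightarrow> 'a \<Rightarrow> ('a \<Rightarrow> 'a) \<Rightarrow> 'a set set" where
  "map_edges V r f = (\<lambda>v. {v, f v}) ` (V - {r})"

locale finite_graph =
  fixes V :: "'a set" and E :: "'a set set"
  assumes finV: "finite V" and wf: "wf_edges E" and UE: "\<Union>E \<subseteq> V"
begin

lemma edge_in_V: "{u, v} \<in> E \<Longrightarrow> u \<in> V \<and> v \<in> V"
  using UE by blast

lemma edge_neq: "{u, v} \<in> E \<Longrightarrow> u \<noteq> v"
  using wf by (auto simp: wf_edges_def)

text \<open>Induction on the number of steps to \<open>r\<close>. If the maps differ at
  \<open>v\<close>, the edge from \<open>v\<close> to \<open>f v\<close> is used by \<open>g\<close>
  at \<open>f v\<close>; the induction hypothesis there yields \<open>f (f v) = v\<close>, a cycle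
  of length two that never reaches \<open>r\<close>.\<close>

lemma map_edges_inj:
  assumes f: "f \<in> rmaps V E r" and g: "g \<in> rmaps V E r" and eq: "map_edges V r f = map_edges V r g"
  shows "f = g"
proof
  fix v
  have "f v = g v" if "v \<in> V" "(f ^^ k) v = r" for k v
    using that
  proof (induction k arbitrary: v)
    case 0
    then show ?case using f g by (simp add: rmaps_def)
  next
    case (Suc k)
    show ?case
    proof (rule ccontr)
      assume ne: "f v \<noteq> g v"
      have vr: "v \<noteq> r" using ne f g by (auto simp: rmaps_def)
      then have vE: "{v, f v} \<in> E" using f Suc.prems by (simp add: rmaps_def)
      have "{v, f v} \<in> map_edges V r g" using vr Suc.prems eq[symmetric] by (auto simp: map_edges_def)
      then obtain w where w: "w \<in> V" "w \<noteq> r" "{v, f v} = {w, g w}" by (auto simp: map_edges_def)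
      then have w': "w = f v" "g w = v" using ne by (auto simp: doubleton_eq_iff)
      have "(f ^^ k) w = r" using Suc.prems(2) w' by (simp add: funpow_swap1)
      then have "f w = v" using Suc.IH[of w] w w' by simp
      then have fv: "f (f v) = v" using w' by simp
      have "(f ^^ j) v = v \<or> (f ^^ j) v = f v" for j by (induction j) (use fv in auto)
      from this[of "Suc k"] show False using Suc.prems(2) vr w w' by simp
    qed
  qed
  then show "f v = g v" using f g by (cases "v \<in> V") (auto simp: rmaps_def)
qed

definition depth :: "'a \<Rightarrow> ('a \<Rightarrow> 'a) \<Rightarrow> 'a \<Rightarrow> nat" where
  "depth r f v = (LEAST k. (f ^^ k) v = r)"

lemma depth_step:
  assumes f: "f \<in> rmaps V E r" and v: "v \<in> V" "v \<noteq> r"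
  shows "depth r f v = Suc (depth r f (f v))"
proof -
  obtain k where k: "(f ^^ k) v = r" using f v by (auto simp: rmaps_def)
  have "(LEAST k. (f ^^ k) v = r) = Suc (LEAST k. (f ^^ Suc k) v = r)"
    using k v by (intro Least_Suc) auto
  then show ?thesis by (simp add: depth_def funpow_swap1)
qed

text \<open>Connectedness goes through the root. On a cycle, a vertex of greatest depth would have
  both of its neighbours equal to its image under \<open>f\<close>, contradicting
  distinctness.\<close>

lemma map_edges_tree:
  assumes f: "f \<in> rmaps V E r" and r: "r \<in> V"
  shows "map_edges V r f \<subseteq> E" "tree \<lparr> verts = V, edges = map_edges V r f \<rparr>"
proof -
  let ?T = "map_edges V r f"
  let ?G = "\<lparr> verts = V, edges = ?T \<rparr>"
  let ?R = "{(x, y). {x, y} \<in> ?T}"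
  show TE: "?T \<subseteq> E" using f by (auto simp: map_edges_def rmaps_def)
  have symR: "sym ?R" by (auto simp: sym_def insert_commute)
  have toroot: "(v, r) \<in> ?R\<^sup>*" if "v \<in> V" "(f ^^ k) v = r" for k v
    using that
  proof (induction k arbitrary: v)
    case (Suc k)
    show ?case
    proof (cases "v = r")
      case False
      then have e: "{v, f v} \<in> ?T" using Suc.prems by (auto simp: map_edges_def)
      then have "f v \<in> V" using TE edge_in_V[of v "f v"] by blast
      then have "(f v, r) \<in> ?R\<^sup>*" using Suc by (simp add: funpow_swap1)
      then show ?thesis using e by (auto intro: converse_rtrancl_into_rtrancl)
    qed simp
  qed simp
  have "(u, v) \<in> ?R\<^sup>*" if "u \<in> V" "v \<in> V" for u v
  proof -
    have "\<exists>k. (f ^^ k) w = r" if "w \<in> V" for w using f that by (auto simp: rmaps_def)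
    then have "(u, r) \<in> ?R\<^sup>*" "(v, r) \<in> ?R\<^sup>*" using toroot that by blast+
    moreover have "(r, v) \<in> ?R\<^sup>*" using \<open>(v, r) \<in> ?R\<^sup>*\<close> sym_rtrancl[OF symR] by (meson symD)
    ultimately show ?thesis by (meson rtrancl_trans)
  qed
  then have conn: "connected_graph ?G" using r by (auto simp: connected_graph_def)
  have "\<not> is_cycle ?G c" for c
  proof
    assume c: "is_cycle ?G c"
    let ?L = "length c"
    let ?d = "depth r f"
    have L: "?L \<ge> 3" "distinct c" and ed: "\<And>i. i < ?L \<Longrightarrow> {c ! i, c ! ((i + 1) mod ?L)} \<in> ?T"
      using c by (auto simp: is_cycle_def)
    have "Max (?d ` set c) \<in> ?d ` set c" using L by (intro Max_in) auto
    then obtain i where i: "i < ?L" "?d (c ! i) = Max (?d ` set c)" by (auto simp: in_set_conv_nth)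
    have mx: "?d (c ! j) \<le> ?d (c ! i)" if "j < ?L" for j using that i by simp
    have nb: "y = f x" if xy: "{x, y} \<in> ?T" and le: "?d y \<le> ?d x" for x y
    proof -
      obtain w where w: "w \<in> V" "w \<noteq> r" "{x, y} = {w, f w}" using xy by (auto simp: map_edges_def)
      then consider "w = x" "y = f x" | "w = y" "x = f y" by (auto simp: doubleton_eq_iff)
      then show ?thesis
      proof cases
        case 2
        then show ?thesis using depth_step[OF f w(1,2)] le by simp
      qed
    qed
    \<comment> \<open>The cyclic successor and predecessor of \<open>i\<close>; they are different
      positions because a cycle has length at least three.\<close>
    let ?s = "(i + 1) mod ?L" and ?p = "(i + ?L - 1) mod ?L"
    have "?L > 0" using L by linarith
    then have lt: "?s < ?L" "?p < ?L" by (rule mod_less_divisor)+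
    have "(?p + 1) mod ?L = (i + ?L - 1 + 1) mod ?L" by (rule mod_add_left_eq)
    also have "i + ?L - 1 + 1 = i + ?L" using L by linarith
    finally have ps: "(?p + 1) mod ?L = i" using i by simp
    have "c ! ?s = f (c ! i)" using nb[OF ed[OF i(1)]] mx[OF lt(1)] by simp
    moreover have "c ! ?p = f (c ! i)"
      using nb[of "c ! i" "c ! ?p"] ed[OF lt(2)] mx[OF lt(2)] unfolding ps by (simp add: insert_commute)
    ultimately have "?s = ?p" using L lt by (metis nth_eq_iff_index_eq)
    moreover have "?s = (if i + 1 = ?L then 0 else i + 1)"
    proof (cases "i + 1 = ?L")
      case False
      then have "i + 1 < ?L" using i by linarith
      then show ?thesis using False by (simp only: mod_less if_False)
    qed simp
    moreover have "?p = (if i = 0 then ?L - 1 else i - 1)"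
    proof (cases "i = 0")
      case True
      then show ?thesis using L by simp
    next
      case False
      then have "i + ?L - 1 = (i - 1) + ?L" by linarith
      then have "?p = (i - 1) mod ?L" by (simp only: mod_add_self2)
      then show ?thesis using False i by simp
    qed
    ultimately show False using i L by (simp split: if_splits)
  qed
  then show "tree ?G" using conn by (simp add: tree_def)
qed

lemma rtrancl_distinct_path:
  assumes "(a, b) \<in> S\<^sup>*"
  shows "\<exists>p. p \<noteq> [] \<and> hd p = a \<and> last p = b \<and> distinct p \<and> (\<forall>i. Suc i < length p \<longrightarrow> (p ! i, p ! Suc i) \<in> S)"
  using assms
proof (induction rule: rtrancl_induct)
  case base
  show ?case by (intro exI[of _ "[a]"]) auto
next
  case (step b c)
  then obtain p where p: "p \<noteq> []" "hd p = a" "last p = b" "distinct p" "\<And>i. Suc i < length p \<Longrightarrow> (p ! i, p ! Suc i) \<in> S"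
    by blast
  show ?case
  proof (cases "c \<in> set p")
    case True
    then obtain j where j: "j < length p" "p ! j = c" by (auto simp: in_set_conv_nth)
    let ?q = "take (Suc j) p"
    have "last ?q = c" using j by (simp add: take_Suc_conv_app_nth)
    moreover have "hd ?q = a" using p by (simp add: hd_take)
    ultimately show ?thesis using p j by (intro exI[of _ ?q]) auto
  next
    case False
    let ?q = "p @ [c]"
    have "(?q ! i, ?q ! Suc i) \<in> S" if "Suc i < length ?q" for i
    proof (cases "Suc i < length p")
      case True
      then show ?thesis using p(5)[of i] by (simp add: nth_append)
    next
      case False
      then have "Suc i = length p" using that by simp
      then have "i = length p - 1" "?q ! Suc i = c" by (simp_all add: nth_append)
      then have "?q ! i = b" using p(1,3) by (simp add: nth_append last_conv_nth)
      then show ?thesis using step.hyps(2) \<open>?q ! Suc i = c\<close> by simp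
    qed
    then show ?thesis using p False by (intro exI[of _ ?q]) auto
  qed
qed

lemma tree_map_edges:
  assumes r: "r \<in> V" and T: "T \<subseteq> E" "tree \<lparr> verts = V, edges = T \<rparr>"
  shows "\<exists>f\<in>rmaps V E r. map_edges V r f = T"
proof -
  let ?R = "{(x, y). {x, y} \<in> T}"
  have conn: "(u, v) \<in> ?R\<^sup>*" if "u \<in> V" "v \<in> V" for u v
    using T(2) that by (auto simp: tree_def connected_graph_def)
  have acyc: "\<not> is_cycle \<lparr> verts = V, edges = T \<rparr> c" for c using T(2) by (auto simp: tree_def)
  define d where "d v = (LEAST n. (v, r) \<in> ?R ^^ n)" for v
  have dex: "(v, r) \<in> ?R ^^ d v" if "v \<in> V" for v
  proof -
    have "\<exists>n. (v, r) \<in> ?R ^^ n" using conn[OF that r] by (simp add: rtrancl_imp_relpow)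
    then show ?thesis unfolding d_def by (rule LeastI_ex)
  qed
  have step: "\<exists>w. (v, w) \<in> ?R \<and> d w < d v" if v: "v \<in> V" "v \<noteq> r" for v
  proof -
    obtain n where n: "d v = Suc n" using dex[OF v(1)] v(2) by (cases "d v") auto
    have "(v, r) \<in> ?R ^^ Suc n" using dex[OF v(1)] unfolding n .
    then obtain w where w: "(v, w) \<in> ?R" "(w, r) \<in> ?R ^^ n" using relpow_Suc_D2 by meson
    then have "d w \<le> n" unfolding d_def by (intro Least_le)
    then show ?thesis using w n by auto
  qed
  define f where "f v = (if v \<in> V \<and> v \<noteq> r then SOME w. (v, w) \<in> ?R \<and> d w < d v else v)" for v
  have f: "{v, f v} \<in> T" "d (f v) < d v" if "v \<in> V" "v \<noteq> r" for v
    using someI_ex[OF step[OF that]] that by (auto simp: f_def)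
  have reach: "\<exists>k. (f ^^ k) v = r" if "v \<in> V" for v
    using that
  proof (induction "d v" arbitrary: v rule: less_induct)
    case less
    show ?case
    proof (cases "v = r")
      case True
      then show ?thesis by (intro exI[of _ 0]) simp
    next
      case False
      have "f v \<in> V" using f(1)[OF less.prems False] T(1) edge_in_V[of v "f v"] by blast
      then obtain k where "(f ^^ k) (f v) = r" using less.hyps[OF f(2)[OF less.prems False]] by blast
      then have "(f ^^ Suc k) v = r" by (simp add: funpow_swap1)
      then show ?thesis by blast
    qed
  qed
  have fR: "f \<in> rmaps V E r"
    using f reach T(1) by (auto simp: rmaps_def f_def)
  have sub: "map_edges V r f \<subseteq> T" using f by (auto simp: map_edges_def)
  have "T \<subseteq> map_edges V r f"
  proof
    fix e assume e: "e \<in> T"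
    have "card e = 2" using e T(1) wf by (auto simp: wf_edges_def)
    then obtain a b where ab: "e = {a, b}" "a \<noteq> b" by (auto simp: card_2_iff)
    have abV: "a \<in> V" "b \<in> V" using edge_in_V[of a b] ab e T(1) by auto
    show "e \<in> map_edges V r f"
    proof (rule ccontr)
      assume ne: "e \<notin> map_edges V r f"
      let ?S = "{(x, y). {x, y} \<in> map_edges V r f}"
      have "(a, b) \<in> ?S\<^sup>*"
        using map_edges_tree(2)[OF fR r] abV by (auto simp: tree_def connected_graph_def)
      from rtrancl_distinct_path[OF this] obtain p where P: "p \<noteq> [] \<and> hd p = a \<and> last p = b \<and> distinct p \<and>
        (\<forall>i. Suc i < length p \<longrightarrow> (p ! i, p ! Suc i) \<in> ?S)" by (elim exE)
      then have p: "p \<noteq> []" "hd p = a" "last p = b" "distinct p"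
        "\<And>i. Suc i < length p \<Longrightarrow> (p ! i, p ! Suc i) \<in> ?S" by (simp_all only: simp_thms)
      \<comment> \<open>The path joins two different vertices by edges of the map, and
        \<open>e\<close> is not among these; so it has at least three vertices and closes to a cycle
        in \<open>T\<close>.\<close>
      have l1: "length p \<noteq> 1"
      proof
        assume "length p = 1"
        then obtain x where "p = [x]" by (auto simp: length_Suc_conv)
        then show False using p ab by simp
      qed
      have l2: "length p \<noteq> 2"
      proof
        assume "length p = 2"
        then obtain x y where "p = [x, y]" by (auto simp: length_Suc_conv numeral_2_eq_2)
        then show False using p(2,3) p(5)[of 0] ne ab by simp
      qed
      have l0: "length p \<noteq> 0" using p(1) by simp
      have l3: "length p \<ge> 3" using l0 l1 l2 by linarith
      have "{p ! i, p ! ((i + 1) mod length p)} \<in> T" if i: "i < length p" for i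
      proof (cases "Suc i < length p")
        case True
        then show ?thesis using p(5)[of i] sub by auto
      next
        case False
        then have "i + 1 = length p" using i by linarith
        then have "i = length p - 1" "(i + 1) mod length p = 0" by simp_all
        then have "p ! i = b" "p ! ((i + 1) mod length p) = a"
          using p(1-3) by (simp_all add: last_conv_nth hd_conv_nth)
        then show ?thesis using e ab by (simp add: insert_commute)
      qed
      then have "is_cycle \<lparr> verts = V, edges = T \<rparr> p" using l3 p(4) by (simp add: is_cycle_def)
      then show False using acyc by blast
    qed
  qed
  then show ?thesis using fR sub by auto
qed

lemma card_rmaps:
  assumes r: "r \<in> V"
  shows "card (rmaps V E r) = card {T. T \<subseteq> E \<and> tree \<lparr> verts = V, edges = T \<rparr>}"
proof (rule bij_betw_same_card[of "map_edges V r"])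
  show "bij_betw (map_edges V r) (rmaps V E r) {T. T \<subseteq> E \<and> tree \<lparr> verts = V, edges = T \<rparr>}"
    unfolding bij_betw_def
  proof
    show "inj_on (map_edges V r) (rmaps V E r)" using map_edges_inj by (auto intro: inj_onI)
    show "map_edges V r ` rmaps V E r = {T. T \<subseteq> E \<and> tree \<lparr> verts = V, edges = T \<rparr>}"
      using map_edges_tree[OF _ r] tree_map_edges[OF r] by (auto simp: image_iff) blast+
  qed
qed

lemma rmaps_root:
  assumes "f \<in> rmaps V E r" "v \<in> V" "f v = v" shows "v = r"
proof (rule ccontr)
  assume "v \<noteq> r"
  then have "{v, f v} \<in> E" using assms(1,2) by (auto simp: rmaps_def)
  then show False using edge_neq assms(3) by metis
qed

end

section \<open>The matrix-tree theorem\<close>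

definition reaches :: "(nat \<Rightarrow> nat) \<Rightarrow> nat \<Rightarrow> bool" where
  "reaches f i \<longleftrightarrow> (\<exists>k. f ((f ^^ k) i) = (f ^^ k) i)"

lemma reaches_step: "reaches f (f i) \<longleftrightarrow> reaches f i"
proof
  assume "reaches f (f i)"
  then obtain k where "f ((f ^^ k) (f i)) = (f ^^ k) (f i)" by (auto simp: reaches_def)
  then have "f ((f ^^ Suc k) i) = (f ^^ Suc k) i" by (simp add: funpow_swap1)
  then show "reaches f i" unfolding reaches_def by blast
next
  assume "reaches f i"
  then obtain k where k: "f ((f ^^ k) i) = (f ^^ k) i" by (auto simp: reaches_def)
  then have "f ((f ^^ k) (f i)) = (f ^^ k) (f i)" by (metis funpow_swap1)
  then show "reaches f (f i)" unfolding reaches_def by blast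
qed

text \<open>Expanding the determinant of \<open>x + L\<close> row by row yields one such matrix for each self-map \<open>f\<close>;
  the fixed points of \<open>f\<close> record the rows contributing \<open>x\<close>.\<close>

definition fun_mat :: "nat \<Rightarrow> (nat \<Rightarrow> nat) \<Rightarrow> complex mat" where
  "fun_mat n f = Matrix.mat n n (\<lambda>(i, j). of_bool (j = i) - of_bool (f i \<noteq> i \<and> j = f i))"

lemma fun_mat_carrier: "fun_mat n f \<in> carrier_mat n n" by (simp add: fun_mat_def)

text \<open>If every vertex reaches a fixed point, a nontrivial permutation with nonzero Leibniz
  term would have to follow \<open>f\<close> around an orbit that avoids fixed points, so only the
  identity contributes. Otherwise the indicator of the vertices that reach no fixed point lies in
  the kernel.\<close>

lemma det_fun_mat:
  assumes f: "\<And>i. i < n \<Longrightarrow> f i < n"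
  shows "Determinant.det (fun_mat n f) = of_bool (\<forall>i<n. reaches f i)"
proof (cases "\<forall>i<n. reaches f i")
  case True
  let ?t = "\<lambda>p. of_int (sign p) * (\<Prod>i = 0..<n. fun_mat n f $$ (i, p i))"
  have zero: "?t p = 0" if p: "p permutes {0..<n}" "p \<noteq> id" for p
  proof (rule ccontr)
    assume "?t p \<noteq> 0"
    then have nz: "fun_mat n f $$ (i, p i) \<noteq> 0" if "i < n" for i using that by auto
    have pn: "p i < n" if "i < n" for i using permutes_in_image[OF p(1), of i] that by simp
    have pi: "p i = i \<or> p i = f i" if "i < n" for i
      using nz[OF that] that pn[OF that] by (auto simp: fun_mat_def split: if_splits)
    obtain i where i: "p i \<noteq> i" using p(2) by (auto simp: fun_eq_iff)
    then have "i < n" using p(1) by (metis atLeastLessThan_iff permutes_not_in zero_le)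
    have inj: "inj p" using permutes_inj[OF p(1)] .
    have pk: "(p ^^ k) i < n" for k by (induction k) (use \<open>i < n\<close> pn in auto)
    have mv: "p ((p ^^ k) i) \<noteq> (p ^^ k) i" for k
      using i inj_fn[OF inj, of k] by (metis funpow_swap1 injD)
    have eqk: "(p ^^ k) i = (f ^^ k) i" for k
    proof (induction k)
      case (Suc k)
      then show ?case using pi[OF pk[of k]] mv[of k] by auto
    qed simp
    obtain k where "f ((f ^^ k) i) = (f ^^ k) i" using True \<open>i < n\<close> by (auto simp: reaches_def)
    then have "(p ^^ Suc k) i = (p ^^ k) i" unfolding eqk by simp
    then show False using mv[of k] by simp
  qed
  have "Determinant.det (fun_mat n f) = (\<Sum>p\<in>{p. p permutes {0..<n}}. ?t p)"
    by (rule det_def'[OF fun_mat_carrier])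
  also have "\<dots> = (\<Sum>p\<in>{id}. ?t p)"
    by (intro sum.mono_neutral_right) (auto simp: finite_permutations permutes_id zero)
  also have "\<dots> = (\<Prod>i = 0..<n. fun_mat n f $$ (i, i))" by (simp add: sign_id)
  also have "\<dots> = 1" by (intro prod.neutral) (auto simp: fun_mat_def)
  finally show ?thesis using True by simp
next
  case False
  let ?y = "Matrix.vec n (\<lambda>j. of_bool (\<not> reaches f j)) :: complex Matrix.vec"
  have "?y \<noteq> 0\<^sub>v n"
  proof -
    obtain i where i: "i < n" "\<not> reaches f i" using False by auto
    then have "?y $ i \<noteq> 0\<^sub>v n $ i" by simp
    then show ?thesis by metis
  qed
  moreover have "fun_mat n f *\<^sub>v ?y = 0\<^sub>v n"
  proof
    fix i assume "i < dim_vec (0\<^sub>v n :: complex Matrix.vec)"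
    then have i: "i < n" by simp
    have "(fun_mat n f *\<^sub>v ?y) $ i = (\<Sum>j = 0..<n. fun_mat n f $$ (i, j) * ?y $ j)"
      using i by (simp add: fun_mat_def scalar_prod_def)
    also have "\<dots> = (\<Sum>j = 0..<n. (if j = i then of_bool (\<not> reaches f j) else 0) -
        (if j = f i then (if f i \<noteq> i then of_bool (\<not> reaches f j) else 0) else 0))"
      using i by (intro sum.cong) (auto simp: fun_mat_def)
    also have "\<dots> = of_bool (\<not> reaches f i) - (if f i \<noteq> i then of_bool (\<not> reaches f (f i)) else 0)"
      using i f[OF i] by (simp add: sum_subtractf)
    also have "\<dots> = 0"
    proof (cases "f i = i")
      case True
      then have "reaches f i" unfolding reaches_def by (intro exI[of _ 0]) simp
      then show ?thesis using True by simp
    next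
      case False
      then show ?thesis by (simp add: reaches_step)
    qed
    finally show "(fun_mat n f *\<^sub>v ?y) $ i = 0\<^sub>v n $ i" using i by simp
  qed (simp add: fun_mat_def)
  ultimately have "Determinant.det (fun_mat n f) = 0"
    unfolding det_0_iff_vec_prod_zero[OF fun_mat_carrier] by (intro exI[of _ ?y]) auto
  then show ?thesis using False by simp
qed

text \<open>The graph Laplacian plus \<open>x\<close> times the identity; the powers of
  \<open>x\<close> will count the roots of a forest.\<close>

definition lap_mat :: "nat \<Rightarrow> (nat \<Rightarrow> nat \<Rightarrow> bool) \<Rightarrow> complex \<Rightarrow> complex mat" where
  "lap_mat n adj x = Matrix.mat n n (\<lambda>(i, j). if i = j then x + of_nat (card {k. k < n \<and> adj i k}) else - of_bool (adj i j))"

definition forests :: "nat \<Rightarrow> (nat \<Rightarrow> nat \<Rightarrow> bool) \<Rightarrow> (nat \<Rightarrow> nat) set" where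
  "forests n adj = {f. (\<forall>i<n. f i < n \<and> (f i = i \<or> adj i (f i)) \<and> reaches f i) \<and> (\<forall>i. \<not> i < n \<longrightarrow> f i = i)}"

lemma finite_self_maps: "finite {f. (\<forall>i\<in>{0..<n::nat}. f i \<in> {0..<n}) \<and> (\<forall>i. i \<notin> {0..<n} \<longrightarrow> f i = i)}"
proof -
  let ?A = "{f. (\<forall>i\<in>{0..<n::nat}. f i \<in> {0..<n}) \<and> (\<forall>i. i \<notin> {0..<n} \<longrightarrow> f i = i)}"
  have "inj_on (\<lambda>f. restrict f {0..<n}) ?A"
  proof (rule inj_onI)
    fix f g assume a: "f \<in> ?A" "g \<in> ?A" "restrict f {0..<n} = restrict g {0..<n}"
    show "f = g"
    proof
      fix i show "f i = g i" using a(1,2) fun_cong[OF a(3), of i] by (cases "i < n") auto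
    qed
  qed
  moreover have "(\<lambda>f. restrict f {0..<n}) ` ?A \<subseteq> {0..<n} \<rightarrow>\<^sub>E {0..<n}" by (auto simp: PiE_iff extensional_def)
  ultimately show ?thesis using finite_PiE[of "{0..<n}" "\<lambda>_. {0..<n}"] by (auto intro: inj_on_finite)
qed

text \<open>Row \<open>i\<close> is \<open>x\<close> times a unit vector plus the sum of the
  differences \<open>e_i - e_k\<close> over the neighbours \<open>k\<close>. Multilinearity chooses
  one summand per row, hence a self-map, whose determinant is \<open>1\<close> for a rooted forest
  and \<open>0\<close> otherwise.\<close>

lemma det_lap_mat:
  assumes irr: "\<And>i. \<not> adj i i"
  shows "Determinant.det (lap_mat n adj x) = (\<Sum>f\<in>forests n adj. x ^ card {i. i < n \<and> f i = i})"
proof -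
  \<comment> \<open>The choice \<open>k = i\<close> stands for the diagonal term and carries the
    weight \<open>x\<close>; any other \<open>k\<close> stands for the edge to
    \<open>k\<close>.\<close>
  define c where "c i k = (if k = i then x else of_bool (adj i k))" for i k
  define a where "a i k = Matrix.vec n (\<lambda>j. of_bool (j = i) - of_bool (k \<noteq> i \<and> j = k) :: complex)" for i k
  let ?F = "{f. (\<forall>i\<in>{0..<n}. f i \<in> {0..<n}) \<and> (\<forall>i. i \<notin> {0..<n} \<longrightarrow> f i = i)}"
  have "lap_mat n adj x = mat\<^sub>r n n (\<lambda>i. finsum_vec TYPE(complex) n (\<lambda>k. c i k \<cdot>\<^sub>v a i k) {0..<n})"
  proof (rule eq_matI)
    fix i j assume ij: "i < dim_row (mat\<^sub>r n n (\<lambda>i. finsum_vec TYPE(complex) n (\<lambda>k. c i k \<cdot>\<^sub>v a i k) {0..<n}))"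
      "j < dim_col (mat\<^sub>r n n (\<lambda>i. finsum_vec TYPE(complex) n (\<lambda>k. c i k \<cdot>\<^sub>v a i k) {0..<n}))"
    then have i: "i < n" and j: "j < n" by auto
    have "mat\<^sub>r n n (\<lambda>i. finsum_vec TYPE(complex) n (\<lambda>k. c i k \<cdot>\<^sub>v a i k) {0..<n}) $$ (i, j)
      = (\<Sum>k = 0..<n. (c i k \<cdot>\<^sub>v a i k) $ j)"
    proof -
      have ac: "(\<lambda>k. c i k \<cdot>\<^sub>v a i k) \<in> {0..<n} \<rightarrow> carrier_vec n" by (auto simp: a_def)
      show ?thesis by (simp add: i j index_finsum_vec[OF finite_atLeastLessThan j ac])
    qed
    also have "\<dots> = (\<Sum>k = 0..<n. (if j = i then c i k else 0) - (if k = j then (if k \<noteq> i then c i k else 0) else 0))"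
      using j by (intro sum.cong) (auto simp: a_def)
    also have "\<dots> = (if j = i then (\<Sum>k = 0..<n. c i k) else 0) - (if j \<noteq> i then c i j else 0)"
      using j by (simp add: sum_subtractf)
    also have "(\<Sum>k = 0..<n. c i k) = (\<Sum>k = 0..<n. (if k = i then x else 0) + of_bool (adj i k))"
      using irr by (intro sum.cong) (auto simp: c_def)
    also have "\<dots> = x + of_nat (card {k. k < n \<and> adj i k})"
      using i by (simp add: sum.distrib of_bool_def sum.If_cases Int_def)
    finally show "lap_mat n adj x $$ (i, j) =
      mat\<^sub>r n n (\<lambda>i. finsum_vec TYPE(complex) n (\<lambda>k. c i k \<cdot>\<^sub>v a i k) {0..<n}) $$ (i, j)"
      using i j by (auto simp: lap_mat_def c_def)
  qed (simp_all add: lap_mat_def)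
  then have "Determinant.det (lap_mat n adj x) = (\<Sum>f\<in>?F. Determinant.det (mat\<^sub>r n n (\<lambda>i. c i (f i) \<cdot>\<^sub>v a i (f i))))"
    by (simp only:) (rule det_linear_rows_sum, auto simp: a_def)
  also have "\<dots> = (\<Sum>f\<in>?F. (\<Prod>i = 0..<n. c i (f i)) * of_bool (\<forall>i<n. reaches f i))"
  proof (rule sum.cong[OF refl])
    fix f assume f: "f \<in> ?F"
    have "mat\<^sub>r n n (\<lambda>i. a i (f i)) = fun_mat n f"
      by (rule eq_matI) (auto simp: a_def fun_mat_def)
    moreover have "Determinant.det (mat\<^sub>r n n (\<lambda>i. c i (f i) \<cdot>\<^sub>v a i (f i))) =
      (\<Prod>i = 0..<n. c i (f i)) * Determinant.det (mat\<^sub>r n n (\<lambda>i. a i (f i)))"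
      by (rule det_rows_mul[of "\<lambda>i. a i (f i)" n "\<lambda>i. c i (f i)"]) (auto simp: a_def)
    ultimately show "Determinant.det (mat\<^sub>r n n (\<lambda>i. c i (f i) \<cdot>\<^sub>v a i (f i))) =
      (\<Prod>i = 0..<n. c i (f i)) * of_bool (\<forall>i<n. reaches f i)"
      using f by (simp add: det_fun_mat)
  qed
  also have "\<dots> = (\<Sum>f\<in>forests n adj. (\<Prod>i = 0..<n. c i (f i)) * of_bool (\<forall>i<n. reaches f i))"
  proof (rule sum.mono_neutral_right[OF finite_self_maps])
    show "forests n adj \<subseteq> ?F" by (auto simp: forests_def)
    show "\<forall>f\<in>?F - forests n adj. (\<Prod>i = 0..<n. c i (f i)) * of_bool (\<forall>i<n. reaches f i) = 0"
    proof
      fix f assume f: "f \<in> ?F - forests n adj"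
      show "(\<Prod>i = 0..<n. c i (f i)) * of_bool (\<forall>i<n. reaches f i) = 0"
      proof (cases "\<forall>i<n. reaches f i")
        case True
        then obtain i where "i < n" "f i \<noteq> i" "\<not> adj i (f i)" using f by (auto simp: forests_def)
        then have "c i (f i) = 0" by (simp add: c_def)
        then show ?thesis using \<open>i < n\<close> by (auto intro!: prod_zero bexI[of _ i])
      qed simp
    qed
  qed
  also have "\<dots> = (\<Sum>f\<in>forests n adj. x ^ card {i. i < n \<and> f i = i})"
  proof (rule sum.cong[OF refl])
    fix f assume f: "f \<in> forests n adj"
    have "(\<Prod>i = 0..<n. c i (f i)) = (\<Prod>i = 0..<n. if f i = i then x else 1)"
      using f by (intro prod.cong) (auto simp: c_def forests_def)
    also have "\<dots> = x ^ card {i. i < n \<and> f i = i}" by (simp add: prod.If_cases Int_def)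
    finally show "(\<Prod>i = 0..<n. c i (f i)) * of_bool (\<forall>i<n. reaches f i) = x ^ card {i. i < n \<and> f i = i}"
      using f by (simp add: forests_def)
  qed
  finally show ?thesis .
qed

text \<open>Orthogonality shows that \<open>W\<close> has nonzero determinant, and
  \<open>A * W = W * D\<close> with \<open>D\<close> diagonal then forces the determinants of
  \<open>A\<close> and \<open>D\<close> to agree.\<close>

lemma det_eigenbasis:
  fixes A W W' :: "complex mat"
  assumes A: "A \<in> carrier_mat n n" and W: "W \<in> carrier_mat n n" and W': "W' \<in> carrier_mat n n"
    and eig: "\<And>i k. i < n \<Longrightarrow> k < n \<Longrightarrow> (\<Sum>j<n. A $$ (i, j) * W $$ (j, k)) = \<mu> k * W $$ (i, k)"
    and orth: "\<And>i k. i < n \<Longrightarrow> k < n \<Longrightarrow> (\<Sum>j<n. W' $$ (i, j) * W $$ (j, k)) = (if i = k then c else 0)"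
    and c: "c \<noteq> 0"
  shows "Determinant.det A = (\<Prod>k<n. \<mu> k)"
proof -
  define D where "D = Matrix.mat n n (\<lambda>(i, j). if i = j then \<mu> j else 0)"
  have D: "D \<in> carrier_mat n n" by (simp add: D_def)
  have AW: "A * W = W * D"
  proof (rule eq_matI)
    fix i k assume "i < dim_row (W * D)" "k < dim_col (W * D)"
    then have ik: "i < n" "k < n" using W D by auto
    have "(A * W) $$ (i, k) = \<mu> k * W $$ (i, k)"
      using eig[OF ik] ik A W by (simp add: scalar_prod_def lessThan_atLeast0)
    also have "\<dots> = (\<Sum>j = 0..<n. W $$ (i, j) * (if j = k then \<mu> k else 0))" using ik by (simp add: if_distrib cong: if_cong)
    also have "\<dots> = (W * D) $$ (i, k)" using ik W by (simp add: scalar_prod_def D_def)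
    finally show "(A * W) $$ (i, k) = (W * D) $$ (i, k)" .
  qed (use A W D in auto)
  have "W' * W = c \<cdot>\<^sub>m 1\<^sub>m n"
  proof (rule eq_matI)
    fix i k assume "i < dim_row (c \<cdot>\<^sub>m 1\<^sub>m n)" "k < dim_col (c \<cdot>\<^sub>m 1\<^sub>m n)"
    then have ik: "i < n" "k < n" by auto
    then show "(W' * W) $$ (i, k) = (c \<cdot>\<^sub>m 1\<^sub>m n) $$ (i, k)"
      using orth[OF ik] W W' by (simp add: scalar_prod_def lessThan_atLeast0)
  qed (use W W' in auto)
  then have "Determinant.det W' * Determinant.det W = c ^ n"
    using det_mult[OF W' W] by (simp add: det_one)
  then have W0: "Determinant.det W \<noteq> 0" using c by auto
  have "Determinant.det A * Determinant.det W = Determinant.det W * Determinant.det D"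
    by (metis det_mult[OF A W] det_mult[OF W D] AW)
  then have "Determinant.det A = Determinant.det D" using W0 by simp
  also have "\<dots> = prod_list (diag_mat D)"
    by (rule det_upper_triangular[OF _ D]) (auto simp: upper_triangular_def D_def)
  also have "\<dots> = (\<Prod>k<n. \<mu> k)" by (simp add: prod_list_diag_prod D_def lessThan_atLeast0)
  finally show ?thesis .
qed

text \<open>A forest with one fixed point is a spanning tree directed to that point, read through
  the numbering \<open>h\<close>. The root is free, which accounts for the factor
  \<open>card V\<close>.\<close>

lemma (in finite_graph) card_single_root_forests:
  assumes h: "bij_betw h {..<n} V"
  defines "adj \<equiv> (\<lambda>i j. i < n \<and> j < n \<and> {h i, h j} \<in> E)"
  shows "card {f \<in> forests n adj. card {i. i < n \<and> f i = i} = 1}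
    = card V * card {T. T \<subseteq> E \<and> tree \<lparr> verts = V, edges = T \<rparr>}"
proof -
  let ?F = "{f \<in> forests n adj. card {i. i < n \<and> f i = i} = 1}"
  let ?g = "the_inv_into {..<n} h"
  have hV: "h i \<in> V" if "i < n" for i using h that by (auto simp: bij_betw_def)
  have hg: "h (?g v) = v" if "v \<in> V" for v using h that by (simp add: f_the_inv_into_f_bij_betw)
  have gn: "?g v < n" if "v \<in> V" for v using bij_betw_the_inv_into[OF h] that by (auto simp: bij_betw_def)
  have gh: "?g (h i) = i" if "i < n" for i using h that by (simp add: the_inv_into_f_f bij_betw_def)
  have hinj: "h i = h j \<Longrightarrow> i < n \<Longrightarrow> j < n \<Longrightarrow> i = j" for i j using gh by metis
  define \<Phi> where "\<Phi> f v = (if v \<in> V then h (f (?g v)) else v)" for f v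
  define \<Psi> where "\<Psi> F i = (if i < n then ?g (F (h i)) else i)" for F i
  have \<Phi>: "\<Phi> f \<in> (\<Union>r\<in>V. rmaps V E r)" "\<Psi> (\<Phi> f) = f" if f: "f \<in> ?F" for f
  proof -
    have fn: "f i < n" "f i = i \<or> adj i (f i)" "reaches f i" if "i < n" for i using f that by (auto simp: forests_def)
    have fo: "f i = i" if "\<not> i < n" for i using f that by (auto simp: forests_def)
    obtain i0 where i0: "{i. i < n \<and> f i = i} = {i0}" using f by (auto simp: card_1_singleton_iff)
    then have i0n: "i0 < n" "f i0 = i0" by auto
    have uniq: "i = i0" if "i < n" "f i = i" for i using i0 that by auto
    have pk: "(f ^^ k) i < n" if "i < n" for i k by (induction k) (use that fn(1) in auto)
    have it: "(\<Phi> f ^^ k) (h i) = h ((f ^^ k) i)" if "i < n" for i k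
      by (induction k) (use pk[OF that] hV gh in \<open>auto simp: \<Phi>_def\<close>)
    have "\<Phi> f \<in> rmaps V E (h i0)" unfolding rmaps_def
    proof (intro CollectI conjI allI ballI impI)
      fix v assume "v \<notin> V \<or> v = h i0"
      then show "\<Phi> f v = v" using i0n gh by (auto simp: \<Phi>_def)
    next
      fix v assume v: "v \<in> V - {h i0}"
      then have "?g v \<noteq> i0" using hg by auto
      then have "f (?g v) \<noteq> ?g v" using uniq gn v by auto
      then have "adj (?g v) (f (?g v))" using fn(2) gn v by auto
      then show "{v, \<Phi> f v} \<in> E" using v hg by (auto simp: adj_def \<Phi>_def)
    next
      fix v assume v: "v \<in> V"
      obtain k where "f ((f ^^ k) (?g v)) = (f ^^ k) (?g v)" using fn(3)[OF gn[OF v]] by (auto simp: reaches_def)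
      then have "(f ^^ k) (?g v) = i0" using uniq pk[OF gn[OF v]] by blast
      then have "(\<Phi> f ^^ k) v = h i0" using it[OF gn[OF v], of k] hg[OF v] by simp
      then show "\<exists>k. (\<Phi> f ^^ k) v = h i0" by blast
    qed
    then show "\<Phi> f \<in> (\<Union>r\<in>V. rmaps V E r)" using hV i0n by blast
    show "\<Psi> (\<Phi> f) = f"
      using hV gh fn(1) fo by (auto simp: \<Psi>_def \<Phi>_def fun_eq_iff)
  qed
  have \<Psi>: "\<Psi> F \<in> ?F" "\<Phi> (\<Psi> F) = F" if FR: "F \<in> (\<Union>r\<in>V. rmaps V E r)" for F
  proof -
    obtain r where r: "r \<in> V" "F \<in> rmaps V E r" using FR by blast
    have Fo: "F v = v" if "v \<notin> V \<or> v = r" for v using r that by (auto simp: rmaps_def)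
    have FE: "{v, F v} \<in> E" if "v \<in> V" "v \<noteq> r" for v using r that by (auto simp: rmaps_def)
    have FV: "F v \<in> V" if "v \<in> V" for v
      using FE[OF that] edge_in_V[of v "F v"] Fo[of v] that by (cases "v = r") auto
    have Fk: "(F ^^ k) v \<in> V" if "v \<in> V" for v k by (induction k) (use that FV in auto)
    have it: "(\<Psi> F ^^ k) i = ?g ((F ^^ k) (h i))" if "i < n" for i k
    proof (induction k)
      case (Suc k)
      have "?g ((F ^^ k) (h i)) < n" "h (?g ((F ^^ k) (h i))) = (F ^^ k) (h i)"
        using gn hg Fk[OF hV[OF that]] by auto
      then show ?case using Suc by (simp add: \<Psi>_def)
    qed (use gh that in simp)
    have fix1: "{i. i < n \<and> \<Psi> F i = i} = {?g r}"
    proof (intro equalityI subsetI)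
      fix i assume "i \<in> {i. i < n \<and> \<Psi> F i = i}"
      then have i: "i < n" "?g (F (h i)) = i" by (auto simp: \<Psi>_def)
      then have "F (h i) = h i" using hg FV[OF hV[OF i(1)]] by metis
      then have "h i = r" using rmaps_root[OF r(2) hV[OF i(1)]] by simp
      then show "i \<in> {?g r}" using gh i by auto
    next
      fix i assume "i \<in> {?g r}"
      then show "i \<in> {i. i < n \<and> \<Psi> F i = i}" using gn[OF r(1)] hg[OF r(1)] Fo[of r] by (auto simp: \<Psi>_def)
    qed
    have "\<Psi> F \<in> forests n adj" unfolding forests_def
    proof (intro CollectI conjI allI impI)
      fix i assume i: "i < n"
      show "\<Psi> F i < n" using i gn FV hV by (simp add: \<Psi>_def)
      show "\<Psi> F i = i \<or> adj i (\<Psi> F i)"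
      proof (cases "h i = r")
        case True
        then have "?g (F (h i)) = i" using Fo[of "h i"] gh[OF i] by simp
        then show ?thesis using i by (simp add: \<Psi>_def)
      next
        case False
        then have "{h i, F (h i)} \<in> E" using FE hV i by blast
        then show ?thesis using i gn FV hV hg by (auto simp: adj_def \<Psi>_def)
      qed
      obtain k where k: "(F ^^ k) (h i) = r" using r(2) hV[OF i] by (auto simp: rmaps_def)
      have "(\<Psi> F ^^ k) i = ?g r" using it[OF i, of k] k by simp
      moreover have "\<Psi> F (?g r) = ?g r" using fix1 by blast
      ultimately show "reaches (\<Psi> F) i" unfolding reaches_def by (intro exI[of _ k]) simp
    next
      fix i assume "\<not> i < n" then show "\<Psi> F i = i" by (simp add: \<Psi>_def)
    qed
    then show "\<Psi> F \<in> ?F" using fix1 by simp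
    show "\<Phi> (\<Psi> F) = F"
    proof
      fix v show "\<Phi> (\<Psi> F) v = F v"
        using gn[of v] hg[of v] hg[OF FV, of v] Fo[of v] by (cases "v \<in> V") (auto simp: \<Phi>_def \<Psi>_def)
    qed
  qed
  have "card ?F = card (\<Union>r\<in>V. rmaps V E r)"
  proof (rule bij_betw_same_card[of \<Phi>])
    show "bij_betw \<Phi> ?F (\<Union>r\<in>V. rmaps V E r)"
      by (rule bij_betw_byWitness[of _ \<Psi>]) (use \<Phi> \<Psi> in auto)
  qed
  also have "\<dots> = (\<Sum>r\<in>V. card (rmaps V E r))"
  proof (rule card_UN_disjoint[OF finV])
    show "\<forall>r\<in>V. finite (rmaps V E r)"
    proof
      fix r assume r: "r \<in> V"
      have "inj_on (map_edges V r) (rmaps V E r)" using map_edges_inj by (auto intro: inj_onI)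
      moreover have "map_edges V r ` rmaps V E r \<subseteq> Pow E" using map_edges_tree(1)[OF _ r] by blast
      moreover have "finite (Pow E)" using wf by (simp add: wf_edges_def)
      ultimately show "finite (rmaps V E r)" by (rule inj_on_finite)
    qed
    show "\<forall>r\<in>V. \<forall>s\<in>V. r \<noteq> s \<longrightarrow> rmaps V E r \<inter> rmaps V E s = {}"
    proof (intro ballI impI, rule ccontr)
      fix r s assume rs: "r \<in> V" "s \<in> V" "r \<noteq> s" "rmaps V E r \<inter> rmaps V E s \<noteq> {}"
      then obtain F where F: "F \<in> rmaps V E r" "F \<in> rmaps V E s" by blast
      then have "F s = s" by (simp add: rmaps_def)
      then show False using rmaps_root[OF F(1) rs(2)] rs(3) by simp
    qed
  qed
  also have "\<dots> = card V * card {T. T \<subseteq> E \<and> tree \<lparr> verts = V, edges = T \<rparr>}"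
    by (simp add: card_rmaps)
  finally show ?thesis .
qed

section \<open>Spectrum of the product graph\<close>

lemma sum_cis_roots:
  fixes a :: int
  assumes "m > 0"
  shows "(\<Sum>u<m. cis (2 * pi * of_int a * real u / real m)) = (if int m dvd a then of_nat m else 0)"
proof -
  let ?z = "cis (2 * pi * of_int a / real m)"
  have z: "cis (2 * pi * of_int a * real u / real m) = ?z ^ u" for u
    unfolding Complex.DeMoivre by (rule arg_cong[of _ _ cis]) simp
  have zm: "?z ^ m = 1"
  proof -
    have "?z ^ m = cis (2 * pi * of_int a)" using assms by (simp add: Complex.DeMoivre)
    also have "\<dots> = 1" by (rule cis_multiple_2pi) simp
    finally show ?thesis .
  qed
  show ?thesis
  proof (cases "int m dvd a")
    case True
    then obtain b where "a = int m * b" by (elim dvdE)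
    then have "2 * pi * of_int a / real m = 2 * pi * of_int b" using assms by simp
    then have "?z = 1" using cis_multiple_2pi[of "of_int b"] by simp
    then show ?thesis unfolding z using True by simp
  next
    case False
    have "?z \<noteq> 1"
    proof
      assume "?z = 1"
      then have "cos (2 * pi * of_int a / real m) = 1" by (simp add: complex_eq_iff)
      then obtain b :: int where "2 * pi * of_int a / real m = of_int b * 2 * pi" by (auto simp: cos_one_2pi_int)
      then have "of_int a = real m * of_int b" using assms by (simp add: field_simps)
      then have "(of_int a :: real) = of_int (int m * b)" by simp
      then have "a = int m * b" by (simp only: of_int_eq_iff)
      then show False using False by simp
    qed
    then show ?thesis unfolding z using False zm by (simp add: geometric_sum)
  qed
qed

definition cell :: "nat \<Rightarrow> nat \<Rightarrow> nat \<times> nat" where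
  "cell l i = (i div l, i mod l)"

lemma bij_cell:
  assumes "l > 0" shows "bij_betw (cell l) {..<m * l} ({..<m} \<times> {..<l})"
proof (rule bij_betw_byWitness[of _ "\<lambda>(u, v). u * l + v"])
  show "(\<lambda>(u, v). u * l + v) ` ({..<m} \<times> {..<l}) \<subseteq> {..<m * l}"
  proof safe
    fix u v assume "u < m" "v < l"
    then have "u * l + v < Suc u * l" by simp
    also have "\<dots> \<le> m * l" using \<open>u < m\<close> by (intro mult_right_mono) auto
    finally show "u * l + v < m * l" .
  qed
qed (use assms in \<open>auto simp: cell_def less_mult_imp_div_less\<close>)

lemma sum_cell: "l > 0 \<Longrightarrow> (\<Sum>i<m * l. g (cell l i)) = (\<Sum>u<m. \<Sum>v<l. g (u, v))"
  using sum.reindex_bij_betw[OF bij_cell, of l g m] by (simp add: sum.cartesian_product)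

lemma prod_cell: "l > 0 \<Longrightarrow> (\<Prod>i<m * l. g (cell l i)) = (\<Prod>u<m. \<Prod>v<l. g (u, v))"
  using prod.reindex_bij_betw[OF bij_cell, of l g m] by (simp add: prod.cartesian_product)

definition chr :: "nat \<Rightarrow> nat \<Rightarrow> nat \<times> nat \<Rightarrow> nat \<times> nat \<Rightarrow> complex" where
  "chr m l = (\<lambda>(a, b) (u, v). cis (2 * pi * real a * real u / real m) * cis (2 * pi * real b * real v / real l))"

lemma chr_orth:
  assumes "m > 0" "l > 0" "a < m" "a' < m" "b < l" "b' < l"
  shows "(\<Sum>u<m. \<Sum>v<l. cnj (chr m l (a, b) (u, v)) * chr m l (a', b') (u, v)) =
    (if (a, b) = (a', b') then of_nat (m * l) else 0)"
proof -
  have "cnj (chr m l (a, b) (u, v)) * chr m l (a', b') (u, v) =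
    cis (2 * pi * of_int (int a' - int a) * real u / real m) * cis (2 * pi * of_int (int b' - int b) * real v / real l)" for u v
  proof -
    have 1: "2 * pi * of_int (int a' - int a) * real u / real m = - (2 * pi * real a * real u / real m) + 2 * pi * real a' * real u / real m"
      by (simp add: field_simps diff_divide_distrib)
    have 2: "2 * pi * of_int (int b' - int b) * real v / real l = - (2 * pi * real b * real v / real l) + 2 * pi * real b' * real v / real l"
      by (simp add: field_simps diff_divide_distrib)
    show ?thesis unfolding 1 2 cis_mult[symmetric] by (simp add: chr_def cis_cnj mult_ac)
  qed
  then have "(\<Sum>u<m. \<Sum>v<l. cnj (chr m l (a, b) (u, v)) * chr m l (a', b') (u, v)) =
    (\<Sum>u<m. cis (2 * pi * of_int (int a' - int a) * real u / real m)) * (\<Sum>v<l. cis (2 * pi * of_int (int b' - int b) * real v / real l))"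
    by (simp add: sum_product)
  moreover have "int m dvd int a' - int a \<longleftrightarrow> a = a'" using assms
    by (metis dvd_0_right eq_iff_diff_eq_0 mod_eq_dvd_iff mod_less nat_int_comparison(1) of_nat_mod)
  moreover have "int l dvd int b' - int b \<longleftrightarrow> b = b'" using assms
    by (metis dvd_0_right eq_iff_diff_eq_0 mod_eq_dvd_iff mod_less nat_int_comparison(1) of_nat_mod)
  ultimately show ?thesis
    unfolding sum_cis_roots[OF assms(1)] sum_cis_roots[OF assms(2)] by simp
qed

text \<open>The Laplacian eigenvalues of a Cartesian product are sums of those of the factors:
  \<open>0\<close> or \<open>m\<close> from the complete graph, and \<open>2 - 2 cos\<close> from
  the cycle.\<close>

definition lapeig :: "nat \<Rightarrow> nat \<Rightarrow> nat \<times> nat \<Rightarrow> real" where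
  "lapeig m l = (\<lambda>(a, b). (if a = 0 then 0 else real m) + 2 - 2 * cos (2 * pi * real b / real l))"

abbreviation (input) kc_box :: "nat \<Rightarrow> nat \<Rightarrow> (nat \<times> nat) ugraph" where
  "kc_box m l \<equiv> complete_graph m \<box> cycle_graph l"

definition prd :: "nat \<Rightarrow> nat \<Rightarrow> nat" where
  "prd l v = (if v = 0 then l - 1 else v - 1)"

lemma prd_unique:
  assumes "w < l" shows "prd l ((w + 1) mod l) = w"
proof (cases "w + 1 = l")
  case False
  then have "(w + 1) mod l = w + 1" using assms by (intro mod_less) simp
  then show ?thesis by (simp add: prd_def)
qed (auto simp: prd_def)

lemma box_neighbours:
  assumes "l \<ge> 3" "u < m" "v < l"
  shows "{q. {(u, v), q} \<in> edges (kc_box m l)} = (\<lambda>w. (w, v)) ` ({..<m} - {u}) \<union> {(u, (v + 1) mod l), (u, prd l v)}"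
    (is "?L = ?R")
proof (intro equalityI subsetI)
  fix q assume "q \<in> ?L"
  then have "{(u, v), q} \<in> edges (kc_box m l)" by simp
  then consider (layer) v' where "{(u, v), q} \<in> layer m v'"
    | (vert) i where "i \<in> {..<m} \<times> {..<l}" "{(u, v), q} = {i, (fst i, (snd i + 1) mod l)}"
    unfolding edges_box by blast
  then show "q \<in> ?R"
  proof cases
    case layer
    then obtain a b where ab: "a < m" "b < m" "a \<noteq> b" "{(u, v), q} = {(a, v'), (b, v')}"
      by (auto simp: layer_def edges_complete_graph)
    then show ?thesis by (auto simp: doubleton_eq_iff)
  next
    case vert
    then consider "i = (u, v)" "q = (u, (v + 1) mod l)" | "q = i" "(u, v) = (fst i, (snd i + 1) mod l)"
      by (auto simp: doubleton_eq_iff)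
    then show ?thesis
    proof cases
      case 2
      then have "snd i = prd l v" "fst i = u" using vert(1) prd_unique[of "snd i" l] by auto
      then show ?thesis using 2 by (cases i) auto
    qed auto
  qed
next
  fix q assume "q \<in> ?R"
  then consider (lay) w where "w < m" "w \<noteq> u" "q = (w, v)" | (suc) "q = (u, (v + 1) mod l)" | (pre) "q = (u, prd l v)"
    by auto
  then have "{(u, v), q} \<in> edges (kc_box m l)"
  proof cases
    case lay
    then have "{u, w} \<in> edges (complete_graph m)" using assms by (auto simp: edges_complete_graph)
    then have "(\<lambda>x. (x, v)) ` {u, w} \<in> layer m v" unfolding layer_def by (rule imageI)
    then show ?thesis unfolding edges_box using assms lay by auto
  next
    case suc
    have "{(u, v), q} = (\<lambda>i. {i, (fst i, (snd i + 1) mod l)}) (u, v)" using suc by simp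
    then show ?thesis unfolding edges_box using assms by blast
  next
    case pre
    have "(prd l v + 1) mod l = v" "prd l v < l" using assms by (auto simp: prd_def)
    then have "{(u, v), q} = (\<lambda>i. {i, (fst i, (snd i + 1) mod l)}) (u, prd l v)" "(u, prd l v) \<in> {..<m} \<times> {..<l}"
      using pre assms by (auto simp: insert_commute)
    then show ?thesis unfolding edges_box by blast
  qed
  then show "q \<in> ?L" by simp
qed

lemma chr_periodic:
  assumes "l > 0" shows "cis (2 * pi * real b * real (w mod l) / real l) = cis (2 * pi * real b * real w / real l)"
proof -
  have "real w = real l * real (w div l) + real (w mod l)" by (metis mult_div_mod_eq of_nat_add of_nat_mult)
  then have "2 * pi * real b * real w / real l = 2 * pi * real b * real (w mod l) / real l + 2 * pi * real (b * (w div l))"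
    using assms by (simp add: field_simps)
  then have "cis (2 * pi * real b * real w / real l) = cis (2 * pi * real b * real (w mod l) / real l) * cis (2 * pi * real (b * (w div l)))"
    by (simp only: cis_mult)
  also have "cis (2 * pi * real (b * (w div l))) = 1" by (rule cis_multiple_2pi) (simp add: Ints_of_nat)
  finally show ?thesis by simp
qed

lemma chr_eigen:
  assumes "l \<ge> 3" "u < m" "v < l" "a < m"
  shows "(\<Sum>q\<in>{q. {(u, v), q} \<in> edges (kc_box m l)}. chr m l (a, b) q) = of_real (real m + 1 - lapeig m l (a, b)) * chr m l (a, b) (u, v)"
proof -
  let ?e = "\<lambda>w. cis (2 * pi * real a * real w / real m)" and ?f = "\<lambda>w. cis (2 * pi * real b * real w / real l)"
  have m0: "m > 0" and l0: "l > 0" using assms by auto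
  have ne: "(v + 1) mod l \<noteq> prd l v" "(v + 1) mod l \<noteq> v" "prd l v \<noteq> v"
    using assms by (auto simp: prd_def mod_if)
  have "(\<Sum>q\<in>{q. {(u, v), q} \<in> edges (kc_box m l)}. chr m l (a, b) q) =
    (\<Sum>q\<in>(\<lambda>w. (w, v)) ` ({..<m} - {u}). chr m l (a, b) q) + (\<Sum>q\<in>{(u, (v + 1) mod l), (u, prd l v)}. chr m l (a, b) q)"
    unfolding box_neighbours[OF assms(1-3)] by (rule sum.union_disjoint) auto
  also have "(\<Sum>q\<in>(\<lambda>w. (w, v)) ` ({..<m} - {u}). chr m l (a, b) q) = (\<Sum>w\<in>{..<m} - {u}. ?e w * ?f v)"
    by (subst sum.reindex) (auto simp: inj_on_def chr_def)
  also have "\<dots> = ((\<Sum>w<m. ?e w) - ?e u) * ?f v"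
    using assms by (simp add: sum_diff1 sum_distrib_right left_diff_distrib)
  \<comment> \<open>For \<open>a \<noteq> 0\<close> the character sums to zero over the copy of the
    complete graph, leaving only minus its value at \<open>u\<close>; this is the adjacency
    eigenvalue \<open>-1\<close>, against \<open>m - 1\<close> for \<open>a = 0\<close>.\<close>
  also have "(\<Sum>w<m. ?e w) = (if a = 0 then of_nat m * ?e u else 0)"
    using sum_cis_roots[OF m0, of "int a"] assms by (auto dest: zdvd_imp_le)
  also have "(\<Sum>q\<in>{(u, (v + 1) mod l), (u, prd l v)}. chr m l (a, b) q) = ?e u * (?f ((v + 1) mod l) + ?f (prd l v))"
    using ne by (simp add: chr_def distrib_left)
  also have "?f ((v + 1) mod l) = ?f v * cis (2 * pi * real b / real l)"
    unfolding chr_periodic[OF l0] cis_mult by (rule arg_cong[of _ _ cis]) (simp add: field_simps add_divide_distrib)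
  also have "?f (prd l v) = ?f v * cis (- (2 * pi * real b / real l))"
  proof -
    have "(prd l v + 1) mod l = v" using assms by (auto simp: prd_def)
    then have "?f v = ?f (prd l v + 1)" using chr_periodic[OF l0, of b "prd l v + 1"] by simp
    also have "\<dots> = ?f (prd l v) * cis (2 * pi * real b / real l)"
      unfolding cis_mult by (rule arg_cong[of _ _ cis]) (simp add: field_simps add_divide_distrib)
    finally show ?thesis by (simp add: cis_mult)
  qed
  also have "?f v * cis (2 * pi * real b / real l) + ?f v * cis (- (2 * pi * real b / real l)) =
    ?f v * of_real (2 * cos (2 * pi * real b / real l))"
    unfolding distrib_left[symmetric] by (simp add: complex_eq_iff)
  finally show ?thesis by (cases "a = 0") (auto simp: chr_def lapeig_def algebra_simps)
qed

section \<open>Laplacian determinant and spanning trees of the product graph\<close>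

definition boxadj :: "nat \<Rightarrow> nat \<Rightarrow> nat \<Rightarrow> nat \<Rightarrow> bool" where
  "boxadj m l i j \<longleftrightarrow> i < m * l \<and> j < m * l \<and> {cell l i, cell l j} \<in> edges (kc_box m l)"

lemma wf_edges_box: "l \<ge> 3 \<Longrightarrow> wf_edges (edges (kc_box m l))"
proof -
  assume l: "l \<ge> 3"
  have "wf_edges (\<Union>v<l. layer m v)" using wf_edges_layer by (auto simp: wf_edges_def)
  moreover have "i \<noteq> (fst i, (snd i + 1) mod l)" if "i \<in> {..<m} \<times> {..<l}" for i
    using l that by (cases i) (auto simp: mod_if)
  then have "wf_edges ((\<lambda>i. {i, (fst i, (snd i + 1) mod l)}) ` ({..<m} \<times> {..<l}))"
    by (auto simp: wf_edges_def card_insert_if)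
  ultimately show ?thesis unfolding edges_box by (auto simp: wf_edges_def)
qed

lemma det_lap_box:
  assumes "l \<ge> 3" "m > 0"
  shows "Determinant.det (lap_mat (m * l) (boxadj m l) x) = (\<Prod>k<m * l. x + of_real (lapeig m l (cell l k)))"
proof (rule det_eigenbasis)
  let ?n = "m * l"
  let ?W = "Matrix.mat ?n ?n (\<lambda>(i, k). chr m l (cell l k) (cell l i))"
  let ?W' = "Matrix.mat ?n ?n (\<lambda>(i, k). cnj (chr m l (cell l i) (cell l k)))"
  have l0: "l > 0" using assms by simp
  have cellin: "cell l i \<in> {..<m} \<times> {..<l}" if "i < ?n" for i
    using bij_cell[OF l0, of m] that by (auto simp: bij_betw_def)
  show "lap_mat ?n (boxadj m l) x \<in> carrier_mat ?n ?n" by (simp add: lap_mat_def)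
  show "?W \<in> carrier_mat ?n ?n" "?W' \<in> carrier_mat ?n ?n" by auto
  show "(of_nat ?n :: complex) \<noteq> 0" using assms l0 by simp
  show "(\<Sum>j<?n. ?W' $$ (i, j) * ?W $$ (j, k)) = (if i = k then of_nat ?n else 0)" if ik: "i < ?n" "k < ?n" for i k
  proof -
    obtain a b a' b' where ab: "cell l i = (a, b)" "cell l k = (a', b')" by fastforce
    have bd: "a < m" "b < l" "a' < m" "b' < l" using cellin[OF ik(1)] cellin[OF ik(2)] ab by auto
    have "(\<Sum>j<?n. ?W' $$ (i, j) * ?W $$ (j, k)) = (\<Sum>j<?n. cnj (chr m l (a, b) (cell l j)) * chr m l (a', b') (cell l j))"
      using ik ab by (intro sum.cong) auto
    also have "\<dots> = (\<Sum>u<m. \<Sum>v<l. cnj (chr m l (a, b) (u, v)) * chr m l (a', b') (u, v))"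
      by (rule sum_cell[OF l0, of "\<lambda>q. cnj (chr m l (a, b) q) * chr m l (a', b') q"])
    also have "\<dots> = (if (a, b) = (a', b') then of_nat (m * l) else 0)"
      using assms l0 bd by (intro chr_orth)
    also have "(a, b) = (a', b') \<longleftrightarrow> i = k"
      using bij_cell[OF l0, of m] ik ab by (metis bij_betw_def inj_on_eq_iff lessThan_iff)
    finally show ?thesis .
  qed
  show "(\<Sum>j<?n. lap_mat ?n (boxadj m l) x $$ (i, j) * ?W $$ (j, k)) = (x + of_real (lapeig m l (cell l k))) * ?W $$ (i, k)"
    if ik: "i < ?n" "k < ?n" for i k
  proof -
    obtain u v a b where uv: "cell l i = (u, v)" "cell l k = (a, b)" by fastforce
    have bd: "u < m" "v < l" "a < m" "b < l" using cellin[OF ik(1)] cellin[OF ik(2)] uv by auto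
    let ?N = "{q. {(u, v), q} \<in> edges (kc_box m l)}"
    have Nsub: "?N \<subseteq> {..<m} \<times> {..<l}" using Union_edges_box[of m l] unfolding verts_box by blast
    have adj: "boxadj m l i j \<longleftrightarrow> cell l j \<in> ?N" if "j < ?n" for j
      using that ik uv by (simp add: boxadj_def)
    have bijN: "bij_betw (cell l) {j. j < ?n \<and> boxadj m l i j} ?N"
    proof (rule bij_betw_subset[OF bij_cell[OF l0, of m]])
      show "cell l ` {j. j < ?n \<and> boxadj m l i j} = ?N"
      proof (intro equalityI subsetI)
        fix q assume q: "q \<in> ?N"
        then have "q \<in> cell l ` {..<?n}" using Nsub bij_cell[OF l0, of m] by (auto simp: bij_betw_def)
        then obtain j where "j < ?n" "q = cell l j" by auto
        then show "q \<in> cell l ` {j. j < ?n \<and> boxadj m l i j}" using q adj by auto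
      qed (use adj in auto)
    qed auto
    have deg: "card {j. j < ?n \<and> boxadj m l i j} = m + 1"
    proof -
      have ne: "(v + 1) mod l \<noteq> prd l v" "(v + 1) mod l \<noteq> v" "prd l v \<noteq> v"
        using assms bd by (auto simp: prd_def mod_if)
      have "card {j. j < ?n \<and> boxadj m l i j} = card ?N" by (rule bij_betw_same_card[OF bijN])
      also have "\<dots> = card ((\<lambda>w. (w, v)) ` ({..<m} - {u})) + card {(u, (v + 1) mod l), (u, prd l v)}"
        unfolding box_neighbours[OF assms(1) bd(1,2)] by (rule card_Un_disjoint) auto
      also have "card ((\<lambda>w. (w, v)) ` ({..<m} - {u})) = m - 1" using bd by (subst card_image) (auto simp: inj_on_def)
      also have "card {(u, (v + 1) mod l), (u, prd l v)} = 2" using ne by simp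
      finally show ?thesis using assms by simp
    qed
    have "(\<Sum>j<?n. lap_mat ?n (boxadj m l) x $$ (i, j) * ?W $$ (j, k)) =
      (\<Sum>j<?n. (if j = i then (x + of_nat (m + 1)) * chr m l (a, b) (cell l j) else 0) -
          (if boxadj m l i j then chr m l (a, b) (cell l j) else 0))"
    proof (intro sum.cong refl)
      fix j assume "j \<in> {..<?n}"
      moreover have "\<not> boxadj m l i i"
        using wf_edges_box[OF assms(1), of m] by (auto simp: boxadj_def wf_edges_def)
      ultimately show "lap_mat ?n (boxadj m l) x $$ (i, j) * ?W $$ (j, k) =
        (if j = i then (x + of_nat (m + 1)) * chr m l (a, b) (cell l j) else 0) -
          (if boxadj m l i j then chr m l (a, b) (cell l j) else 0)"
        using ik uv deg by (auto simp: lap_mat_def)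
    qed
    also have "\<dots> = (x + of_nat (m + 1)) * chr m l (a, b) (u, v) - (\<Sum>j\<in>{j. j < ?n \<and> boxadj m l i j}. chr m l (a, b) (cell l j))"
      using ik uv by (simp add: sum_subtractf sum.If_cases Int_def)
    also have "(\<Sum>j\<in>{j. j < ?n \<and> boxadj m l i j}. chr m l (a, b) (cell l j)) = (\<Sum>q\<in>?N. chr m l (a, b) q)"
      by (rule sum.reindex_bij_betw[OF bijN])
    also have "\<dots> = of_real (real m + 1 - lapeig m l (a, b)) * chr m l (a, b) (u, v)"
      by (rule chr_eigen[OF assms(1) bd(1-3)])
    finally show ?thesis using ik uv by (simp add: algebra_simps)
  qed
qed

text \<open>The nontrivial roots of unity are the zeros of the monic polynomial
  \<open>1 + z + ... + z ^ (l - 1)\<close>; evaluate both forms at \<open>1\<close>.\<close>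

lemma prod_one_minus_roots:
  assumes "l > 0"
  shows "(\<Prod>b\<in>{1..<l}. 1 - cis (2 * pi * real b / real l)) = of_nat l"
proof -
  let ?w = "\<lambda>b. cis (2 * pi * real b / real l)"
  let ?p = "\<Sum>i<l. Polynomial.monom 1 i :: complex poly"
  let ?q = "\<Prod>b\<in>{1..<l}. [:- ?w b, 1:]"
  have inj: "inj_on ?w {1..<l}"
    using Complex.bij_betw_roots_unity[OF assms] by (auto simp: bij_betw_def intro: inj_on_subset)
  have dq: "Polynomial.degree ?q = l - 1" by (subst degree_prod_eq_sum_degree) auto
  have "lead_coeff ?q = 1" by (simp add: lead_coeff_prod)
  then have cq: "poly.coeff ?q (l - 1) = 1" by (simp only: dq)
  have cp: "poly.coeff ?p (l - 1) = 1"
    using assms by (simp add: coeff_sum)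
  have dp: "Polynomial.degree ?p \<le> l - 1" by (intro degree_sum_le) (auto intro: order_trans[OF degree_monom_le])
  have "?p = ?q"
  proof (rule poly_eqI_degree_lead_coeff[where A="?w ` {1..<l}" and n="l - 1"])
    show "card (?w ` {1..<l}) \<ge> l - 1" using inj by (simp add: card_image)
    fix z assume "z \<in> ?w ` {1..<l}"
    then obtain b where b: "1 \<le> b" "b < l" "z = ?w b" by auto
    have "poly ?q z = 0" using b by (auto simp: poly_prod intro!: prod_zero bexI[of _ b])
    moreover have "poly ?p z = (\<Sum>i<l. cis (2 * pi * of_int (int b) * real i / real l))"
      using b by (simp add: poly_sum poly_monom Complex.DeMoivre mult_ac)
    moreover have "\<dots> = 0" using b sum_cis_roots[OF assms, of "int b"] by (auto dest: zdvd_imp_le)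
    ultimately show "poly ?p z = poly ?q z" by simp
  qed (use cp cq dp dq in auto)
  then have "poly ?p 1 = poly ?q 1" by simp
  then show ?thesis by (simp add: poly_sum poly_monom poly_prod)
qed

text \<open>Each factor \<open>2 - 2 cos t\<close> is the squared modulus of
  \<open>1 - cis t\<close>, so this is the square of the product over the roots of unity.\<close>

lemma prod_cycle_eig:
  assumes "l > 0"
  shows "(\<Prod>b\<in>{1..<l}. 2 - 2 * cos (2 * pi * real b / real l)) = (real l)\<^sup>2"
proof -
  have "2 - 2 * cos t = (cmod (1 - cis t))\<^sup>2" for t
  proof -
    have "(cmod (1 - cis t))\<^sup>2 = (1 - cos t)\<^sup>2 + (sin t)\<^sup>2" by (simp add: cmod_power2)
    also have "\<dots> = 1 - 2 * cos t + ((cos t)\<^sup>2 + (sin t)\<^sup>2)" by (simp add: power2_diff)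
    finally show ?thesis by simp
  qed
  then have "(\<Prod>b\<in>{1..<l}. 2 - 2 * cos (2 * pi * real b / real l)) = (cmod (\<Prod>b\<in>{1..<l}. 1 - cis (2 * pi * real b / real l)))\<^sup>2"
    by (simp add: prod_norm[symmetric] prod_power_distrib)
  then show ?thesis unfolding prod_one_minus_roots[OF assms] by simp
qed

text \<open>Both sides of the determinant identity are divisible by \<open>x\<close>: every forest
  has a root, and the eigenvalue at index \<open>0\<close> vanishes. After division and
  \<open>x\<close> tending to \<open>0\<close>, the forests with exactly one root face the product
  of the nonzero eigenvalues.\<close>

lemma num_spanning_trees_box:
  assumes "l \<ge> 3" "m > 0"
  shows "real (m * l) * real (num_spanning_trees (kc_box m l)) =
    (real l)\<^sup>2 * (\<Prod>b<l. real m + 2 - 2 * cos (2 * pi * real b / real l)) ^ (m - 1)"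
proof -
  let ?n = "m * l"
  let ?F = "forests ?n (boxadj m l)"
  let ?fx = "\<lambda>f. card {i. i < ?n \<and> f i = i}"
  have l0: "l > 0" and n0: "?n > 0" using assms by auto
  interpret finite_graph "verts (kc_box m l)" "edges (kc_box m l)"
    by standard (use wf_edges_box[OF assms(1)] Union_edges_box in \<open>auto simp: verts_box\<close>)
  have finF: "finite ?F"
    by (rule finite_subset[OF _ finite_self_maps[of ?n]]) (auto simp: forests_def)
  have fx: "?fx f \<ge> 1" if "f \<in> ?F" for f
  proof -
    have "reaches f 0" "\<And>i. i < ?n \<Longrightarrow> f i < ?n" using that n0 by (auto simp: forests_def)
    then obtain k where k: "f ((f ^^ k) 0) = (f ^^ k) 0" by (auto simp: reaches_def)
    moreover have "(f ^^ k) 0 < ?n" by (induction k) (use n0 \<open>\<And>i. i < ?n \<Longrightarrow> f i < ?n\<close> in auto)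
    ultimately have "{i. i < ?n \<and> f i = i} \<noteq> {}" by blast
    then show ?thesis by (simp add: Suc_le_eq card_gt_0_iff)
  qed
  have irr: "\<not> boxadj m l i i" for i
    using wf_edges_box[OF assms(1), of m] by (auto simp: boxadj_def wf_edges_def)
  let ?lam = "\<lambda>k. lapeig m l (cell l k)"
  have eq: "(\<Sum>f\<in>?F. x ^ (?fx f - 1)) = (\<Prod>k\<in>{1..<?n}. x + ?lam k)" if "x \<noteq> 0" for x :: real
  proof -
    have "complex_of_real (\<Sum>f\<in>?F. x ^ ?fx f) = complex_of_real (\<Prod>k<?n. x + ?lam k)"
      using det_lap_mat[of "boxadj m l" ?n "of_real x", OF irr] det_lap_box[OF assms, of "of_real x"] by simp
    then have e: "(\<Sum>f\<in>?F. x ^ ?fx f) = (\<Prod>k<?n. x + ?lam k)" by (simp only: of_real_eq_iff)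
    have "(\<Sum>f\<in>?F. x ^ ?fx f) = (\<Sum>f\<in>?F. x * x ^ (?fx f - 1))"
    proof (rule sum.cong[OF refl])
      fix f assume "f \<in> ?F"
      then have "?fx f \<noteq> 0" using fx[of f] by linarith
      then obtain j where "?fx f = Suc j" using not0_implies_Suc by blast
      then show "x ^ ?fx f = x * x ^ (?fx f - 1)" by (simp only: power_Suc diff_Suc_1)
    qed
    moreover have "{..<?n} = insert 0 {1..<?n}" using n0 by auto
    then have "(\<Prod>k<?n. x + ?lam k) = (x + ?lam 0) * (\<Prod>k\<in>{1..<?n}. x + ?lam k)" by simp
    moreover have "?lam 0 = 0" by (simp add: lapeig_def cell_def)
    ultimately have "x * (\<Sum>f\<in>?F. x ^ (?fx f - 1)) = x * (\<Prod>k\<in>{1..<?n}. x + ?lam k)"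
      using e by (simp add: sum_distrib_left)
    then show ?thesis using that by simp
  qed
  have lim0: "((\<lambda>x::real. \<Sum>f\<in>?F. x ^ (?fx f - 1)) \<longlongrightarrow> (\<Sum>f\<in>?F. 0 ^ (?fx f - 1))) (at 0)"
    by (intro tendsto_intros)
  have "((\<lambda>x::real. \<Prod>k\<in>{1..<?n}. x + ?lam k) \<longlongrightarrow> (\<Prod>k\<in>{1..<?n}. 0 + ?lam k)) (at 0)"
    by (intro tendsto_intros)
  moreover have "\<forall>\<^sub>F x::real in at 0. (\<Prod>k\<in>{1..<?n}. x + ?lam k) = (\<Sum>f\<in>?F. x ^ (?fx f - 1))"
    unfolding eventually_at_filter by (intro always_eventually allI impI) (rule eq[symmetric])
  ultimately have "((\<lambda>x::real. \<Sum>f\<in>?F. x ^ (?fx f - 1)) \<longlongrightarrow> (\<Prod>k\<in>{1..<?n}. 0 + ?lam k)) (at 0)"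
    by (rule Lim_transform_eventually)
  from lim0 this have lim: "(\<Sum>f\<in>?F. 0 ^ (?fx f - 1)) = (\<Prod>k\<in>{1..<?n}. 0 + ?lam k)"
    by (rule tendsto_unique[rotated]) simp
  have "(\<Sum>f\<in>?F. (0::real) ^ (?fx f - 1)) = (\<Sum>f\<in>?F. of_bool (?fx f = 1))"
  proof (rule sum.cong[OF refl])
    fix f assume "f \<in> ?F"
    then show "(0::real) ^ (?fx f - 1) = of_bool (?fx f = 1)"
      using fx[of f] by (cases "?fx f = 1") (simp_all only: power_0_left diff_self_eq_0 of_bool_eq if_True simp_thms, simp)
  qed
  also have "\<dots> = real (card {f \<in> ?F. ?fx f = 1})" using finF by (simp add: of_bool_def sum.If_cases Int_def)
  also have "\<dots> = real (card (verts (kc_box m l)) * num_spanning_trees (kc_box m l))"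
    using card_single_root_forests[OF bij_cell[OF l0, of m, folded verts_box]]
    by (simp add: boxadj_def[abs_def] num_spanning_trees_def)
  also have "card (verts (kc_box m l)) = ?n" by (simp add: verts_box card_cartesian_product)
  finally have N: "real (?n * num_spanning_trees (kc_box m l)) = (\<Prod>k\<in>{1..<?n}. ?lam k)" using lim by simp
  let ?D = "\<Prod>b<l. real m + 2 - 2 * cos (2 * pi * real b / real l)"
  \<comment> \<open>The zero eigenvalue is replaced by \<open>1\<close>, so that the product over
    all cells splits into the row \<open>a = 0\<close>, which gives \<open>l^2\<close>, and
    \<open>m - 1\<close> identical rows.\<close>
  have "(\<Prod>k\<in>{1..<?n}. ?lam k) = (\<Prod>k<?n. (\<lambda>q. if q = (0, 0) then 1 else lapeig m l q) (cell l k))"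
  proof -
    have "{..<?n} = insert 0 {1..<?n}" using n0 by auto
    moreover have "cell l 0 = (0, 0)" by (simp add: cell_def)
    moreover have "cell l k \<noteq> (0, 0)" if "k \<in> {1..<?n}" for k
      using bij_cell[OF l0, of m] that n0 \<open>cell l 0 = (0, 0)\<close>
      by (metis atLeastLessThan_iff bij_betw_def inj_on_eq_iff lessThan_iff not_one_le_zero)
    ultimately show ?thesis by (simp add: prod.insert)
  qed
  also have "\<dots> = (\<Prod>u<m. \<Prod>v<l. if (u, v) = (0, 0) then 1 else lapeig m l (u, v))"
    by (rule prod_cell[OF l0])
  also have "\<dots> = (\<Prod>v<l. if v = 0 then 1 else lapeig m l (0, v)) * (\<Prod>u\<in>{1..<m}. \<Prod>v<l. lapeig m l (u, v))"
  proof -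
    have "{..<m} = insert 0 {1..<m}" using assms by auto
    moreover have "(\<Prod>u\<in>{1..<m}. \<Prod>v<l. if (u, v) = (0, 0) then 1 else lapeig m l (u, v)) = (\<Prod>u\<in>{1..<m}. \<Prod>v<l. lapeig m l (u, v))"
      by (intro prod.cong refl) auto
    ultimately show ?thesis by (simp only: prod.insert finite_atLeastLessThan atLeastLessThan_iff) simp
  qed
  also have "(\<Prod>v<l. if v = 0 then 1 else lapeig m l (0, v)) = (\<Prod>v\<in>{1..<l}. 2 - 2 * cos (2 * pi * real v / real l))"
  proof -
    have "{..<l} = insert 0 {1..<l}" using l0 by auto
    moreover have "(\<Prod>v\<in>{1..<l}. if v = 0 then 1 else lapeig m l (0, v)) = (\<Prod>v\<in>{1..<l}. 2 - 2 * cos (2 * pi * real v / real l))"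
      by (intro prod.cong refl) (auto simp: lapeig_def)
    ultimately show ?thesis by (simp only: prod.insert finite_atLeastLessThan atLeastLessThan_iff) simp
  qed
  also have "\<dots> = (real l)\<^sup>2" by (rule prod_cycle_eig[OF l0])
  also have "(\<Prod>u\<in>{1..<m}. \<Prod>v<l. lapeig m l (u, v)) = (\<Prod>u\<in>{1..<m}. ?D)"
    by (intro prod.cong refl) (auto simp: lapeig_def)
  also have "\<dots> = ?D ^ (m - 1)" by simp
  finally show ?thesis using N by simp
qed

section \<open>The central binomial coefficient\<close>

text \<open>The central binomial probability; this scaling gives a rational recursion and leads to
  Wallis' product.\<close>

definition cbin :: "nat \<Rightarrow> real" where
  "cbin k = real ((2 * k) choose k) / 4 ^ k"

lemma cbin_Suc: "cbin (Suc k) = cbin k * (2 * real k + 1) / (2 * real k + 2)"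
proof -
  have 1: "Suc k * (Suc (2 * k) choose Suc k) = Suc (2 * k) * ((2 * k) choose k)"
    by (rule Suc_times_binomial)
  have 2: "Suc k * (Suc (Suc (2 * k)) choose Suc k) = Suc (Suc (2 * k)) * (Suc (2 * k) choose k)"
    by (rule Suc_times_binomial)
  have 3: "(Suc (2 * k) choose k) = (Suc (2 * k) choose Suc k)"
    using binomial_symmetric[of k "Suc (2 * k)"] by simp
  have "Suc k * (Suc (Suc (2 * k)) choose Suc k) = 2 * (Suc k * (Suc (2 * k) choose Suc k))"
    unfolding 2 3 by simp
  also have "\<dots> = 2 * (Suc (2 * k) * ((2 * k) choose k))" by (simp only: 1)
  finally have "real (Suc k * (Suc (Suc (2 * k)) choose Suc k)) = real (2 * (Suc (2 * k) * ((2 * k) choose k)))"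
    by (simp only:)
  then have "real (Suc (Suc (2 * k)) choose Suc k) * (real k + 1) = 2 * (2 * real k + 1) * real ((2 * k) choose k)"
    by (simp only: of_nat_mult of_nat_Suc) (simp add: algebra_simps)
  then have "real (Suc (Suc (2 * k)) choose Suc k) = 2 * (2 * real k + 1) * real ((2 * k) choose k) / (real k + 1)"
    by (simp add: eq_divide_eq)
  then have "cbin (Suc k) = 2 * (2 * real k + 1) * real ((2 * k) choose k) / (real k + 1) / 4 ^ Suc k"
    unfolding cbin_def by (simp only: mult_Suc_right add_2_eq_Suc)
  also have "\<dots> = cbin k * (2 * real k + 1) / (2 * real k + 2)"
    unfolding cbin_def power_Suc by (simp add: divide_simps) (simp add: algebra_simps)
  finally show ?thesis .
qed

lemma cbin_pos: "cbin k > 0" by (simp add: cbin_def)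

text \<open>The recursion for \<open>cbin\<close> supplies precisely the reciprocals of the factors
  in Wallis' product.\<close>

lemma cbin_wallis: "(cbin k)\<^sup>2 * (2 * real k + 1) * (\<Prod>j=1..k. (4 * real j ^ 2) / (4 * real j ^ 2 - 1)) = 1"
proof (induction k)
  case 0
  show ?case by (simp add: cbin_def)
next
  case (Suc k)
  let ?P = "\<Prod>j=1..k. (4 * real j ^ 2) / (4 * real j ^ 2 - 1)"
  define x where "x = real k"
  have x: "x \<ge> 0" by (simp add: x_def)
  have f: "4 * (x + 1) ^ 2 - 1 = (2 * x + 1) * (2 * x + 3)" by (simp add: power2_eq_square algebra_simps)
  have *: "((2 * x + 1) / (2 * x + 2))\<^sup>2 * (2 * (x + 1) + 1) * ((4 * (x + 1) ^ 2) / (4 * (x + 1) ^ 2 - 1)) = 2 * x + 1"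
  proof -
    have b: "4 * (x + 1) ^ 2 = (2 * x + 2)\<^sup>2" "2 * (x + 1) + 1 = 2 * x + 3" by (simp_all add: power2_eq_square algebra_simps)
    show ?thesis unfolding f unfolding b using x by (simp add: power_divide) (simp add: power2_eq_square)
  qed
  have "(cbin (Suc k))\<^sup>2 * (2 * real (Suc k) + 1) * (?P * ((4 * real (Suc k) ^ 2) / (4 * real (Suc k) ^ 2 - 1)))
    = (cbin k)\<^sup>2 * (2 * x + 1) * ?P"
  proof -
    have s: "real (Suc k) = x + 1" by (simp add: x_def)
    have m: "(c * q)\<^sup>2 * t * (p * w) = c\<^sup>2 * e * p" if "q\<^sup>2 * t * w = e" for c q t p w e :: real
      unfolding that[symmetric] by (simp add: power_mult_distrib)
    show ?thesis unfolding cbin_Suc[unfolded times_divide_eq_right[symmetric]] x_def[symmetric] s by (rule m) (rule * )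
  qed
  moreover have "(\<Prod>j=1..Suc k. (4 * real j ^ 2) / (4 * real j ^ 2 - 1)) = ?P * ((4 * real (Suc k) ^ 2) / (4 * real (Suc k) ^ 2 - 1))"
    by simp
  ultimately show ?case using Suc by (simp only: x_def)
qed

lemma cbin_limit: "(\<lambda>k. (cbin k)\<^sup>2 * (2 * real k + 1)) \<longlonglongrightarrow> 2 / pi"
proof -
  have "(\<lambda>k. inverse (\<Prod>j=1..k. (4 * real j ^ 2) / (4 * real j ^ 2 - 1))) \<longlonglongrightarrow> inverse (pi / 2)"
    by (intro tendsto_inverse wallis) simp
  moreover have "inverse (\<Prod>j=1..k. (4 * real j ^ 2) / (4 * real j ^ 2 - 1)) = (cbin k)\<^sup>2 * (2 * real k + 1)" for k
    by (rule inverse_unique) (use cbin_wallis[of k] in \<open>simp add: mult_ac\<close>)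
  ultimately show ?thesis by simp
qed

lemma cbin_limit':
  assumes "c \<longlonglongrightarrow> (c0 :: real)"
  shows "(\<lambda>k. (cbin k)\<^sup>2 * (real k + c k)) \<longlonglongrightarrow> 1 / pi"
proof -
  have lim: "(\<lambda>k. (real k + c k) / (2 * real k + 1)) \<longlonglongrightarrow> 1 / 2"
  proof -
    have "(\<lambda>k. real k / (2 * real k + 1)) \<longlonglongrightarrow> 1 / 2" by real_asymp
    moreover have "(\<lambda>k. 1 / (2 * real k + 1)) \<longlonglongrightarrow> 0" by real_asymp
    then have "(\<lambda>k. c k * (1 / (2 * real k + 1))) \<longlonglongrightarrow> c0 * 0" by (intro tendsto_mult assms)
    ultimately have "(\<lambda>k. real k / (2 * real k + 1) + c k * (1 / (2 * real k + 1))) \<longlonglongrightarrow> 1 / 2 + c0 * 0"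
      by (rule tendsto_add)
    then show ?thesis by (simp add: add_divide_distrib)
  qed
  have "(\<lambda>k. ((cbin k)\<^sup>2 * (2 * real k + 1)) * ((real k + c k) / (2 * real k + 1))) \<longlonglongrightarrow> 2 / pi * (1 / 2)"
    by (intro tendsto_mult cbin_limit lim)
  moreover have "((cbin k)\<^sup>2 * (2 * real k + 1)) * ((real k + c k) / (2 * real k + 1)) = (cbin k)\<^sup>2 * (real k + c k)" for k
    by (simp add: add_pos_nonneg less_imp_neq[symmetric])
  ultimately show ?thesis by simp
qed

text \<open>The first sequence increases and the second decreases, both to \<open>1 / pi\<close>.
  With shift \<open>1 / 4\<close> the cross-multiplied sides of the monotonicity claim differ only
  by the constant \<open>1 / 4\<close>; adding \<open>1 / (8 * k)\<close> to the shift reverses the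
  inequality.\<close>

lemma cbin_bounds:
  assumes "k \<ge> 1"
  shows "(cbin k)\<^sup>2 * (real k + 1 / 4) \<le> 1 / pi" "1 / pi \<le> (cbin k)\<^sup>2 * (real k + (1 / 4 + 1 / (8 * real k)))"
proof -
  have step: "(cbin (Suc n))\<^sup>2 = (cbin n)\<^sup>2 * ((2 * real n + 1)\<^sup>2 / (2 * real n + 2)\<^sup>2)" for n
    unfolding cbin_Suc by (simp add: power_mult_distrib power_divide)
  have "incseq (\<lambda>k. (cbin k)\<^sup>2 * (real k + 1 / 4))"
  proof (rule incseq_SucI)
    fix n
    define x where "x = real n"
    have x: "x \<ge> 0" by (simp add: x_def)
    have "x + 1 / 4 \<le> (2 * x + 1)\<^sup>2 / (2 * x + 2)\<^sup>2 * (x + 1 + 1 / 4)"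
    proof -
      have "(2 * x + 1)\<^sup>2 * (x + 1 + 1 / 4) = (x + 1 / 4) * (2 * x + 2)\<^sup>2 + 1 / 4" by (simp add: power2_eq_square algebra_simps)
      then have "(x + 1 / 4) * (2 * x + 2)\<^sup>2 \<le> (2 * x + 1)\<^sup>2 * (x + 1 + 1 / 4)" by linarith
      moreover have "(2 * x + 2)\<^sup>2 > 0" using x by simp
      ultimately show ?thesis by (simp only: times_divide_eq_left pos_le_divide_eq)
    qed
    then have "(cbin n)\<^sup>2 * (x + 1 / 4) \<le> (cbin n)\<^sup>2 * ((2 * x + 1)\<^sup>2 / (2 * x + 2)\<^sup>2 * (x + 1 + 1 / 4))"
      by (intro mult_left_mono) auto
    then show "(cbin n)\<^sup>2 * (real n + 1 / 4) \<le> (cbin (Suc n))\<^sup>2 * (real (Suc n) + 1 / 4)"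
      unfolding step x_def by (simp add: mult.assoc add_ac)
  qed
  then show "(cbin k)\<^sup>2 * (real k + 1 / 4) \<le> 1 / pi"
    using cbin_limit'[of "\<lambda>_. 1 / 4"] by (intro incseq_le) auto
  let ?b = "\<lambda>k. (cbin (Suc k))\<^sup>2 * (real (Suc k) + (1 / 4 + 1 / (8 * real (Suc k))))"
  have "decseq ?b"
  proof (rule decseq_SucI)
    fix n
    define x where "x = real (Suc n)"
    have x: "x \<ge> 1" by (simp add: x_def)
    have "(2 * x + 1)\<^sup>2 * (x + 1 + (1 / 4 + 1 / (8 * (x + 1)))) \<le> (2 * x + 2)\<^sup>2 * (x + (1 / 4 + 1 / (8 * x)))"
    proof -
      have l: "(2 * x + 1)\<^sup>2 * (1 / (8 * (x + 1))) = x / 2 + 1 / (8 * (x + 1))"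
        using x by (simp add: field_simps power2_eq_square)
      have r: "(2 * x + 2)\<^sup>2 * (1 / (8 * x)) = x / 2 + 1 + 1 / (2 * x)"
        using x by (simp add: field_simps power2_eq_square)
      have "1 / (8 * (x + 1)) \<le> 1 / 8" using x by (simp add: field_simps)
      moreover have "0 \<le> 1 / (2 * x)" using x by simp
      moreover have "(2 * x + 1)\<^sup>2 * (x + 5 / 4) = (2 * x + 2)\<^sup>2 * (x + 1 / 4) + 1 / 4"
        by (simp add: power2_eq_square algebra_simps)
      moreover have "(2 * x + 1)\<^sup>2 * (x + 1 + (1 / 4 + 1 / (8 * (x + 1)))) = (2 * x + 1)\<^sup>2 * (x + 5 / 4) + (2 * x + 1)\<^sup>2 * (1 / (8 * (x + 1)))"
        by (subst distrib_left[symmetric]) simp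
      moreover have "(2 * x + 2)\<^sup>2 * (x + (1 / 4 + 1 / (8 * x))) = (2 * x + 2)\<^sup>2 * (x + 1 / 4) + (2 * x + 2)\<^sup>2 * (1 / (8 * x))"
        by (subst distrib_left[symmetric]) simp
      ultimately show ?thesis unfolding l r by linarith
    qed
    then have "(2 * x + 1)\<^sup>2 / (2 * x + 2)\<^sup>2 * (x + 1 + (1 / 4 + 1 / (8 * (x + 1)))) \<le> x + (1 / 4 + 1 / (8 * x))"
      using x by (simp add: divide_le_eq mult.commute)
    then have "(cbin (Suc n))\<^sup>2 * ((2 * x + 1)\<^sup>2 / (2 * x + 2)\<^sup>2 * (x + 1 + (1 / 4 + 1 / (8 * (x + 1))))) \<le> (cbin (Suc n))\<^sup>2 * (x + (1 / 4 + 1 / (8 * x)))"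
      by (intro mult_left_mono) auto
    moreover have "real (Suc (Suc n)) = x + 1" by (simp add: x_def)
    ultimately show "?b (Suc n) \<le> ?b n"
      unfolding step[of "Suc n"] x_def[symmetric] by (simp only: mult.assoc)
  qed
  moreover have "?b \<longlonglongrightarrow> 1 / pi"
  proof -
    have "(\<lambda>k. 1 / 4 + 1 / (8 * real k)) \<longlonglongrightarrow> 1 / 4" by real_asymp
    from LIMSEQ_Suc[OF cbin_limit'[OF this]] show ?thesis .
  qed
  ultimately have "1 / pi \<le> ?b (k - 1)" by (rule decseq_ge)
  then show "1 / pi \<le> (cbin k)\<^sup>2 * (real k + (1 / 4 + 1 / (8 * real k)))" using assms by simp
qed

text \<open>An error of order \<open>1 / k^2\<close> is indispensable, since \<open>rho_hat\<close>
  is this logarithm itself and is not divided by the number of vertices. Hence the correction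
  \<open>1 / (8 * k)\<close>, half of the relative shift \<open>1 / (4 * k)\<close>, is
  kept.\<close>

lemma ln_cbin:
  assumes "k \<ge> 1"
  shows "\<bar>ln (cbin k) + (ln pi + ln (real k)) / 2 + 1 / (8 * real k)\<bar> \<le> 1 / (16 * (real k)\<^sup>2)"
proof -
  have k0: "real k \<ge> 1" using assms by simp
  define y where "y = 1 / (4 * real k)"
  define z where "z = 1 / (4 * real k) + 1 / (8 * (real k)\<^sup>2)"
  have y: "0 < y" "y \<le> 1 / 2" using k0 by (auto simp: y_def field_simps)
  have z: "0 < z" using k0 by (auto simp: z_def intro!: add_pos_pos)
  have ky: "real k + 1 / 4 = real k * (1 + y)" using k0 by (simp add: y_def field_simps)
  have kz: "real k + (1 / 4 + 1 / (8 * real k)) = real k * (1 + z)" using k0 by (simp add: z_def field_simps power2_eq_square)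
  have lny: "ln ((cbin k)\<^sup>2 * (real k * (1 + y))) = 2 * ln (cbin k) + (ln (real k) + ln (1 + y))" if "y > 0" for y
    using that k0 cbin_pos[of k] by (simp add: ln_mult ln_realpow)
  have lnpi: "ln (1 / pi) = - ln pi" by (simp add: ln_div)
  have "ln ((cbin k)\<^sup>2 * (real k * (1 + y))) \<le> ln (1 / pi)"
    using cbin_bounds(1)[OF assms] cbin_pos[of k] y k0 unfolding ky by (intro ln_mono) auto
  then have u: "2 * ln (cbin k) + (ln (real k) + ln (1 + y)) \<le> - ln pi" using y by (simp only: lny lnpi)
  have "ln (1 / pi) \<le> ln ((cbin k)\<^sup>2 * (real k * (1 + z)))"
    using cbin_bounds(2)[OF assms] cbin_pos[of k] z k0 unfolding kz by (intro ln_mono) auto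
  then have l: "- ln pi \<le> 2 * ln (cbin k) + (ln (real k) + ln (1 + z))" using z by (simp only: lny lnpi)
  have "\<bar>ln (1 + y) - y\<bar> \<le> 2 * y\<^sup>2" using y by (intro abs_ln_one_plus_x_minus_x_bound) auto
  moreover have "ln (1 + z) \<le> z" using z by (intro ln_add_one_self_le_self) auto
  moreover have "2 * y\<^sup>2 = 2 * (1 / (16 * (real k)\<^sup>2))" by (simp add: y_def power_divide power_mult_distrib)
  moreover have "z = y + 2 * (1 / (16 * (real k)\<^sup>2))" by (simp add: y_def z_def)
  moreover have "y = 2 * (1 / (8 * real k))" by (simp add: y_def)
  \<comment> \<open>All nonlinear terms are replaced by variables here, so that the remaining
    combination of the estimates is linear.\<close>
  moreover have "\<bar>c + (P + K) / 2 + p\<bar> \<le> w" if "\<bar>L - y\<bar> \<le> y2" "L' \<le> z" "y2 = 2 * w" "z = y + 2 * w" "y = 2 * p"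
    "2 * c + (K + L) \<le> - P" "- P \<le> 2 * c + (K + L')" for c P K p w L y y2 L' z :: real
    using that add_divide_distrib[of P K 2] by (unfold abs_le_iff, (elim conjE)?, (intro conjI)?; linarith)
  ultimately show ?thesis using u l by blast
qed

section \<open>Assembling the estimates\<close>

text \<open>The asymptotic value of the logarithm of the largest row sum.\<close>

definition layerent :: "real \<Rightarrow> real" where
  "layerent m = m * (m + 2) / 2 * ln 2 - (m - 1) / 2 * ln m - m / 2 * ln pi - 3 / 2"

lemma ln_central:
  assumes "odd m"
  shows "\<bar>ln (real ((m + 1) choose ((m + 1) div 2))) -
    ((real m + 1) * ln 2 - (ln pi + ln (real m + 1) - ln 2) / 2 - 1 / (4 * (real m + 1)))\<bar> \<le> 1 / (4 * (real m + 1)\<^sup>2)"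
proof -
  obtain h where h: "m = 2 * h + 1" using assms by (elim oddE)
  define k where "k = h + 1"
  have k: "k \<ge> 1" "m + 1 = 2 * k" "(m + 1) div 2 = k" using h by (auto simp: k_def)
  have mk: "real m + 1 = 2 * real k" using h by (simp add: k_def)
  have "real ((m + 1) choose ((m + 1) div 2)) = cbin k * 4 ^ k" unfolding k(3) unfolding k(2) by (simp add: cbin_def)
  then have "ln (real ((m + 1) choose ((m + 1) div 2))) = ln (cbin k) + real k * ln 4"
    using cbin_pos[of k] by (simp add: ln_mult ln_realpow)
  also have "ln (4 :: real) = 2 * ln 2" using ln_realpow[of 2 2] by simp
  finally have "ln (real ((m + 1) choose ((m + 1) div 2))) = ln (cbin k) + 2 * real k * ln 2" by simp
  moreover have "ln (real m + 1) = ln 2 + ln (real k)" unfolding mk using k(1) by (simp add: ln_mult)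
  moreover have "1 / (4 * (real m + 1)) = 1 / (8 * real k)" "1 / (4 * (real m + 1)\<^sup>2) = 1 / (16 * (real k)\<^sup>2)"
    unfolding mk by (simp_all add: power_mult_distrib)
  ultimately show ?thesis using ln_cbin[OF k(1)] mk by (simp add: algebra_simps)
qed

lemma ln_one_plus_two_div:
  assumes "m \<ge> (4 :: real)" shows "\<bar>ln (m + 2) - ln m - 2 / m\<bar> \<le> 8 / m\<^sup>2"
proof -
  have "m + 2 = m * (1 + 2 / m)" using assms by (simp add: field_simps)
  moreover have "1 + 2 / m > 0" using assms by (intro add_pos_pos) auto
  ultimately have "ln (m + 2) = ln m + ln (1 + 2 / m)" using assms ln_mult_pos[of m] by simp
  moreover have "\<bar>ln (1 + 2 / m) - 2 / m\<bar> \<le> 2 * (2 / m)\<^sup>2"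
    using assms by (intro abs_ln_one_plus_x_minus_x_bound) (simp add: field_simps)
  ultimately show ?thesis by (simp add: power_divide)
qed

lemma ln_one_plus_one_div:
  assumes "m \<ge> (4 :: real)" shows "\<bar>ln (m + 1) - ln m - 1 / m\<bar> \<le> 2 / m\<^sup>2"
proof -
  have "m + 1 = m * (1 + 1 / m)" using assms by (simp add: field_simps)
  moreover have "1 + 1 / m > 0" using assms by (intro add_pos_pos) auto
  ultimately have "ln (m + 1) = ln m + ln (1 + 1 / m)" using assms ln_mult_pos[of m] by simp
  moreover have "\<bar>ln (1 + 1 / m) - 1 / m\<bar> \<le> 2 * (1 / m)\<^sup>2"
    using assms by (intro abs_ln_one_plus_x_minus_x_bound) (simp add: field_simps)
  ultimately show ?thesis by (simp add: power_divide)
qed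

text \<open>For odd \<open>m\<close> the central coefficient of \<open>m + 1\<close> is twice that
  of \<open>m\<close>, so the row sum is a tournament count over a central binomial coefficient, and
  both have known asymptotics.\<close>

lemma rtour_central:
  assumes "odd m"
  shows "rtour (m + 2) = ((m + 1) choose ((m + 1) div 2)) * rowsum m (m div 2)"
proof -
  obtain h where h: "m = 2 * h + 1" using assms by (elim oddE)
  have "(m choose Suc h) = (m choose h)" using binomial_symmetric[of h m] h by simp
  then have "((m + 1) choose Suc h) = 2 * (m choose h)" by simp
  then show ?thesis using rtour_add2[OF assms] h by simp
qed

text \<open>The last estimate says that the factor lost in \<open>EO_box_upper\<close> is polynomial
  in \<open>m\<close>: the tournament counts on \<open>m\<close> and on \<open>m + 2\<close>
  vertices agree closely enough that all larger terms cancel.\<close>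

lemma ln_rowsum_asymp:
  obtains C M where "C > 0" "\<And>m. odd m \<Longrightarrow> m \<ge> M \<Longrightarrow> rowsum m (m div 2) > 0 \<and> rtour m > 0 \<and>
    \<bar>ln (real (rowsum m (m div 2))) - layerent (real m)\<bar> \<le> C / real m \<and>
    real m * ln 2 + ln (real (rtour m)) - ln (real (rowsum m (m div 2))) \<le> C * ln (real m)"
proof -
  obtain C M where C: "C > 0" "\<And>m. odd m \<Longrightarrow> m \<ge> M \<Longrightarrow> rtour m > 0 \<and>
    \<bar>ln (real (rtour m)) - (((real m)\<^sup>2 - 1) / 2 * ln 2 - (real m - 1) / 2 * ln pi - (real m - 2) / 2 * ln (real m) - 1 / 2)\<bar> \<le> C / real m"
    using ln_rtour_asymp by blast
  define D where "D = C + 7"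
  show ?thesis
  proof (rule that[of "C + D + 3" "max M 4"])
    fix m assume m: "odd m" "m \<ge> max M 4"
    define x where "x = real m"
    have x4: "x \<ge> 4" using m by (simp add: x_def)
    define R where "R = ln (real (rowsum m (m div 2)))"
    define T2 where "T2 = ln (real (rtour (m + 2)))"
    define T where "T = ln (real (rtour m))"
    define B where "B = ln (real ((m + 1) choose ((m + 1) div 2)))"
    have pos2: "rtour (m + 2) > 0" and
      t2: "\<bar>T2 - (((x + 2)\<^sup>2 - 1) / 2 * ln 2 - (x + 1) / 2 * ln pi - x / 2 * ln (x + 2) - 1 / 2)\<bar> \<le> C / (x + 2)"
      using C(2)[of "m + 2"] m by (auto simp: T2_def x_def add.commute)
    have pos: "rtour m > 0" and t: "\<bar>T - ((x\<^sup>2 - 1) / 2 * ln 2 - (x - 1) / 2 * ln pi - (x - 2) / 2 * ln x - 1 / 2)\<bar> \<le> C / x"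
      using C(2)[of m] m by (auto simp: T_def x_def)
    have rpos: "rowsum m (m div 2) > 0" using pos2 rtour_central[OF m(1)] by (cases "rowsum m (m div 2)") auto
    have bpos: "((m + 1) choose ((m + 1) div 2)) > 0" by (simp add: zero_less_binomial_iff)
    have TR: "T2 = B + R"
      unfolding T2_def B_def R_def rtour_central[OF m(1)] using rpos bpos by (simp add: ln_mult)
    have b: "\<bar>B - ((x + 1) * ln 2 - (ln pi + ln (x + 1) - ln 2) / 2 - 1 / (4 * (x + 1)))\<bar> \<le> 1 / (4 * (x + 1)\<^sup>2)"
      using ln_central[OF m(1)] by (simp add: B_def x_def)
    have c1: "C / (x + 2) \<le> C / x" using C(1) x4 by (intro divide_left_mono) auto
    have c2: "1 / (4 * (x + 1)) \<le> 1 / x" "0 \<le> 1 / (4 * (x + 1))" using x4 by (auto simp: field_simps)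
    have c3: "1 / (4 * (x + 1)\<^sup>2) \<le> 1 / x"
    proof -
      have "x * 1 \<le> (4 * (x + 1)) * (x + 1)" using x4 by (intro mult_mono) auto
      then have "x \<le> 4 * (x + 1)\<^sup>2" by (simp only: power2_eq_square mult.assoc mult_1_right)
      then show ?thesis using x4 by (intro divide_left_mono) auto
    qed
    have l2: "\<bar>x / 2 * ln (x + 2) - x / 2 * ln x - 1\<bar> \<le> 4 / x"
    proof -
      have "\<bar>x / 2 * (ln (x + 2) - ln x - 2 / x)\<bar> \<le> x / 2 * (8 / x\<^sup>2)"
        unfolding abs_mult using ln_one_plus_two_div[OF x4] x4 by (intro mult_mono) auto
      also have "x / 2 * (8 / x\<^sup>2) = 4 / x" using x4 by (simp add: power2_eq_square)
      also have "x / 2 * (ln (x + 2) - ln x - 2 / x) = x / 2 * ln (x + 2) - x / 2 * ln x - 1" using x4 by (simp add: field_simps)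
      finally show ?thesis .
    qed
    have l1: "\<bar>ln (x + 1) - ln x\<bar> \<le> 2 / x"
    proof -
      have "2 / x\<^sup>2 \<le> 1 / x" using x4 by (simp add: field_simps power2_eq_square)
      moreover have "0 \<le> 1 / x" "2 / x = 1 / x + 1 / x" using x4 by simp_all
      ultimately show ?thesis using ln_one_plus_one_div[OF x4] by (unfold abs_le_iff, (elim conjE)?, (intro conjI)?; linarith)
    qed
    have main: "\<bar>R - layerent x\<bar> \<le> D / x"
    proof -
      \<comment> \<open>The constant \<open>- 3 / 2\<close> of \<open>layerent\<close> arises as
        \<open>- 1 / 2\<close> from the tournaments on \<open>m + 2\<close> vertices and
        \<open>- 1\<close> from the limit of \<open>x / 2 * (ln (x + 2) - ln x)\<close>.\<close>
      have e: "R - layerent x = (T2 - (((x + 2)\<^sup>2 - 1) / 2 * ln 2 - (x + 1) / 2 * ln pi - x / 2 * ln (x + 2) - 1 / 2))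
        - (B - ((x + 1) * ln 2 - (ln pi + ln (x + 1) - ln 2) / 2 - 1 / (4 * (x + 1))))
        - (x / 2 * ln (x + 2) - x / 2 * ln x - 1) + (ln (x + 1) - ln x) / 2 + 1 / (4 * (x + 1))"
        unfolding TR layerent_def by (simp add: power2_eq_square algebra_simps add_divide_distrib diff_divide_distrib)
      have s: "D / x = C / x + 1 / x + 4 / x + 2 / x / 2 + 1 / x" by (simp add: D_def add_divide_distrib)
      have "\<bar>A - P - E + F / 2 + G\<bar> \<le> c' + i + f + t / 2 + i"
        if "\<bar>A\<bar> \<le> a" "\<bar>P\<bar> \<le> p" "\<bar>E\<bar> \<le> f" "\<bar>F\<bar> \<le> t" "a \<le> c'" "G \<le> i" "0 \<le> G" "p \<le> i"
        for A P E F G a p f t i c' :: real using that by (unfold abs_le_iff, (elim conjE)?, (intro conjI)?; linarith)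
      from this[OF t2 b l2 l1 c1 c2 c3] show ?thesis unfolding e s .
    qed
    have lnx: "1 \<le> ln x"
    proof -
      have "exp 1 \<le> x" using exp_le x4 by linarith
      then have "ln (exp 1) \<le> ln x" using x4 by (subst ln_le_cancel_iff) auto
      then show ?thesis by simp
    qed
    have "x * ln 2 + T - R \<le> (C + D + 3) * ln x"
    proof -
      \<comment> \<open>The terms of order \<open>x^2\<close>, \<open>x * ln x\<close> and
        \<open>x\<close> cancel, and \<open>ln x / 2\<close> is the largest that remains.\<close>
      have e: "x * ln 2 + ((x\<^sup>2 - 1) / 2 * ln 2 - (x - 1) / 2 * ln pi - (x - 2) / 2 * ln x - 1 / 2) - layerent x
        = ln x / 2 + (ln pi - ln 2) / 2 + 1"
        unfolding layerent_def by (simp add: power2_eq_square algebra_simps add_divide_distrib diff_divide_distrib)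
      have "ln pi \<le> pi - 1" by (intro ln_le_minus_one) simp
      then have lp: "ln pi \<le> 3" using pi_less_4 by linarith
      have l2': "0 \<le> ln (2::real)" by simp
      have "C / x \<le> C" "D / x \<le> D" using C(1) x4 by (auto simp: D_def divide_le_eq)
      then have "x * ln 2 + T - R \<le> ln x / 2 + 5 / 2 + C + D"
      proof -
        have "u + T - R \<le> v + 5 / 2 + C + D" if "u + A - K = v + (P - l) / 2 + 1" "\<bar>T - A\<bar> \<le> c" "\<bar>R - K\<bar> \<le> d" "P \<le> 3" "0 \<le> l" "c \<le> C" "d \<le> D"
          for u A K v P l c d T R C D :: real using that diff_divide_distrib[of P l 2] by linarith
        from this[OF e t main lp l2'] \<open>C / x \<le> C\<close> \<open>D / x \<le> D\<close> show ?thesis .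
      qed
      also have "\<dots> \<le> ln x / 2 + (5 / 2 + C + D) * ln x"
        using mult_left_mono[OF lnx, of "5 / 2 + C + D"] C(1) by (simp add: D_def)
      also have "\<dots> = (C + D + 3) * ln x" by (simp add: algebra_simps)
      finally show ?thesis .
    qed
    moreover have "D / x \<le> (C + D + 3) / x" using C(1) x4 by (intro divide_right_mono) auto
    ultimately show "rowsum m (m div 2) > 0 \<and> rtour m > 0 \<and>
      \<bar>ln (real (rowsum m (m div 2))) - layerent (real m)\<bar> \<le> (C + D + 3) / real m \<and>
      real m * ln 2 + ln (real (rtour m)) - ln (real (rowsum m (m div 2))) \<le> (C + D + 3) * ln (real m)"
      using rpos pos main by (simp add: R_def T_def x_def)
  qed (use C in \<open>simp add: D_def\<close>)
qed

text \<open>The error \<open>C / m\<close> of the row sum occurs \<open>l\<close> times, the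
  logarithm of the polynomial factor once; division by \<open>m * l\<close> turns them into the two
  error terms.\<close>

lemma rho_box_asymp:
  obtains C M where "C > 0" "\<And>m l. odd m \<Longrightarrow> m \<ge> M \<Longrightarrow> l \<ge> 3 \<Longrightarrow>
    \<bar>rho (kc_box m l) - layerent (real m) / real m\<bar> \<le> C * (1 / (real m)\<^sup>2 + ln (real m) / (real m * real l))"
proof -
  obtain C M where C: "C > 0" "\<And>m. odd m \<Longrightarrow> m \<ge> M \<Longrightarrow> rowsum m (m div 2) > 0 \<and> rtour m > 0 \<and>
    \<bar>ln (real (rowsum m (m div 2))) - layerent (real m)\<bar> \<le> C / real m \<and>
    real m * ln 2 + ln (real (rtour m)) - ln (real (rowsum m (m div 2))) \<le> C * ln (real m)"
    using ln_rowsum_asymp by blast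
  show ?thesis
  proof (rule that[of C "max M 1"])
    fix m l :: nat assume m: "odd m" "m \<ge> max M 1" and l: "l \<ge> 3"
    define x y where "x = real m" and "y = real l"
    have xy: "x \<ge> 1" "y \<ge> 3" using m l by (auto simp: x_def y_def)
    define q where "q = rowsum m (m div 2)"
    define R where "R = ln (real q)"
    have q: "q > 0" "rtour m > 0" "\<bar>R - layerent x\<bar> \<le> C / x" "x * ln 2 + ln (real (rtour m)) - R \<le> C * ln x"
      using C(2)[of m] m by (auto simp: q_def R_def x_def)
    define W where "W = ln (real (EO (kc_box m l)))"
    have Epos: "EO (kc_box m l) > 0" using EO_box_lower[OF l, of m] q(1) by (simp add: q_def[symmetric]) (metis gr0I not_le zero_less_power)
    have low: "y * R \<le> W"
    proof -
      have "ln (real (q ^ l)) \<le> W" unfolding W_def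
        using EO_box_lower[OF l, of m] q(1) by (intro ln_mono) (auto simp: q_def[symmetric] simp flip: of_nat_power)
      then show ?thesis using q(1) by (simp add: ln_realpow R_def y_def)
    qed
    have up: "W \<le> x * ln 2 + ln (real (rtour m)) + (y - 1) * R"
    proof -
      have "W \<le> ln (real (2 ^ m * rtour m * q ^ (l - 1)))" unfolding W_def
        using EO_box_upper[OF l, of m] Epos by (intro ln_mono) (auto simp: q_def[symmetric] simp flip: of_nat_power of_nat_mult)
      also have "\<dots> = x * ln 2 + ln (real (rtour m)) + (y - 1) * R"
        using q(1,2) l by (simp add: ln_mult ln_realpow R_def x_def y_def of_nat_diff)
      finally show ?thesis .
    qed
    have ab: "y * R - y * layerent x \<le> C * y / x" "y * layerent x - y * R \<le> C * y / x"
    proof -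
      have "y * \<bar>R - layerent x\<bar> \<le> y * (C / x)" using q(3) xy by (intro mult_left_mono) auto
      then have "\<bar>y * (R - layerent x)\<bar> \<le> C * y / x" using xy by (simp add: abs_mult mult.commute)
      then show "y * R - y * layerent x \<le> C * y / x" "y * layerent x - y * R \<le> C * y / x"
        by (simp_all add: abs_le_iff algebra_simps)
    qed
    have lx: "0 \<le> C * ln x" using C(1) xy by simp
    have "W \<le> y * R + C * ln x" using up q(4) by (simp add: algebra_simps)
    then have d: "\<bar>W - y * layerent x\<bar> \<le> C * y / x + C * ln x"
      using low ab lx by (unfold abs_le_iff, (elim conjE)?, (intro conjI)?; linarith)
    have "\<bar>rho (kc_box m l) - layerent x / x\<bar> = \<bar>W - y * layerent x\<bar> / (x * y)"
    proof -
      have "rho (kc_box m l) = W / (x * y)"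
        by (simp add: rho_def W_def verts_box card_cartesian_product x_def y_def)
      then have "rho (kc_box m l) - layerent x / x = (W - y * layerent x) / (x * y)" using xy by (simp add: diff_divide_distrib)
      then show ?thesis using xy by (simp add: abs_mult)
    qed
    also have "\<dots> \<le> (C * y / x + C * ln x) / (x * y)" using d xy by (intro divide_right_mono) auto
    also have "\<dots> = C * (1 / x\<^sup>2 + ln x / (x * y))" using xy by (simp add: field_simps power2_eq_square)
    finally show "\<bar>rho (kc_box m l) - layerent (real m) / real m\<bar> \<le> C * (1 / (real m)\<^sup>2 + ln (real m) / (real m * real l))"
      by (simp add: x_def y_def)
  qed (rule C(1))
qed

section \<open>Comparison with \<open>rho_hat\<close> and with the spanning-tree correction\<close>

lemma rho_hat_box:
  assumes "m \<ge> 1" "l \<ge> 3"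
  shows "rho_hat (kc_box m l) = ln (real ((m + 1) choose ((m + 1) div 2))) - (real m + 1) / 2 * ln 2"
proof -
  have "(\<Sum>v\<in>verts (kc_box m l). ln (real (Defs.degree (kc_box m l) v choose (Defs.degree (kc_box m l) v div 2))) - real (Defs.degree (kc_box m l) v) / 2 * ln 2)
    = (\<Sum>v\<in>verts (kc_box m l). ln (real ((m + 1) choose ((m + 1) div 2))) - real (m + 1) / 2 * ln 2)"
    unfolding verts_box using assms by (intro sum.cong refl) (auto simp: degree_complete_box_cycle)
  then show ?thesis unfolding rho_hat_def using assms
    by (simp add: verts_box card_cartesian_product add.commute)
qed

lemma rho_hat_asymp:
  assumes "odd m" "m \<ge> 4" "l \<ge> 3"
  shows "\<bar>layerent (real m) / real m - (rho_hat (kc_box m l) + ln (real m) / (2 * real m) - 3 / (4 * real m))\<bar> \<le> 2 / (real m)\<^sup>2"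
proof -
  define x where "x = real m"
  have x4: "x \<ge> 4" using assms by (simp add: x_def)
  define B where "B = ln (real ((m + 1) choose ((m + 1) div 2)))"
  have b: "\<bar>B - ((x + 1) * ln 2 - (ln pi + ln (x + 1) - ln 2) / 2 - 1 / (4 * (x + 1)))\<bar> \<le> 1 / (4 * (x + 1)\<^sup>2)"
    using ln_central[OF assms(1)] by (simp add: B_def x_def)
  have c: "1 / (4 * (x + 1)\<^sup>2) \<le> 1 / (4 * x\<^sup>2)" using x4 by (intro divide_left_mono mult_left_mono power_mono) auto
  have c': "\<bar>1 / (4 * (x + 1)) - 1 / (4 * x)\<bar> \<le> 1 / (4 * x\<^sup>2)"
  proof -
    have "1 / (4 * x) - 1 / (4 * (x + 1)) = 1 / (4 * (x * (x + 1)))" using x4 by (simp add: field_simps)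
    moreover have "1 / (4 * (x * (x + 1))) \<le> 1 / (4 * x\<^sup>2)" unfolding power2_eq_square
      using x4 by (intro divide_left_mono mult_left_mono) auto
    moreover have "0 \<le> 1 / (4 * (x * (x + 1)))" using x4 by simp
    ultimately show ?thesis by linarith
  qed
  note l1 = ln_one_plus_one_div[OF x4]
  have e: "layerent x / x - (B - (x + 1) / 2 * ln 2 + ln x / (2 * x) - 3 / (4 * x)) =
    - (B - ((x + 1) * ln 2 - (ln pi + ln (x + 1) - ln 2) / 2 - 1 / (4 * (x + 1)))) + (ln (x + 1) - ln x - 1 / x) / 2
     + (1 / (4 * (x + 1)) - 1 / (4 * x))"
  proof -
    have "layerent x / x = (x + 2) / 2 * ln 2 - ln x / 2 + ln x / (2 * x) - ln pi / 2 - 3 / (2 * x)"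
      unfolding layerent_def using x4 by (simp add: field_simps)
    moreover have "3 / (2 * x) - 3 / (4 * x) = 1 / x / 2 + 1 / (4 * x)" using x4 by (simp add: field_simps)
    ultimately show ?thesis by (simp add: algebra_simps add_divide_distrib diff_divide_distrib)
  qed
  have "2 / x\<^sup>2 = 2 * (1 / x\<^sup>2)" "1 / (4 * x\<^sup>2) = 1 / x\<^sup>2 / 4" "0 \<le> 1 / x\<^sup>2" by simp_all
  moreover have "\<bar>- P + Q / 2 + S\<bar> \<le> t" if "\<bar>P\<bar> \<le> p'" "p' \<le> q'" "\<bar>S\<bar> \<le> q'" "\<bar>Q\<bar> \<le> t" "t = 2 * w" "q' = w / 4" "0 \<le> w"
    for P Q S t p' q' w :: real using that by (unfold abs_le_iff, (elim conjE)?, (intro conjI)?; linarith)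
  ultimately have "\<bar>layerent x / x - (B - (x + 1) / 2 * ln 2 + ln x / (2 * x) - 3 / (4 * x))\<bar> \<le> 2 / x\<^sup>2"
    unfolding e using b c c' l1 by blast
  then show ?thesis using assms by (simp add: rho_hat_box B_def x_def)
qed

text \<open>For \<open>d = m + 1\<close> one has \<open>d^2 - 2 d = m^2 - 1\<close>, so the quantity
  equals \<open>ln m - (m - 1) / 2 * ln (1 - 1 / m^2)\<close>; the second term produces
  \<open>1 / (2 * m)\<close>.\<close>

lemma tau_reg_asymp:
  assumes "m \<ge> 4"
  shows "\<bar>tau_reg (m + 1) - (ln (real m) + 1 / (2 * real m))\<bar> \<le> 2 / (real m)\<^sup>2"
proof -
  define x where "x = real m"
  have x4: "x \<ge> 4" using assms by (simp add: x_def)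
  have p: "(real (m + 1))\<^sup>2 - 2 * real (m + 1) = x\<^sup>2 - 1" by (simp add: x_def power2_eq_square algebra_simps)
  have x2: "x\<^sup>2 > 1" using power_mono[OF x4, of 2] by simp
  have "tau_reg (m + 1) = ln (x ^ m / (x\<^sup>2 - 1) powr ((x - 1) / 2))"
    unfolding tau_reg_def p by (simp add: x_def field_simps)
  also have "\<dots> = x * ln x - (x - 1) / 2 * ln (x\<^sup>2 - 1)"
    using x2 x4 by (simp add: ln_div ln_realpow ln_powr power2_eq_1_iff flip: x_def)
  also have "ln (x\<^sup>2 - 1) = 2 * ln x + ln (1 + - (1 / x\<^sup>2))"
  proof -
    have "x\<^sup>2 - 1 = x\<^sup>2 * (1 + - (1 / x\<^sup>2))" using x4 by (simp add: field_simps)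
    moreover have "1 + - (1 / x\<^sup>2) > 0"
    proof -
      have "1 / x\<^sup>2 < 1" using x2 by (subst divide_less_eq_1_pos) linarith+
      then show ?thesis by linarith
    qed
    ultimately show ?thesis using x4 ln_mult_pos[of "x\<^sup>2" "1 + - (1 / x\<^sup>2)"] by (simp add: ln_realpow)
  qed
  finally have t: "tau_reg (m + 1) = ln x - (x - 1) / 2 * ln (1 + - (1 / x\<^sup>2))" by (simp add: algebra_simps add_divide_distrib diff_divide_distrib)
  have h: "1 / x\<^sup>2 \<le> 1 / 16"
  proof -
    have "4\<^sup>2 \<le> x\<^sup>2" using x4 by (intro power_mono) auto
    then show ?thesis using x4 by (intro divide_left_mono) auto
  qed
  then have b: "\<bar>ln (1 + - (1 / x\<^sup>2)) - - (1 / x\<^sup>2)\<bar> \<le> 2 * (- (1 / x\<^sup>2))\<^sup>2"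
    by (intro abs_ln_one_plus_x_minus_x_bound) auto
  have "\<bar>(x - 1) / 2 * (ln (1 + - (1 / x\<^sup>2)) - - (1 / x\<^sup>2))\<bar> \<le> x / 2 * (2 * (- (1 / x\<^sup>2))\<^sup>2)"
    unfolding abs_mult using b x4 by (intro mult_mono) auto
  also have "\<dots> = 1 / x * (1 / x\<^sup>2)" using x4 by (simp add: power2_eq_square)
  also have "\<dots> \<le> 1 * (1 / x\<^sup>2)" using x4 by (intro mult_right_mono) auto
  finally have b': "\<bar>(x - 1) / 2 * (ln (1 + - (1 / x\<^sup>2)) - - (1 / x\<^sup>2))\<bar> \<le> 1 / x\<^sup>2" by simp
  have e: "tau_reg (m + 1) - (ln x + 1 / (2 * x)) = - ((x - 1) / 2 * (ln (1 + - (1 / x\<^sup>2)) - - (1 / x\<^sup>2))) - 1 / x\<^sup>2 / 2"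
  proof -
    have "(x - 1) / 2 * - (- (1 / x\<^sup>2)) = 1 / (2 * x) - 1 / x\<^sup>2 / 2" using x4 by (simp add: field_simps power2_eq_square)
    then show ?thesis unfolding t by (simp add: algebra_simps add_divide_distrib diff_divide_distrib)
  qed
  have "2 / x\<^sup>2 = 2 * (1 / x\<^sup>2)" "0 \<le> 1 / x\<^sup>2" by simp_all
  moreover have "\<bar>- p - w / 2\<bar> \<le> t" if "t = 2 * w" "0 \<le> w" "\<bar>p\<bar> \<le> w" for p w t :: real
    using that by linarith
  ultimately have "\<bar>tau_reg (m + 1) - (ln x + 1 / (2 * x))\<bar> \<le> 2 / x\<^sup>2"
    unfolding e using b' by blast
  then show ?thesis by (simp add: x_def)
qed

lemma sum_cos_roots:
  assumes "l \<ge> 2" shows "(\<Sum>b<l. cos (2 * pi * real b / real l)) = 0"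
proof -
  have "(\<Sum>b<l. cis (2 * pi * of_int 1 * real b / real l)) = 0"
    using sum_cis_roots[of l 1] assms by (auto dest: zdvd_imp_le)
  then have "Re (\<Sum>b<l. cis (2 * pi * real b / real l)) = 0" by simp
  then show ?thesis by simp
qed

text \<open>Relative to \<open>m + 2\<close> each factor deviates by a multiple of
  \<open>1 / m\<close>, but these deviations are cosines at equally spaced angles and sum to zero,
  so only second-order terms remain.\<close>

lemma ln_prod_lapeig:
  assumes "m \<ge> 4" "l \<ge> 3"
  shows "(\<Prod>b<l. real m + 2 - 2 * cos (2 * pi * real b / real l)) > 0"
    "\<bar>ln (\<Prod>b<l. real m + 2 - 2 * cos (2 * pi * real b / real l)) - real l * ln (real m + 2)\<bar> \<le> 8 * real l / (real m)\<^sup>2"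
proof -
  define x where "x = real m"
  have x4: "x \<ge> 4" using assms by (simp add: x_def)
  define u where "u b = - (2 / (x + 2) * cos (2 * pi * real b / real l))" for b
  have u: "\<bar>u b\<bar> \<le> 2 / x" for b
  proof -
    have "\<bar>u b\<bar> = 2 / (x + 2) * \<bar>cos (2 * pi * real b / real l)\<bar>" using x4 by (simp add: u_def abs_mult)
    also have "\<dots> \<le> 2 / x * 1" using x4 by (intro mult_mono divide_left_mono) auto
    finally show ?thesis by simp
  qed
  have x2: "2 / x \<le> 1 / 2" using x4 by (simp add: field_simps)
  have uh: "\<bar>u b\<bar> \<le> 1 / 2" for b using u[of b] x2 by linarith
  have fac: "x + 2 - 2 * cos (2 * pi * real b / real l) = (x + 2) * (1 + u b)" for b
    using x4 by (simp add: u_def field_simps)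
  have pos: "1 + u b > 0" for b using uh[of b] by (simp add: abs_le_iff)
  show "(\<Prod>b<l. real m + 2 - 2 * cos (2 * pi * real b / real l)) > 0"
    unfolding x_def[symmetric] fac using x4 pos by (intro prod_pos) auto
  have "ln (\<Prod>b<l. x + 2 - 2 * cos (2 * pi * real b / real l)) = (\<Sum>b<l. ln ((x + 2) * (1 + u b)))"
    unfolding fac using x4 pos by (intro ln_prod) (simp_all add: less_imp_neq[OF pos, symmetric] add_nonneg_eq_0_iff)
  also have "\<dots> = (\<Sum>b<l. ln (x + 2) + ln (1 + u b))"
    using x4 pos by (intro sum.cong refl ln_mult_pos) auto
  also have "\<dots> = real l * ln (x + 2) + (\<Sum>b<l. ln (1 + u b))" by (simp add: sum.distrib)
  also have "(\<Sum>b<l. ln (1 + u b)) = (\<Sum>b<l. ln (1 + u b) - u b)"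
  proof -
    have "(\<Sum>b<l. u b) = - (2 / (x + 2)) * (\<Sum>b<l. cos (2 * pi * real b / real l))"
      by (simp add: u_def sum_distrib_left sum_negf)
    then have "(\<Sum>b<l. u b) = 0" using sum_cos_roots[of l] assms by simp
    then show ?thesis by (simp add: sum_subtractf)
  qed
  finally have "\<bar>ln (\<Prod>b<l. x + 2 - 2 * cos (2 * pi * real b / real l)) - real l * ln (x + 2)\<bar> = \<bar>\<Sum>b<l. ln (1 + u b) - u b\<bar>"
    by simp
  also have "\<dots> \<le> (\<Sum>b<l. \<bar>ln (1 + u b) - u b\<bar>)" by (rule sum_abs)
  also have "\<dots> \<le> (\<Sum>b<l. 8 / x\<^sup>2)"
  proof (rule sum_mono)
    fix b
    have "\<bar>ln (1 + u b) - u b\<bar> \<le> 2 * (u b)\<^sup>2" by (rule abs_ln_one_plus_x_minus_x_bound[OF uh])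
    also have "(u b)\<^sup>2 = \<bar>u b\<bar>\<^sup>2" by simp
    also have "2 * \<bar>u b\<bar>\<^sup>2 \<le> 2 * (2 / x)\<^sup>2" using u by (intro mult_left_mono power_mono) auto
    finally show "\<bar>ln (1 + u b) - u b\<bar> \<le> 8 / x\<^sup>2" by (simp add: power_divide)
  qed
  finally show "\<bar>ln (\<Prod>b<l. real m + 2 - 2 * cos (2 * pi * real b / real l)) - real l * ln (real m + 2)\<bar> \<le> 8 * real l / (real m)\<^sup>2"
    by (simp add: x_def mult.commute)
qed

text \<open>The constant \<open>19\<close> collects \<open>8\<close> from the product of
  eigenvalues, \<open>10\<close> from replacing \<open>ln (m + 2)\<close>, and \<open>1\<close> from
  the stray term \<open>ln l\<close>.\<close>

lemma tau_asymp:
  assumes "m \<ge> 4" "l \<ge> 3"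
  shows "\<bar>tau (kc_box m l) - ((real m - 1) / real m * ln (real m) + 2 / real m)\<bar>
    \<le> 19 * (1 / (real m)\<^sup>2 + ln (real m) / (real m * real l))"
proof -
  define x y where "x = real m" and "y = real l"
  have x4: "x \<ge> 4" and y3: "y \<ge> 3" using assms by (auto simp: x_def y_def)
  define P where "P = (\<Prod>b<l. real m + 2 - 2 * cos (2 * pi * real b / real l))"
  define N where "N = real (num_spanning_trees (kc_box m l))"
  have P0: "P > 0" and lnP: "\<bar>ln P - y * ln (x + 2)\<bar> \<le> 8 * y / x\<^sup>2"
    using ln_prod_lapeig[OF assms] by (auto simp: P_def x_def y_def)
  have NP: "x * y * N = y\<^sup>2 * P ^ (m - 1)"
    using num_spanning_trees_box[of l m] assms by (simp add: N_def P_def x_def y_def)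
  have N0: "N > 0"
  proof -
    have "x * y * N > 0" unfolding NP using P0 y3 by simp
    moreover have "x * y > 0" using x4 y3 by simp
    ultimately show ?thesis by (rule zero_less_mult_pos)
  qed
  have "ln (x * y * N) = ln x + ln y + ln N" using x4 y3 N0 by (simp add: ln_mult)
  moreover have "ln (y\<^sup>2 * P ^ (m - 1)) = 2 * ln y + (x - 1) * ln P"
    using y3 P0 assms by (simp add: ln_mult ln_realpow x_def of_nat_diff)
  ultimately have lnN: "ln N = ln y - ln x + (x - 1) * ln P" using NP by simp
  have lx: "ln x \<ge> 0" and ly: "ln y \<ge> 0" using x4 y3 by auto
  \<comment> \<open>The number of trees contains a factor \<open>l\<close>, and \<open>l\<close> is
    not bounded in terms of \<open>m\<close>; this splits \<open>ln l\<close> into parts that fit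
    the two error terms after division by \<open>m * l\<close>.\<close>
  have lyx: "ln y \<le> ln x + y / x"
  proof -
    have "ln (y / x) \<le> y / x - 1" using x4 y3 by (intro ln_le_minus_one) auto
    moreover have "ln (y / x) = ln y - ln x" using x4 y3 by (simp add: ln_div)
    ultimately show ?thesis by simp
  qed
  have A: "\<bar>(x - 1) * ln P - (x - 1) * (y * ln (x + 2))\<bar> \<le> 8 * y / x"
  proof -
    have "\<bar>(x - 1) * (ln P - y * ln (x + 2))\<bar> \<le> x * (8 * y / x\<^sup>2)"
      unfolding abs_mult using lnP x4 by (intro mult_mono) auto
    also have "\<dots> = 8 * y / x" using x4 by (simp add: power2_eq_square)
    finally show ?thesis by (simp add: right_diff_distrib)
  qed
  have Bd: "\<bar>(x - 1) * (y * ln (x + 2)) - y * ((x - 1) * ln x + 2)\<bar> \<le> 10 * y / x"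
  proof -
    have "\<bar>(x - 1) * (ln (x + 2) - ln x - 2 / x)\<bar> \<le> x * (8 / x\<^sup>2)"
      unfolding abs_mult using ln_one_plus_two_div[OF x4] x4 by (intro mult_mono) auto
    also have "\<dots> = 8 / x" using x4 by (simp add: power2_eq_square)
    finally have 1: "\<bar>(x - 1) * (ln (x + 2) - ln x - 2 / x)\<bar> \<le> 8 / x" .
    have "(x - 1) * ln (x + 2) - ((x - 1) * ln x + 2) = (x - 1) * (ln (x + 2) - ln x - 2 / x) - 2 / x"
      using x4 by (simp add: field_simps)
    moreover have "10 / x = 8 / x + 2 / x" "0 \<le> 2 / x" using x4 by simp_all
    moreover have "\<bar>p\<bar> \<le> u" if "p = r - t" "u = s + t" "0 \<le> t" "\<bar>r\<bar> \<le> s" for p r s t u :: real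
      using that by linarith
    ultimately have "\<bar>(x - 1) * ln (x + 2) - ((x - 1) * ln x + 2)\<bar> \<le> 10 / x"
      using 1 by blast
    then have "y * \<bar>(x - 1) * ln (x + 2) - ((x - 1) * ln x + 2)\<bar> \<le> y * (10 / x)" using y3 by (intro mult_left_mono) auto
    moreover have "y * \<bar>(x - 1) * ln (x + 2) - ((x - 1) * ln x + 2)\<bar> = \<bar>y * ((x - 1) * ln (x + 2) - ((x - 1) * ln x + 2))\<bar>"
      using y3 by (simp add: abs_mult)
    moreover have "y * ((x - 1) * ln (x + 2) - ((x - 1) * ln x + 2)) = (x - 1) * (y * ln (x + 2)) - y * ((x - 1) * ln x + 2)"
      by (simp add: algebra_simps)
    ultimately show ?thesis by (simp add: mult.commute)
  qed
  have "\<bar>ln N - y * ((x - 1) * ln x + 2)\<bar> \<le> 19 * (y / x) + ln x"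
  proof -
    have "8 * y / x = 8 * (y / x)" "10 * y / x = 10 * (y / x)" "0 \<le> y / x" using x4 y3 by simp_all
    moreover have "\<bar>q - r + a - c\<bar> \<le> 19 * t + r"
      if "\<bar>a - b\<bar> \<le> t8" "\<bar>b - c\<bar> \<le> t10" "0 \<le> r" "0 \<le> q" "q \<le> r + t" "t8 = 8 * t" "t10 = 10 * t" "0 \<le> t"
      for a b c q r t t8 t10 :: real using that by (unfold abs_le_iff, (elim conjE)?, (intro conjI)?; linarith)
    ultimately show ?thesis unfolding lnN using A Bd lx ly lyx by blast
  qed
  also have "\<dots> \<le> 19 * (y / x + ln x)" using lx by simp
  finally have main: "\<bar>ln N - y * ((x - 1) * ln x + 2)\<bar> \<le> 19 * (y / x + ln x)" .
  have "tau (kc_box m l) - ((x - 1) / x * ln x + 2 / x) = (ln N - y * ((x - 1) * ln x + 2)) / (x * y)"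
  proof -
    have "tau (kc_box m l) = ln N / (x * y)" by (simp add: tau_def N_def verts_box card_cartesian_product x_def y_def)
    moreover have "(x - 1) / x * ln x + 2 / x = y * ((x - 1) * ln x + 2) / (x * y)"
      using x4 y3 by (simp add: field_simps)
    ultimately show ?thesis by (simp add: diff_divide_distrib)
  qed
  then have "\<bar>tau (kc_box m l) - ((x - 1) / x * ln x + 2 / x)\<bar> = \<bar>ln N - y * ((x - 1) * ln x + 2)\<bar> / (x * y)"
    using x4 y3 by (simp add: abs_mult)
  also have "\<dots> \<le> 19 * (y / x + ln x) / (x * y)" using main x4 y3 by (intro divide_right_mono) auto
  also have "\<dots> = 19 * (1 / x\<^sup>2 + ln x / (x * y))" using x4 y3 by (simp add: field_simps power2_eq_square)
  finally show ?thesis by (simp add: x_def y_def)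
qed

lemma bigo_odd_uniform:
  assumes "\<And>m l. odd m \<Longrightarrow> m \<ge> M \<Longrightarrow> l \<ge> 3 \<Longrightarrow> \<bar>f m l\<bar> \<le> C * g m l" "\<And>m l. 0 \<le> g m l"
  shows "(\<lambda>(m, l). f m l :: real) \<in> O[odd_uniform](\<lambda>(m, l). g m l)"
proof (rule bigoI[of _ C])
  show "eventually (\<lambda>x. norm (case x of (m, l) \<Rightarrow> f m l) \<le> C * norm (case x of (m, l) \<Rightarrow> g m l)) odd_uniform"
    unfolding eventually_odd_uniform using assms by (intro exI[of _ M]) (auto simp: abs_of_nonneg)
qed

theorem theorem7p7:
  shows "(\<lambda>(m, l). rho (complete_graph m \<box> cycle_graph l)
            - ((real m + 2) / 2 * ln 2 - (real m - 1) / (2 * real m) * ln (real m)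
               - ln pi / 2 - 3 / (2 * real m)))
           \<in> O[odd_uniform](\<lambda>(m, l). 1 / (real m)\<^sup>2 + ln (real m) / (real m * real l))
       \<and> (\<lambda>(m, l). rho (complete_graph m \<box> cycle_graph l)
            - (rho_hat (complete_graph m \<box> cycle_graph l)
               + ln (real m) / (2 * real m) - 3 / (4 * real m)))
           \<in> O[odd_uniform](\<lambda>(m, l). 1 / (real m)\<^sup>2 + ln (real m) / (real m * real l))
       \<and> (\<lambda>(m, l). rho (complete_graph m \<box> cycle_graph l)
            - rho_tau (complete_graph m \<box> cycle_graph l))
           \<in> O[odd_uniform](\<lambda>(m, l). 1 / (real m)\<^sup>2 + ln (real m) / (real m * real l))"
proof -
  obtain C M where C: "C > 0" "\<And>m l. odd m \<Longrightarrow> m \<ge> M \<Longrightarrow> l \<ge> 3 \<Longrightarrow>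
    \<bar>rho (kc_box m l) - layerent (real m) / real m\<bar> \<le> C * (1 / (real m)\<^sup>2 + ln (real m) / (real m * real l))"
    using rho_box_asymp by blast
  define g where "g m l = 1 / (real m)\<^sup>2 + ln (real m) / (real m * real l)" for m l :: nat
  \<comment> \<open>At \<open>m = 0\<close> this rests on \<open>ln 0 = 0\<close>; nonnegativity is
    wanted for all arguments by \<open>bigo_odd_uniform\<close>.\<close>
  have ln0: "0 \<le> ln (real m) / (real m * real l)" for m l :: nat by (cases m) auto
  have g0: "0 \<le> g m l" for m l unfolding g_def using ln0[of m l] by simp
  have g1: "1 / (real m)\<^sup>2 \<le> g m l" for m l unfolding g_def using ln0[of m l] by simp
  have one: "\<bar>rho (kc_box m l) - ((real m + 2) / 2 * ln 2 - (real m - 1) / (2 * real m) * ln (real m)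
               - ln pi / 2 - 3 / (2 * real m))\<bar> \<le> C * g m l"
    if "odd m" "m \<ge> max M 4" "l \<ge> 3" for m l
  proof -
    have "layerent (real m) / real m = (real m + 2) / 2 * ln 2 - (real m - 1) / (2 * real m) * ln (real m)
               - ln pi / 2 - 3 / (2 * real m)"
      unfolding layerent_def using that by (simp add: field_simps)
    then show ?thesis using C(2)[of m l] that by (simp add: g_def)
  qed
  have two: "\<bar>rho (kc_box m l) - (rho_hat (kc_box m l) + ln (real m) / (2 * real m) - 3 / (4 * real m))\<bar> \<le> (C + 2) * g m l"
    if "odd m" "m \<ge> max M 4" "l \<ge> 3" for m l
  proof -
    have 1: "\<bar>rho (kc_box m l) - layerent (real m) / real m\<bar> \<le> C * g m l" using C(2)[of m l] that by (simp add: g_def)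
    have "2 / (real m)\<^sup>2 \<le> 2 * g m l" using g1[of m l] by simp
    then have 2: "\<bar>layerent (real m) / real m - (rho_hat (kc_box m l) + ln (real m) / (2 * real m) - 3 / (4 * real m))\<bar> \<le> 2 * g m l"
      using rho_hat_asymp[of m l] that by (intro order_trans[OF rho_hat_asymp]) auto
    have "(C + 2) * g m l = C * g m l + 2 * g m l" by (simp add: distrib_right)
    then show ?thesis using 1 2 by (unfold abs_le_iff, (elim conjE)?, (intro conjI)?; linarith)
  qed
  have three: "\<bar>rho (kc_box m l) - rho_tau (kc_box m l)\<bar> \<le> (C + 13) * g m l"
    if "odd m" "m \<ge> max M 4" "l \<ge> 3" for m l
  proof -
    have m4: "m \<ge> 4" "m \<ge> 1" using that by auto
    have rt: "rho_tau (kc_box m l) = rho_hat (kc_box m l) + tau_reg (m + 1) / 2 - tau (kc_box m l) / 2"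
      using regular_degree_complete_box_cycle[OF m4(2) that(3)] by (simp add: rho_tau_def)
    have 1: "\<bar>tau_reg (m + 1) - (ln (real m) + 1 / (2 * real m))\<bar> \<le> 2 * g m l"
      using tau_reg_asymp[OF m4(1)] g1[of m l] by simp
    have 2: "\<bar>tau (kc_box m l) - ((real m - 1) / real m * ln (real m) + 2 / real m)\<bar> \<le> 19 * g m l"
      using tau_asymp[OF m4(1) that(3)] by (simp only: g_def)
    \<comment> \<open>This is where the spanning-tree correction reproduces the second expansion:
      the coefficients of \<open>ln m\<close> leave \<open>1 / (2 * m)\<close>, and
      \<open>1 / 4 - 1 = - 3 / 4\<close> gives the next term.\<close>
    have e: "(ln (real m) + 1 / (2 * real m)) / 2 - ((real m - 1) / real m * ln (real m) + 2 / real m) / 2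
      = ln (real m) / (2 * real m) - 3 / (4 * real m)"
      using m4 by (simp add: field_simps)
    \<comment> \<open>The errors \<open>2\<close> and \<open>19\<close> enter with weight one half,
      so \<open>11\<close> covers them.\<close>
    have "(C + 13) * g m l = (C + 2) * g m l + 11 * g m l" by (simp add: algebra_simps)
    moreover have "\<bar>r - (h + a / 2 - t / 2)\<bar> \<le> z" if "z = c + 11 * g" "\<bar>r - (h + p - q)\<bar> \<le> c" "\<bar>a - A\<bar> \<le> 2 * g" "\<bar>t - T\<bar> \<le> 19 * g"
      "A / 2 - T / 2 = p - q" "0 \<le> g" for r h a t z c g p q A T :: real
      using that by (unfold abs_le_iff, (elim conjE)?, (intro conjI)?; linarith)
    ultimately show ?thesis unfolding rt using two[OF that] 1 2 e g0[of m l] by blast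
  qed
  show ?thesis
    unfolding g_def[symmetric]
    by (intro conjI bigo_odd_uniform[where M = "max M 4"]; (rule one two three g0; assumption?))
qed

end
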